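(* Let $U$ be a separable Banach space, $T>0$, and let $L$ be a cylindrical Lévy process in $U$ with cylindrical characteristics $(a,Q,\mu)$. Assume that $V$ is a (separable) Hilbert space with orthonormal basis $(e_k)_{k\in\mathbb N}$ and let $f:[0,T]\to\mathcal L(U,V)$ be a function which is weakly in $\mathcal G([0,T];U^* )$. Then $f$ is stochastically integrable with respect to $L$ if and only if the following is satisfied: (1) the mapping $$T_a:V^*\to L^1([0,T];\mathbb R),\qquad T_av^*=a(f^*(\cdot)v^* ),$$ is weak-weakly sequentially continuous; (2) $\displaystyle\int_0^T\mathrm{tr}\big[f(s)Qf^*(s)\big]\,ds<\infty$; (3) $\displaystyle\limsup_{m\to\infty}\sup_{n\ge m}\int_0^T\int_U\Big(\sum_{k=m}^n\langle u,f^*(s)e_k\rangle^2\wedge1\Big)\,\mu(du)\,ds=0.$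
   Context: $V^*$ is identified with $V$ where needed; $\mathrm{tr}[f(s)Qf^*(s)]=\sum_k\langle f^*(s)e_k,Qf^*(s)e_k\rangle$. In (3) the minimum with $1$ is taken of the whole sum. Cylindrical objects. $\langle\cdot,\cdot\rangle$ is the dual pairing of $U$ and $U^*$; $B_{\mathbb R}=[-1,1]$; $(\Omega,\mathcal A,P)$ is a probability space; $L^0_P(\Omega;\cdot)$ denotes (classes of) random variables with the topology of convergence in probability. Cylindrical sets are sets $\{u\in U:(\langle u,u_1^*\rangle,\dots,\langle u,u_n^*\rangle)\in B\}$, $u_i^*\in U^*$, $B\in\mathcal B(\mathbb R^n)$; they form the algebra $\mathcal Z(U)$. A cylindrical measure on $\mathcal Z(U)$ is a map $\mathcal Z(U)\to[0,\infty]$ whose restriction to the $\sigma$-algebra generated by the cylindrical sets with $u_i^*\in\Gamma$ is a measure for every finite $\Gamma\subseteq U^*$. It is a cylindrical Lévy measure if $\int_U(\langle u,u^*\rangle^2\wedge1)\mu(du)<\infty$ for all $u^*$. A cylindrical random variable in $U$ is a linear continuous map $U^*\to L^0_P(\Omega;\mathbb R)$. A family $(L(t):t\ge0)$ of cylindrical random variables is a cylindrical Lévy process in $U$ if $((L(t)u_1^*,\dots,L(t)u_n^* ):t\ge0)$ is a Lévy process in $\mathbb R^n$ for all $u_1^*,\dots,u_n^*\in U^*$, $n\in\mathbb N$. Then $E[e^{iL(t)u^*}]=e^{t\Psi(u^* )}$, where $\Psi(u^* )=ia(u^* )-\tfrac12\langle u^*,Qu^*\rangle+\int_U(e^{i\langle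 u,u^*\rangle}-1-i\langle u,u^*\rangle1_{B_{\mathbb R}}(\langle u,u^*\rangle))\mu(du)$; $(a,Q,\mu)$ are the cylindrical characteristics, with $a:U^*\to\mathbb R$, $a(0)=0$, $Q:U^*\to U^{**}$ positive symmetric, $\mu$ a cylindrical Lévy measure. Standing assumption: $L(t)=W(t)+P(t)$ with $W(t),P(t):U^*\to L^0_P(\Omega;\mathbb R)$ continuous, $W$ and $P$ independent cylindrical Lévy processes with characteristics $(0,Q,0)$ and $(a,0,\mu)$. It is known that then $a$ is continuous, $Q$ is bounded, and $u_n^*\to u_0^*$ in norm implies $(|\beta|^2\wedge1)(\mu\circ(u_n^* )^{-1})(d\beta)\to(|\beta|^2\wedge1)(\mu\circ(u_0^* )^{-1})(d\beta)$ weakly. Stochastic integrability. $\mathcal G([0,T];U^* )$ is the space of regulated functions $g:[0,T]\to U^*$ (one-sided limits exist everywhere), with supremum norm. $f:[0,T]\to\mathcal L(U,V)$ (bounded linear operators) is weakly in $\mathcal G([0,T];U^* )$ if $f^*(\cdot)v^*\in\mathcal G([0,T];U^* )$ for each $v^*\in V^*$, where $f^*(s)$ is the adjoint of $f(s)$. For a simple function $g$ with value $u_k^*$ on $(t_k,t_{k+1})$, $0=t_0\le\dots\le t_m=T$, put $J(g)=\sum_{k=0}^{m-1}(L(t_{k+1})-L(t_k))u_k^*$. $J$ is extended to $\mathcal G([0,T];U^* )$ by continuity: $J(g)=\lim_nJ(g_n)$ in probability for simple $g_n\to g$ uniformly. As part of the setting it is asserted that $\tau g\in\mathcal G([0,T];U^*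 )$ for every bounded measurable $\tau:[0,T]\to\mathbb R$ and $g\in\mathcal G([0,T];U^* )$; accordingly $1_A(\cdot)f^*(\cdot)v^*$ is taken as an element of $\mathcal G([0,T];U^* )$ for each $A\in\mathcal B([0,T])$. The cylindrical integral of $f$ on $A$ is $Z_A:V^*\to L^0_P(\Omega;\mathbb R)$, $Z_Av^*=J(1_A(\cdot)f^*(\cdot)v^* )$; it is a cylindrical random variable with $E[e^{iZ_Av^*}]=\exp(\int_A\Psi(f^*(s)v^* )ds)$. $f$ is stochastically integrable w.r.t. $L$ if it is weakly in $\mathcal G([0,T];U^* )$ and for each $A\in\mathcal B([0,T])$ there is $I_A\in L^0_P(\Omega;V)$ with $\langle I_A,v^*\rangle=Z_Av^*$ for all $v^*\in V^*$; then $\int_Af(s)\,dL(s):=I_A$. $T_a$ is weak-weakly sequentially continuous if $v_n^*\to v^*$ weakly implies $T_av_n^*\to T_av^*$ weakly in $L^1([0,T];\mathbb R)$.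
   Formalization: Since 1_A f*v need not be regulated (A the rationals), J(1_A f*v) is defined by extending J along bounded a.e. convergent regulated sequences; continuity of a is assumed, as it fails e.g. for a Poisson process with truncation 1_{[-1,1]}, where (1) can fail for integrable f. *)

theory Defs
  imports "HOL-Probability.Probability"
begin

section \<open>Convergence in probability and weak convergence\<close>

text \<open>Elements of \<open>L\<^sup>0\<close> are represented by measurable functions; equations between them hold
  almost surely.\<close>

definition tendsto_prob ::
    "'w measure \<Rightarrow> ('i \<Rightarrow> 'w \<Rightarrow> real) \<Rightarrow> ('w \<Rightarrow> real) \<Rightarrow> 'i filter \<Rightarrow> bool" where
  "tendsto_prob M X Y F \<longleftrightarrow>
     (\<forall>\<epsilon>>0. ((\<lambda>i. measure M {\<omega> \<in> space M. \<epsilon> < \<bar>X i \<omega> - Y \<omega>\<bar>}) \<longlongrightarrow> 0) F)"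

definition weakly_tendsto :: "(nat \<Rightarrow> 'a::real_normed_vector) \<Rightarrow> 'a \<Rightarrow> bool" where
  "weakly_tendsto v w \<longleftrightarrow> (\<forall>\<phi> :: 'a \<Rightarrow>\<^sub>L real. (\<lambda>n. \<phi> (v n)) \<longlonglongrightarrow> \<phi> w)"

text \<open>The library has no type \<open>L\<^sup>1(N)\<close>, so its dual is described on representatives. The norm bound
  makes such a functional insensitive to changes on null sets.\<close>

definition L1_functional :: "'s measure \<Rightarrow> (('s \<Rightarrow> real) \<Rightarrow> real) \<Rightarrow> bool" where
  "L1_functional N \<phi> \<longleftrightarrow>
     (\<forall>g h. integrable N g \<longrightarrow> integrable N h \<longrightarrow> \<phi> (\<lambda>s. g s + h s) = \<phi> g + \<phi> h) \<and>
     (\<forall>c g. integrable N g \<longrightarrow> \<phi> (\<lambda>s. c * g s) = c * \<phi> g) \<and>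
     (\<exists>C. \<forall>g. integrable N g \<longrightarrow> \<bar>\<phi> g\<bar> \<le> C * (LINT s|N. \<bar>g s\<bar>))"

definition L1_weakly_tendsto :: "'s measure \<Rightarrow> (nat \<Rightarrow> 's \<Rightarrow> real) \<Rightarrow> ('s \<Rightarrow> real) \<Rightarrow> bool" where
  "L1_weakly_tendsto N g h \<longleftrightarrow>
     (\<forall>n. integrable N (g n)) \<and> integrable N h \<and>
     (\<forall>\<phi>. L1_functional N \<phi> \<longrightarrow> (\<lambda>n. \<phi> (g n)) \<longlonglongrightarrow> \<phi> h)"

definition weak_weak_seq_continuous ::
    "'s measure \<Rightarrow> ('a::real_normed_vector \<Rightarrow> 's \<Rightarrow> real) \<Rightarrow> bool" where
  "weak_weak_seq_continuous N T \<longleftrightarrow>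
     (\<forall>v w. weakly_tendsto v w \<longrightarrow> L1_weakly_tendsto N (\<lambda>n. T (v n)) (T w))"

section \<open>Cylindrical measures\<close>

definition cylinder_sets :: "('u::real_normed_vector \<Rightarrow>\<^sub>L real) set \<Rightarrow> 'u set set" where
  "cylinder_sets \<Gamma> =
     {{u. (\<lambda>i\<in>{..<n}. blinfun_apply (x i) u) \<in> B} | (n::nat) x B.
        (\<forall>i<n. x i \<in> \<Gamma>) \<and> B \<in> sets (Pi\<^sub>M {..<n} (\<lambda>_. borel))}"

text \<open>Only the values of \<open>\<mu>\<close> on \<open>cylinder_sets UNIV\<close> matter: for finite \<open>\<Gamma>\<close> the
  \<open>\<sigma>\<close>-algebra below consists of such sets.\<close>

definition cylindrical_measure :: "('u::real_normed_vector set \<Rightarrow> ennreal) \<Rightarrow> bool" where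
  "cylindrical_measure \<mu> \<longleftrightarrow>
     (\<forall>\<Gamma>. finite \<Gamma> \<longrightarrow> measure_space UNIV (sigma_sets UNIV (cylinder_sets \<Gamma>)) \<mu>)"

text \<open>The restriction of \<open>\<mu>\<close> to the \<open>\<sigma>\<close>-algebra generated by \<open>\<Gamma>\<close>. A cylindrical function of the
  functionals in the finite set \<open>\<Gamma>\<close> is integrated against this measure.\<close>

definition cyl_restr ::
    "('u::real_normed_vector set \<Rightarrow> ennreal) \<Rightarrow> ('u \<Rightarrow>\<^sub>L real) set \<Rightarrow> 'u measure" where
  "cyl_restr \<mu> \<Gamma> = measure_of UNIV (cylinder_sets \<Gamma>) \<mu>"

definition cylindrical_levy_measure :: "('u::real_normed_vector set \<Rightarrow> ennreal) \<Rightarrow> bool" where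
  "cylindrical_levy_measure \<mu> \<longleftrightarrow>
     cylindrical_measure \<mu> \<and>
     (\<forall>x. (\<integral>\<^sup>+ u. ennreal (min ((blinfun_apply x u)\<^sup>2) 1) \<partial>cyl_restr \<mu> {x}) < \<infinity>)"

section \<open>Cylindrical L\'evy processes\<close>

definition cylindrical_rv ::
    "'w measure \<Rightarrow> (('u::real_normed_vector \<Rightarrow>\<^sub>L real) \<Rightarrow> 'w \<Rightarrow> real) \<Rightarrow> bool" where
  "cylindrical_rv M X \<longleftrightarrow>
     (\<forall>x. X x \<in> borel_measurable M) \<and>
     (\<forall>x y. AE \<omega> in M. X (x + y) \<omega> = X x \<omega> + X y \<omega>) \<and>
     (\<forall>c x. AE \<omega> in M. X (c *\<^sub>R x) \<omega> = c * X x \<omega>) \<and>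
     (\<forall>xs x. xs \<longlonglongrightarrow> x \<longrightarrow> tendsto_prob M (\<lambda>n. X (xs n)) (X x) sequentially)"

text \<open>A process in \<open>\<real>\<^sup>n\<close> is given by its coordinates \<open>X t i\<close>, \<open>i < n\<close>, so that the dimension can be
  quantified over. Paths are not required to be right-continuous, since the processes considered
  here are families of classes of random variables.\<close>

definition increment ::
    "nat \<Rightarrow> (real \<Rightarrow> nat \<Rightarrow> 'w \<Rightarrow> real) \<Rightarrow> real \<Rightarrow> real \<Rightarrow> 'w \<Rightarrow> nat \<Rightarrow> real" where
  "increment n X s t \<omega> = (\<lambda>i\<in>{..<n}. X t i \<omega> - X s i \<omega>)"

definition levy_process :: "'w measure \<Rightarrow> nat \<Rightarrow> (real \<Rightarrow> nat \<Rightarrow> 'w \<Rightarrow> real) \<Rightarrow> bool" where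
  "levy_process M n X \<longleftrightarrow>
     (\<forall>t\<ge>0. \<forall>i<n. X t i \<in> borel_measurable M) \<and>
     (\<forall>i<n. AE \<omega> in M. X 0 i \<omega> = 0) \<and>
     (\<forall>(m::nat) t. 0 \<le> t 0 \<longrightarrow> (\<forall>j<m. t j \<le> t (Suc j)) \<longrightarrow>
        prob_space.indep_vars M (\<lambda>_. Pi\<^sub>M {..<n} (\<lambda>_. borel))
          (\<lambda>j. increment n X (t j) (t (Suc j))) {..<m}) \<and>
     (\<forall>s t. 0 \<le> s \<longrightarrow> s \<le> t \<longrightarrow>
        distr M (Pi\<^sub>M {..<n} (\<lambda>_. borel)) (increment n X s t) =
        distr M (Pi\<^sub>M {..<n} (\<lambda>_. borel)) (increment n X 0 (t - s))) \<and>
     (\<forall>t\<ge>0. \<forall>i<n. tendsto_prob M (\<lambda>s. X s i) (X t i) (at t within {0..}))"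

definition cylindrical_levy_process ::
    "'w measure \<Rightarrow> (real \<Rightarrow> ('u::real_normed_vector \<Rightarrow>\<^sub>L real) \<Rightarrow> 'w \<Rightarrow> real) \<Rightarrow> bool" where
  "cylindrical_levy_process M L \<longleftrightarrow>
     (\<forall>t\<ge>0. cylindrical_rv M (L t)) \<and>
     (\<forall>n (x :: nat \<Rightarrow> 'u \<Rightarrow>\<^sub>L real). levy_process M n (\<lambda>t i. L t (x i)))"

definition levy_symbol ::
    "(('u::real_normed_vector \<Rightarrow>\<^sub>L real) \<Rightarrow> real) \<Rightarrow>
     (('u \<Rightarrow>\<^sub>L real) \<Rightarrow>\<^sub>L (('u \<Rightarrow>\<^sub>L real) \<Rightarrow>\<^sub>L real)) \<Rightarrow>
     ('u set \<Rightarrow> ennreal) \<Rightarrow> ('u \<Rightarrow>\<^sub>L real) \<Rightarrow> complex" where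
  "levy_symbol a Q \<mu> x =
     \<i> * complex_of_real (a x) - complex_of_real (blinfun_apply (blinfun_apply Q x) x) / 2 +
     (LINT u|cyl_restr \<mu> {x}.
        iexp (blinfun_apply x u) - 1
        - \<i> * complex_of_real (blinfun_apply x u) * indicator {-1..1} (blinfun_apply x u))"

definition has_characteristics ::
    "'w measure \<Rightarrow> (real \<Rightarrow> ('u::real_normed_vector \<Rightarrow>\<^sub>L real) \<Rightarrow> 'w \<Rightarrow> real) \<Rightarrow>
     (('u \<Rightarrow>\<^sub>L real) \<Rightarrow> real) \<Rightarrow> (('u \<Rightarrow>\<^sub>L real) \<Rightarrow>\<^sub>L (('u \<Rightarrow>\<^sub>L real) \<Rightarrow>\<^sub>L real)) \<Rightarrow>
     ('u set \<Rightarrow> ennreal) \<Rightarrow> bool" where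
  "has_characteristics M L a Q \<mu> \<longleftrightarrow>
     a 0 = 0 \<and>
     (\<forall>x. 0 \<le> blinfun_apply (blinfun_apply Q x) x) \<and>
     (\<forall>x y. blinfun_apply (blinfun_apply Q x) y = blinfun_apply (blinfun_apply Q y) x) \<and>
     cylindrical_levy_measure \<mu> \<and>
     (\<forall>t\<ge>0. \<forall>x. (LINT \<omega>|M. iexp (L t x \<omega>)) = exp (complex_of_real t * levy_symbol a Q \<mu> x))"

definition independent_processes ::
    "'w measure \<Rightarrow> (real \<Rightarrow> 'x \<Rightarrow> 'w \<Rightarrow> real) \<Rightarrow> (real \<Rightarrow> 'x \<Rightarrow> 'w \<Rightarrow> real) \<Rightarrow> bool" where
  "independent_processes M W P \<longleftrightarrow>
     prob_space.indep_var M
       (Pi\<^sub>M ({0..} \<times> UNIV) (\<lambda>_. borel)) (\<lambda>\<omega>. \<lambda>(t, x)\<in>{0..} \<times> UNIV. W t x \<omega>)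
       (Pi\<^sub>M ({0..} \<times> UNIV) (\<lambda>_. borel)) (\<lambda>\<omega>. \<lambda>(t, x)\<in>{0..} \<times> UNIV. P t x \<omega>)"

section \<open>The stochastic integral\<close>

definition regulated :: "real \<Rightarrow> (real \<Rightarrow> 'b::real_normed_vector) \<Rightarrow> bool" where
  "regulated T g \<longleftrightarrow>
     (\<forall>t\<in>{0..<T}. \<exists>l. (g \<longlongrightarrow> l) (at_right t)) \<and>
     (\<forall>t\<in>{0<..T}. \<exists>l. (g \<longlongrightarrow> l) (at_left t))"

text \<open>\<open>g\<close> takes the value \<open>x k\<close> on the open interval \<open>(t k, t (k + 1))\<close>; its values at the partition
  points are arbitrary.\<close>

definition simple_on ::
    "real \<Rightarrow> (real \<Rightarrow> 'b) \<Rightarrow> nat \<Rightarrow> (nat \<Rightarrow> real) \<Rightarrow> (nat \<Rightarrow> 'b) \<Rightarrow> bool" where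
  "simple_on T g m t x \<longleftrightarrow>
     t 0 = 0 \<and> t m = T \<and> (\<forall>k<m. t k \<le> t (Suc k)) \<and>
     (\<forall>k<m. \<forall>s\<in>{t k<..<t (Suc k)}. g s = x k)"

definition simple_integral_wrt ::
    "(real \<Rightarrow> 'x \<Rightarrow> 'w \<Rightarrow> real) \<Rightarrow> nat \<Rightarrow> (nat \<Rightarrow> real) \<Rightarrow> (nat \<Rightarrow> 'x) \<Rightarrow> 'w \<Rightarrow> real" where
  "simple_integral_wrt L m t x \<omega> = (\<Sum>k<m. L (t (Suc k)) (x k) \<omega> - L (t k) (x k) \<omega>)"

text \<open>\<open>has_J M L T g X\<close>: \<open>g\<close> is regulated and \<open>J(g) = X\<close> almost surely.\<close>

definition has_J ::
    "'w measure \<Rightarrow> (real \<Rightarrow> ('u::real_normed_vector \<Rightarrow>\<^sub>L real) \<Rightarrow> 'w \<Rightarrow> real) \<Rightarrow> real \<Rightarrow>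
     (real \<Rightarrow> 'u \<Rightarrow>\<^sub>L real) \<Rightarrow> ('w \<Rightarrow> real) \<Rightarrow> bool" where
  "has_J M L T g X \<longleftrightarrow>
     regulated T g \<and> X \<in> borel_measurable M \<and>
     (\<exists>G m t x. (\<forall>n. simple_on T (G n) (m n) (t n) (x n)) \<and>
        uniform_limit {0..T} G g sequentially \<and>
        tendsto_prob M (\<lambda>n. simple_integral_wrt L (m n) (t n) (x n)) X sequentially)"

text \<open>For a Borel set \<open>A\<close> and a regulated \<open>g\<close> the product \<open>1\<^sub>A g\<close> need not be regulated (take \<open>A\<close> to be
  the rational numbers), so \<open>J\<close> has to be extended once more to give \<open>J(1\<^sub>A g)\<close> a meaning. The extension
  is by continuity along uniformly bounded sequences of regulated functions that converge Lebesgue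
  almost everywhere. It agrees with \<open>J\<close> on regulated functions, and it preserves the formula
  \<open>E exp(i J(h)) = exp(\<integral>\<^sub>0\<^sup>T \<Psi>(h(s)) ds)\<close>.\<close>

definition has_cyl_integral ::
    "'w measure \<Rightarrow> (real \<Rightarrow> ('u::real_normed_vector \<Rightarrow>\<^sub>L real) \<Rightarrow> 'w \<Rightarrow> real) \<Rightarrow> real \<Rightarrow>
     (real \<Rightarrow> 'u \<Rightarrow>\<^sub>L real) \<Rightarrow> ('w \<Rightarrow> real) \<Rightarrow> bool" where
  "has_cyl_integral M L T h X \<longleftrightarrow>
     X \<in> borel_measurable M \<and>
     (\<exists>G Y C. (\<forall>n. has_J M L T (G n) (Y n)) \<and>
        (\<forall>n. \<forall>s\<in>{0..T}. norm (G n s) \<le> C) \<and>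
        (AE s in lborel. s \<in> {0..T} \<longrightarrow> (\<lambda>n. G n s) \<longlonglongrightarrow> h s) \<and>
        tendsto_prob M Y X sequentially)"

text \<open>The adjoint \<open>f\<^sup>* : V \<rightarrow> U\<^sup>*\<close>, with \<open>V\<^sup>*\<close> identified with the Hilbert space \<open>V\<close>:
  \<open>\<langle>u, f\<^sup>* v\<rangle> = \<langle>f u, v\<rangle>\<close>.\<close>

definition adj ::
    "('u::real_normed_vector \<Rightarrow>\<^sub>L 'v::real_inner) \<Rightarrow> 'v \<Rightarrow> 'u \<Rightarrow>\<^sub>L real" where
  "adj F v = blinfun_inner_left v o\<^sub>L F"

lemma adj_apply [simp]: "blinfun_apply (adj F v) u = inner (blinfun_apply F u) v"
  by (simp add: adj_def)

definition weakly_regulated ::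
    "real \<Rightarrow> (real \<Rightarrow> 'u::real_normed_vector \<Rightarrow>\<^sub>L 'v::real_inner) \<Rightarrow> bool" where
  "weakly_regulated T f \<longleftrightarrow> (\<forall>v. regulated T (\<lambda>s. adj (f s) v))"

definition stochastically_integrable ::
    "'w measure \<Rightarrow> (real \<Rightarrow> ('u::real_normed_vector \<Rightarrow>\<^sub>L real) \<Rightarrow> 'w \<Rightarrow> real) \<Rightarrow> real \<Rightarrow>
     (real \<Rightarrow> 'u \<Rightarrow>\<^sub>L 'v::real_inner) \<Rightarrow> bool" where
  "stochastically_integrable M L T f \<longleftrightarrow>
     weakly_regulated T f \<and>
     (\<forall>A\<in>sets borel. A \<subseteq> {0..T} \<longrightarrow>
        (\<exists>I\<in>borel_measurable M. \<forall>v.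
           has_cyl_integral M L T (\<lambda>s. indicator A s *\<^sub>R adj (f s) v) (\<lambda>\<omega>. inner (I \<omega>) v)))"

section \<open>Hilbert spaces\<close>

definition orthonormal_basis :: "(nat \<Rightarrow> 'v::real_inner) \<Rightarrow> bool" where
  "orthonormal_basis e \<longleftrightarrow>
     (\<forall>i j. inner (e i) (e j) = (if i = j then 1 else 0)) \<and> closure (span (range e)) = UNIV"

text \<open>The trace of \<open>F Q F\<^sup>*\<close> computed in the basis \<open>e\<close>. For positive \<open>Q\<close> the terms are nonnegative.\<close>

definition trace_conj ::
    "(nat \<Rightarrow> 'v::real_inner) \<Rightarrow>
     (('u::real_normed_vector \<Rightarrow>\<^sub>L real) \<Rightarrow>\<^sub>L (('u \<Rightarrow>\<^sub>L real) \<Rightarrow>\<^sub>L real)) \<Rightarrow>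
     ('u \<Rightarrow>\<^sub>L 'v) \<Rightarrow> ennreal" where
  "trace_conj e Q F =
     (\<Sum>k. ennreal (blinfun_apply (blinfun_apply Q (adj F (e k))) (adj F (e k))))"

end

theory Submission
  imports Defs
begin

text \<open>Let \<open>k = - Re \<Psi>\<close> and let \<open>G\<^sub>m\<^sub>n\<close> be a standard Gaussian combination of \<open>e\<^sub>m, \<dots>, e\<^sub>n\<close>.
  Conditions (2) and (3) together say that \<open>\<kappa>(m, n) = E \<integral>\<^sub>0\<^sup>T k(f\<^sup>*(s) G\<^sub>m\<^sub>n) ds\<close> becomes small for large
  \<open>m\<close>, because the Gaussian mean of \<open>k\<close> splits into half the trace of \<open>Q\<close> and the integral of
  \<open>1 - exp(- \<Sum> \<langle>u, f\<^sup>* e\<^sub>k\<rangle>\<^sup>2 / 2)\<close> against \<open>\<mu>\<close>.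

  For \<open>X\<^sub>k = Z\<^sub>A e\<^sub>k\<close> and an independent copy \<open>X'\<close>, the mean of \<open>1 - exp(- \<Sum> (X\<^sub>k - X\<^sub>k')\<^sup>2 / 2)\<close> over the
  indices \<open>m, \<dots>, n\<close> is at most \<open>2 \<kappa>(m, n)\<close>. If \<open>\<kappa>\<close> is small, \<open>\<Sum> (X\<^sub>k - X\<^sub>k')\<^sup>2\<close> therefore converges almost surely;
  freezing the copy and applying the Banach--Steinhaus theorem gives \<open>\<Sum> X\<^sub>k\<^sup>2 < \<infinity>\<close>, and \<open>\<Sum> X\<^sub>k e\<^sub>k\<close> is the
  integral on \<open>A\<close>. Conversely, \<open>\<integral> k(f\<^sup>*(s) G) ds\<close> satisfies a reverse Hoelder inequality in \<open>G\<close>, so that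
  the same mean bounds \<open>\<kappa>\<close> from above.

  For condition (1), weak convergence \<open>v\<^sub>n \<rightarrow> v\<close> makes \<open>\<langle>I\<^sub>A, v\<^sub>n\<rangle>\<close> converge and hence \<open>\<integral>\<^sub>A Im \<Psi>(f\<^sup>* v\<^sub>n)\<close>, for
  every \<open>A\<close>. Moreover \<open>\<integral>\<integral> \<langle>u, f\<^sup>*(v\<^sub>n - v)\<rangle>\<^sup>2 \<and> 1 d\<mu> ds\<close> tends to \<open>0\<close>. This controls the integral over \<open>\<mu>\<close> in
  \<open>Im \<Psi>\<close>, and \<open>a\<close> is the remainder. The discontinuity of the truncation at \<open>\<plusminus>1\<close> is harmless since
  the norm continuity of \<open>a\<close> excludes one-sided contributions there.\<close>

section \<open>Convergence in probability\<close>

text \<open>Gaussian coefficients link norms to laws: \<open>exp (- |y|^2 / 2)\<close> is the mean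
  of the characters \<open>exp (i <G, y>)\<close>, so tail sums of squares of the coordinates
  \<open>X_k\<close> are expressed through characteristic functions, which are known from \<Psi>.
  Symmetrization by an independent copy removes the imaginary part of \<Psi> and with it the drift.
  The converse needs more: with \<open>K\<close> the integral of \<open>k(f^* G)\<close> over
  \<open>[0, T]\<close>, a small mean of \<open>1 - exp (- 2 K)\<close> bounds the mean of
  \<open>K\<close> only if \<open>K\<close> cannot be concentrated on rare values of
  \<open>G\<close>. That is the role of the reverse Hoelder inequality; its constant 3 is the
  normalized fourth moment of a normal variable, the case of a quadratic \<open>k\<close>.

  Two obstacles shape the rest. The dual of \<open>U\<close> may be non-separable, so measurability
  in \<open>s\<close> is drawn from the countability of the discontinuities of regulated functions.
  And \<mu> is only a consistent family of measures on finitely generated \<sigma>-algebras, so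
  integrals for different functionals have to be compared on a common finite set of
  functionals.\<close>

lemma uniform_boundedness_seminorms:
  fixes p :: "'i \<Rightarrow> 'a::banach \<Rightarrow> real"
  assumes cont: "\<And>i. i \<in> I \<Longrightarrow> continuous_on UNIV (p i)"
    and sub: "\<And>i x y. i \<in> I \<Longrightarrow> p i (x + y) \<le> p i x + p i y"
    and hom: "\<And>i c x. i \<in> I \<Longrightarrow> p i (c *\<^sub>R x) = \<bar>c\<bar> * p i x"
    and bdd: "\<And>x. \<exists>C. \<forall>i\<in>I. p i x \<le> C"
  obtains C where "C \<ge> 0" "\<And>i x. i \<in> I \<Longrightarrow> p i x \<le> C * norm x"
proof -
  define K where "K n = {x. \<forall>i\<in>I. p i x \<le> real n}" for n :: nat
  have closed: "closed (K n)" for n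
  proof -
    have "K n = (\<Inter>i\<in>I. {x. p i x \<le> real n})" by (auto simp: K_def)
    moreover have "closed {x. p i x \<le> real n}" if "i \<in> I" for i
      using cont[OF that] by (intro closed_Collect_le continuous_intros) auto
    ultimately show ?thesis by auto
  qed
  have "\<exists>n. interior (K n) \<noteq> {}"
  proof (rule ccontr)
    assume "\<not> ?thesis"
    then have "euclidean interior_of \<Union>(range K) = {}"
      using closed by (intro Baire_category_alt) (auto simp: completely_metrizable_space_euclidean)
    moreover have "\<Union>(range K) = UNIV"
    proof -
      have "\<exists>n. x \<in> K n" for x
      proof -
        obtain C where C: "\<forall>i\<in>I. p i x \<le> C" using bdd by blast
        obtain n where "C \<le> real n" using real_arch_simple by blast
        with C have "x \<in> K n" by (force simp: K_def)
        then show ?thesis ..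
      qed
      then show ?thesis by blast
    qed
    ultimately show False by simp
  qed
  then obtain n z r where r: "r > 0" "cball z r \<subseteq> K n"
    by (metis ex_in_conv mem_interior_cball)
  have neg: "p i (- x) = p i x" if "i \<in> I" for i x
    using hom[OF that, of "-1" x] by simp
  \<comment> \<open>The ball around \<open>z\<close> is moved to the origin through
    \<open>x = (z + x) - z\<close>, which costs the factor 2.\<close>
  have *: "p i x \<le> 2 * real n" if "i \<in> I" "norm x \<le> r" for i x
  proof -
    have "z + x \<in> K n" "z \<in> K n" using r that by (auto simp: dist_norm subset_iff)
    then have "p i (z + x) \<le> real n" "p i z \<le> real n" using that by (auto simp: K_def)
    then show ?thesis using sub[OF that(1), of "z + x" "- z"] neg[OF that(1), of z] by simp
  qed
  have "p i x \<le> (2 * real n / r) * norm x" if i: "i \<in> I" for i x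
  proof (cases "x = 0")
    case True
    then show ?thesis using hom[OF i, of 0 x] by simp
  next
    case False
    have "p i ((r / norm x) *\<^sub>R x) \<le> 2 * real n"
      using r False by (intro *[OF i]) simp
    then have "r / norm x * p i x \<le> 2 * real n"
      using r False by (subst (asm) hom[OF i]) simp
    then show ?thesis using r False by (simp add: field_simps)
  qed
  then show thesis using r by (intro that[of "2 * real n / r"]) auto
qed

lemma cmod_iexp_diff_le: "cmod (iexp a - iexp b) \<le> \<bar>a - b\<bar>"
proof -
  have "iexp a - iexp b = iexp b * (iexp (a - b) - 1)"
    by (simp add: algebra_simps flip: exp_add)
  then have "cmod (iexp a - iexp b) = cmod (iexp (a - b) - 1)"
    by (simp add: norm_mult)
  also have "\<dots> \<le> \<bar>a - b\<bar>" using iexp_approx1[of "a - b" 0] by simp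
  finally show ?thesis .
qed

lemma cmod_iexp_diff_le2: "cmod (iexp a - iexp b) \<le> 2"
  using norm_triangle_ineq4[of "iexp a" "iexp b"] by simp

context prob_space
begin

lemma integrable_iexp [simp]: "X \<in> borel_measurable M \<Longrightarrow> integrable M (\<lambda>\<omega>. iexp (X \<omega>))"
  by (rule integrable_const_bound[of _ 1]) auto

lemma cmod_expectation_iexp_le: "X \<in> borel_measurable M \<Longrightarrow> cmod (LINT \<omega>|M. iexp (X \<omega>)) \<le> 1"
  using integral_norm_bound[of M "\<lambda>\<omega>. iexp (X \<omega>)"] by (simp add: prob_space)

lemma tendsto_prob_iexp:
  assumes [measurable]: "\<And>n. X n \<in> borel_measurable M" "Y \<in> borel_measurable M"
    and "tendsto_prob M X Y F"
  shows "((\<lambda>n. LINT \<omega>|M. iexp (X n \<omega>)) \<longlongrightarrow> (LINT \<omega>|M. iexp (Y \<omega>))) F"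
proof (rule tendstoI)
  fix e :: real assume e: "e > 0"
  have "((\<lambda>i. measure M {\<omega> \<in> space M. e / 4 < \<bar>X i \<omega> - Y \<omega>\<bar>}) \<longlongrightarrow> 0) F"
    using assms(3) divide_pos_pos[OF e zero_less_numeral] unfolding tendsto_prob_def by blast
  then have "eventually (\<lambda>i. measure M {\<omega> \<in> space M. e / 4 < \<bar>X i \<omega> - Y \<omega>\<bar>} < e / 4) F"
    using e by (intro order_tendstoD) auto
  then show "eventually (\<lambda>n. dist (LINT \<omega>|M. iexp (X n \<omega>)) (LINT \<omega>|M. iexp (Y \<omega>)) < e) F"
  proof eventually_elim
    case (elim i)
    let ?A = "{\<omega> \<in> space M. e / 4 < \<bar>X i \<omega> - Y \<omega>\<bar>}"
    have "dist (LINT \<omega>|M. iexp (X i \<omega>)) (LINT \<omega>|M. iexp (Y \<omega>))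
      = cmod (LINT \<omega>|M. iexp (X i \<omega>) - iexp (Y \<omega>))"
      by (simp add: dist_norm)
    also have "\<dots> \<le> (LINT \<omega>|M. cmod (iexp (X i \<omega>) - iexp (Y \<omega>)))"
      by (rule integral_norm_bound)
    \<comment> \<open>Off \<open>?A\<close> the Lipschitz bound gives \<open>e / 4\<close>. On
      \<open>?A\<close> the trivial bound 2 meets a mass below \<open>e / 4\<close>, so the total
      stays below \<open>3 e / 4\<close>.\<close>
    also have "\<dots> \<le> (LINT \<omega>|M. e / 4 + 2 * indicator ?A \<omega>)"
    proof (rule integral_mono)
      show "integrable M (\<lambda>\<omega>. cmod (iexp (X i \<omega>) - iexp (Y \<omega>)))" by simp
      show "integrable M (\<lambda>\<omega>. e / 4 + 2 * indicator ?A \<omega>)"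
        using e by (intro integrable_const_bound[of _ "e / 4 + 2"]) (auto simp: indicator_def)
      fix \<omega> assume "\<omega> \<in> space M"
      then show "cmod (iexp (X i \<omega>) - iexp (Y \<omega>)) \<le> e / 4 + 2 * indicator ?A \<omega>"
        using cmod_iexp_diff_le[of "X i \<omega>" "Y \<omega>"] cmod_iexp_diff_le2[of "X i \<omega>" "Y \<omega>"] e
        by (auto simp: indicator_def)
    qed
    also have "\<dots> = e / 4 + 2 * measure M ?A"
      by (subst Bochner_Integration.integral_add) (simp_all add: prob_space emeasure_eq_measure)
    also have "\<dots> < e" using elim e by simp
    finally show ?case .
  qed
qed

text \<open>The Gaussian device in dimension one: averaging the characteristic functions over a
  standard normal \<open>t\<close> gives \<open>E exp (- X_n^2 / 2)\<close>, which therefore tends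
  to 1. Markov's inequality for \<open>1 - exp (- x^2 / 2)\<close>, whose value at the threshold
  \<epsilon> is \<open>c\<close>, then bounds the probabilities.\<close>

lemma tendsto_prob_zero_if_char:
  assumes [measurable]: "\<And>n. X n \<in> borel_measurable M"
    and lim: "\<And>t. (\<lambda>n. LINT \<omega>|M. iexp (t * X n \<omega>)) \<longlonglongrightarrow> 1"
  shows "tendsto_prob M X (\<lambda>_. 0) sequentially"
  unfolding tendsto_prob_def
proof (intro allI impI)
  fix \<epsilon> :: real assume \<epsilon>: "\<epsilon> > 0"
  let ?N = std_normal_distribution
  interpret N: real_distribution ?N by (rule real_dist_normal_dist)
  interpret P: pair_prob_space ?N M ..
  have ch: "(LINT t|?N. iexp (t * x)) = of_real (exp (- (x\<^sup>2) / 2))" for x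
    using fun_cong[OF char_std_normal_distribution, of x] unfolding char_def
    by (simp add: mult.commute)
  have eq: "(LINT t|?N. (LINT \<omega>|M. iexp (t * X n \<omega>))) = of_real (LINT \<omega>|M. exp (- ((X n \<omega>)\<^sup>2) / 2))" for n
  proof -
    have "(LINT t|?N. (LINT \<omega>|M. iexp (t * X n \<omega>))) = (LINT \<omega>|M. (LINT t|?N. iexp (t * X n \<omega>)))"
      by (rule P.Fubini_integral[symmetric], rule P.integrable_const_bound[of _ 1])
        (auto simp: split_beta')
    also have "\<dots> = (LINT \<omega>|M. of_real (exp (- ((X n \<omega>)\<^sup>2) / 2)))" by (simp only: ch)
    finally show ?thesis by (simp only: integral_complex_of_real)
  qed
  have "(\<lambda>n. LINT t|?N. (LINT \<omega>|M. iexp (t * X n \<omega>))) \<longlonglongrightarrow> (LINT t|?N. 1)"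
  proof (rule integral_dominated_convergence[where w="\<lambda>_. 1"])
    show "(\<lambda>t. LINT \<omega>|M. iexp (t * X n \<omega>)) \<in> borel_measurable ?N" for n
      by (intro borel_measurable_lebesgue_integral) measurable
    show "AE t in ?N. cmod (LINT \<omega>|M. iexp (t * X n \<omega>)) \<le> 1" for n
      by (intro AE_I2 cmod_expectation_iexp_le) auto
  qed (use lim in \<open>simp_all add: mult.assoc\<close>)
  then have "(\<lambda>n. Re (LINT t|?N. (LINT \<omega>|M. iexp (t * X n \<omega>)))) \<longlonglongrightarrow> 1"
    using tendsto_Re by (fastforce simp: N.prob_space[simplified])
  then have l1: "(\<lambda>n. LINT \<omega>|M. exp (- ((X n \<omega>)\<^sup>2) / 2)) \<longlonglongrightarrow> 1"
    unfolding eq by simp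
  define c where "c = 1 - exp (- (\<epsilon>\<^sup>2) / 2)"
  have c: "c > 0" using \<epsilon> by (simp add: c_def)
  have bound: "measure M {\<omega> \<in> space M. \<epsilon> < \<bar>X n \<omega> - 0\<bar>} \<le> (1 - (LINT \<omega>|M. exp (- ((X n \<omega>)\<^sup>2) / 2))) / c" for n
  proof -
    let ?A = "{\<omega> \<in> space M. \<epsilon> < \<bar>X n \<omega> - 0\<bar>}"
    have int: "integrable M (\<lambda>\<omega>. exp (- ((X n \<omega>)\<^sup>2) / 2))"
      by (rule integrable_const_bound[of _ 1]) auto
    have "c * measure M ?A = (LINT \<omega>|M. c * indicator ?A \<omega>)" by simp
    also have "\<dots> \<le> (LINT \<omega>|M. 1 - exp (- ((X n \<omega>)\<^sup>2) / 2))"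
    proof (rule integral_mono)
      show "integrable M (\<lambda>\<omega>. c * indicator ?A \<omega>)"
        by (rule integrable_const_bound[of _ "\<bar>c\<bar>"]) (auto simp: indicator_def)
      fix \<omega> assume "\<omega> \<in> space M"
      have "c \<le> 1 - exp (- ((X n \<omega>)\<^sup>2) / 2)" if "\<epsilon> < \<bar>X n \<omega>\<bar>"
        using that \<epsilon> abs_le_square_iff[of \<epsilon> "X n \<omega>"] by (simp add: c_def)
      then show "c * indicator ?A \<omega> \<le> 1 - exp (- ((X n \<omega>)\<^sup>2) / 2)"
        by (auto simp: indicator_def)
    qed (use int in auto)
    also have "\<dots> = 1 - (LINT \<omega>|M. exp (- ((X n \<omega>)\<^sup>2) / 2))" using int by (simp add: prob_space)
    finally show ?thesis using c by (simp add: field_simps)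
  qed
  have "(\<lambda>n. (1 - (LINT \<omega>|M. exp (- ((X n \<omega>)\<^sup>2) / 2))) / c) \<longlonglongrightarrow> (1 - 1) / c"
    using c by (intro tendsto_intros l1) auto
  then have "(\<lambda>n. (1 - (LINT \<omega>|M. exp (- ((X n \<omega>)\<^sup>2) / 2))) / c) \<longlonglongrightarrow> 0" by simp
  then show "(\<lambda>n. measure M {\<omega> \<in> space M. \<epsilon> < \<bar>X n \<omega> - 0\<bar>}) \<longlonglongrightarrow> 0"
    by (rule Lim_null_comparison[rotated]) (use bound in auto)
qed

lemma tendsto_prob_AE_cong:
  assumes "\<And>n. AE \<omega> in M. X n \<omega> - Y \<omega> = X' n \<omega> - Y' \<omega>"
    and [measurable]: "\<And>n. X n \<in> borel_measurable M" "Y \<in> borel_measurable M"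
      "\<And>n. X' n \<in> borel_measurable M" "Y' \<in> borel_measurable M"
  shows "tendsto_prob M X Y F \<longleftrightarrow> tendsto_prob M X' Y' F"
proof -
  have "measure M {\<omega> \<in> space M. e < \<bar>X n \<omega> - Y \<omega>\<bar>} = measure M {\<omega> \<in> space M. e < \<bar>X' n \<omega> - Y' \<omega>\<bar>}" for e n
    by (rule measure_eq_AE, use assms(1)[of n] in eventually_elim) auto
  then show ?thesis unfolding tendsto_prob_def by simp
qed

lemma tendsto_prob_add:
  assumes [measurable]: "\<And>n. X n \<in> borel_measurable M" "Y \<in> borel_measurable M"
      "\<And>n. X' n \<in> borel_measurable M" "Y' \<in> borel_measurable M"
    and "tendsto_prob M X Y F" "tendsto_prob M X' Y' F"
  shows "tendsto_prob M (\<lambda>n \<omega>. X n \<omega> + X' n \<omega>) (\<lambda>\<omega>. Y \<omega> + Y' \<omega>) F"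
  unfolding tendsto_prob_def
proof (intro allI impI)
  fix e :: real assume e: "e > 0"
  have "((\<lambda>n. measure M {\<omega> \<in> space M. e / 2 < \<bar>X n \<omega> - Y \<omega>\<bar>}
      + measure M {\<omega> \<in> space M. e / 2 < \<bar>X' n \<omega> - Y' \<omega>\<bar>}) \<longlongrightarrow> 0 + 0) F"
    using assms(5,6) half_gt_zero[OF e] unfolding tendsto_prob_def by (intro tendsto_add) blast+
  then have *: "((\<lambda>n. measure M {\<omega> \<in> space M. e / 2 < \<bar>X n \<omega> - Y \<omega>\<bar>}
      + measure M {\<omega> \<in> space M. e / 2 < \<bar>X' n \<omega> - Y' \<omega>\<bar>}) \<longlongrightarrow> 0) F" by simp
  show "((\<lambda>n. measure M {\<omega> \<in> space M. e < \<bar>X n \<omega> + X' n \<omega> - (Y \<omega> + Y' \<omega>)\<bar>}) \<longlongrightarrow> 0) F"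
  proof (rule Lim_null_comparison[OF _ *], intro always_eventually allI)
    fix n
    have "measure M {\<omega> \<in> space M. e < \<bar>X n \<omega> + X' n \<omega> - (Y \<omega> + Y' \<omega>)\<bar>}
      \<le> measure M ({\<omega> \<in> space M. e / 2 < \<bar>X n \<omega> - Y \<omega>\<bar>} \<union> {\<omega> \<in> space M. e / 2 < \<bar>X' n \<omega> - Y' \<omega>\<bar>})"
      by (intro finite_measure_mono) (auto simp: not_less, smt (verit) field_sum_of_halves)
    also have "\<dots> \<le> measure M {\<omega> \<in> space M. e / 2 < \<bar>X n \<omega> - Y \<omega>\<bar>}
      + measure M {\<omega> \<in> space M. e / 2 < \<bar>X' n \<omega> - Y' \<omega>\<bar>}"
      by (intro measure_Un_le) auto
    finally show "norm (measure M {\<omega> \<in> space M. e < \<bar>X n \<omega> + X' n \<omega> - (Y \<omega> + Y' \<omega>)\<bar>})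
      \<le> measure M {\<omega> \<in> space M. e / 2 < \<bar>X n \<omega> - Y \<omega>\<bar>}
        + measure M {\<omega> \<in> space M. e / 2 < \<bar>X' n \<omega> - Y' \<omega>\<bar>}" by simp
  qed
qed

lemma tendsto_prob_cmult:
  assumes "tendsto_prob M X Y F"
  shows "tendsto_prob M (\<lambda>n \<omega>. c * X n \<omega>) (\<lambda>\<omega>. c * Y \<omega>) F"
proof (cases "c = 0")
  case True
  then show ?thesis unfolding tendsto_prob_def by auto
next
  case False
  have *: "e < \<bar>c * a - c * b\<bar> \<longleftrightarrow> e / \<bar>c\<bar> < \<bar>a - b\<bar>" for a b e
    using False by (simp add: field_simps flip: abs_mult right_diff_distrib)
  show ?thesis unfolding tendsto_prob_def *
    using assms False unfolding tendsto_prob_def by simp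
qed

lemma tendsto_prob_if_AE:
  assumes [measurable]: "\<And>n. X n \<in> borel_measurable M" "Y \<in> borel_measurable M"
    and ae: "AE \<omega> in M. (\<lambda>n. X n \<omega>) \<longlonglongrightarrow> Y \<omega>"
  shows "tendsto_prob M X Y sequentially"
  unfolding tendsto_prob_def
proof (intro allI impI)
  fix e :: real assume e: "e > 0"
  have "(\<lambda>n. LINT \<omega>|M. indicator {\<omega> \<in> space M. e < \<bar>X n \<omega> - Y \<omega>\<bar>} \<omega> :: real) \<longlonglongrightarrow> (LINT \<omega>|M. 0)"
  proof (rule integral_dominated_convergence[where w="\<lambda>_. 1"])
    show "AE \<omega> in M. (\<lambda>n. indicator {\<omega> \<in> space M. e < \<bar>X n \<omega> - Y \<omega>\<bar>} \<omega> :: real) \<longlonglongrightarrow> 0"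
      using ae
    proof eventually_elim
      case (elim \<omega>)
      then have "eventually (\<lambda>n. dist (X n \<omega>) (Y \<omega>) < e) sequentially" using e by (rule tendstoD)
      then have "eventually (\<lambda>n. indicator {\<omega> \<in> space M. e < \<bar>X n \<omega> - Y \<omega>\<bar>} \<omega> = (0::real)) sequentially"
        by eventually_elim (auto simp: dist_real_def)
      then show ?case by (rule tendsto_eventually)
    qed
  qed (auto simp: indicator_def)
  then show "(\<lambda>n. measure M {\<omega> \<in> space M. e < \<bar>X n \<omega> - Y \<omega>\<bar>}) \<longlonglongrightarrow> 0" by simp
qed

lemma tendsto_prob_unique:
  assumes [measurable]: "\<And>n. X n \<in> borel_measurable M" "Y \<in> borel_measurable M" "Z \<in> borel_measurable M"
    and Y: "tendsto_prob M X Y sequentially" and Z: "tendsto_prob M X Z sequentially"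
  shows "AE \<omega> in M. Y \<omega> = Z \<omega>"
proof -
  have "tendsto_prob M (\<lambda>n \<omega>. X n \<omega> + (-1) * X n \<omega>) (\<lambda>\<omega>. Y \<omega> + (-1) * Z \<omega>) sequentially"
    by (intro tendsto_prob_add tendsto_prob_cmult Y Z) auto
  then have *: "measure M {\<omega> \<in> space M. e < \<bar>Y \<omega> - Z \<omega>\<bar>} = 0" if "e > 0" for e
    using that unfolding tendsto_prob_def by (auto simp: LIMSEQ_const_iff abs_minus_commute)
  have "AE \<omega> in M. \<bar>Y \<omega> - Z \<omega>\<bar> \<le> 1 / real (Suc n)" for n
  proof (rule AE_I)
    show "{\<omega> \<in> space M. \<not> \<bar>Y \<omega> - Z \<omega>\<bar> \<le> 1 / real (Suc n)} \<subseteq> {\<omega> \<in> space M. 1 / real (Suc n) < \<bar>Y \<omega> - Z \<omega>\<bar>}"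
      by auto
    show "emeasure M {\<omega> \<in> space M. 1 / real (Suc n) < \<bar>Y \<omega> - Z \<omega>\<bar>} = 0"
      using *[of "1 / real (Suc n)"] by (simp add: emeasure_eq_measure)
  qed auto
  then have "AE \<omega> in M. \<forall>n. \<bar>Y \<omega> - Z \<omega>\<bar> \<le> 1 / real (Suc n)" by (simp add: AE_all_countable)
  then show ?thesis
  proof eventually_elim
    case (elim \<omega>)
    then have "\<bar>Y \<omega> - Z \<omega>\<bar> \<le> 0"
      by (intro LIMSEQ_le_const[OF LIMSEQ_inverse_real_of_nat]) (auto simp: field_simps)
    then show ?case by simp
  qed
qed

text \<open>The Cauchy condition is phrased along pairs of index sequences because the criterion by
  characteristic functions applies to sequences. A failure at some \<open>e\<close> would produce
  such a pair. Borel--Cantelli gives an almost sure limit along a fast subsequence \<open>r\<close>,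
  and the pair of the identity and \<open>r\<close> transfers it to the whole sequence.\<close>

lemma tendsto_prob_complete:
  assumes [measurable]: "\<And>n. X n \<in> borel_measurable M"
    and cauchy: "\<And>p q. (\<And>i::nat. p i \<ge> i) \<Longrightarrow> (\<And>i. q i \<ge> i) \<Longrightarrow>
        tendsto_prob M (\<lambda>i \<omega>. X (p i) \<omega> - X (q i) \<omega>) (\<lambda>_. 0) sequentially"
  obtains Y where "Y \<in> borel_measurable M" "tendsto_prob M X Y sequentially"
proof -
  have C: "\<exists>N. \<forall>p\<ge>N. \<forall>q\<ge>N. measure M {\<omega> \<in> space M. e < \<bar>X p \<omega> - X q \<omega>\<bar>} < e" if e: "e > 0" for e
  proof (rule ccontr)
    assume "\<not> ?thesis"
    then have "\<forall>i. \<exists>p q. p \<ge> i \<and> q \<ge> i \<and> measure M {\<omega> \<in> space M. e < \<bar>X p \<omega> - X q \<omega>\<bar>} \<ge> e"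
      by (meson not_less)
    then obtain p q where pq: "\<And>i. p i \<ge> i" "\<And>i. q i \<ge> i"
      "\<And>i. measure M {\<omega> \<in> space M. e < \<bar>X (p i) \<omega> - X (q i) \<omega>\<bar>} \<ge> e" by metis
    from cauchy[OF pq(1,2)] e have "(\<lambda>i. measure M {\<omega> \<in> space M. e < \<bar>X (p i) \<omega> - X (q i) \<omega>\<bar>}) \<longlonglongrightarrow> 0"
      unfolding tendsto_prob_def by simp
    then have "e \<le> 0" by (rule LIMSEQ_le_const) (use pq in auto)
    with e show False by simp
  qed
  have "\<exists>r. strict_mono r \<and> (\<forall>i. \<forall>p\<ge>r i. \<forall>q\<ge>r i. measure M {\<omega> \<in> space M. (1/2)^i < \<bar>X p \<omega> - X q \<omega>\<bar>} < (1/2)^i)"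
  proof -
    have "\<exists>N. \<forall>p\<ge>N. \<forall>q\<ge>N. measure M {\<omega> \<in> space M. (1/2)^i < \<bar>X p \<omega> - X q \<omega>\<bar>} < (1/2)^i" for i
      by (rule C) simp
    then obtain N where N: "\<And>i::nat. \<forall>p\<ge>N i. \<forall>q\<ge>N i. measure M {\<omega> \<in> space M. (1/2)^i < \<bar>X p \<omega> - X q \<omega>\<bar>} < (1/2)^i"
      by metis
    define r where "r = rec_nat (N 0) (\<lambda>i ri. max (Suc ri) (N (Suc i)))"
    have "r (Suc i) = max (Suc (r i)) (N (Suc i))" "r 0 = N 0" for i by (simp_all add: r_def)
    then have "r i < r (Suc i)" "r i \<ge> N i" for i by (simp, cases i, simp_all)
    then show ?thesis using N by (intro exI[of _ r]) (meson le_trans strict_mono_Suc_iff)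
  qed
  then obtain r where r: "strict_mono r"
    "\<And>i p q. p \<ge> r i \<Longrightarrow> q \<ge> r i \<Longrightarrow> measure M {\<omega> \<in> space M. (1/2)^i < \<bar>X p \<omega> - X q \<omega>\<bar>} < (1/2)^i"
    by blast
  let ?A = "\<lambda>i. {\<omega> \<in> space M. (1/2)^i < \<bar>X (r (Suc i)) \<omega> - X (r i) \<omega>\<bar>}"
  have "AE \<omega> in M. eventually (\<lambda>i. \<omega> \<in> space M - ?A i) sequentially"
  proof (rule borel_cantelli_AE1)
    have "measure M (?A i) \<le> (1/2)^i" for i
    proof (rule less_imp_le, rule r(2))
      show "r i \<le> r (Suc i)" using strict_mono_less_eq[OF r(1), of i "Suc i"] by linarith
    qed (rule order_refl)
    then show "summable (\<lambda>i. measure M (?A i))"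
      by (intro summable_comparison_test'[OF summable_geometric[of "1/2 :: real"], of 0]) simp_all
    show "?A i \<in> sets M" for i by measurable
    show "emeasure M (?A i) < \<infinity>" for i by (simp add: emeasure_eq_measure)
  qed
  then have conv: "AE \<omega> in M. convergent (\<lambda>i. X (r i) \<omega>)"
  proof eventually_elim
    case (elim \<omega>)
    then have "eventually (\<lambda>i. norm (X (r (Suc i)) \<omega> - X (r i) \<omega>) \<le> (1/2)^i) sequentially"
      by eventually_elim (use elim in \<open>simp add: not_less\<close>)
    then have "summable (\<lambda>i. X (r (Suc i)) \<omega> - X (r i) \<omega>)"
      by (rule summable_comparison_test_ev) (simp add: summable_geometric)
    then have "convergent (\<lambda>n. X (r n) \<omega> - X (r 0) \<omega>)"
      by (simp only: summable_iff_convergent sum_lessThan_telescope[of "\<lambda>i. X (r i) \<omega>"])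
    then have "convergent (\<lambda>n. X (r n) \<omega> - X (r 0) \<omega> + X (r 0) \<omega>)"
      by (intro convergent_add convergent_const)
    then show ?case by simp
  qed
  define Y where "Y \<omega> = lim (\<lambda>i. X (r i) \<omega>)" for \<omega>
  have Y[measurable]: "Y \<in> borel_measurable M" unfolding Y_def by (rule borel_measurable_lim_metric) simp
  have sub: "tendsto_prob M (\<lambda>i. X (r i)) Y sequentially"
    by (rule tendsto_prob_if_AE, simp_all, use conv in eventually_elim) (simp add: Y_def convergent_LIMSEQ_iff)
  have ge: "r i \<ge> i" for i using r(1) by (rule strict_mono_imp_increasing)
  have "tendsto_prob M (\<lambda>i \<omega>. X i \<omega> - X (r i) \<omega>) (\<lambda>_. 0) sequentially"
    by (rule cauchy[of "\<lambda>i. i" r]) (rule order_refl ge)+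
  then have "tendsto_prob M (\<lambda>i \<omega>. X (r i) \<omega> + (X i \<omega> - X (r i) \<omega>)) (\<lambda>\<omega>. Y \<omega> + 0) sequentially"
    by (rule tendsto_prob_add[rotated -1]) (use sub in simp_all)
  then show thesis by (intro that[OF Y]) simp
qed

end

section \<open>Gaussian averages and regulated functions\<close>

abbreviation gauss :: "nat set \<Rightarrow> (nat \<Rightarrow> real) measure" where
  "gauss I \<equiv> Pi\<^sub>M I (\<lambda>_. std_normal_distribution)"

lemma prob_space_std_normal: "prob_space std_normal_distribution"
  using real_dist_normal_dist by (simp add: real_distribution_def)

lemma prob_space_gauss: "prob_space (gauss I)"
  by (intro prob_space_PiM prob_space_std_normal)

lemma product_sigma_finite_gauss: "product_sigma_finite (\<lambda>_::nat. std_normal_distribution)"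
  using prob_space_std_normal
  by (auto simp: product_sigma_finite_def prob_space_imp_sigma_finite)

text \<open>Read from right to left, this trades a function of a squared norm for an average of
  characters.\<close>

lemma gauss_iexp:
  assumes "finite I"
  shows "(LINT g|gauss I. iexp (\<Sum>k\<in>I. g k * y k)) = of_real (exp (- (\<Sum>k\<in>I. (y k)\<^sup>2) / 2))"
proof -
  interpret product_sigma_finite "\<lambda>_::nat. std_normal_distribution" by (rule product_sigma_finite_gauss)
  interpret N: prob_space std_normal_distribution by (rule prob_space_std_normal)
  have ch: "(LINT t|std_normal_distribution. iexp (t * x)) = of_real (exp (- (x\<^sup>2) / 2))" for x
    using fun_cong[OF char_std_normal_distribution, of x] unfolding char_def
    by (simp add: mult.commute)
  have "(LINT g|gauss I. iexp (\<Sum>k\<in>I. g k * y k)) = (LINT g|gauss I. (\<Prod>k\<in>I. iexp (g k * y k)))"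
    using assms by (simp add: exp_sum sum_distrib_left)
  also have "\<dots> = (\<Prod>k\<in>I. LINT t|std_normal_distribution. iexp (t * y k))"
    by (rule product_integral_prod[OF assms]) (intro N.integrable_iexp, measurable)
  also have "\<dots> = of_real (\<Prod>k\<in>I. exp (- ((y k)\<^sup>2) / 2))" by (simp only: ch of_real_prod)
  also have "(\<Prod>k\<in>I. exp (- ((y k)\<^sup>2) / 2)) = exp (- (\<Sum>k\<in>I. (y k)\<^sup>2) / 2)"
    using assms by (simp add: sum_negf sum_divide_distrib flip: exp_sum)
  finally show ?thesis .
qed

lemma gauss_cos:
  assumes "finite I"
  shows "(LINT g|gauss I. cos (\<Sum>k\<in>I. g k * y k)) = exp (- (\<Sum>k\<in>I. (y k)\<^sup>2) / 2)"
proof -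
  interpret prob_space "gauss I" by (rule prob_space_gauss)
  have "(LINT g|gauss I. cos (\<Sum>k\<in>I. g k * y k)) = (LINT g|gauss I. Re (iexp (\<Sum>k\<in>I. g k * y k)))"
    by (simp del: of_real_sum of_real_mult add: cis_conv_exp[symmetric])
  also have "\<dots> = Re (LINT g|gauss I. iexp (\<Sum>k\<in>I. g k * y k))"
    by (intro integral_Re integrable_iexp) measurable
  finally show ?thesis using gauss_iexp[OF assms, of y] by simp
qed

lemma gauss_one_minus_cos:
  assumes "finite I"
  shows "(\<integral>\<^sup>+g. ennreal (1 - cos (\<Sum>k\<in>I. g k * y k)) \<partial>gauss I) = ennreal (1 - exp (- (\<Sum>k\<in>I. (y k)\<^sup>2) / 2))"
proof -
  interpret prob_space "gauss I" by (rule prob_space_gauss)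
  have int: "integrable (gauss I) (\<lambda>g. cos (\<Sum>k\<in>I. g k * y k))"
    by (rule integrable_const_bound[of _ 1]) auto
  have "(\<integral>\<^sup>+g. ennreal (1 - cos (\<Sum>k\<in>I. g k * y k)) \<partial>gauss I)
    = ennreal (LINT g|gauss I. 1 - cos (\<Sum>k\<in>I. g k * y k))"
    by (rule nn_integral_eq_integral) (use int in auto)
  also have "(LINT g|gauss I. 1 - cos (\<Sum>k\<in>I. g k * y k)) = 1 - exp (- (\<Sum>k\<in>I. (y k)\<^sup>2) / 2)"
    using int by (simp add: prob_space gauss_cos[OF assms])
  finally show ?thesis .
qed

text \<open>With \<open>q = exp (- v / 2)\<close> the two sides are
  \<open>(1 - q)^2 (q^2 + 2 q + 3) / 2\<close> and \<open>3 (1 - q)^2\<close>. The constant 3 is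
  sharp as the variance tends to 0, where \<open>1 - cos S\<close> behaves like
  \<open>S^2 / 2\<close> and the ratio becomes that of the moments of order 4 and 2.\<close>

lemma gauss_one_minus_cos_square_le:
  assumes "finite I"
  shows "(\<integral>\<^sup>+g. (ennreal (1 - cos (\<Sum>k\<in>I. g k * y k)))\<^sup>2 \<partial>gauss I)
    \<le> 3 * (\<integral>\<^sup>+g. ennreal (1 - cos (\<Sum>k\<in>I. g k * y k)) \<partial>gauss I)\<^sup>2"
proof -
  interpret prob_space "gauss I" by (rule prob_space_gauss)
  let ?S = "\<lambda>g. \<Sum>k\<in>I. g k * y k" and ?v = "\<Sum>k\<in>I. (y k)\<^sup>2"
  define q where "q = exp (- ?v / 2)"
  have q: "0 \<le> q" "q \<le> 1" by (auto simp: q_def sum_nonneg)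
  have int: "integrable (gauss I) (\<lambda>g. cos (?S g))" "integrable (gauss I) (\<lambda>g. cos (2 * ?S g))"
    by (rule integrable_const_bound[of _ 1]; auto)+
  \<comment> \<open>The square is rewritten by frequencies 0, 1 and 2. Doubling the frequency
    multiplies the variance by 4, so the mean of the last cosine is \<open>q^4\<close>.\<close>
  have sq: "(1 - cos x)\<^sup>2 = 3/2 - 2 * cos x + cos (2 * x) / 2" for x :: real
    by (simp only: cos_double_cos) (simp add: power2_eq_square field_simps)
  have i2: "(LINT g|gauss I. cos (2 * ?S g)) = q^4"
    using gauss_cos[OF assms, of "\<lambda>k. 2 * y k"]
    by (simp add: q_def sum_distrib_left power_mult_distrib mult_ac flip: exp_of_nat_mult)
  have "(\<integral>\<^sup>+g. (ennreal (1 - cos (?S g)))\<^sup>2 \<partial>gauss I) = (\<integral>\<^sup>+g. ennreal (3/2 - 2 * cos (?S g) + cos (2 * ?S g) / 2) \<partial>gauss I)"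
    by (simp add: ennreal_power sq[symmetric])
  also have "\<dots> = ennreal (LINT g|gauss I. 3/2 - 2 * cos (?S g) + cos (2 * ?S g) / 2)"
  proof (rule nn_integral_eq_integral)
    show "integrable (gauss I) (\<lambda>g. 3/2 - 2 * cos (?S g) + cos (2 * ?S g) / 2)" using int by simp
  qed (simp add: sq[symmetric])
  also have "(LINT g|gauss I. 3/2 - 2 * cos (?S g) + cos (2 * ?S g) / 2) = 3/2 - 2 * q + q^4 / 2"
    using int i2 gauss_cos[OF assms, of y] by (simp add: prob_space q_def)
  also have "ennreal \<dots> \<le> ennreal (3 * (1 - q)\<^sup>2)"
  proof (rule ennreal_leI)
    have "3/2 - 2 * q + q^4 / 2 = (1 - q)\<^sup>2 * ((q\<^sup>2 + 2 * q + 3) / 2)"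
      by (simp add: power2_eq_square power4_eq_xxxx field_simps)
    also have "\<dots> \<le> (1 - q)\<^sup>2 * 3"
      using q power_le_one[of q 2] by (intro mult_left_mono) auto
    finally show "3/2 - 2 * q + q^4 / 2 \<le> 3 * (1 - q)\<^sup>2" by simp
  qed
  also have "\<dots> = 3 * (ennreal (1 - q))\<^sup>2" using q by (simp add: ennreal_mult ennreal_power)
  finally show ?thesis unfolding gauss_one_minus_cos[OF assms] q_def .
qed

lemma ennreal_le_if_power2_le: "x \<le> y" if "x\<^sup>2 \<le> y\<^sup>2" for x y :: ennreal
proof (cases x; cases y)
  fix a b :: real assume "x = ennreal a" "y = ennreal b" "0 \<le> a" "0 \<le> b"
  then show ?thesis using that by (auto simp: ennreal_power power2_le_iff_abs_le)
qed (use that in \<open>auto simp: ennreal_power top_unique\<close>)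

text \<open>Minkowski's inequality turns a reverse Hoelder inequality for each \<open>\<kappa>(s, \<cdot>)\<close> into one for the
  mixture over \<open>s\<close>.\<close>

lemma reverse_Hoelder_mixture:
  fixes \<kappa> :: "'s \<times> 'g \<Rightarrow> ennreal"
  assumes "sigma_finite_measure S" "sigma_finite_measure G"
    and [measurable]: "\<kappa> \<in> borel_measurable (S \<Otimes>\<^sub>M G)"
    and le: "AE s in S. (\<integral>\<^sup>+g. (\<kappa> (s, g))\<^sup>2 \<partial>G) \<le> c * (\<integral>\<^sup>+g. \<kappa> (s, g) \<partial>G)\<^sup>2"
  shows "(\<integral>\<^sup>+g. (\<integral>\<^sup>+s. \<kappa> (s, g) \<partial>S)\<^sup>2 \<partial>G) \<le> c * (\<integral>\<^sup>+g. (\<integral>\<^sup>+s. \<kappa> (s, g) \<partial>S) \<partial>G)\<^sup>2"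
proof -
  interpret S: sigma_finite_measure S by fact
  interpret G: sigma_finite_measure G by fact
  interpret P: pair_sigma_finite S G ..
  let ?E = "\<lambda>s. \<integral>\<^sup>+g. \<kappa> (s, g) \<partial>G"
  \<comment> \<open>Minkowski's inequality is used in bilinear form: the square of the mixture is a
    double integral over \<open>s\<close> and \<open>s'\<close>, and Cauchy--Schwarz in
    \<open>g\<close> bounds each cross term.\<close>
  have pair: "(\<integral>\<^sup>+g. \<kappa> (s, g) * \<kappa> (s', g) \<partial>G) \<le> c * (?E s * ?E s')"
    if "s \<in> space S" "s' \<in> space S" "(\<integral>\<^sup>+g. (\<kappa> (s, g))\<^sup>2 \<partial>G) \<le> c * (?E s)\<^sup>2" "(\<integral>\<^sup>+g. (\<kappa> (s', g))\<^sup>2 \<partial>G) \<le> c * (?E s')\<^sup>2" for s s'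
  proof (rule ennreal_le_if_power2_le)
    have "(\<integral>\<^sup>+g. \<kappa> (s, g) * \<kappa> (s', g) \<partial>G)\<^sup>2 \<le> (\<integral>\<^sup>+g. (\<kappa> (s, g))\<^sup>2 \<partial>G) * (\<integral>\<^sup>+g. (\<kappa> (s', g))\<^sup>2 \<partial>G)"
      using that by (intro Cauchy_Schwarz_nn_integral) measurable
    also have "\<dots> \<le> (c * (?E s)\<^sup>2) * (c * (?E s')\<^sup>2)" by (intro mult_mono that) auto
    finally show "(\<integral>\<^sup>+g. \<kappa> (s, g) * \<kappa> (s', g) \<partial>G)\<^sup>2 \<le> (c * (?E s * ?E s'))\<^sup>2"
      by (simp add: power2_eq_square mult_ac)
  qed
  have "(\<integral>\<^sup>+g. (\<integral>\<^sup>+s. \<kappa> (s, g) \<partial>S)\<^sup>2 \<partial>G) = (\<integral>\<^sup>+g. (\<integral>\<^sup>+s. (\<integral>\<^sup>+s'. \<kappa> (s, g) * \<kappa> (s', g) \<partial>S) \<partial>S) \<partial>G)"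
    by (intro nn_integral_cong) (simp add: power2_eq_square nn_integral_cmult nn_integral_multc)
  also have "\<dots> = (\<integral>\<^sup>+s. (\<integral>\<^sup>+g. (\<integral>\<^sup>+s'. \<kappa> (s, g) * \<kappa> (s', g) \<partial>S) \<partial>G) \<partial>S)"
    by (rule P.Fubini') measurable
  also have "\<dots> = (\<integral>\<^sup>+s. (\<integral>\<^sup>+s'. (\<integral>\<^sup>+g. \<kappa> (s, g) * \<kappa> (s', g) \<partial>G) \<partial>S) \<partial>S)"
    by (intro nn_integral_cong P.Fubini') measurable
  also have "\<dots> \<le> (\<integral>\<^sup>+s. (\<integral>\<^sup>+s'. c * (?E s * ?E s') \<partial>S) \<partial>S)"
  proof (rule nn_integral_mono_AE, use le AE_space in eventually_elim)
    fix s assume s: "(\<integral>\<^sup>+g. (\<kappa> (s, g))\<^sup>2 \<partial>G) \<le> c * (?E s)\<^sup>2" "s \<in> space S"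
    show "(\<integral>\<^sup>+s'. (\<integral>\<^sup>+g. \<kappa> (s, g) * \<kappa> (s', g) \<partial>G) \<partial>S) \<le> (\<integral>\<^sup>+s'. c * (?E s * ?E s') \<partial>S)"
      by (rule nn_integral_mono_AE, use le AE_space in eventually_elim) (use s pair in blast)
  qed
  also have "\<dots> = c * (\<integral>\<^sup>+s. ?E s \<partial>S)\<^sup>2"
    by (simp add: nn_integral_cmult nn_integral_multc power2_eq_square mult.assoc)
  also have "(\<integral>\<^sup>+s. ?E s \<partial>S) = (\<integral>\<^sup>+g. (\<integral>\<^sup>+s. \<kappa> (s, g) \<partial>S) \<partial>G)"
    by (rule P.Fubini'[symmetric]) measurable
  finally show ?thesis .
qed

section \<open>Regulated functions and Lebesgue measure on \<open>[0, T]\<close>\<close>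

abbreviation leb :: "real \<Rightarrow> real measure" where
  "leb T \<equiv> restrict_space lborel {0..T}"

lemma finite_measure_leb: "finite_measure (leb T)"
  by (rule finite_measureI)
    (use emeasure_compact_finite[OF compact_Icc, of 0 T] in \<open>simp add: emeasure_restrict_space space_restrict_space\<close>)

lemma AE_leb_iff: "(AE s in leb T. P s) \<longleftrightarrow> (AE s in lborel. s \<in> {0..T} \<longrightarrow> P s)"
  by (simp add: AE_restrict_space_iff)

lemma AE_leb_if_countable:
  assumes "countable N" "\<And>s. s \<in> {0..T} \<Longrightarrow> s \<notin> N \<Longrightarrow> P s"
  shows "AE s in leb T. P s"
  unfolding AE_leb_iff
  by (rule AE_I'[of N]) (use assms countable_imp_null_set_lborel in auto)

lemma measurable_leb_if_countable_eq:
  assumes "f \<in> measurable (leb T) N" "countable X" "\<And>s. s \<in> X \<Longrightarrow> g s \<in> space N"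
    and "\<And>s. s \<in> {0..T} \<Longrightarrow> s \<notin> X \<Longrightarrow> f s = g s"
  shows "g \<in> measurable (leb T) N"
  by (rule measurable_discrete_difference[of f _ _ "X \<inter> {0..T}"])
    (use assms in \<open>auto simp: space_restrict_space sets_restrict_space image_iff\<close>)

text \<open>The first point of the grid of width \<open>T / (j + 1)\<close> strictly to the right of
  \<open>s\<close>. Strictness makes samples converge to right limits, and \<open>s\<close> enters
  through an integer only, which gives measurability after composition with arbitrary
  functions.\<close>

definition rsample :: "real \<Rightarrow> nat \<Rightarrow> real \<Rightarrow> real" where
  "rsample T j s = T * (of_int \<lfloor>real (Suc j) * s / T\<rfloor> + 1) / real (Suc j)"

lemma rsample_gt: "s < rsample T j s" if "T > 0"
proof -
  have "real (Suc j) * s / T < of_int \<lfloor>real (Suc j) * s / T\<rfloor> + 1" by linarith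
  with that show ?thesis by (simp add: rsample_def field_simps)
qed

lemma rsample_le: "rsample T j s \<le> s + T / real (Suc j)" if "T > 0"
proof -
  obtain m where m: "m = real (Suc j)" "m > 0" by simp
  have "rsample T j s \<le> T * (m * s / T + 1) / m"
    unfolding rsample_def m(1)[symmetric] using m(2) that by (intro divide_right_mono mult_left_mono add_right_mono) auto
  also have "\<dots> = s + T / m" using m(2) that by (simp add: field_simps)
  finally show ?thesis by (simp only: m(1))
qed

lemma rsample_tendsto: "filterlim (\<lambda>j. rsample T j s) (at_right s) sequentially" if "T > 0"
proof (rule tendsto_imp_filterlim_at_right)
  show "(\<lambda>j. rsample T j s) \<longlonglongrightarrow> s"
  proof (rule tendsto_sandwich)
    show "(\<lambda>j. s) \<longlonglongrightarrow> s" by simp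
    have "(\<lambda>j. s + T * inverse (real (Suc j))) \<longlonglongrightarrow> s + T * 0"
      by (intro tendsto_intros LIMSEQ_inverse_real_of_nat)
    then show "(\<lambda>j. s + T / real (Suc j)) \<longlonglongrightarrow> s" by (simp add: field_simps)
    show "\<forall>\<^sub>F n in sequentially. s \<le> rsample T n s"
      using rsample_gt[OF that] by (intro always_eventually allI less_imp_le)
    show "\<forall>\<^sub>F n in sequentially. rsample T n s \<le> s + T / real (Suc n)"
      using rsample_le[OF that] by (intro always_eventually allI)
  qed
qed (use that rsample_gt in auto)

text \<open>The Cauchy form of the one-sided limits. It holds at both endpoints as well, since the
  side without points of the interval imposes nothing.\<close>

lemma regulated_local:
  assumes g: "regulated T g" and x: "x \<in> {0..T}" and e: "e > 0"
  obtains d where "d > 0"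
    "\<And>y z. y \<in> {0..T} \<Longrightarrow> z \<in> {0..T} \<Longrightarrow> x < y \<Longrightarrow> y < x + d \<Longrightarrow> x < z \<Longrightarrow> z < x + d \<Longrightarrow> norm (g y - g z) < e"
    "\<And>y z. y \<in> {0..T} \<Longrightarrow> z \<in> {0..T} \<Longrightarrow> x - d < y \<Longrightarrow> y < x \<Longrightarrow> x - d < z \<Longrightarrow> z < x \<Longrightarrow> norm (g y - g z) < e"
proof -
  have tri: "norm (g y - g z) < e" if "dist (g y) l < e / 2" "dist (g z) l < e / 2" for y z l
    using dist_triangle_half_l[OF that] by (simp add: dist_norm)
  have "\<exists>d>0. \<forall>y\<in>{0..T}. \<forall>z\<in>{0..T}. x < y \<longrightarrow> y < x + d \<longrightarrow> x < z \<longrightarrow> z < x + d \<longrightarrow> norm (g y - g z) < e"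
  proof (cases "x < T")
    case True
    then have "x \<in> {0..<T}" using x by auto
    then obtain l where "(g \<longlongrightarrow> l) (at_right x)" using g unfolding regulated_def by blast
    then have "eventually (\<lambda>y. dist (g y) l < e / 2) (at_right x)" using e by (intro tendstoD) auto
    then obtain b where "b > x" "\<forall>y. x < y \<and> y < b \<longrightarrow> dist (g y) l < e / 2"
      unfolding eventually_at_right_field by blast
    then show ?thesis by (intro exI[of _ "b - x"]) (auto intro!: tri)
  qed (use x in \<open>auto intro!: exI[of _ 1]\<close>)
  then obtain d1 where d1: "d1 > 0" "\<forall>y\<in>{0..T}. \<forall>z\<in>{0..T}. x < y \<longrightarrow> y < x + d1 \<longrightarrow> x < z \<longrightarrow> z < x + d1 \<longrightarrow> norm (g y - g z) < e"
    by blast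
  have "\<exists>d>0. \<forall>y\<in>{0..T}. \<forall>z\<in>{0..T}. x - d < y \<longrightarrow> y < x \<longrightarrow> x - d < z \<longrightarrow> z < x \<longrightarrow> norm (g y - g z) < e"
  proof (cases "0 < x")
    case True
    then have "x \<in> {0<..T}" using x by auto
    then obtain l where "(g \<longlongrightarrow> l) (at_left x)" using g unfolding regulated_def by blast
    then have "eventually (\<lambda>y. dist (g y) l < e / 2) (at_left x)" using e by (intro tendstoD) auto
    then obtain b where "b < x" "\<forall>y. b < y \<and> y < x \<longrightarrow> dist (g y) l < e / 2"
      unfolding eventually_at_left_field by blast
    then show ?thesis by (intro exI[of _ "x - b"]) (auto intro!: tri)
  qed (use x in \<open>auto intro!: exI[of _ 1]\<close>)
  then obtain d2 where d2: "d2 > 0" "\<forall>y\<in>{0..T}. \<forall>z\<in>{0..T}. x - d2 < y \<longrightarrow> y < x \<longrightarrow> x - d2 < z \<longrightarrow> z < x \<longrightarrow> norm (g y - g z) < e"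
    by blast
  show thesis by (rule that[of "min d1 d2"]) (use d1 d2 in auto)
qed

lemma regulated_bounded:
  assumes g: "regulated T g"
  obtains C where "C > 0" "\<And>s. s \<in> {0..T} \<Longrightarrow> norm (g s) \<le> C"
proof -
  have "\<exists>n::nat. \<forall>s\<in>{0..T}. norm (g s) \<le> real n"
  proof (rule ccontr)
    assume "\<not> ?thesis"
    then have "\<forall>n::nat. \<exists>s. s \<in> {0..T} \<and> norm (g s) > real n" by (meson not_le)
    then obtain t where t: "\<And>n::nat. t n \<in> {0..T}" "\<And>n. norm (g (t n)) > real n" by metis
    obtain x r where x: "x \<in> {0..T}" and r: "strict_mono (r :: nat \<Rightarrow> nat)" and lim: "(t \<circ> r) \<longlonglongrightarrow> x"
      using compact_Icc[of 0 T] t(1) unfolding compact_def by blast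
    obtain d where d: "d > 0"
      "\<And>y z. y \<in> {0..T} \<Longrightarrow> z \<in> {0..T} \<Longrightarrow> x < y \<Longrightarrow> y < x + d \<Longrightarrow> x < z \<Longrightarrow> z < x + d \<Longrightarrow> norm (g y - g z) < 1"
      "\<And>y z. y \<in> {0..T} \<Longrightarrow> z \<in> {0..T} \<Longrightarrow> x - d < y \<Longrightarrow> y < x \<Longrightarrow> x - d < z \<Longrightarrow> z < x \<Longrightarrow> norm (g y - g z) < 1"
      using regulated_local[OF g x, of 1] by auto
    define R where "R = {0..T} \<inter> {x<..<x + d}"
    define S where "S = {0..T} \<inter> {x - d<..<x}"
    \<comment> \<open>One reference value on each side of \<open>x\<close> plus 1, and the value at
      \<open>x\<close> itself. If a side contains no point of the interval, its \<open>SOME\<close>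
      is arbitrary, which only enlarges the bound.\<close>
    define C where "C = max (norm (g x)) (max (norm (g (SOME y. y \<in> R)) + 1) (norm (g (SOME y. y \<in> S)) + 1))"
    have C: "norm (g y) \<le> C" if y: "y \<in> {0..T}" "\<bar>y - x\<bar> < d" for y
    proof (cases y x rule: linorder_cases)
      case less
      then have "y \<in> S" using y by (auto simp: S_def)
      then have "(SOME y. y \<in> S) \<in> S" by (rule someI)
      then have "norm (g y - g (SOME y. y \<in> S)) < 1" using \<open>y \<in> S\<close> by (intro d(3)) (auto simp: S_def)
      then show ?thesis using norm_triangle_sub[of "g y" "g (SOME y. y \<in> S)"] by (simp add: C_def)
    next
      case greater
      then have "y \<in> R" using y by (auto simp: R_def)
      then have "(SOME y. y \<in> R) \<in> R" by (rule someI)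
      then have "norm (g y - g (SOME y. y \<in> R)) < 1" using \<open>y \<in> R\<close> by (intro d(2)) (auto simp: R_def)
      then show ?thesis using norm_triangle_sub[of "g y" "g (SOME y. y \<in> R)"] by (simp add: C_def)
    qed (simp add: C_def)
    have "eventually (\<lambda>n. dist ((t \<circ> r) n) x < d) sequentially" using lim d(1) by (rule tendstoD)
    moreover have "eventually (\<lambda>n. n \<ge> nat \<lceil>C\<rceil>) sequentially" by (rule eventually_ge_at_top)
    ultimately have "eventually (\<lambda>n. False) sequentially"
    proof eventually_elim
      case (elim n)
      then have "norm (g (t (r n))) \<le> C" by (intro C t) (simp add: dist_real_def)
      moreover have "C \<le> real (r n)" using elim(2) strict_mono_imp_increasing[OF r, of n] by linarith
      ultimately show False using t(2)[of "r n"] by linarith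
    qed
    then show False by simp
  qed
  then obtain n :: nat where "\<forall>s\<in>{0..T}. norm (g s) \<le> real n" by blast
  then show thesis by (intro that[of "real n + 1"]) force+
qed

text \<open>The points whose right jump exceeds \<open>1 / (n + 1)\<close> cannot accumulate: on
  either side of an accumulation point the oscillation becomes smaller than that. So each
  \<open>D n\<close> is finite by compactness.\<close>

lemma regulated_right_continuous_off_countable:
  assumes g: "regulated T g"
  shows "countable {t \<in> {0..<T}. \<not> (g \<longlongrightarrow> g t) (at_right t)}"
proof -
  define gr where "gr t = (SOME l. (g \<longlongrightarrow> l) (at_right t))" for t
  have gr: "(g \<longlongrightarrow> gr t) (at_right t)" if "t \<in> {0..<T}" for t
    using g that unfolding gr_def regulated_def by (metis someI_ex)
  define D where "D n = {t \<in> {0..<T}. norm (gr t - g t) > 1 / real (Suc n)}" for n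
  have near: "norm (gr y - g y) \<le> e" if y: "y \<in> {0..<T}" and b: "y < b"
    and le: "\<And>z. z \<in> {0..T} \<Longrightarrow> y < z \<Longrightarrow> z < b \<Longrightarrow> norm (g y - g z) < e" for y b e
  proof (rule tendsto_upperbound)
    show "((\<lambda>z. norm (g z - g y)) \<longlongrightarrow> norm (gr y - g y)) (at_right y)"
      by (intro tendsto_intros gr y)
    have "min b T > y" using y b by auto
    then have "eventually (\<lambda>z. z \<in> {y<..<min b T}) (at_right y)" by (rule eventually_at_right_real)
    then show "eventually (\<lambda>z. norm (g z - g y) \<le> e) (at_right y)"
      by eventually_elim (use y in \<open>auto simp: norm_minus_commute[of _ "g y"] intro!: less_imp_le[OF le]\<close>)
  qed simp
  have "finite (D n)" for n
  proof (rule ccontr)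
    assume inf: "infinite (D n)"
    have "D n \<subseteq> {0..T}" by (auto simp: D_def)
    then obtain x where x: "x \<in> {0..T}" "x islimpt D n"
      using inf Heine_Borel_imp_Bolzano_Weierstrass[OF compact_Icc] by metis
    obtain d where d: "d > 0"
      "\<And>y z. y \<in> {0..T} \<Longrightarrow> z \<in> {0..T} \<Longrightarrow> x < y \<Longrightarrow> y < x + d \<Longrightarrow> x < z \<Longrightarrow> z < x + d \<Longrightarrow> norm (g y - g z) < 1 / real (Suc n)"
      "\<And>y z. y \<in> {0..T} \<Longrightarrow> z \<in> {0..T} \<Longrightarrow> x - d < y \<Longrightarrow> y < x \<Longrightarrow> x - d < z \<Longrightarrow> z < x \<Longrightarrow> norm (g y - g z) < 1 / real (Suc n)"
      using regulated_local[OF g x(1), of "1 / real (Suc n)"] by auto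
    obtain y where y: "y \<in> D n" "y \<noteq> x" "dist y x < d"
      using x(2) d(1) unfolding islimpt_approachable by blast
    then have y': "y \<in> {0..<T}" "norm (gr y - g y) > 1 / real (Suc n)" by (auto simp: D_def)
    have "norm (gr y - g y) \<le> 1 / real (Suc n)"
    proof (cases "x < y")
      case True
      show ?thesis
        by (rule near[of _ "x + d", OF y'(1)])
          (use True y y'(1) in \<open>auto simp: dist_real_def simp del: of_nat_Suc intro!: d(2)\<close>)
    next
      case False
      show ?thesis
        by (rule near[of _ "x", OF y'(1)])
          (use False y y'(1) in \<open>auto simp: dist_real_def simp del: of_nat_Suc intro!: d(3)\<close>)
    qed
    with y'(2) show False by simp
  qed
  then have "countable (\<Union>n. D n)" by (auto intro: countable_finite)
  moreover have "{t \<in> {0..<T}. \<not> (g \<longlongrightarrow> g t) (at_right t)} \<subseteq> (\<Union>n. D n)"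
  proof (rule subsetI)
    fix t assume t: "t \<in> {t \<in> {0..<T}. \<not> (g \<longlongrightarrow> g t) (at_right t)}"
    then have "gr t \<noteq> g t" using gr[of t] by auto
    then obtain n where "1 / real (Suc n) < norm (gr t - g t)"
      using reals_Archimedean[of "norm (gr t - g t)"] by (auto simp: inverse_eq_divide)
    then show "t \<in> (\<Union>n. D n)" using t by (auto simp: D_def)
  qed
  ultimately show ?thesis by (rule countable_subset[rotated])
qed

text \<open>Finitely many functions share one countable exceptional set. The endpoint
  \<open>T\<close> belongs to it because the samples taken there lie outside the interval.\<close>

lemma regulated_rsample:
  assumes T: "T > 0" and g: "\<And>i. i \<in> I \<Longrightarrow> regulated T (g i)" and I: "finite I"
  obtains N where "countable N"
    "\<And>i s. i \<in> I \<Longrightarrow> s \<in> {0..T} \<Longrightarrow> s \<notin> N \<Longrightarrow> (\<lambda>j. g i (rsample T j s)) \<longlonglongrightarrow> g i s"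
proof (rule that[of "insert T (\<Union>i\<in>I. {t \<in> {0..<T}. \<not> (g i \<longlongrightarrow> g i t) (at_right t)})"])
  show "countable (insert T (\<Union>i\<in>I. {t \<in> {0..<T}. \<not> (g i \<longlongrightarrow> g i t) (at_right t)}))"
    by (intro countable_insert countable_UN regulated_right_continuous_off_countable g countable_finite[OF I])
  fix i s assume i: "i \<in> I" "s \<in> {0..T}" "s \<notin> insert T (\<Union>i\<in>I. {t \<in> {0..<T}. \<not> (g i \<longlongrightarrow> g i t) (at_right t)})"
  then have "(g i \<longlongrightarrow> g i s) (at_right s)" by auto
  then show "(\<lambda>j. g i (rsample T j s)) \<longlonglongrightarrow> g i s" using rsample_tendsto[OF T] by (rule filterlim_compose)
qed

text \<open>\<open>\<Phi>\<close> is a Caratheodory function. Its values need no measurable structure on the space of the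
  \<open>g i\<close>, which is in general not separable.\<close>

lemma measurable_regulated_Caratheodory:
  fixes \<Phi> :: "('i \<Rightarrow> 'b::real_normed_vector) \<Rightarrow> 'w \<Rightarrow> 'c::{metric_space}"
  assumes T: "T > 0" and g: "\<And>i. i \<in> I \<Longrightarrow> regulated T (g i)" and I: "finite I"
    and [measurable]: "\<And>y. \<Phi> y \<in> borel_measurable W"
    and cont: "\<And>Y y w. w \<in> space W \<Longrightarrow> (\<And>i. i \<in> I \<Longrightarrow> (\<lambda>j. Y j i) \<longlonglongrightarrow> y i) \<Longrightarrow> (\<lambda>j. \<Phi> (Y j) w) \<longlonglongrightarrow> \<Phi> y w"
  obtains \<kappa> N where "\<kappa> \<in> borel_measurable (leb T \<Otimes>\<^sub>M W)" "countable N"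
    "\<And>s w. s \<in> {0..T} \<Longrightarrow> s \<notin> N \<Longrightarrow> w \<in> space W \<Longrightarrow> \<kappa> (s, w) = \<Phi> (\<lambda>i. g i s) w"
proof -
  obtain N where N: "countable N"
    "\<And>i s. i \<in> I \<Longrightarrow> s \<in> {0..T} \<Longrightarrow> s \<notin> N \<Longrightarrow> (\<lambda>j. g i (rsample T j s)) \<longlonglongrightarrow> g i s"
    using regulated_rsample[of T I g, OF T g I] by blast
  obtain z where z: "z = (undefined :: 'c)" by simp
  have NB: "N \<in> sets borel" using N(1) by (rule sets.countable[rotated]) auto
  \<comment> \<open>On \<open>N\<close> the approximations and the limit all take the same arbitrary
    value \<open>z\<close>, so that the convergence holds at every point and measurability passes to
    the limit.\<close>
  define K where "K j sw = (if fst sw \<in> N then z else \<Phi> (\<lambda>i. g i (rsample T j (fst sw))) (snd sw))" for j and sw :: "real \<times> 'w"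
  have K[measurable]: "K j \<in> borel_measurable (leb T \<Otimes>\<^sub>M W)" for j
  proof -
    have "(\<lambda>s. s) \<in> borel_measurable (leb T)" by (simp add: borel_measurable_restrict_space_iff measurable_restrict_space1)
    then have [measurable]: "(\<lambda>sw :: real \<times> 'w. fst sw) \<in> borel_measurable (leb T \<Otimes>\<^sub>M W)"
      by (rule measurable_compose[OF measurable_fst])
    \<comment> \<open>The sample point is a function of an integer that depends measurably on
      \<open>s\<close>, so a countable case distinction replaces measurability of
      \<open>g i\<close>.\<close>
    have "(\<lambda>sw :: real \<times> 'w. \<lfloor>real (Suc j) * fst sw / T\<rfloor>) \<in> measurable (leb T \<Otimes>\<^sub>M W) (count_space UNIV)"
      by measurable
    from measurable_compose_countable[OF _ this, of "\<lambda>k sw. \<Phi> (\<lambda>i. g i (T * (of_int k + 1) / real (Suc j))) (snd sw)"]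
    have m: "(\<lambda>sw. \<Phi> (\<lambda>i. g i (rsample T j (fst sw))) (snd sw)) \<in> borel_measurable (leb T \<Otimes>\<^sub>M W)"
      by (simp add: rsample_def)
    have "{sw \<in> space (leb T \<Otimes>\<^sub>M W). fst sw \<in> N} \<in> sets (leb T \<Otimes>\<^sub>M W)"
      using NB by measurable
    then show ?thesis unfolding K_def using m by (intro measurable_If) auto
  qed
  define \<kappa> where "\<kappa> sw = (if fst sw \<in> N then z else \<Phi> (\<lambda>i. g i (fst sw)) (snd sw))" for sw :: "real \<times> 'w"
  have "\<kappa> \<in> borel_measurable (leb T \<Otimes>\<^sub>M W)"
  proof (rule borel_measurable_LIMSEQ_metric[OF K])
    fix sw assume sw: "sw \<in> space (leb T \<Otimes>\<^sub>M W)"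
    show "(\<lambda>j. K j sw) \<longlonglongrightarrow> \<kappa> sw"
      using sw by (auto simp: K_def \<kappa>_def space_pair_measure space_restrict_space intro!: cont N)
  qed
  then show thesis by (rule that[OF _ N(1)]) (auto simp: \<kappa>_def)
qed

lemma measurable_continuous_regulated:
  fixes \<phi> :: "'b::real_normed_vector \<Rightarrow> 'c::metric_space"
  assumes T: "T > 0" and g: "regulated T g" and \<phi>: "continuous_on UNIV \<phi>"
  shows "(\<lambda>s. \<phi> (g s)) \<in> borel_measurable (leb T)"
proof -
  have lim: "(\<lambda>j. \<phi> (Y j)) \<longlonglongrightarrow> \<phi> y" if "Y \<longlonglongrightarrow> y" for Y y
    using continuous_on_tendsto_compose[OF \<phi> that] by simp
  obtain \<kappa> N where \<kappa>: "\<kappa> \<in> borel_measurable (leb T \<Otimes>\<^sub>M count_space (UNIV :: unit set))" "countable N"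
    "\<And>s w. s \<in> {0..T} \<Longrightarrow> s \<notin> N \<Longrightarrow> w \<in> space (count_space (UNIV :: unit set)) \<Longrightarrow> \<kappa> (s, w) = \<phi> (g s)"
    by (rule measurable_regulated_Caratheodory[of T "{()}" "\<lambda>_. g" "\<lambda>y _. \<phi> (y ())" "count_space UNIV", OF T g])
      (auto intro: lim)
  have [measurable]: "\<kappa> \<in> borel_measurable (leb T \<Otimes>\<^sub>M count_space (UNIV :: unit set))" by (rule \<kappa>)
  have "(\<lambda>s. \<kappa> (s, ())) \<in> borel_measurable (leb T)" by measurable
  then show ?thesis by (rule measurable_leb_if_countable_eq[OF _ \<kappa>(2)]) (use \<kappa>(3) in auto)
qed

section \<open>The symbol of a cylindrical Levy process\<close>

text \<open>The factor \<open>w\<close> stays on the left so that \<open>w = 0\<close> is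
  included.\<close>

lemma integral_exp_mult_Icc:
  fixes w :: complex
  shows "w * (LINT t:{0..1}|lborel. exp (complex_of_real t * w)) = exp w - 1"
proof -
  have "(LINT t|lborel. indicator {0..1} t *\<^sub>R (w * exp (complex_of_real t * w))) = exp (of_real 1 * w) - exp (of_real 0 * w)"
  proof (rule integral_FTC_atLeastAtMost)
    show "((\<lambda>t. exp (complex_of_real t * w)) has_vector_derivative w * exp (complex_of_real t * w)) (at t within {0..1})" for t
    proof -
      have "((\<lambda>t. exp (t * w)) has_field_derivative exp (complex_of_real t * w) * (1 * w)) (at (of_real t))"
        by (auto intro!: derivative_eq_intros)
      from has_vector_derivative_real_field[OF this] show ?thesis by (simp add: mult.commute)
    qed
  qed (auto intro!: continuous_intros)
  moreover have "indicator {0..1} t *\<^sub>R (w * exp (complex_of_real t * w)) = w * (indicator {0..1} t *\<^sub>R exp (complex_of_real t * w))" for t :: real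
    by simp
  ultimately show ?thesis
    unfolding set_lebesgue_integral_def by (simp only: integral_mult_right_zero) simp
qed

text \<open>Averaging over \<open>t \<in> [0, 1]\<close> excludes that the imaginary parts differ by multiples of \<open>2\<pi>\<close>.\<close>

lemma tendsto_if_exp_semigroup_tendsto:
  fixes z :: "nat \<Rightarrow> complex"
  assumes lim: "\<And>t. t \<ge> 0 \<Longrightarrow> (\<lambda>n. exp (complex_of_real t * z n)) \<longlonglongrightarrow> exp (complex_of_real t * w)"
    and neg: "\<And>n. Re (z n) \<le> 0"
  shows "z \<longlonglongrightarrow> w"
proof -
  define d where "d n = z n - w" for n
  have lim1: "(\<lambda>n. exp (complex_of_real t * d n)) \<longlonglongrightarrow> 1" if "t \<ge> 0" for t
  proof -
    have "(\<lambda>n. exp (complex_of_real t * z n) / exp (complex_of_real t * w)) \<longlonglongrightarrow> exp (complex_of_real t * w) / exp (complex_of_real t * w)"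
      by (intro tendsto_divide lim that tendsto_const) auto
    then show ?thesis by (simp add: d_def right_diff_distrib exp_diff)
  qed
  have "(\<lambda>n. LINT t:{0..1}|lborel. exp (complex_of_real t * d n)) \<longlonglongrightarrow> (LINT t:{0..1::real}|lborel. (1::complex))"
    unfolding set_lebesgue_integral_def
  proof (rule integral_dominated_convergence[where w="\<lambda>t. indicator {0..1} t * exp \<bar>Re w\<bar>"])
    show "AE t in lborel. (\<lambda>n. indicator {0..1} t *\<^sub>R exp (complex_of_real t * d n)) \<longlonglongrightarrow> indicator {0..1} t *\<^sub>R 1"
      using lim1 by (intro AE_I2) (auto simp: indicator_def)
    show "AE t in lborel. norm (indicator {0..1} t *\<^sub>R exp (complex_of_real t * d n)) \<le> indicator {0..1} t * exp \<bar>Re w\<bar>" for n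
    proof (rule AE_I2)
      fix t :: real
      have "t * Re (d n) \<le> \<bar>Re w\<bar>" if t: "t \<in> {0..1}"
      proof -
        have "Re (d n) \<le> \<bar>Re w\<bar>" using neg[of n] by (simp add: d_def)
        then have "t * Re (d n) \<le> t * \<bar>Re w\<bar>" using t by (intro mult_left_mono) auto
        also have "\<dots> \<le> \<bar>Re w\<bar>" using t by (intro mult_left_le_one_le) auto
        finally show ?thesis .
      qed
      then show "norm (indicator {0..1} t *\<^sub>R exp (complex_of_real t * d n)) \<le> indicator {0..1} t * exp \<bar>Re w\<bar>"
        by (auto simp: indicator_def)
    qed
    show "integrable lborel (\<lambda>t. indicator {0..1::real} t * exp \<bar>Re w\<bar> :: real)"
      by (intro integrable_mult_left integrable_real_indicator) auto
  qed measurable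
  also have "(LINT t:{0..1::real}|lborel. (1::complex)) = 1"
    by (simp add: set_lebesgue_integral_def)
  finally have I: "(\<lambda>n. LINT t:{0..1}|lborel. exp (complex_of_real t * d n)) \<longlonglongrightarrow> 1" .
  \<comment> \<open>Dividing \<open>exp d - 1\<close> by the integral of \<open>exp (t d)\<close>
    over \<open>[0, 1]\<close> returns \<open>d\<close> itself, without a choice of logarithm. The
    denominators tend to 1.\<close>
  have "(\<lambda>n. (exp (of_real 1 * d n) - 1) / (LINT t:{0..1}|lborel. exp (complex_of_real t * d n))) \<longlonglongrightarrow> (1 - 1) / 1"
    by (intro tendsto_intros I lim1) auto
  moreover have "eventually (\<lambda>n. (LINT t:{0..1}|lborel. exp (complex_of_real t * d n)) \<noteq> 0) sequentially"
    using tendsto_imp_eventually_ne[OF I, of 0] by simp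
  then have "eventually (\<lambda>n. (exp (of_real 1 * d n) - 1) / (LINT t:{0..1}|lborel. exp (complex_of_real t * d n)) = d n) sequentially"
    by eventually_elim (simp add: integral_exp_mult_Icc[symmetric])
  ultimately have "d \<longlonglongrightarrow> 0" using tendsto_cong by force
  then show ?thesis unfolding d_def[abs_def] by (rule LIM_zero_cancel)
qed

text \<open>Recovers a symbol from its semigroup, so that inequalities between laws at small times
  become inequalities for \<Psi>.\<close>

lemma exp_difference_quotient_tendsto:
  "(\<lambda>n. (exp (of_real (inverse (real (Suc n))) * z) - 1) * of_nat (Suc n)) \<longlonglongrightarrow> (z :: 'a::{banach,real_normed_field})"
proof -
  have "((\<lambda>h. exp (h * z)) has_field_derivative exp (0 * z) * (1 * z)) (at 0)"
    by (auto intro!: derivative_eq_intros)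
  then have "((\<lambda>h. (exp (h * z) - 1) / h) \<longlongrightarrow> z) (at 0)"
    by (simp add: has_field_derivative_def has_derivative_at DERIV_def flip: has_field_derivative_def)
  moreover have "filterlim (\<lambda>n. of_real (inverse (real (Suc n))) :: 'a) (at 0) sequentially"
    unfolding filterlim_at
    using tendsto_of_real[OF LIMSEQ_inverse_real_of_nat, where 'a='a] by (simp del: of_nat_Suc)
  ultimately have "(\<lambda>n. (exp (of_real (inverse (real (Suc n))) * z) - 1) / of_real (inverse (real (Suc n)))) \<longlonglongrightarrow> z"
    by (rule filterlim_compose)
  then show ?thesis by (simp add: divide_inverse del: of_nat_Suc)
qed

context prob_space
begin

text \<open>The difference of two independent copies has characteristic function equal to the
  squared modulus; phases, and hence drifts, cancel.\<close>

lemma nn_integral_symmetrization_cos: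
  assumes [measurable]: "X \<in> borel_measurable M"
  shows "(\<integral>\<^sup>+\<omega>. ennreal (1 - cos (X (fst \<omega>) - X (snd \<omega>))) \<partial>(M \<Otimes>\<^sub>M M)) = ennreal (1 - (cmod (LINT \<omega>|M. iexp (X \<omega>)))\<^sup>2)"
proof -
  interpret P: pair_prob_space M M ..
  have [measurable]: "cnj \<in> borel_measurable borel"
    by (intro borel_measurable_continuous_onI continuous_intros)
  have i: "integrable (M \<Otimes>\<^sub>M M) (\<lambda>\<omega>. iexp (X (fst \<omega>)) * cnj (iexp (X (snd \<omega>))))"
    by (rule P.integrable_const_bound[of _ 1]) (auto simp: norm_mult)
  have c: "integrable (M \<Otimes>\<^sub>M M) (\<lambda>\<omega>. cos (X (fst \<omega>) - X (snd \<omega>)))"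
    by (rule P.integrable_const_bound[of _ 1]) auto
  let ?m = "LINT \<omega>|M. iexp (X \<omega>)"
  have "(LINT \<omega>|(M \<Otimes>\<^sub>M M). iexp (X (fst \<omega>)) * cnj (iexp (X (snd \<omega>))))
    = (LINT \<omega>|M. LINT \<omega>'|M. iexp (X \<omega>) * cnj (iexp (X \<omega>')))"
    using P.integral_fst'[OF i] by simp
  also have "\<dots> = ?m * (LINT \<omega>'|M. cnj (iexp (X \<omega>')))"
    by (simp only: integral_mult_right_zero integral_mult_left_zero)
  also have "(LINT \<omega>'|M. cnj (iexp (X \<omega>'))) = cnj ?m" by (rule Bochner_Integration.integral_cnj)
  finally have e: "(LINT \<omega>|(M \<Otimes>\<^sub>M M). iexp (X (fst \<omega>)) * cnj (iexp (X (snd \<omega>)))) = of_real ((cmod ?m)\<^sup>2)"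
    by (simp only: complex_norm_square)
  have "(LINT \<omega>|(M \<Otimes>\<^sub>M M). cos (X (fst \<omega>) - X (snd \<omega>)))
    = (LINT \<omega>|(M \<Otimes>\<^sub>M M). Re (iexp (X (fst \<omega>)) * cnj (iexp (X (snd \<omega>)))))"
    by (simp add: cis_conv_exp[symmetric] cos_diff)
  also have "\<dots> = (cmod ?m)\<^sup>2" using integral_Re[OF i] e by simp
  finally have "(LINT \<omega>|(M \<Otimes>\<^sub>M M). cos (X (fst \<omega>) - X (snd \<omega>))) = (cmod ?m)\<^sup>2" .
  moreover have "(\<integral>\<^sup>+\<omega>. ennreal (1 - cos (X (fst \<omega>) - X (snd \<omega>))) \<partial>(M \<Otimes>\<^sub>M M))
    = ennreal (LINT \<omega>|(M \<Otimes>\<^sub>M M). 1 - cos (X (fst \<omega>) - X (snd \<omega>)))"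
    by (rule nn_integral_eq_integral) (use c in auto)
  ultimately show ?thesis using c by (simp add: P.prob_space)
qed

text \<open>Fubini between the Gaussian coefficients and the doubled probability space: integrating
  the coefficients first leaves the squared norm, integrating the outcomes first leaves
  characteristic functions of linear combinations.\<close>

lemma nn_integral_symmetrization_gauss:
  assumes [measurable]: "\<And>k. k \<in> I \<Longrightarrow> X k \<in> borel_measurable M" and I: "finite I"
  shows "(\<integral>\<^sup>+\<omega>. ennreal (1 - exp (- (\<Sum>k\<in>I. (X k (fst \<omega>) - X k (snd \<omega>))\<^sup>2) / 2)) \<partial>(M \<Otimes>\<^sub>M M))
    = (\<integral>\<^sup>+g. ennreal (1 - (cmod (LINT \<omega>|M. iexp (\<Sum>k\<in>I. g k * X k \<omega>)))\<^sup>2) \<partial>gauss I)"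
proof -
  interpret P: pair_prob_space M M ..
  interpret G: prob_space "gauss I" by (rule prob_space_gauss)
  interpret Q: pair_sigma_finite "gauss I" "M \<Otimes>\<^sub>M M" ..
  have comp[measurable]: "(\<lambda>p. fst p k) \<in> borel_measurable (gauss I \<Otimes>\<^sub>M (M \<Otimes>\<^sub>M M))" if "k \<in> I" for k
    using measurable_compose[OF measurable_fst measurable_component_singleton[OF that, of "\<lambda>_. std_normal_distribution"]]
    by simp
  have "(\<integral>\<^sup>+\<omega>. ennreal (1 - exp (- (\<Sum>k\<in>I. (X k (fst \<omega>) - X k (snd \<omega>))\<^sup>2) / 2)) \<partial>(M \<Otimes>\<^sub>M M))
    = (\<integral>\<^sup>+\<omega>. (\<integral>\<^sup>+g. ennreal (1 - cos (\<Sum>k\<in>I. g k * (X k (fst \<omega>) - X k (snd \<omega>)))) \<partial>gauss I) \<partial>(M \<Otimes>\<^sub>M M))"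
    by (simp add: gauss_one_minus_cos[OF I])
  also have "\<dots> = (\<integral>\<^sup>+g. (\<integral>\<^sup>+\<omega>. ennreal (1 - cos (\<Sum>k\<in>I. g k * (X k (fst \<omega>) - X k (snd \<omega>)))) \<partial>(M \<Otimes>\<^sub>M M)) \<partial>gauss I)"
  proof (rule Q.Fubini')
    have "(\<lambda>p. ennreal (1 - cos (\<Sum>k\<in>I. fst p k * (X k (fst (snd p)) - X k (snd (snd p))))))
      \<in> borel_measurable (gauss I \<Otimes>\<^sub>M (M \<Otimes>\<^sub>M M))"
      by measurable
    then show "(\<lambda>(g, \<omega>). ennreal (1 - cos (\<Sum>k\<in>I. g k * (X k (fst \<omega>) - X k (snd \<omega>)))))
      \<in> borel_measurable (gauss I \<Otimes>\<^sub>M (M \<Otimes>\<^sub>M M))"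
      by (simp add: split_beta')
  qed
  also have "\<dots> = (\<integral>\<^sup>+g. ennreal (1 - (cmod (LINT \<omega>|M. iexp (\<Sum>k\<in>I. g k * X k \<omega>)))\<^sup>2) \<partial>gauss I)"
  proof (rule nn_integral_cong)
    fix g
    have "(\<lambda>\<omega>. \<Sum>k\<in>I. g k * X k \<omega>) \<in> borel_measurable M" by measurable
    from nn_integral_symmetrization_cos[OF this]
    show "(\<integral>\<^sup>+\<omega>. ennreal (1 - cos (\<Sum>k\<in>I. g k * (X k (fst \<omega>) - X k (snd \<omega>)))) \<partial>(M \<Otimes>\<^sub>M M))
      = ennreal (1 - (cmod (LINT \<omega>|M. iexp (\<Sum>k\<in>I. g k * X k \<omega>)))\<^sup>2)"
      by (simp only: right_diff_distrib sum_subtractf)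
  qed
  finally show ?thesis .
qed

text \<open>A variance identity: the left side is the modulus of the mean of
  \<open>(exp (i X) - m)^2\<close>, and the mean of the squared distance of \<open>exp (i X)\<close>
  from \<open>m\<close> is \<open>1 - |m|^2\<close>.\<close>

lemma cmod_char_double_le:
  assumes [measurable]: "X \<in> borel_measurable M"
  defines "m \<equiv> LINT \<omega>|M. iexp (X \<omega>)"
  shows "cmod ((LINT \<omega>|M. iexp (2 * X \<omega>)) - m\<^sup>2) \<le> 1 - (cmod m)\<^sup>2"
proof -
  have i: "integrable M (\<lambda>\<omega>. iexp (2 * X \<omega>))" "integrable M (\<lambda>\<omega>. iexp (X \<omega>))"
    by (intro integrable_iexp; measurable)+
  have e: "(iexp (X \<omega>) - m)\<^sup>2 = iexp (2 * X \<omega>) - 2 * m * iexp (X \<omega>) + m\<^sup>2" for \<omega>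
    by (simp add: power2_eq_square algebra_simps flip: exp_add)
  have "(LINT \<omega>|M. (iexp (X \<omega>) - m)\<^sup>2) = (LINT \<omega>|M. iexp (2 * X \<omega>)) - 2 * m * m + m\<^sup>2"
    unfolding e using i by (simp add: prob_space m_def)
  then have "cmod ((LINT \<omega>|M. iexp (2 * X \<omega>)) - m\<^sup>2) = cmod (LINT \<omega>|M. (iexp (X \<omega>) - m)\<^sup>2)"
    by (simp add: power2_eq_square)
  also have "\<dots> \<le> (LINT \<omega>|M. cmod ((iexp (X \<omega>) - m)\<^sup>2))" by (rule integral_norm_bound)
  also have "\<dots> = (LINT \<omega>|M. 1 - 2 * Re (cnj m * iexp (X \<omega>)) + (cmod m)\<^sup>2)"
  proof (rule Bochner_Integration.integral_cong[OF refl])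
    fix \<omega>
    have "cmod ((iexp (X \<omega>) - m)\<^sup>2) = (cmod (iexp (X \<omega>) - m))\<^sup>2" by (simp add: norm_power)
    also have "\<dots> = (cmod (iexp (X \<omega>)))\<^sup>2 - 2 * Re (cnj m * iexp (X \<omega>)) + (cmod m)\<^sup>2"
      by (simp only: cmod_power2) (simp add: power2_eq_square algebra_simps)
    finally show "cmod ((iexp (X \<omega>) - m)\<^sup>2) = 1 - 2 * Re (cnj m * iexp (X \<omega>)) + (cmod m)\<^sup>2" by simp
  qed
  also have "\<dots> = 1 - 2 * (LINT \<omega>|M. Re (cnj m * iexp (X \<omega>))) + (cmod m)\<^sup>2"
    using i by (simp add: prob_space)
  also have "(LINT \<omega>|M. Re (cnj m * iexp (X \<omega>))) = Re (cnj m * m)"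
    using i by (simp only: integral_Re integrable_mult_right integral_mult_right_zero m_def[symmetric])
  also have "Re (cnj m * m) = (cmod m)\<^sup>2" by (simp add: cmod_power2) (simp add: power2_eq_square)
  finally show ?thesis by simp
qed

end

locale cyl_levy = prob_space M for M :: "'w measure" +
  fixes L :: "real \<Rightarrow> ('u::real_normed_vector \<Rightarrow>\<^sub>L real) \<Rightarrow> 'w \<Rightarrow> real"
    and a :: "('u \<Rightarrow>\<^sub>L real) \<Rightarrow> real"
    and Q :: "('u \<Rightarrow>\<^sub>L real) \<Rightarrow>\<^sub>L (('u \<Rightarrow>\<^sub>L real) \<Rightarrow>\<^sub>L real)"
    and \<mu> :: "'u set \<Rightarrow> ennreal"
  assumes levy: "cylindrical_levy_process M L" and char: "has_characteristics M L a Q \<mu>"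
begin

abbreviation \<Psi> :: "('u \<Rightarrow>\<^sub>L real) \<Rightarrow> complex" where "\<Psi> \<equiv> levy_symbol a Q \<mu>"

definition kexp :: "('u \<Rightarrow>\<^sub>L real) \<Rightarrow> real" where "kexp x = - Re (\<Psi> x)"

lemma L_measurable [measurable]: "t \<ge> 0 \<Longrightarrow> L t x \<in> borel_measurable M"
  and L_add: "t \<ge> 0 \<Longrightarrow> AE \<omega> in M. L t (x + y) \<omega> = L t x \<omega> + L t y \<omega>"
  and L_scale: "t \<ge> 0 \<Longrightarrow> AE \<omega> in M. L t (c *\<^sub>R x) \<omega> = c * L t x \<omega>"
  and L_cont: "t \<ge> 0 \<Longrightarrow> xs \<longlonglongrightarrow> x \<Longrightarrow> tendsto_prob M (\<lambda>n. L t (xs n)) (L t x) sequentially"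
  using levy unfolding cylindrical_levy_process_def cylindrical_rv_def by blast+

lemma L_sum:
  assumes t: "t \<ge> 0" and I: "finite I"
  shows "AE \<omega> in M. L t (\<Sum>k\<in>I. c k *\<^sub>R x k) \<omega> = (\<Sum>k\<in>I. c k * L t (x k) \<omega>)"
  using I
proof induction
  case empty
  then show ?case using L_scale[OF t, of 0 0] by simp
next
  case (insert k I)
  show ?case
    using insert.IH L_add[OF t, of "c k *\<^sub>R x k" "\<Sum>k\<in>I. c k *\<^sub>R x k"] L_scale[OF t, of "c k" "x k"]
    by eventually_elim (use insert.hyps in simp)
qed

lemma L_char: "t \<ge> 0 \<Longrightarrow> (LINT \<omega>|M. iexp (L t x \<omega>)) = exp (complex_of_real t * \<Psi> x)"
  using char unfolding has_characteristics_def by blast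

lemma kexp_nonneg: "kexp x \<ge> 0"
  using cmod_expectation_iexp_le[OF L_measurable[of 1 x]] L_char[of 1 x] by (simp add: kexp_def)

lemma Re_\<Psi>_le [simp]: "Re (\<Psi> x) \<le> 0"
  using kexp_nonneg[of x] by (simp add: kexp_def)

lemma \<Psi>_0 [simp]: "\<Psi> 0 = 0"
  using char by (simp add: levy_symbol_def has_characteristics_def)

lemma kexp_0 [simp]: "kexp 0 = 0"
  by (simp add: kexp_def)

text \<open>Continuity is read off from the laws: convergence in probability of \<open>L t\<close>
  at every time \<open>t\<close> gives convergence of all powers
  \<open>exp (t \<Psi>)\<close>.\<close>

lemma \<Psi>_tendsto:
  assumes "xs \<longlonglongrightarrow> x"
  shows "(\<lambda>n. \<Psi> (xs n)) \<longlonglongrightarrow> \<Psi> x"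
proof (rule tendsto_if_exp_semigroup_tendsto)
  fix t :: real assume t: "t \<ge> 0"
  from tendsto_prob_iexp[OF _ _ L_cont[OF t assms]]
  show "(\<lambda>n. exp (complex_of_real t * \<Psi> (xs n))) \<longlonglongrightarrow> exp (complex_of_real t * \<Psi> x)"
    using t by (simp add: L_char)
qed simp

lemma continuous_\<Psi>: "continuous_on UNIV \<Psi>"
  by (auto simp: continuous_on_sequentially comp_def \<Psi>_tendsto)

lemma continuous_kexp: "continuous_on UNIV kexp"
  unfolding kexp_def by (intro continuous_intros continuous_\<Psi>)

lemma kexp_le_cmod: "kexp x \<le> cmod (\<Psi> x)"
  unfolding kexp_def using complex_Re_le_cmod[of "- \<Psi> x"] by simp

text \<open>The variance bound at time \<open>1 / (n + 1)\<close>, multiplied by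
  \<open>n + 1\<close>, becomes \<open>|\<Psi>(2 x) - 2 \<Psi>(x)| \<le> 2 k(x)\<close> in the
  limit, and \<open>k \<le> |\<Psi>|\<close>. The factor 4 is \<open>2 + 2\<close>.\<close>

lemma cmod_\<Psi>_double_le: "cmod (\<Psi> (2 *\<^sub>R x)) \<le> 4 * cmod (\<Psi> x)"
proof -
  define t :: "nat \<Rightarrow> real" where "t n = inverse (real (Suc n))" for n
  have t: "t n > 0" for n by (simp add: t_def)
  have b: "cmod (exp (of_real (t n) * \<Psi> (2 *\<^sub>R x)) - exp (of_real (t n) * (2 * \<Psi> x))) \<le> 1 - exp (of_real (t n) * (- 2 * kexp x))" for n
  proof -
    have [measurable]: "L (t n) x \<in> borel_measurable M" using t[of n] by (intro L_measurable) simp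
    have "(LINT \<omega>|M. iexp (2 * L (t n) x \<omega>)) = (LINT \<omega>|M. iexp (L (t n) (2 *\<^sub>R x) \<omega>))"
      using L_scale[of "t n" 2 x] t[of n]
      by (intro integral_cong_AE) (auto intro: borel_measurable_exp borel_measurable_times)
    with L_char[of "t n" x] L_char[of "t n" "2 *\<^sub>R x"] cmod_char_double_le[of "L (t n) x"] t[of n]
    have "cmod (exp (of_real (t n) * \<Psi> (2 *\<^sub>R x)) - (exp (of_real (t n) * \<Psi> x))\<^sup>2) \<le> 1 - (cmod (exp (of_real (t n) * \<Psi> x)))\<^sup>2"
      by simp
    moreover have "(exp (of_real (t n) * \<Psi> x))\<^sup>2 = exp (of_real (t n) * (2 * \<Psi> x))"
      by (simp add: mult.left_commute flip: exp_double)
    moreover have "(cmod (exp (of_real (t n) * \<Psi> x)))\<^sup>2 = exp (of_real (t n) * (- 2 * kexp x))"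
      by (simp add: kexp_def mult.left_commute flip: exp_double)
    ultimately show ?thesis by simp
  qed
  let ?q = "\<lambda>z n. (exp (of_real (t n) * z) - 1) * of_nat (Suc n)"
  have "cmod (?q (\<Psi> (2 *\<^sub>R x)) n - ?q (2 * \<Psi> x) n) \<le> - ?q (- 2 * kexp x) n" for n
  proof -
    have "?q (\<Psi> (2 *\<^sub>R x)) n - ?q (2 * \<Psi> x) n = (exp (of_real (t n) * \<Psi> (2 *\<^sub>R x)) - exp (of_real (t n) * (2 * \<Psi> x))) * of_nat (Suc n)"
      by (simp add: algebra_simps)
    then have "cmod (?q (\<Psi> (2 *\<^sub>R x)) n - ?q (2 * \<Psi> x) n) = cmod (exp (of_real (t n) * \<Psi> (2 *\<^sub>R x)) - exp (of_real (t n) * (2 * \<Psi> x))) * real (Suc n)"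
      by (simp only: norm_mult norm_of_nat)
    also have "\<dots> \<le> (1 - exp (of_real (t n) * (- 2 * kexp x))) * real (Suc n)"
      by (intro mult_right_mono b) auto
    finally show ?thesis by (simp add: algebra_simps)
  qed
  moreover have "(\<lambda>n. cmod (?q (\<Psi> (2 *\<^sub>R x)) n - ?q (2 * \<Psi> x) n)) \<longlonglongrightarrow> cmod (\<Psi> (2 *\<^sub>R x) - 2 * \<Psi> x)"
    unfolding t_def by (intro tendsto_intros exp_difference_quotient_tendsto)
  moreover have "(\<lambda>n. - ?q (- 2 * kexp x) n) \<longlonglongrightarrow> - (- 2 * kexp x)"
    unfolding t_def by (intro tendsto_minus exp_difference_quotient_tendsto)
  ultimately have "cmod (\<Psi> (2 *\<^sub>R x) - 2 * \<Psi> x) \<le> - (- 2 * kexp x)"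
    by (intro LIMSEQ_le) auto
  moreover note kexp_le_cmod[of x]
  ultimately show ?thesis
    using norm_triangle_sub[of "\<Psi> (2 *\<^sub>R x)" "2 * \<Psi> x"] by (simp add: norm_mult)
qed

text \<open>Balls are not compact in infinite dimension, so continuity only yields a bound near 0.
  The doubling inequality spreads it to every ball.\<close>

lemma \<Psi>_bounded:
  obtains C where "C \<ge> 0" "\<And>x. norm x \<le> r \<Longrightarrow> cmod (\<Psi> x) \<le> C"
proof -
  have "isCont \<Psi> 0" using continuous_\<Psi> by (simp add: continuous_on_eq_continuous_at)
  then obtain d where d: "d > 0" "\<And>x. norm x < d \<Longrightarrow> cmod (\<Psi> x) < 1"
    unfolding continuous_at_eps_delta dist_norm \<Psi>_0 diff_0_right by (metis zero_less_one)
  have *: "cmod (\<Psi> ((2 ^ n) *\<^sub>R x)) \<le> 4 ^ n" if "norm x < d" for n x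
  proof (induction n)
    case 0
    then show ?case using d(2)[OF that] by simp
  next
    case (Suc n)
    show ?case using cmod_\<Psi>_double_le[of "(2 ^ n) *\<^sub>R x"] Suc by simp
  qed
  obtain n where n: "r / d < 2 ^ n" using real_arch_pow[of 2 "r / d"] by auto
  have "cmod (\<Psi> x) \<le> 4 ^ n" if "norm x \<le> r" for x
  proof -
    have "norm ((1 / 2 ^ n) *\<^sub>R x) < d"
      using n d(1) that by (simp add: field_simps)
    from *[OF this, of n] show ?thesis by simp
  qed
  then show thesis by (intro that[of "4 ^ n"]) auto
qed

end

text \<open>The vectors may live in a non-separable space, so their sum is not treated as a random
  element. The scalar composite is continuous on the space of real sequences, where Borel and
  product \<sigma>-algebra agree; coefficients outside \<open>I\<close> are set to 0.\<close>

lemma measurable_gauss_continuous: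
  fixes \<phi> :: "'b::real_normed_vector \<Rightarrow> 'c::metric_space"
  assumes "continuous_on UNIV \<phi>"
  shows "(\<lambda>g. \<phi> (\<Sum>k\<in>I. g k *\<^sub>R x k)) \<in> borel_measurable (gauss I)"
proof -
  have "continuous_on UNIV (\<lambda>g :: nat \<Rightarrow> real. \<Sum>k\<in>I. g k *\<^sub>R x k)"
    by (intro continuous_intros continuous_on_product_coordinates)
  then have "continuous_on UNIV (\<lambda>g :: nat \<Rightarrow> real. \<phi> (\<Sum>k\<in>I. g k *\<^sub>R x k))"
    by (rule continuous_on_compose2[OF assms]) auto
  then have m: "(\<lambda>g :: nat \<Rightarrow> real. \<phi> (\<Sum>k\<in>I. g k *\<^sub>R x k)) \<in> borel_measurable (Pi\<^sub>M UNIV (\<lambda>_. borel))"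
    by (simp add: borel_measurable_continuous_onI measurable_cong_sets[OF sets_PiM_equal_borel refl])
  have "(\<lambda>g k. if k \<in> I then g k else 0) \<in> measurable (gauss I) (Pi\<^sub>M UNIV (\<lambda>_. borel))"
  proof (rule measurable_PiM_single')
    fix k
    show "(\<lambda>g. if k \<in> I then g k else 0) \<in> borel_measurable (gauss I)"
      using measurable_component_singleton[of k I "\<lambda>_. std_normal_distribution"] by (cases "k \<in> I") simp_all
  qed auto
  from measurable_compose[OF this m] show ?thesis by (simp cong: sum.cong)
qed

context cyl_levy
begin

text \<open>\<open>kexp\<close> is the limit of \<open>n / 2\<close> times the symmetrized mean of \<open>1 - cos\<close> at time \<open>1 / n\<close>, and
  Gaussian averages of \<open>1 - cos\<close> satisfy such a bound by an explicit computation.\<close>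

lemma reverse_Hoelder_kexp:
  assumes I: "finite I"
  shows "(\<integral>\<^sup>+g. (ennreal (kexp (\<Sum>k\<in>I. g k *\<^sub>R x k)))\<^sup>2 \<partial>gauss I)
    \<le> 3 * (\<integral>\<^sup>+g. ennreal (kexp (\<Sum>k\<in>I. g k *\<^sub>R x k)) \<partial>gauss I)\<^sup>2"
proof -
  interpret P: pair_prob_space M M ..
  interpret G: prob_space "gauss I" by (rule prob_space_gauss)
  define K where "K g = kexp (\<Sum>k\<in>I. g k *\<^sub>R x k)" for g :: "nat \<Rightarrow> real"
  have [measurable]: "K \<in> borel_measurable (gauss I)"
    unfolding K_def by (rule measurable_gauss_continuous[OF continuous_kexp])
  have K0: "K g \<ge> 0" for g by (simp add: K_def kexp_nonneg)
  define t :: "nat \<Rightarrow> real" where "t n = inverse (real (Suc n))" for n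
  have t: "t n > 0" for n by (simp add: t_def)
  define E where "E n g = 1 - exp (- 2 * t n * K g)" for n g
  have E0: "E n g \<ge> 0" for n g using t[of n] K0[of g] by (simp add: E_def mult_nonneg_nonneg)
  have [measurable]: "E n \<in> borel_measurable (gauss I)" for n unfolding E_def by measurable
  \<comment> \<open>The bound for \<open>1 - cos\<close> holds for each pair of outcomes and passes
    to the mixture over pairs, which is \<open>E n\<close>, one minus the squared modulus of a
    characteristic function at time \<open>t n\<close>.\<close>
  have A: "(\<integral>\<^sup>+g. (ennreal (E n g))\<^sup>2 \<partial>gauss I) \<le> 3 * (\<integral>\<^sup>+g. ennreal (E n g) \<partial>gauss I)\<^sup>2" for n
  proof -
    have [measurable]: "L (t n) (x k) \<in> borel_measurable M" for k using t[of n] by (intro L_measurable) simp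
    let ?\<kappa> = "\<lambda>p :: ('w \<times> 'w) \<times> (nat \<Rightarrow> real).
      ennreal (1 - cos (\<Sum>k\<in>I. snd p k * (L (t n) (x k) (fst (fst p)) - L (t n) (x k) (snd (fst p)))))"
    have comp[measurable]: "(\<lambda>p. snd p k) \<in> borel_measurable ((M \<Otimes>\<^sub>M M) \<Otimes>\<^sub>M gauss I)" if "k \<in> I" for k
      using measurable_compose[OF measurable_snd measurable_component_singleton[OF that, of "\<lambda>_. std_normal_distribution"]]
      by simp
    have "(\<integral>\<^sup>+g. (\<integral>\<^sup>+\<omega>. ?\<kappa> (\<omega>, g) \<partial>(M \<Otimes>\<^sub>M M))\<^sup>2 \<partial>gauss I) \<le> 3 * (\<integral>\<^sup>+g. (\<integral>\<^sup>+\<omega>. ?\<kappa> (\<omega>, g) \<partial>(M \<Otimes>\<^sub>M M)) \<partial>gauss I)\<^sup>2"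
    proof (rule reverse_Hoelder_mixture)
      show "?\<kappa> \<in> borel_measurable ((M \<Otimes>\<^sub>M M) \<Otimes>\<^sub>M gauss I)" by measurable
      show "AE \<omega> in M \<Otimes>\<^sub>M M. (\<integral>\<^sup>+g. (?\<kappa> (\<omega>, g))\<^sup>2 \<partial>gauss I) \<le> 3 * (\<integral>\<^sup>+g. ?\<kappa> (\<omega>, g) \<partial>gauss I)\<^sup>2"
        using gauss_one_minus_cos_square_le[OF I] by simp
    qed (rule P.sigma_finite_measure_axioms G.sigma_finite_measure_axioms)+
    moreover have "(\<integral>\<^sup>+\<omega>. ?\<kappa> (\<omega>, g) \<partial>(M \<Otimes>\<^sub>M M)) = ennreal (E n g)" for g
    proof -
      let ?X = "\<lambda>\<omega>. \<Sum>k\<in>I. g k * L (t n) (x k) \<omega>"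
      have "(LINT \<omega>|M. iexp (?X \<omega>)) = (LINT \<omega>|M. iexp (L (t n) (\<Sum>k\<in>I. g k *\<^sub>R x k) \<omega>))"
      proof (rule integral_cong_AE)
        show "AE \<omega> in M. iexp (?X \<omega>) = iexp (L (t n) (\<Sum>k\<in>I. g k *\<^sub>R x k) \<omega>)"
          using L_sum[OF less_imp_le[OF t[of n]] I, of g x] by eventually_elim simp
        show "(\<lambda>\<omega>. iexp (L (t n) (\<Sum>k\<in>I. g k *\<^sub>R x k) \<omega>)) \<in> borel_measurable M"
          using L_measurable[OF less_imp_le[OF t[of n]]] by measurable
      qed measurable
      then have "(cmod (LINT \<omega>|M. iexp (?X \<omega>)))\<^sup>2 = exp (- 2 * t n * K g)"
        using t[of n] by (simp add: L_char K_def kexp_def power2_eq_square flip: exp_add)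
      then show ?thesis
        using nn_integral_symmetrization_cos[of ?X] by (simp add: right_diff_distrib sum_subtractf E_def)
    qed
    ultimately show ?thesis by simp
  qed
  \<comment> \<open>\<open>F n\<close> tends to \<open>K\<close> and stays below it, because
    \<open>1 - exp (- y) \<le> y\<close>. Hence the right side is already bounded by its limit, and
    Fatou's lemma treats the left side.\<close>
  define F where "F n g = E n g * (real (Suc n) / 2)" for n g
  have [measurable]: "F n \<in> borel_measurable (gauss I)" for n unfolding F_def by measurable
  have F: "(\<integral>\<^sup>+g. (ennreal (F n g))\<^sup>2 \<partial>gauss I) \<le> 3 * (\<integral>\<^sup>+g. ennreal (K g) \<partial>gauss I)\<^sup>2" for n
  proof -
    let ?c = "ennreal (real (Suc n) / 2)"
    have e: "ennreal (F n g) = ennreal (E n g) * ?c" for g unfolding F_def by (rule ennreal_mult) (use E0 in auto)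
    have "(\<integral>\<^sup>+g. (ennreal (F n g))\<^sup>2 \<partial>gauss I) = (\<integral>\<^sup>+g. (ennreal (E n g))\<^sup>2 \<partial>gauss I) * ?c\<^sup>2"
      unfolding e power_mult_distrib by (rule nn_integral_multc) measurable
    also have "\<dots> \<le> 3 * (\<integral>\<^sup>+g. ennreal (E n g) \<partial>gauss I)\<^sup>2 * ?c\<^sup>2" by (intro mult_right_mono A) auto
    also have "\<dots> = 3 * (\<integral>\<^sup>+g. ennreal (F n g) \<partial>gauss I)\<^sup>2"
      unfolding e by (subst nn_integral_multc) (auto simp: power_mult_distrib mult.assoc)
    also have "\<dots> \<le> 3 * (\<integral>\<^sup>+g. ennreal (K g) \<partial>gauss I)\<^sup>2"
    proof (intro mult_left_mono power_mono nn_integral_mono ennreal_leI)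
      fix g
      have "E n g \<le> 2 * t n * K g" using exp_ge_add_one_self[of "- 2 * t n * K g"] by (simp add: E_def)
      then have "F n g \<le> 2 * t n * K g * (real (Suc n) / 2)" unfolding F_def by (rule mult_right_mono) auto
      then show "F n g \<le> K g" by (simp add: t_def field_simps del: of_nat_Suc)
    qed auto
    finally show ?thesis .
  qed
  have lim: "(\<lambda>n. F n g) \<longlonglongrightarrow> K g" for g
  proof -
    have "(\<lambda>n. (exp (of_real (inverse (real (Suc n))) * (- 2 * K g)) - 1) * of_nat (Suc n) * (- 1 / 2)) \<longlonglongrightarrow> (- 2 * K g) * (- 1 / 2)"
      by (intro tendsto_mult exp_difference_quotient_tendsto tendsto_const)
    moreover have "(exp (of_real (inverse (real (Suc n))) * (- 2 * K g)) - 1) * of_nat (Suc n) * (- 1 / 2) = F n g" for n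
      by (simp add: F_def E_def t_def mult_ac del: of_nat_Suc) (simp add: field_simps)
    ultimately show ?thesis by simp
  qed
  have "(\<integral>\<^sup>+g. (ennreal (K g))\<^sup>2 \<partial>gauss I) = (\<integral>\<^sup>+g. liminf (\<lambda>n. (ennreal (F n g))\<^sup>2) \<partial>gauss I)"
  proof (rule nn_integral_cong)
    fix g
    have "F n g \<ge> 0" for n using E0[of n g] by (simp add: F_def)
    then have "(\<lambda>n. (ennreal (F n g))\<^sup>2) \<longlonglongrightarrow> (ennreal (K g))\<^sup>2"
      using K0[of g] by (simp add: ennreal_power) (intro tendsto_intros lim)
    then show "(ennreal (K g))\<^sup>2 = liminf (\<lambda>n. (ennreal (F n g))\<^sup>2)"
      using lim_imp_Liminf[OF sequentially_bot] by metis
  qed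
  also have "\<dots> \<le> liminf (\<lambda>n. \<integral>\<^sup>+g. (ennreal (F n g))\<^sup>2 \<partial>gauss I)"
    by (rule nn_integral_liminf) measurable
  also have "\<dots> \<le> 3 * (\<integral>\<^sup>+g. ennreal (K g) \<partial>gauss I)\<^sup>2"
    using F by (intro Liminf_le) auto
  finally show ?thesis by (simp add: K_def)
qed

end

section \<open>Integrals of step functions\<close>

lemma simple_on_mono:
  assumes "simple_on T g m t x" "i \<le> j" "j \<le> m"
  shows "t i \<le> t j"
  using assms(2,3)
proof (induction rule: dec_induct)
  case (step n)
  then have "t n \<le> t (Suc n)" using assms(1) unfolding simple_on_def by simp
  with step show ?case by simp
qed simp

lemma simple_on_range:
  assumes "simple_on T g m t x" "k \<le> m"
  shows "t k \<in> {0..T}"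
  using simple_on_mono[OF assms(1), of 0 k] simple_on_mono[OF assms(1), of k m] assms
  by (auto simp: simple_on_def)

lemma simple_on_cover:
  assumes g: "simple_on T g m t x" and s: "s \<in> {0..T}" "s \<notin> t ` {..m}"
  obtains k where "k < m" "s \<in> {t k<..<t (Suc k)}"
proof -
  have ends: "t 0 = 0" "t m = T" using g by (auto simp: simple_on_def)
  \<comment> \<open>Partition points may coincide. The first one strictly beyond \<open>s\<close>
    has a predecessor that is strictly below \<open>s\<close>, since \<open>s\<close> is not a
    partition point.\<close>
  define k where "k = (LEAST j. j \<le> m \<and> s < t j)"
  have ex: "m \<le> m \<and> s < t m" using s ends by (force simp: image_iff)
  have k: "k \<le> m" "s < t k" using LeastI[of "\<lambda>j. j \<le> m \<and> s < t j", OF ex] by (auto simp: k_def)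
  have "k \<noteq> 0" using k(2) ends s(1) by (cases k) auto
  then obtain j where j: "k = Suc j" by (cases k) auto
  have "\<not> s < t j" using not_less_Least[of j "\<lambda>j. j \<le> m \<and> s < t j"] k(1) j by (auto simp: k_def[symmetric])
  moreover have "s \<noteq> t j" using s(2) k(1) j by auto
  ultimately show thesis using k j by (intro that[of j]) auto
qed

lemma simple_on_integral:
  fixes H :: "'b \<Rightarrow> complex"
  assumes g: "simple_on T g m t x"
  shows "(\<lambda>s. H (g s)) \<in> borel_measurable (leb T)"
    and "(LINT s|leb T. H (g s)) = (\<Sum>k<m. of_real (t (Suc k) - t k) * H (x k))"
proof -
  \<comment> \<open>\<open>H\<close> is an arbitrary function, so measurability comes from the
    finitely many values: \<open>F\<close> agrees with \<open>H (g s)\<close> off the partition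
    points, where \<open>g\<close> is unspecified.\<close>
  define F where "F s = (\<Sum>k<m. indicator {t k<..<t (Suc k)} s *\<^sub>R H (x k))" for s
  have [measurable]: "F \<in> borel_measurable (leb T)"
    unfolding F_def by (intro measurable_restrict_space1) measurable
  have cs: "countable (t ` {..m})" by (auto intro: countable_finite)
  have eq: "F s = H (g s)" if s: "s \<in> {0..T}" "s \<notin> t ` {..m}" for s
  proof -
    obtain k where k: "k < m" "s \<in> {t k<..<t (Suc k)}" using simple_on_cover[OF g s] by blast
    have "F s = (\<Sum>i<m. if i = k then H (x k) else 0)"
      unfolding F_def
    proof (rule sum.cong[OF refl])
      fix i assume i: "i \<in> {..<m}"
      consider "i < k" | "i = k" | "i > k" by linarith
      then show "indicator {t i<..<t (Suc i)} s *\<^sub>R H (x i) = (if i = k then H (x k) else 0)"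
      proof cases
        case 1
        then show ?thesis using simple_on_mono[OF g, of "Suc i" k] k by auto
      next
        case 3
        then show ?thesis using simple_on_mono[OF g, of "Suc k" i] k i by auto
      qed (use k in auto)
    qed
    also have "\<dots> = H (x k)" using k by simp
    also have "\<dots> = H (g s)" using g k by (auto simp: simple_on_def)
    finally show ?thesis .
  qed
  show m: "(\<lambda>s. H (g s)) \<in> borel_measurable (leb T)"
    by (rule measurable_leb_if_countable_eq[of F _ _ "t ` {..m}"]) (use eq cs in auto)
  interpret finite_measure "leb T" by (rule finite_measure_leb)
  have "(LINT s|leb T. H (g s)) = (LINT s|leb T. F s)"
    by (intro integral_cong_AE m AE_leb_if_countable[OF cs]) (use eq in auto)
  also have "\<dots> = (\<Sum>k<m. (LINT s|leb T. indicator {t k<..<t (Suc k)} s *\<^sub>R H (x k)))"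
  proof -
    have "integrable (leb T) (\<lambda>s. indicator {t k<..<t (Suc k)} s *\<^sub>R H (x k))" for k
      by (rule integrable_const_bound[of _ "cmod (H (x k))"])
        (auto simp: indicator_def intro!: measurable_restrict_space1)
    then show ?thesis unfolding F_def by (intro Bochner_Integration.integral_sum) auto
  qed
  also have "\<dots> = (\<Sum>k<m. of_real (t (Suc k) - t k) * H (x k))"
  proof (rule sum.cong[OF refl])
    fix k assume k: "k \<in> {..<m}"
    then have r: "t k \<in> {0..T}" "t (Suc k) \<in> {0..T}" "t k \<le> t (Suc k)"
      using simple_on_range[OF g] simple_on_mono[OF g] by auto
    then have sub: "{t k<..<t (Suc k)} \<subseteq> {0..T}" by auto
    have "{t k<..<t (Suc k)} \<in> sets (leb T)"
      using sub by (auto simp: sets_restrict_space image_iff intro!: exI[of _ "{t k<..<t (Suc k)}"])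
    then have "(LINT s|leb T. indicator {t k<..<t (Suc k)} s *\<^sub>R H (x k)) = measure (leb T) {t k<..<t (Suc k)} *\<^sub>R H (x k)"
      by (subst integral_scaleR_left) (auto simp: emeasure_eq_measure Int_absorb2[OF sub] space_restrict_space)
    also have "measure (leb T) {t k<..<t (Suc k)} = t (Suc k) - t k"
      using sub r(3) by (simp add: measure_restrict_space)
    finally show "(LINT s|leb T. indicator {t k<..<t (Suc k)} s *\<^sub>R H (x k)) = of_real (t (Suc k) - t k) * H (x k)"
      by (simp add: scaleR_conv_of_real)
  qed
  finally show "(LINT s|leb T. H (g s)) = (\<Sum>k<m. of_real (t (Suc k) - t k) * H (x k))" .
qed

text \<open>Step functions are represented by lists of triples \<open>(p, q, x)\<close>, standing for \<open>x 1\<^bsub>(p, q]\<^esub>\<close>. The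
  intervals may overlap, so that sums are concatenations.\<close>

definition step_fun :: "(real \<times> real \<times> 'b::real_vector) list \<Rightarrow> real \<Rightarrow> 'b" where
  "step_fun xs s = (\<Sum>(p, q, x)\<leftarrow>xs. indicator {p<..q} s *\<^sub>R x)"

definition step_int :: "(real \<Rightarrow> 'b \<Rightarrow> 'w \<Rightarrow> real) \<Rightarrow> (real \<times> real \<times> 'b) list \<Rightarrow> 'w \<Rightarrow> real" where
  "step_int L xs \<omega> = (\<Sum>(p, q, x)\<leftarrow>xs. L q x \<omega> - L p x \<omega>)"

definition steps_on :: "real \<Rightarrow> (real \<times> real \<times> 'b) list \<Rightarrow> bool" where
  "steps_on T xs \<longleftrightarrow> (\<forall>(p, q, x)\<in>set xs. 0 \<le> p \<and> p \<le> q \<and> q \<le> T)"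

definition step_scale :: "real \<Rightarrow> (real \<times> real \<times> 'b::real_vector) list \<Rightarrow> (real \<times> real \<times> 'b) list" where
  "step_scale c = map (\<lambda>(p, q, x). (p, q, c *\<^sub>R x))"

lemma step_fun_append [simp]: "step_fun (xs @ ys) s = step_fun xs s + step_fun ys s"
  by (simp add: step_fun_def)

lemma step_int_append [simp]: "step_int L (xs @ ys) \<omega> = step_int L xs \<omega> + step_int L ys \<omega>"
  by (simp add: step_int_def)

lemma steps_on_append [simp]: "steps_on T (xs @ ys) \<longleftrightarrow> steps_on T xs \<and> steps_on T ys"
  by (simp add: steps_on_def ball_Un)

lemma step_fun_scale [simp]: "step_fun (step_scale c xs) s = c *\<^sub>R step_fun xs s"
  by (induction xs) (auto simp: step_fun_def step_scale_def scaleR_add_right mult.commute)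

lemma steps_on_scale [simp]: "steps_on T (step_scale c xs) \<longleftrightarrow> steps_on T xs"
  by (auto simp: steps_on_def step_scale_def)

lemma sum_sum_list_swap: "(\<Sum>k\<in>A. \<Sum>z\<leftarrow>xs. f k z) = (\<Sum>z\<leftarrow>xs. \<Sum>k\<in>A. f k z)"
  by (induction xs) (simp_all add: sum.distrib)

lemma indicator_eventually_at_right:
  "eventually (\<lambda>s'. indicator {p<..q} s' = (indicator {p..<q} s :: real)) (at_right (s :: real))"
proof -
  define b where "b = (if s < p then p else if s < q then q else s + 1)"
  have "b > s" by (auto simp: b_def)
  then have "eventually (\<lambda>s'. s' \<in> {s<..<b}) (at_right s)" by (rule eventually_at_right_real)
  then show ?thesis by eventually_elim (auto simp: b_def indicator_def split: if_splits)
qed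

lemma indicator_eventually_at_left:
  "eventually (\<lambda>s'. indicator {p<..q} s' = (indicator {p<..q} s :: real)) (at_left (s :: real))"
proof -
  define b where "b = (if s > q then q else if s > p then p else s - 1)"
  have "b < s" by (auto simp: b_def)
  then have "eventually (\<lambda>s'. s' \<in> {b<..<s}) (at_left s)" by (rule eventually_at_left_real)
  then show ?thesis by eventually_elim (auto simp: b_def indicator_def split: if_splits)
qed

lemma regulated_step_fun: "regulated T (step_fun xs)"
proof -
  have "\<exists>l. (step_fun xs \<longlongrightarrow> l) (at_right s) \<and> True" for s
  proof (induction xs)
    case (Cons z xs)
    obtain p q x where z: "z = (p, q, x)" by (cases z)
    from Cons obtain l where l: "(step_fun xs \<longlongrightarrow> l) (at_right s)" by blast
    have "((\<lambda>s'. indicator {p<..q} s' :: real) \<longlongrightarrow> indicator {p..<q} s) (at_right s)"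
      by (intro tendsto_eventually indicator_eventually_at_right)
    then have "((\<lambda>s'. indicator {p<..q} s' *\<^sub>R x + step_fun xs s') \<longlongrightarrow> indicator {p..<q} s *\<^sub>R x + l) (at_right s)"
      by (intro tendsto_intros l)
    then show ?case by (auto simp: step_fun_def z)
  qed (auto simp: step_fun_def)
  moreover have "\<exists>l. (step_fun xs \<longlongrightarrow> l) (at_left s) \<and> True" for s
  proof (induction xs)
    case (Cons z xs)
    obtain p q x where z: "z = (p, q, x)" by (cases z)
    from Cons obtain l where l: "(step_fun xs \<longlongrightarrow> l) (at_left s)" by blast
    have "((\<lambda>s'. indicator {p<..q} s' :: real) \<longlongrightarrow> indicator {p<..q} s) (at_left s)"
      by (intro tendsto_eventually indicator_eventually_at_left)
    then have "((\<lambda>s'. indicator {p<..q} s' *\<^sub>R x + step_fun xs s') \<longlongrightarrow> indicator {p<..q} s *\<^sub>R x + l) (at_left s)"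
      by (intro tendsto_intros l)
    then show ?case by (auto simp: step_fun_def z)
  qed (auto simp: step_fun_def)
  ultimately show ?thesis unfolding regulated_def by simp
qed

context cyl_levy
begin

lemma increment_char:
  assumes st: "0 \<le> s" "s \<le> t"
  shows "(LINT \<omega>|M. iexp (L t x \<omega> - L s x \<omega>)) = exp (complex_of_real (t - s) * \<Psi> x)"
proof -
  let ?X = "\<lambda>t (i::nat). L t x" and ?B = "Pi\<^sub>M {..<1::nat} (\<lambda>_. borel :: real measure)"
  have "\<forall>n y. levy_process M n (\<lambda>t i. L t (y i))"
    using levy unfolding cylindrical_levy_process_def by blast
  from this[rule_format, of 1 "\<lambda>_. x"] have lp: "levy_process M 1 ?X" .
  have d: "distr M ?B (increment 1 ?X s t) = distr M ?B (increment 1 ?X 0 (t - s))"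
    using lp st unfolding levy_process_def by blast
  have z: "AE \<omega> in M. L 0 x \<omega> = 0" using lp unfolding levy_process_def by simp
  have [measurable]: "L t x \<in> borel_measurable M" "L s x \<in> borel_measurable M" "L 0 x \<in> borel_measurable M" "L (t - s) x \<in> borel_measurable M"
    using st by (auto intro: L_measurable)
  have m: "increment 1 ?X u v \<in> measurable M ?B"
    if [measurable]: "L u x \<in> borel_measurable M" "L v x \<in> borel_measurable M" for u v
    unfolding increment_def by (rule measurable_restrict) measurable
  have c: "(\<lambda>v. iexp (v (0::nat))) \<in> borel_measurable ?B"
  proof -
    have [measurable]: "(\<lambda>v. v 0) \<in> borel_measurable ?B" by (rule measurable_component_singleton) simp
    show ?thesis by measurable
  qed
  have "(LINT \<omega>|M. iexp (L v x \<omega> - L u x \<omega>)) = (LINT y|distr M ?B (increment 1 ?X u v). iexp (y (0::nat)))"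
    if "L u x \<in> borel_measurable M" "L v x \<in> borel_measurable M" for u v
    by (subst integral_distr[OF m[OF that] c]) (simp add: increment_def)
  then have "(LINT \<omega>|M. iexp (L t x \<omega> - L s x \<omega>)) = (LINT \<omega>|M. iexp (L (t - s) x \<omega> - L 0 x \<omega>))"
    using d by simp
  also have "\<dots> = (LINT \<omega>|M. iexp (L (t - s) x \<omega>))"
    by (rule integral_cong_AE) (use z in auto)
  also have "\<dots> = exp (complex_of_real (t - s) * \<Psi> x)" using st by (intro L_char) auto
  finally show ?thesis .
qed

text \<open>Independence is available for increments of one vector-valued process at a time. All
  values \<open>y j\<close> are put into a single process of dimension \<open>m\<close>, and the
  \<open>j\<close>-th coordinate is taken from its \<open>j\<close>-th increment.\<close>

lemma simple_integral_char:
  assumes t0: "0 \<le> t 0" and inc: "\<And>j. j < m \<Longrightarrow> t j \<le> t (Suc j)"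
  shows "(LINT \<omega>|M. iexp (simple_integral_wrt L m t y \<omega>)) = exp (\<Sum>j<m. complex_of_real (t (Suc j) - t j) * \<Psi> (y j))"
proof -
  let ?X = "\<lambda>t i. L t (y i)" and ?B = "Pi\<^sub>M {..<m} (\<lambda>_. borel :: real measure)"
  have pos: "0 \<le> t j" if "j \<le> m" for j
    using that
  proof (induction j)
    case (Suc j)
    then show ?case using inc[of j] by simp
  qed (use t0 in simp)
  have "\<forall>n y. levy_process M n (\<lambda>t i. L t (y i))"
    using levy unfolding cylindrical_levy_process_def by blast
  from this[rule_format, of m y] have "levy_process M m ?X" .
  then have "indep_vars (\<lambda>_. ?B) (\<lambda>j. increment m ?X (t j) (t (Suc j))) {..<m}"
    using t0 inc unfolding levy_process_def by blast
  then have "indep_vars (\<lambda>_. borel) (\<lambda>j \<omega>. iexp (increment m ?X (t j) (t (Suc j)) \<omega> j)) {..<m}"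
  proof (rule indep_vars_compose2)
    fix j assume j: "j \<in> {..<m}"
    have [measurable]: "(\<lambda>v. v j) \<in> borel_measurable ?B" using j by (rule measurable_component_singleton)
    show "(\<lambda>v. iexp (v j)) \<in> borel_measurable ?B" by measurable
  qed
  then have "(LINT \<omega>|M. (\<Prod>j\<in>{..<m}. iexp (increment m ?X (t j) (t (Suc j)) \<omega> j))) = (\<Prod>j\<in>{..<m}. LINT \<omega>|M. iexp (increment m ?X (t j) (t (Suc j)) \<omega> j))"
  proof (rule indep_vars_lebesgue_integral[rotated])
    fix j assume j: "j \<in> {..<m}"
    then have "L (t j) (y j) \<in> borel_measurable M" "L (t (Suc j)) (y j) \<in> borel_measurable M"
      using pos by (auto intro!: L_measurable)
    then have "(\<lambda>\<omega>. increment m ?X (t j) (t (Suc j)) \<omega> j) \<in> borel_measurable M"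
      using j unfolding increment_def by simp
    then show "integrable M (\<lambda>\<omega>. iexp (increment m ?X (t j) (t (Suc j)) \<omega> j))" by (rule integrable_iexp)
  qed simp
  also have "\<dots> = (\<Prod>j\<in>{..<m}. exp (complex_of_real (t (Suc j) - t j) * \<Psi> (y j)))"
  proof (rule prod.cong[OF refl])
    fix j assume j: "j \<in> {..<m}"
    then show "(LINT \<omega>|M. iexp (increment m ?X (t j) (t (Suc j)) \<omega> j)) = exp (complex_of_real (t (Suc j) - t j) * \<Psi> (y j))"
      using increment_char[of "t j" "t (Suc j)" "y j"] pos inc by (simp add: increment_def)
  qed
  also have "\<dots> = exp (\<Sum>j<m. complex_of_real (t (Suc j) - t j) * \<Psi> (y j))" by (simp add: exp_sum)
  also have "(\<lambda>\<omega>. \<Prod>j\<in>{..<m}. iexp (increment m ?X (t j) (t (Suc j)) \<omega> j)) = (\<lambda>\<omega>. iexp (simple_integral_wrt L m t y \<omega>))"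
    unfolding simple_integral_wrt_def of_real_sum sum_distrib_left by (simp add: exp_sum increment_def)
  finally show ?thesis .
qed

lemma simple_on_char:
  assumes g: "simple_on T g m t x"
  shows "(LINT \<omega>|M. iexp (simple_integral_wrt L m t x \<omega>)) = exp (LINT s|leb T. \<Psi> (g s))"
  unfolding simple_on_integral(2)[OF g]
  using g by (intro simple_integral_char) (auto simp: simple_on_def)

lemma simple_integral_measurable:
  assumes g: "simple_on T g m t x"
  shows "simple_integral_wrt L m t x \<in> borel_measurable M"
proof -
  have [measurable]: "L (t k) y \<in> borel_measurable M" if "k \<le> m" for k y
    using simple_on_range[OF g that] by (intro L_measurable) auto
  show ?thesis unfolding simple_integral_wrt_def by (intro borel_measurable_sum borel_measurable_diff) auto
qed

lemma step_int_measurable: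
  assumes "steps_on T xs"
  shows "step_int L xs \<in> borel_measurable M"
  using assms
proof (induction xs)
  case Nil
  then show ?case by (simp add: step_int_def[abs_def])
next
  case (Cons z xs)
  obtain p q x where z: "z = (p, q, x)" by (cases z)
  have [measurable]: "step_int L xs \<in> borel_measurable M" "L p x \<in> borel_measurable M" "L q x \<in> borel_measurable M"
    using Cons by (auto simp: steps_on_def z intro!: L_measurable)
  have "step_int L (z # xs) = (\<lambda>\<omega>. L q x \<omega> - L p x \<omega> + step_int L xs \<omega>)"
    by (auto simp: step_int_def z)
  then show ?case by simp
qed

lemma L_sum_list:
  assumes t: "t \<ge> 0"
  shows "AE \<omega> in M. L t (\<Sum>z\<leftarrow>xs. c z *\<^sub>R y z) \<omega> = (\<Sum>z\<leftarrow>xs. c z * L t (y z) \<omega>)"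
proof (induction xs)
  case Nil
  then show ?case using L_scale[OF t, of 0 0] by simp
next
  case (Cons z xs)
  show ?case
    using Cons.IH L_add[OF t, of "c z *\<^sub>R y z" "\<Sum>z\<leftarrow>xs. c z *\<^sub>R y z"] L_scale[OF t, of "c z" "y z"]
    by eventually_elim simp
qed

lemma step_int_scale:
  assumes "steps_on T xs"
  shows "AE \<omega> in M. step_int L (step_scale c xs) \<omega> = c * step_int L xs \<omega>"
  using assms
proof (induction xs)
  case (Cons z xs)
  obtain p q x where z: "z = (p, q, x)" by (cases z)
  have pq: "0 \<le> p" "0 \<le> q" and xs: "steps_on T xs" using Cons.prems by (auto simp: steps_on_def z)
  show ?case
    using Cons.IH[OF xs] L_scale[OF pq(1), of c x] L_scale[OF pq(2), of c x]
    by eventually_elim (simp add: step_int_def step_scale_def z algebra_simps)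
qed (simp add: step_int_def step_scale_def)

text \<open>Overlapping intervals are resolved by the partition formed by all endpoints together
  with 0 and \<open>T\<close>. On each cell the vectors of the intervals covering it add up, and
  almost sure linearity of \<open>L\<close> at the finitely many partition points makes the
  integrals telescope.\<close>

lemma step_fun_simple:
  assumes xs: "steps_on T xs" and T: "T \<ge> 0"
  obtains m t y where "simple_on T (step_fun xs) m t y" "AE \<omega> in M. step_int L xs \<omega> = simple_integral_wrt L m t y \<omega>"
proof -
  define P where "P = {0, T} \<union> fst ` set xs \<union> (fst \<circ> snd) ` set xs"
  have P: "finite P" "0 \<in> P" "T \<in> P" by (auto simp: P_def)
  have PT: "P \<subseteq> {0..T}" using xs T by (force simp: P_def steps_on_def)
  have Pxs: "p \<in> P" "q \<in> P" if "(p, q, x) \<in> set xs" for p q x using that by (force simp: P_def)+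
  define r where "r = sorted_list_of_set P"
  have r: "sorted r" "distinct r" "set r = P" using P(1) by (auto simp: r_def)
  define m where "m = length r - 1"
  have len: "length r = Suc m" using r(3) P(2) by (cases r) (auto simp: m_def)
  define t where "t k = r ! k" for k
  have tm: "t i \<le> t j" if "i \<le> j" "j \<le> m" for i j
    using sorted_nth_mono[OF r(1), of i j] that len by (simp add: t_def)
  have ts: "t i < t j" if "i < j" "j \<le> m" for i j
    using tm[of i j] that nth_eq_iff_index_eq[OF r(2), of i j] len by (simp add: t_def less_le)
  have tP: "\<exists>j\<le>m. v = t j" if "v \<in> P" for v
    using that r(3) len by (auto simp: t_def in_set_conv_nth less_Suc_eq_le)
  have tin: "t j \<in> P" if "j \<le> m" for j using that r(3) len by (auto simp: t_def)
  have t0: "t 0 = 0"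
  proof -
    obtain j where "j \<le> m" "0 = t j" using tP[OF P(2)] by blast
    then have "t 0 \<le> 0" using tm[of 0 j] by simp
    then show ?thesis using tin[of 0] PT by force
  qed
  have tT: "t m = T"
  proof -
    obtain j where "j \<le> m" "T = t j" using tP[OF P(3)] by blast
    then have "T \<le> t m" using tm[of j m] by simp
    then show ?thesis using tin[of m] PT by force
  qed
  have tlt: "t i < t j \<longleftrightarrow> i < j" and tle: "t i \<le> t j \<longleftrightarrow> i \<le> j" if "i \<le> m" "j \<le> m" for i j
    using ts[of i j] ts[of j i] tm[of i j] tm[of j i] that by (force simp: not_less not_le)+
  \<comment> \<open>The cell from \<open>t k\<close> to \<open>t (k + 1)\<close> contains no
    endpoint inside, so testing its left end decides whether the interval of \<open>z\<close> covers
    it.\<close>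
  define w where "w k z = (case z of (p, q, x) \<Rightarrow> if p \<le> t k \<and> t k < q then 1 else (0 :: real))"
    for k and z :: "real \<times> real \<times> ('u \<Rightarrow>\<^sub>L real)"
  have w_def': "w k (p, q, x) = (if p \<le> t k \<and> t k < q then 1 else 0)" for k p q x by (simp add: w_def)
  define y where "y k = (\<Sum>z\<leftarrow>xs. w k z *\<^sub>R snd (snd z))" for k
  have "simple_on T (step_fun xs) m t y"
    unfolding simple_on_def
  proof (intro conjI allI impI ballI t0 tT)
    fix k assume k: "k < m"
    then show "t k \<le> t (Suc k)" by (intro tm) auto
    fix s assume s: "s \<in> {t k<..<t (Suc k)}"
    show "step_fun xs s = y k"
      unfolding step_fun_def y_def
    proof (intro arg_cong[of _ _ sum_list] map_cong refl)
      fix z assume z: "z \<in> set xs"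
      obtain p q x where pq: "z = (p, q, x)" by (cases z)
      obtain i j where ij: "i \<le> m" "j \<le> m" "p = t i" "q = t j"
        using tP Pxs z pq by metis
      have "(t i < s) = (t i \<le> t k)" "(s \<le> t j) = (t k < t j)"
        using s k ij tle[of i k] tle[of "Suc k" i] tlt[of k j] tle[of "Suc k" j] tle[of j k]
        by (auto simp: not_le not_less Suc_le_eq)
      then show "(case z of (p, q, x) \<Rightarrow> indicator {p<..q} s *\<^sub>R x) = w k z *\<^sub>R snd (snd z)"
        by (simp add: pq w_def' ij(3,4))
    qed
  qed
  moreover have "AE \<omega> in M. step_int L xs \<omega> = simple_integral_wrt L m t y \<omega>"
  proof -
    have pos: "t k \<ge> 0" if "k \<le> m" for k using tin[OF that] PT by auto
    have "AE \<omega> in M. \<forall>k\<in>{..<m}. L (t (Suc k)) (y k) \<omega> = (\<Sum>z\<leftarrow>xs. w k z * L (t (Suc k)) (snd (snd z)) \<omega>)"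
      unfolding y_def by (intro AE_finite_allI L_sum_list pos) auto
    moreover have "AE \<omega> in M. \<forall>k\<in>{..<m}. L (t k) (y k) \<omega> = (\<Sum>z\<leftarrow>xs. w k z * L (t k) (snd (snd z)) \<omega>)"
      unfolding y_def by (intro AE_finite_allI L_sum_list pos) auto
    ultimately show ?thesis
    proof eventually_elim
      case (elim \<omega>)
      have "simple_integral_wrt L m t y \<omega>
        = (\<Sum>k<m. (\<Sum>z\<leftarrow>xs. w k z * (L (t (Suc k)) (snd (snd z)) \<omega> - L (t k) (snd (snd z)) \<omega>)))"
        unfolding simple_integral_wrt_def
        by (intro sum.cong) (use elim in \<open>auto simp: right_diff_distrib sum_list_subtractf\<close>)
      also have "\<dots> = (\<Sum>z\<leftarrow>xs. (\<Sum>k<m. w k z * (L (t (Suc k)) (snd (snd z)) \<omega> - L (t k) (snd (snd z)) \<omega>)))"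
        by (rule sum_sum_list_swap)
      also have "\<dots> = step_int L xs \<omega>"
        unfolding step_int_def
      proof (intro arg_cong[of _ _ sum_list] map_cong refl)
        fix z assume z: "z \<in> set xs"
        obtain p q x where pq: "z = (p, q, x)" by (cases z)
        obtain i j where ij: "i \<le> m" "j \<le> m" "p = t i" "q = t j"
          using tP Pxs z pq by metis
        have "t i \<le> t j" using xs z ij unfolding steps_on_def pq by force
        then have le: "i \<le> j" using tle ij by simp
        have "(\<Sum>k<m. w k z * (L (t (Suc k)) x \<omega> - L (t k) x \<omega>)) = (\<Sum>k\<in>{i..<j}. L (t (Suc k)) x \<omega> - L (t k) x \<omega>)"
          by (intro sum.mono_neutral_cong_right) (use ij tle tlt in \<open>auto simp: pq w_def'\<close>)
        also have "\<dots> = L (t j) x \<omega> - L (t i) x \<omega>" using le by (rule sum_Suc_diff')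
        finally show "(\<Sum>k<m. w k z * (L (t (Suc k)) (snd (snd z)) \<omega> - L (t k) (snd (snd z)) \<omega>)) = (case z of (p, q, x) \<Rightarrow> L q x \<omega> - L p x \<omega>)"
          using ij by (simp add: pq)
      qed
      finally show ?case ..
    qed
  qed
  ultimately show thesis by (rule that)
qed

lemma step_fun_char:
  assumes xs: "steps_on T xs" and T: "T \<ge> 0"
  shows "(LINT \<omega>|M. iexp (step_int L xs \<omega>)) = exp (LINT s|leb T. \<Psi> (step_fun xs s))"
    and "(\<lambda>s. \<Psi> (step_fun xs s)) \<in> borel_measurable (leb T)"
proof -
  obtain m t y where *: "simple_on T (step_fun xs) m t y" "AE \<omega> in M. step_int L xs \<omega> = simple_integral_wrt L m t y \<omega>"
    using step_fun_simple[OF assms] by blast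
  note [measurable] = step_int_measurable[OF xs] simple_integral_measurable[OF *(1)]
  have "(LINT \<omega>|M. iexp (step_int L xs \<omega>)) = (LINT \<omega>|M. iexp (simple_integral_wrt L m t y \<omega>))"
    by (rule integral_cong_AE, measurable, use *(2) in eventually_elim) simp
  then show "(LINT \<omega>|M. iexp (step_int L xs \<omega>)) = exp (LINT s|leb T. \<Psi> (step_fun xs s))"
    using simple_on_char[OF *(1)] by simp
  show "(\<lambda>s. \<Psi> (step_fun xs s)) \<in> borel_measurable (leb T)"
    by (rule simple_on_integral(1)[OF *(1)])
qed

text \<open>\<Psi> is bounded on bounded sets, which dominates the integrands on a finite interval.
  Measurability is asked of the compositions with \<Psi>, as the dual of \<open>U\<close> may be
  non-separable.\<close>

lemma \<Psi>_integral_tendsto: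
  assumes m: "\<And>n. (\<lambda>s. \<Psi> (G n s)) \<in> borel_measurable (leb T)" "(\<lambda>s. \<Psi> (h s)) \<in> borel_measurable (leb T)"
    and C: "\<And>n s. s \<in> {0..T} \<Longrightarrow> norm (G n s) \<le> C"
    and lim: "AE s in leb T. (\<lambda>n. G n s) \<longlonglongrightarrow> h s"
  shows "(\<lambda>n. LINT s|leb T. \<Psi> (G n s)) \<longlonglongrightarrow> (LINT s|leb T. \<Psi> (h s))"
proof -
  interpret finite_measure "leb T" by (rule finite_measure_leb)
  obtain B where B: "\<And>x. norm x \<le> C \<Longrightarrow> cmod (\<Psi> x) \<le> B" using \<Psi>_bounded by blast
  show ?thesis
  proof (rule integral_dominated_convergence[where w="\<lambda>_. B"])
    show "AE s in leb T. (\<lambda>n. \<Psi> (G n s)) \<longlonglongrightarrow> \<Psi> (h s)"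
      using lim by eventually_elim (rule \<Psi>_tendsto)
    show "AE s in leb T. cmod (\<Psi> (G n s)) \<le> B" for n
      by (rule AE_I2) (use B C in \<open>auto simp: space_restrict_space\<close>)
  qed (use m in auto)
qed

end

section \<open>Integrals of limits of step functions\<close>

lemma regulated_diff:
  assumes "regulated T g" "regulated T h"
  shows "regulated T (\<lambda>s. g s - h s)"
  using assms unfolding regulated_def by (blast intro: tendsto_diff)

lemma regulated_scaleR:
  assumes c: "continuous_on UNIV c" and g: "regulated T g"
  shows "regulated T (\<lambda>s. c s *\<^sub>R g s)"
proof -
  have "(c \<longlongrightarrow> c s) (at s within X)" for s X
    using c by (simp add: continuous_on_eq_continuous_at continuous_within[symmetric] continuous_at_imp_continuous_at_within)
  with g show ?thesis unfolding regulated_def by (blast intro: tendsto_scaleR)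
qed

text \<open>Each cell carries the value at its right end, in agreement with
  \<open>rsample\<close>.\<close>

definition sample_steps :: "real \<Rightarrow> nat \<Rightarrow> (real \<Rightarrow> 'b) \<Rightarrow> (real \<times> real \<times> 'b) list" where
  "sample_steps T j \<phi> =
     map (\<lambda>k. (T * real k / real (Suc j), T * real (Suc k) / real (Suc j), \<phi> (T * real (Suc k) / real (Suc j)))) [0..<Suc j]"

lemma steps_on_sample_steps: "T \<ge> 0 \<Longrightarrow> steps_on T (sample_steps T j \<phi>)"
  unfolding steps_on_def sample_steps_def
  by (auto simp: divide_right_mono mult_left_mono divide_le_eq simp del: upt_Suc of_nat_Suc)

lemma step_fun_sample_steps:
  fixes j :: nat
  assumes T: "T > 0" and s: "0 < s" "s \<le> T"
  defines "u \<equiv> T * of_int \<lceil>real (Suc j) * s / T\<rceil> / real (Suc j)"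
  shows "step_fun (sample_steps T j \<phi>) s = \<phi> u" and "u \<in> {0..T}"
proof -
  obtain m where m: "m = real (Suc j)" "m > 0" by simp
  define y where "y = m * s / T"
  have y: "y > 0" "y \<le> m" using T s m(2) by (auto simp: y_def divide_le_eq)
  \<comment> \<open>The ceiling numbers the half-open cells from one, the list numbers them from
    zero.\<close>
  define k where "k = nat (\<lceil>y\<rceil> - 1)"
  have k: "\<lceil>y\<rceil> = int (Suc k)" using y by (simp add: k_def)
  have kj: "k < Suc j" using y k m(1) by (simp add: ceiling_le_iff flip: of_nat_Suc) linarith
  have u: "u = T * real (Suc k) / m" unfolding u_def m(1)[symmetric] y_def[symmetric] k by simp
  have ind: "s \<in> {T * real i / m<..T * real (Suc i) / m} \<longleftrightarrow> i = k" for i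
  proof -
    have "T * real i / m < s \<longleftrightarrow> real i < y" "s \<le> T * real (Suc i) / m \<longleftrightarrow> y \<le> real (Suc i)"
      using T m(2) by (auto simp: y_def field_simps)
    then have "s \<in> {T * real i / m<..T * real (Suc i) / m} \<longleftrightarrow> real i < y \<and> y \<le> real (Suc i)" by simp
    also have "\<dots> \<longleftrightarrow> \<lceil>y\<rceil> = int (Suc i)" by (simp add: ceiling_eq_iff)
    also have "\<dots> \<longleftrightarrow> i = k" using k by auto
    finally show ?thesis .
  qed
  have "step_fun (sample_steps T j \<phi>) s = (\<Sum>i<Suc j. indicator {T * real i / m<..T * real (Suc i) / m} s *\<^sub>R \<phi> (T * real (Suc i) / m))"
    unfolding step_fun_def sample_steps_def m(1)[symmetric]
    by (simp add: comp_def interv_sum_list_conv_sum_set_nat atLeast0LessThan del: upt_Suc sum.lessThan_Suc of_nat_Suc)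
  also have "\<dots> = (\<Sum>i<Suc j. if i = k then \<phi> u else 0)"
    by (rule sum.cong[OF refl]) (simp add: indicator_def ind u del: of_nat_Suc greaterThanAtMost_iff)
  also have "\<dots> = \<phi> u" using kj by simp
  finally show "step_fun (sample_steps T j \<phi>) s = \<phi> u" .
  have "real (Suc k) \<le> m" using kj m(1) by simp
  then have "T * real (Suc k) \<le> T * m" using T by (intro mult_left_mono) auto
  then show "u \<in> {0..T}" unfolding u using T m(2) by (auto simp: divide_le_eq)
qed

lemma step_fun_sample_steps_bound:
  assumes T: "T > 0" and s: "s \<in> {0..T}" and C: "\<And>u. u \<in> {0..T} \<Longrightarrow> norm (\<phi> u) \<le> C"
  shows "norm (step_fun (sample_steps T j \<phi>) s) \<le> C"
proof (cases "s = 0")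
  case True
  \<comment> \<open>The cells are open on the left, so none of them contains 0 and the step function
    vanishes there.\<close>
  have "\<not> (T * real k / real (Suc j) < 0)" for k using T by (simp add: divide_less_0_iff mult_less_0_iff del: of_nat_Suc)
  then have "step_fun (sample_steps T j \<phi>) s = (\<Sum>k\<leftarrow>[0..<Suc j]. 0)"
    unfolding True step_fun_def sample_steps_def map_map
    by (intro arg_cong[of _ _ sum_list] map_cong refl) (simp add: indicator_def del: of_nat_Suc)
  also have "\<dots> = 0" by simp
  finally show ?thesis using order_trans[OF norm_ge_zero C[of 0]] T by simp
next
  case False
  then show ?thesis using step_fun_sample_steps(1)[OF T, where s=s and j=j and \<phi>=\<phi>]
      step_fun_sample_steps(2)[OF T, where s=s and j=j] s C by auto
qed

text \<open>The step function rounds up by a ceiling, \<open>rsample\<close> by a floor plus one.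
  They differ exactly at grid points, which are countably many over all levels.\<close>

lemma step_fun_sample_steps_rsample:
  assumes T: "T > 0" and s: "s \<in> {0..T}" "s \<notin> (\<lambda>(i, j). T * of_int i / real (Suc j)) ` UNIV"
  shows "step_fun (sample_steps T j \<phi>) s = \<phi> (rsample T j s)"
proof -
  have "s \<noteq> T * of_int i / real (Suc j)" for i :: int using s(2) by (force simp: image_iff)
  then have ne: "real (Suc j) * s / T \<noteq> of_int i" for i :: int using T by (simp add: field_simps)
  have "s > 0" using s \<open>s \<noteq> T * of_int 0 / real (Suc j)\<close> by auto
  moreover have "of_int \<lceil>real (Suc j) * s / T\<rceil> = of_int \<lfloor>real (Suc j) * s / T\<rfloor> + (1::real)"
    using ne[of "\<lfloor>real (Suc j) * s / T\<rfloor>"] by (simp add: ceiling_altdef del: of_nat_Suc)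
  ultimately show ?thesis using step_fun_sample_steps(1)[OF T, where s=s and j=j and \<phi>=\<phi>] s(1) by (simp add: rsample_def del: of_nat_Suc)
qed

text \<open>Continuous multipliers keep a regulated function regulated, unlike the indicator itself.
  Clipping to \<open>[0, 1]\<close> provides the uniform bound and fixes both values of the
  indicator.\<close>

lemma indicator_limit_of_continuous:
  assumes A: "A \<in> sets (borel :: real measure)"
  obtains c :: "nat \<Rightarrow> real \<Rightarrow> real" where "\<And>n. continuous_on UNIV (c n)" "\<And>n s. \<bar>c n s\<bar> \<le> 1"
    "AE s in leb T. (\<lambda>n. c n s) \<longlonglongrightarrow> indicator A s"
proof -
  have "(indicator A :: real \<Rightarrow> real) \<in> borel_measurable borel" using A by measurable
  then have "(indicator A :: real \<Rightarrow> real) \<in> borel_measurable (lebesgue_on UNIV)"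
    by (intro measurable_completion measurable_restrict_space1) simp
  then have "(indicator A :: real \<Rightarrow> real) measurable_on UNIV"
    by (subst measurable_on_iff_borel_measurable) auto
  then obtain N g where N: "negligible N" and g: "\<And>n. continuous_on UNIV (g n)"
    "\<And>x. x \<notin> N \<Longrightarrow> (\<lambda>n. g n x) \<longlonglongrightarrow> (if x \<in> UNIV then indicator A x else 0 :: real)"
    unfolding measurable_on_def by blast
  show thesis
  proof (rule that[of "\<lambda>n s. max 0 (min 1 (g n s))"])
    show "continuous_on UNIV (\<lambda>s. max 0 (min 1 (g n s)))" for n by (intro continuous_intros g)
    have "AE s in lebesgue. s \<notin> N" using N by (simp add: negligible_iff_null_sets AE_not_in)
    then have "AE s in lborel. s \<notin> N" by (simp add: AE_completion_iff)
    then show "AE s in leb T. (\<lambda>n. max 0 (min 1 (g n s))) \<longlonglongrightarrow> indicator A s"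
      unfolding AE_leb_iff
    proof eventually_elim
      case (elim s)
      then have "(\<lambda>n. max 0 (min 1 (g n s))) \<longlonglongrightarrow> max 0 (min 1 (indicator A s))"
        using g(2)[of s] by (intro tendsto_intros) auto
      then show ?case by (auto simp: indicator_def)
    qed
  qed auto
qed

text \<open>\<open>J n\<close> is chosen so that the mean of \<open>h n (J n)\<close> is below
  \<open>2^(-n)\<close>. The series then has finite integral and converges almost everywhere, so its
  terms tend to 0.\<close>

lemma AE_diagonal_limit:
  fixes h :: "nat \<Rightarrow> nat \<Rightarrow> 's \<Rightarrow> real"
  assumes "finite_measure S" and [measurable]: "\<And>n j. h n j \<in> borel_measurable S"
    and b: "\<And>n j s. 0 \<le> h n j s \<and> h n j s \<le> 1"
    and lim: "\<And>n. AE s in S. (\<lambda>j. h n j s) \<longlonglongrightarrow> 0"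
  obtains J where "AE s in S. (\<lambda>n. h n (J n) s) \<longlonglongrightarrow> 0"
proof -
  interpret finite_measure S by fact
  have int: "integrable S (h n j)" for n j
    using b by (intro integrable_const_bound[of _ 1]) auto
  have "\<exists>j. (LINT s|S. h n j s) < (1/2)^n" for n
  proof -
    have "(\<lambda>j. LINT s|S. h n j s) \<longlonglongrightarrow> (LINT s|S. 0)"
      using lim[of n] b by (intro integral_dominated_convergence[where w="\<lambda>_. 1"]) auto
    then have "eventually (\<lambda>j. (LINT s|S. h n j s) < (1/2)^n) sequentially"
      by (intro order_tendstoD) auto
    then show ?thesis by (auto simp: eventually_sequentially)
  qed
  then obtain J where J: "\<And>n. (LINT s|S. h n (J n) s) < (1/2)^n" by metis
  have "(\<integral>\<^sup>+s. (\<Sum>n. ennreal (h n (J n) s)) \<partial>S) = (\<Sum>n. \<integral>\<^sup>+s. ennreal (h n (J n) s) \<partial>S)"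
    by (rule nn_integral_suminf) measurable
  also have "\<dots> = (\<Sum>n. ennreal (LINT s|S. h n (J n) s))"
    using int b by (simp add: nn_integral_eq_integral)
  also have "\<dots> \<le> (\<Sum>n. ennreal ((1/2)^n))"
    using J by (intro suminf_le ennreal_leI) (auto intro: less_imp_le)
  also have "\<dots> < \<infinity>"
    by (subst suminf_ennreal2) (auto simp: summable_geometric)
  finally have "AE s in S. (\<Sum>n. ennreal (h n (J n) s)) \<noteq> \<infinity>"
    by (intro nn_integral_PInf_AE) (auto simp: less_top)
  then have "AE s in S. (\<lambda>n. h n (J n) s) \<longlonglongrightarrow> 0"
    by eventually_elim (use b in \<open>auto intro!: summable_LIMSEQ_zero summable_suminf_not_top\<close>)
  then show thesis by (rule that)
qed

text \<open>Two limits, from the indicator to continuous multipliers and from these products to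
  sampled steps, are merged by the diagonal choice. The errors are truncated at 1 to meet its
  hypotheses.\<close>

lemma step_approximation:
  fixes g :: "real \<Rightarrow> 'b::real_normed_vector"
  assumes T: "T > 0" and A: "A \<in> sets borel" and g: "regulated T g"
  obtains xs C where "\<And>n. steps_on T (xs n)" "\<And>n s. s \<in> {0..T} \<Longrightarrow> norm (step_fun (xs n) s) \<le> C"
    "AE s in leb T. (\<lambda>n. step_fun (xs n) s) \<longlonglongrightarrow> indicator A s *\<^sub>R g s"
proof -
  obtain C where C: "C > 0" "\<And>s. s \<in> {0..T} \<Longrightarrow> norm (g s) \<le> C" using regulated_bounded[OF g] by blast
  obtain c :: "nat \<Rightarrow> real \<Rightarrow> real" where c: "\<And>n. continuous_on UNIV (c n)" "\<And>n s. \<bar>c n s\<bar> \<le> 1"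
    "AE s in leb T. (\<lambda>n. c n s) \<longlonglongrightarrow> indicator A s"
    using indicator_limit_of_continuous[OF A] by blast
  define \<phi> where "\<phi> n s = c n s *\<^sub>R g s" for n s
  have \<phi>: "norm (\<phi> n s) \<le> C" if "s \<in> {0..T}" for n s
    using mult_mono[OF c(2)[of n s] C(2)[OF that]] C(1) by (simp add: \<phi>_def)
  have reg: "regulated T (\<phi> n)" for n
    unfolding \<phi>_def by (intro regulated_scaleR c g)
  define h where "h n j s = min 1 (norm (step_fun (sample_steps T j (\<phi> n)) s - \<phi> n s))" for n j s
  have "AE s in leb T. (\<lambda>j. h n j s) \<longlonglongrightarrow> 0" for n
  proof -
    obtain N where N: "countable N" "\<And>s. s \<in> {0..T} \<Longrightarrow> s \<notin> N \<Longrightarrow> (\<lambda>j. \<phi> n (rsample T j s)) \<longlonglongrightarrow> \<phi> n s"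
      using regulated_rsample[OF T, of "{()}" "\<lambda>_. \<phi> n"] reg by auto
    show ?thesis
    proof (rule AE_leb_if_countable[of "N \<union> (\<lambda>(i, j). T * of_int i / real (Suc j)) ` UNIV"])
      fix s assume s: "s \<in> {0..T}" "s \<notin> N \<union> (\<lambda>(i, j). T * of_int i / real (Suc j)) ` UNIV"
      then have "(\<lambda>j. h n j s) = (\<lambda>j. min 1 (norm (\<phi> n (rsample T j s) - \<phi> n s)))"
        unfolding h_def by (intro ext) (simp add: step_fun_sample_steps_rsample[OF T])
      moreover have "(\<lambda>j. min 1 (norm (\<phi> n (rsample T j s) - \<phi> n s))) \<longlonglongrightarrow> min 1 (norm (\<phi> n s - \<phi> n s))"
        using s N(2) by (intro tendsto_intros) auto
      ultimately show "(\<lambda>j. h n j s) \<longlonglongrightarrow> 0" by simp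
    qed (use N in auto)
  qed
  moreover have "h n j \<in> borel_measurable (leb T)" for n j
    unfolding h_def
    by (rule measurable_continuous_regulated[OF T regulated_diff[OF regulated_step_fun reg], of "\<lambda>x. min 1 (norm x)"])
      (intro continuous_intros)
  moreover have "0 \<le> h n j s \<and> h n j s \<le> 1" for n j s by (simp add: h_def)
  ultimately obtain J where J: "AE s in leb T. (\<lambda>n. h n (J n) s) \<longlonglongrightarrow> 0"
    using AE_diagonal_limit[OF finite_measure_leb, of h T] by blast
  show thesis
  proof (rule that[of "\<lambda>n. sample_steps T (J n) (\<phi> n)" C])
    show "steps_on T (sample_steps T (J n) (\<phi> n))" for n using T by (intro steps_on_sample_steps) auto
    show "norm (step_fun (sample_steps T (J n) (\<phi> n)) s) \<le> C" if "s \<in> {0..T}" for n s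
      by (rule step_fun_sample_steps_bound[OF T that \<phi>])
    show "AE s in leb T. (\<lambda>n. step_fun (sample_steps T (J n) (\<phi> n)) s) \<longlonglongrightarrow> indicator A s *\<^sub>R g s"
      using J c(3)
    proof eventually_elim
      case (elim s)
      \<comment> \<open>Below 1 the truncation in \<open>h\<close> has no effect, so the norms
        themselves tend to 0.\<close>
      have "eventually (\<lambda>n. h n (J n) s < 1) sequentially" using elim(1) by (rule order_tendstoD) simp
      then have "eventually (\<lambda>n. norm (step_fun (sample_steps T (J n) (\<phi> n)) s - \<phi> n s) = h n (J n) s) sequentially"
        by eventually_elim (auto simp: h_def min_def split: if_splits)
      then have "(\<lambda>n. norm (step_fun (sample_steps T (J n) (\<phi> n)) s - \<phi> n s)) \<longlonglongrightarrow> 0"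
        using elim(1) by (simp add: tendsto_cong)
      then have "(\<lambda>n. step_fun (sample_steps T (J n) (\<phi> n)) s - \<phi> n s) \<longlonglongrightarrow> 0" by (rule tendsto_norm_zero_cancel)
      moreover have "(\<lambda>n. \<phi> n s) \<longlonglongrightarrow> indicator A s *\<^sub>R g s"
        unfolding \<phi>_def by (intro tendsto_intros elim)
      ultimately have "(\<lambda>n. (step_fun (sample_steps T (J n) (\<phi> n)) s - \<phi> n s) + \<phi> n s) \<longlonglongrightarrow> 0 + indicator A s *\<^sub>R g s"
        by (rule tendsto_add)
      then show ?case by simp
    qed
  qed
qed

context cyl_levy
begin

text \<open>The integral of a bounded almost everywhere limit of step functions, in one limiting step
  instead of the two of \<open>has_cyl_integral\<close>.\<close>

definition step_limit_int :: "real \<Rightarrow> (real \<Rightarrow> 'u \<Rightarrow>\<^sub>L real) \<Rightarrow> ('w \<Rightarrow> real) \<Rightarrow> bool" where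
  "step_limit_int T h X \<longleftrightarrow> X \<in> borel_measurable M \<and>
    (\<exists>xs C. (\<forall>n. steps_on T (xs n)) \<and> (\<forall>n. \<forall>s\<in>{0..T}. norm (step_fun (xs n) s) \<le> C) \<and>
      (AE s in leb T. (\<lambda>n. step_fun (xs n) s) \<longlonglongrightarrow> h s) \<and>
      tendsto_prob M (\<lambda>n. step_int L (xs n)) X sequentially)"

lemma step_limit_int_measurable: "step_limit_int T h X \<Longrightarrow> X \<in> borel_measurable M"
  by (simp add: step_limit_int_def)

lemma step_int_lincomb:
  assumes "steps_on T xs" "steps_on T ys"
  shows "AE \<omega> in M. step_int L (xs @ step_scale c ys) \<omega> = step_int L xs \<omega> + c * step_int L ys \<omega>"
  using step_int_scale[OF assms(2), of c] by eventually_elim simp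

lemma step_limit_int_lincomb:
  assumes "step_limit_int T h X" "step_limit_int T h' X'"
  shows "step_limit_int T (\<lambda>s. h s + c *\<^sub>R h' s) (\<lambda>\<omega>. X \<omega> + c * X' \<omega>)"
proof -
  from assms(1) obtain xs C where xs: "\<And>n. steps_on T (xs n)" "\<And>n s. s \<in> {0..T} \<Longrightarrow> norm (step_fun (xs n) s) \<le> C"
      "AE s in leb T. (\<lambda>n. step_fun (xs n) s) \<longlonglongrightarrow> h s"
      "tendsto_prob M (\<lambda>n. step_int L (xs n)) X sequentially" and [measurable]: "X \<in> borel_measurable M"
    unfolding step_limit_int_def by blast
  from assms(2) obtain xs' C' where xs': "\<And>n. steps_on T (xs' n)" "\<And>n s. s \<in> {0..T} \<Longrightarrow> norm (step_fun (xs' n) s) \<le> C'"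
      "AE s in leb T. (\<lambda>n. step_fun (xs' n) s) \<longlonglongrightarrow> h' s"
      "tendsto_prob M (\<lambda>n. step_int L (xs' n)) X' sequentially" and [measurable]: "X' \<in> borel_measurable M"
    unfolding step_limit_int_def by blast
  have m: "steps_on T (xs n @ step_scale c (xs' n))" for n using xs(1) xs'(1) by simp
  note [measurable] = step_int_measurable[OF xs(1)] step_int_measurable[OF xs'(1)] step_int_measurable[OF m]
  have "tendsto_prob M (\<lambda>n \<omega>. step_int L (xs n) \<omega> + c * step_int L (xs' n) \<omega>) (\<lambda>\<omega>. X \<omega> + c * X' \<omega>) sequentially"
    by (intro tendsto_prob_add tendsto_prob_cmult xs xs') measurable
  moreover have "AE \<omega> in M. step_int L (xs n @ step_scale c (xs' n)) \<omega> - (X \<omega> + c * X' \<omega>)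
      = step_int L (xs n) \<omega> + c * step_int L (xs' n) \<omega> - (X \<omega> + c * X' \<omega>)" for n
    using step_int_lincomb[OF xs(1) xs'(1), of n c n] by eventually_elim simp
  ultimately have "tendsto_prob M (\<lambda>n. step_int L (xs n @ step_scale c (xs' n))) (\<lambda>\<omega>. X \<omega> + c * X' \<omega>) sequentially"
    by (subst tendsto_prob_AE_cong) simp_all
  moreover have "AE s in leb T. (\<lambda>n. step_fun (xs n @ step_scale c (xs' n)) s) \<longlonglongrightarrow> h s + c *\<^sub>R h' s"
    using xs(3) xs'(3) by eventually_elim (simp, intro tendsto_intros)
  moreover have "norm (step_fun (xs n @ step_scale c (xs' n)) s) \<le> C + \<bar>c\<bar> * C'" if "s \<in> {0..T}" for n s
    using xs(2)[OF that, of n] mult_left_mono[OF xs'(2)[OF that, of n], of "\<bar>c\<bar>"]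
    by (simp add: norm_triangle_le)
  ultimately show ?thesis using m unfolding step_limit_int_def
    by (intro conjI exI[of _ "\<lambda>n. xs n @ step_scale c (xs' n)"] exI[of _ "C + \<bar>c\<bar> * C'"]) auto
qed

lemma step_limit_int_char:
  assumes T: "T \<ge> 0" and X: "step_limit_int T h X" and m: "(\<lambda>s. \<Psi> (h s)) \<in> borel_measurable (leb T)"
  shows "(LINT \<omega>|M. iexp (X \<omega>)) = exp (LINT s|leb T. \<Psi> (h s))"
proof -
  from X obtain xs C where xs: "\<And>n. steps_on T (xs n)" "\<And>n s. s \<in> {0..T} \<Longrightarrow> norm (step_fun (xs n) s) \<le> C"
      "AE s in leb T. (\<lambda>n. step_fun (xs n) s) \<longlonglongrightarrow> h s"
      "tendsto_prob M (\<lambda>n. step_int L (xs n)) X sequentially" and [measurable]: "X \<in> borel_measurable M"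
    unfolding step_limit_int_def by blast
  have "(\<lambda>n. LINT \<omega>|M. iexp (step_int L (xs n) \<omega>)) \<longlonglongrightarrow> (LINT \<omega>|M. iexp (X \<omega>))"
    by (rule tendsto_prob_iexp[OF step_int_measurable[OF xs(1)] _ xs(4)]) simp
  moreover have "(\<lambda>n. exp (LINT s|leb T. \<Psi> (step_fun (xs n) s))) \<longlonglongrightarrow> exp (LINT s|leb T. \<Psi> (h s))"
    by (intro tendsto_exp \<Psi>_integral_tendsto[where C=C] step_fun_char(2)[OF xs(1) T] m xs)
  ultimately show ?thesis
    by (simp add: step_fun_char(1)[OF xs(1) T] LIMSEQ_unique)
qed

text \<open>The differences of late approximations are bounded and tend to 0 almost everywhere.
  Their characteristic functions tend to \<open>exp 0 = 1\<close> at each \<open>t\<close>, so the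
  integrals form a Cauchy sequence in probability.\<close>

lemma step_limit_int_exists:
  assumes T: "T \<ge> 0" and xs: "\<And>n. steps_on T (xs n)" "\<And>n s. s \<in> {0..T} \<Longrightarrow> norm (step_fun (xs n) s) \<le> C"
      "AE s in leb T. (\<lambda>n. step_fun (xs n) s) \<longlonglongrightarrow> h s"
  obtains X where "step_limit_int T h X"
proof -
  note [measurable] = step_int_measurable[OF xs(1)]
  have cauchy: "tendsto_prob M (\<lambda>i \<omega>. step_int L (xs (p i)) \<omega> - step_int L (xs (q i)) \<omega>) (\<lambda>_. 0) sequentially"
    if p: "\<And>i::nat. p i \<ge> i" and q: "\<And>i. q i \<ge> i" for p q
  proof (rule tendsto_prob_zero_if_char)
    fix t :: real
    let ?ys = "\<lambda>i. step_scale t (xs (p i) @ step_scale (-1) (xs (q i)))"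
    have ys: "steps_on T (?ys i)" for i using xs(1) by simp
    note [measurable] = step_int_measurable[OF ys]
    have pq: "filterlim p at_top sequentially" "filterlim q at_top sequentially"
      using p q by (auto intro: filterlim_at_top_mono[OF filterlim_ident])
    have "(LINT \<omega>|M. iexp (t * (step_int L (xs (p i)) \<omega> - step_int L (xs (q i)) \<omega>))) = exp (LINT s|leb T. \<Psi> (step_fun (?ys i) s))" for i
    proof -
      have "(LINT \<omega>|M. iexp (t * (step_int L (xs (p i)) \<omega> - step_int L (xs (q i)) \<omega>))) = (LINT \<omega>|M. iexp (step_int L (?ys i) \<omega>))"
      proof (rule integral_cong_AE)
        show "AE \<omega> in M. iexp (t * (step_int L (xs (p i)) \<omega> - step_int L (xs (q i)) \<omega>)) = iexp (step_int L (?ys i) \<omega>)"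
          using step_int_scale[of T "xs (p i) @ step_scale (-1) (xs (q i))" t] step_int_lincomb[OF xs(1) xs(1), of "p i" "-1" "q i"] xs(1)
          by (auto elim: eventually_elim2)
      qed measurable
      then show ?thesis using step_fun_char(1)[OF ys T] by simp
    qed
    moreover have "(\<lambda>i. exp (LINT s|leb T. \<Psi> (step_fun (?ys i) s))) \<longlonglongrightarrow> exp (LINT s|leb T. \<Psi> 0)"
    proof (intro tendsto_exp \<Psi>_integral_tendsto[where C="\<bar>t\<bar> * (C + C)"] step_fun_char(2)[OF ys T])
      show "norm (step_fun (?ys i) s) \<le> \<bar>t\<bar> * (C + C)" if "s \<in> {0..T}" for i s
        using xs(2)[OF that, of "p i"] xs(2)[OF that, of "q i"] norm_triangle_ineq4[of "step_fun (xs (p i)) s" "step_fun (xs (q i)) s"]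
        by (auto intro!: mult_left_mono)
      show "AE s in leb T. (\<lambda>i. step_fun (?ys i) s) \<longlonglongrightarrow> 0"
        using xs(3)
      proof eventually_elim
        case (elim s)
        have "(\<lambda>i. t *\<^sub>R (step_fun (xs (p i)) s + (-1) *\<^sub>R step_fun (xs (q i)) s)) \<longlonglongrightarrow> t *\<^sub>R (h s + (-1) *\<^sub>R h s)"
          by (intro tendsto_intros filterlim_compose[OF elim pq(1)] filterlim_compose[OF elim pq(2)])
        then show ?case by simp
      qed
    qed simp
    ultimately show "(\<lambda>i. LINT \<omega>|M. iexp (t * (step_int L (xs (p i)) \<omega> - step_int L (xs (q i)) \<omega>))) \<longlonglongrightarrow> 1"
      by simp
  qed measurable
  obtain X where "X \<in> borel_measurable M" "tendsto_prob M (\<lambda>n. step_int L (xs n)) X sequentially"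
    by (rule tendsto_prob_complete[of "\<lambda>n. step_int L (xs n)"]) (use cauchy in auto)
  with xs have "step_limit_int T h X" unfolding step_limit_int_def by blast
  then show thesis by (rule that)
qed

lemma step_limit_int_AE_cong:
  assumes X: "step_limit_int T h X" and [measurable]: "Y \<in> borel_measurable M" and eq: "AE \<omega> in M. X \<omega> = Y \<omega>"
  shows "step_limit_int T h Y"
proof -
  have [measurable]: "X \<in> borel_measurable M" using X by (rule step_limit_int_measurable)
  from X obtain xs C where xs: "\<And>n. steps_on T (xs n)" "\<And>n s. s \<in> {0..T} \<Longrightarrow> norm (step_fun (xs n) s) \<le> C"
      "AE s in leb T. (\<lambda>n. step_fun (xs n) s) \<longlonglongrightarrow> h s"
      "tendsto_prob M (\<lambda>n. step_int L (xs n)) X sequentially"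
    unfolding step_limit_int_def by blast
  note [measurable] = step_int_measurable[OF xs(1)]
  have "AE \<omega> in M. step_int L (xs n) \<omega> - X \<omega> = step_int L (xs n) \<omega> - Y \<omega>" for n
    using eq by eventually_elim simp
  then have "tendsto_prob M (\<lambda>n. step_int L (xs n)) Y sequentially"
    using xs(4) by (subst (asm) tendsto_prob_AE_cong) simp_all
  then show ?thesis using xs unfolding step_limit_int_def by (intro conjI exI[of _ xs] exI[of _ C]) auto
qed

lemma has_J_step_int:
  assumes T: "T \<ge> 0" and xs: "steps_on T xs"
  shows "has_J M L T (step_fun xs) (step_int L xs)"
proof -
  obtain m t y where *: "simple_on T (step_fun xs) m t y" "AE \<omega> in M. step_int L xs \<omega> = simple_integral_wrt L m t y \<omega>"
    using step_fun_simple[OF xs T] by blast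
  note [measurable] = step_int_measurable[OF xs] simple_integral_measurable[OF *(1)]
  have "tendsto_prob M (\<lambda>n::nat. step_int L xs) (step_int L xs) sequentially"
    unfolding tendsto_prob_def by simp
  moreover have "AE \<omega> in M. simple_integral_wrt L m t y \<omega> - step_int L xs \<omega> = step_int L xs \<omega> - step_int L xs \<omega>"
    using *(2) by eventually_elim simp
  ultimately have "tendsto_prob M (\<lambda>n::nat. simple_integral_wrt L m t y) (step_int L xs) sequentially"
    by (subst tendsto_prob_AE_cong) simp_all
  moreover have "uniform_limit {0..T} (\<lambda>n::nat. step_fun xs) (step_fun xs) sequentially"
    by (auto simp: uniform_limit_iff)
  ultimately show ?thesis
    unfolding has_J_def using *(1) regulated_step_fun[of T xs]
    by (intro conjI exI[of _ "\<lambda>_. step_fun xs"] exI[of _ "\<lambda>_. m"] exI[of _ "\<lambda>_. t"] exI[of _ "\<lambda>_. y"]) auto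
qed

lemma has_cyl_integral_if_step_limit_int:
  assumes T: "T \<ge> 0" and X: "step_limit_int T h X"
  shows "has_cyl_integral M L T h X"
proof -
  from X obtain xs C where xs: "\<And>n. steps_on T (xs n)" "\<And>n s. s \<in> {0..T} \<Longrightarrow> norm (step_fun (xs n) s) \<le> C"
      "AE s in leb T. (\<lambda>n. step_fun (xs n) s) \<longlonglongrightarrow> h s"
      "tendsto_prob M (\<lambda>n. step_int L (xs n)) X sequentially" and "X \<in> borel_measurable M"
    unfolding step_limit_int_def by blast
  then show ?thesis unfolding has_cyl_integral_def AE_leb_iff
    by (intro conjI exI[of _ "\<lambda>n. step_fun (xs n)"] exI[of _ "\<lambda>n. step_int L (xs n)"] exI[of _ C])
      (auto intro: has_J_step_int[OF T])
qed

lemma has_J_char: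
  assumes T: "T > 0" and J: "has_J M L T g X"
  shows "(LINT \<omega>|M. iexp (X \<omega>)) = exp (LINT s|leb T. \<Psi> (g s))"
proof -
  from J obtain G m t x where g: "regulated T g" and [measurable]: "X \<in> borel_measurable M"
    and G: "\<And>n. simple_on T (G n) (m n) (t n) (x n)" and lim: "uniform_limit {0..T} G g sequentially"
    and X: "tendsto_prob M (\<lambda>n. simple_integral_wrt L (m n) (t n) (x n)) X sequentially"
    unfolding has_J_def by blast
  obtain C where C: "\<And>s. s \<in> {0..T} \<Longrightarrow> norm (g s) \<le> C" using regulated_bounded[OF g] by blast
  have "eventually (\<lambda>n. \<forall>s\<in>{0..T}. dist (G n s) (g s) < 1) sequentially"
    using lim unfolding uniform_limit_iff by simp
  \<comment> \<open>Uniform convergence bounds the approximations from index \<open>N\<close> on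
    only; the shift by \<open>N\<close> provides one dominating constant.\<close>
  then obtain N where N: "\<And>n s. n \<ge> N \<Longrightarrow> s \<in> {0..T} \<Longrightarrow> dist (G n s) (g s) < 1"
    unfolding eventually_sequentially by blast
  have "(\<lambda>n. LINT \<omega>|M. iexp (simple_integral_wrt L (m n) (t n) (x n) \<omega>)) \<longlonglongrightarrow> (LINT \<omega>|M. iexp (X \<omega>))"
    by (rule tendsto_prob_iexp[OF simple_integral_measurable[OF G] _ X]) simp
  then have "(\<lambda>n. exp (LINT s|leb T. \<Psi> (G n s))) \<longlonglongrightarrow> (LINT \<omega>|M. iexp (X \<omega>))"
    by (simp add: simple_on_char[OF G])
  then have "(\<lambda>n. exp (LINT s|leb T. \<Psi> (G (n + N) s))) \<longlonglongrightarrow> (LINT \<omega>|M. iexp (X \<omega>))"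
    by (rule LIMSEQ_ignore_initial_segment)
  moreover have "(\<lambda>n. exp (LINT s|leb T. \<Psi> (G (n + N) s))) \<longlonglongrightarrow> exp (LINT s|leb T. \<Psi> (g s))"
  proof (intro tendsto_exp \<Psi>_integral_tendsto[where C="C + 1"] simple_on_integral(1)[OF G]
      measurable_continuous_regulated[OF T g continuous_\<Psi>])
    show "norm (G (n + N) s) \<le> C + 1" if "s \<in> {0..T}" for n s
      using C[OF that] N[OF _ that, of "n + N"] norm_triangle_sub[of "G (n + N) s" "g s"] by (simp add: dist_norm)
    show "AE s in leb T. (\<lambda>n. G (n + N) s) \<longlonglongrightarrow> g s"
      by (rule AE_I2) (use tendsto_uniform_limitI[OF lim] in \<open>auto intro!: LIMSEQ_ignore_initial_segment simp: space_restrict_space\<close>)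
  qed
  ultimately show ?thesis by (rule LIMSEQ_unique)
qed

text \<open>Fixes the law of every version of the cylindrical integral, as required when an integral
  is given and its approximating sequence is arbitrary.\<close>

lemma has_cyl_integral_char:
  assumes T: "T > 0" and X: "has_cyl_integral M L T h X" and m: "(\<lambda>s. \<Psi> (h s)) \<in> borel_measurable (leb T)"
  shows "(LINT \<omega>|M. iexp (X \<omega>)) = exp (LINT s|leb T. \<Psi> (h s))"
proof -
  from X obtain G Y C where [measurable]: "X \<in> borel_measurable M" and G: "\<And>n. has_J M L T (G n) (Y n)"
    "\<And>n s. s \<in> {0..T} \<Longrightarrow> norm (G n s) \<le> C" "AE s in leb T. (\<lambda>n. G n s) \<longlonglongrightarrow> h s"
    "tendsto_prob M Y X sequentially"
    unfolding has_cyl_integral_def AE_leb_iff by blast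
  have reg: "regulated T (G n)" and Y: "Y n \<in> borel_measurable M" for n
    using G(1)[of n] unfolding has_J_def by auto
  have "(\<lambda>n. LINT \<omega>|M. iexp (Y n \<omega>)) \<longlonglongrightarrow> (LINT \<omega>|M. iexp (X \<omega>))"
    by (rule tendsto_prob_iexp[OF Y _ G(4)]) simp
  moreover have "(\<lambda>n. exp (LINT s|leb T. \<Psi> (G n s))) \<longlonglongrightarrow> exp (LINT s|leb T. \<Psi> (h s))"
    by (intro tendsto_exp \<Psi>_integral_tendsto[where C=C] measurable_continuous_regulated[OF T reg continuous_\<Psi>] m G)
  ultimately show ?thesis by (simp add: has_J_char[OF T G(1)] LIMSEQ_unique)
qed

end

section \<open>Gaussian means of the symbol\<close>

lemma gauss_mean_component:
  assumes I: "finite I" and kl: "k \<in> I" "l \<in> I"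
  shows "integrable (gauss I) (\<lambda>g. g k * g l)" "(LINT g|gauss I. g k * g l) = (if k = l then 1 else 0)"
proof -
  interpret product_sigma_finite "\<lambda>_::nat. std_normal_distribution" by (rule product_sigma_finite_gauss)
  interpret N: prob_space std_normal_distribution by (rule prob_space_std_normal)
  \<comment> \<open>Writes \<open>g k * g l\<close> as a product over all coordinates, also for
    \<open>k = l\<close>, where both factors fall on the same coordinate.\<close>
  define f where "f i t = (if i = k then t else 1) * (if i = l then t else 1 :: real)" for i :: nat and t
  have f: "(\<Prod>i\<in>I. f i (g i)) = g k * g l" for g
    using I kl by (simp add: f_def prod.distrib prod.delta)
  have sq: "integrable std_normal_distribution (\<lambda>t. t * t)" "(LINT t|std_normal_distribution. t * t) = 1"
    using std_normal_distribution_even_moments[of 1] by (simp_all add: power2_eq_square)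
  have lin: "integrable std_normal_distribution (\<lambda>t. t)" "(LINT t|std_normal_distribution. t) = 0"
    using integrable_std_normal_distribution_moment[of 1] integral_std_normal_distribution_moment_odd[of 1] by simp_all
  have int: "integrable std_normal_distribution (f i)" for i
    unfolding f_def using sq(1) lin(1) by (cases "i = k"; cases "i = l") simp_all
  show "integrable (gauss I) (\<lambda>g. g k * g l)"
    using product_integrable_prod[OF I, of f, OF int] by (simp add: f)
  have "(LINT g|gauss I. g k * g l) = (\<Prod>i\<in>I. LINT t|std_normal_distribution. f i t)"
    using product_integral_prod[OF I, of f, OF int] by (simp add: f)
  also have "\<dots> = (if k = l then 1 else 0)"
  proof (cases "k = l")
    case True
    then have "(LINT t|std_normal_distribution. f i t) = 1" for i
      using sq by (cases "i = k") (simp_all add: f_def N.prob_space[simplified])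
    then show ?thesis using True by simp
  next
    case False
    then have "(LINT t|std_normal_distribution. f k t) = 0" using lin by (simp add: f_def)
    then show ?thesis using False I kl by (auto simp: prod_zero_iff)
  qed
  finally show "(LINT g|gauss I. g k * g l) = (if k = l then 1 else 0)" .
qed

section \<open>Integration with respect to a cylindrical measure\<close>

lemma cylinder_sets_mono: "\<Gamma> \<subseteq> \<Gamma>' \<Longrightarrow> cylinder_sets \<Gamma> \<subseteq> cylinder_sets \<Gamma>'"
  unfolding cylinder_sets_def by blast

lemma space_cyl_restr [simp]: "space (cyl_restr \<mu> \<Gamma>) = UNIV"
  by (simp add: cyl_restr_def)

lemma sets_cyl_restr: "sets (cyl_restr \<mu> \<Gamma>) = sigma_sets UNIV (cylinder_sets \<Gamma>)"
  by (simp add: cyl_restr_def)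

lemma sets_cyl_restr_mono: "\<Gamma> \<subseteq> \<Gamma>' \<Longrightarrow> sets (cyl_restr \<mu> \<Gamma>) \<subseteq> sets (cyl_restr \<mu> \<Gamma>')"
  unfolding sets_cyl_restr by (rule sigma_sets_mono') (rule cylinder_sets_mono)

lemma measurable_cyl_restr:
  assumes "x \<in> \<Gamma>"
  shows "blinfun_apply x \<in> borel_measurable (cyl_restr \<mu> \<Gamma>)"
proof (rule measurableI)
  fix B :: "real set" assume B: "B \<in> sets borel"
  let ?C = "{v \<in> space (Pi\<^sub>M {..<1::nat} (\<lambda>_. borel)). v 0 \<in> B}"
  have "(\<lambda>v. v 0) \<in> borel_measurable (Pi\<^sub>M {..<1::nat} (\<lambda>_. borel :: real measure))"
    by (rule measurable_component_singleton) simp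
  from measurable_sets[OF this B]
  have "(\<lambda>v. v 0) -` B \<inter> space (Pi\<^sub>M {..<1::nat} (\<lambda>_. borel)) \<in> sets (Pi\<^sub>M {..<1::nat} (\<lambda>_. borel))" .
  also have "(\<lambda>v. v 0) -` B \<inter> space (Pi\<^sub>M {..<1::nat} (\<lambda>_. borel)) = ?C" by auto
  finally have C: "?C \<in> sets (Pi\<^sub>M {..<1::nat} (\<lambda>_. borel))" .
  have "{u. (\<lambda>i\<in>{..<1::nat}. blinfun_apply x u) \<in> ?C} \<in> cylinder_sets \<Gamma>"
    unfolding cylinder_sets_def using C assms by (intro CollectI exI[of _ "1::nat"] exI[of _ "\<lambda>_. x"] exI[of _ ?C]) auto
  moreover have "{u. (\<lambda>i\<in>{..<1::nat}. blinfun_apply x u) \<in> ?C} = blinfun_apply x -` B \<inter> space (cyl_restr \<mu> \<Gamma>)"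
    by (auto simp: space_PiM)
  ultimately show "blinfun_apply x -` B \<inter> space (cyl_restr \<mu> \<Gamma>) \<in> sets (cyl_restr \<mu> \<Gamma>)"
    unfolding sets_cyl_restr by (metis sigma_sets.Basic)
qed simp

lemma emeasure_cyl_restr:
  assumes "cylindrical_measure \<mu>" "finite \<Gamma>" "C \<in> sets (cyl_restr \<mu> \<Gamma>)"
  shows "emeasure (cyl_restr \<mu> \<Gamma>) C = \<mu> C"
  using assms unfolding cylindrical_measure_def sets_cyl_restr
  by (simp add: cyl_restr_def emeasure_measure_of_conv)

text \<open>Consistency of the family of restrictions. It allows integrals for several functionals
  to be moved to one finite set containing them all, where they can be added and compared.\<close>

lemma cyl_restr_subalgebra:
  assumes "cylindrical_measure \<mu>" "finite \<Gamma>'" "\<Gamma> \<subseteq> \<Gamma>'"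
  shows "sets (cyl_restr \<mu> \<Gamma>) \<subseteq> sets (cyl_restr \<mu> \<Gamma>')" "space (cyl_restr \<mu> \<Gamma>) = space (cyl_restr \<mu> \<Gamma>')"
    "\<And>A. A \<in> sets (cyl_restr \<mu> \<Gamma>) \<Longrightarrow> emeasure (cyl_restr \<mu> \<Gamma>) A = emeasure (cyl_restr \<mu> \<Gamma>') A"
  using assms sets_cyl_restr_mono[OF assms(3), of \<mu>] finite_subset[OF assms(3,2)]
  by (auto simp: emeasure_cyl_restr subset_iff)

lemma nn_integral_cyl_restr_mono:
  assumes "cylindrical_measure \<mu>" "finite \<Gamma>'" "\<Gamma> \<subseteq> \<Gamma>'" "f \<in> borel_measurable (cyl_restr \<mu> \<Gamma>)"
  shows "(\<integral>\<^sup>+u. f u \<partial>cyl_restr \<mu> \<Gamma>) = (\<integral>\<^sup>+u. f u \<partial>cyl_restr \<mu> \<Gamma>')"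
  by (intro nn_integral_subalgebra cyl_restr_subalgebra assms)

lemma integral_cyl_restr_mono:
  fixes f :: "_ \<Rightarrow> 'c::{banach, second_countable_topology}"
  assumes "cylindrical_measure \<mu>" "finite \<Gamma>'" "\<Gamma> \<subseteq> \<Gamma>'" "f \<in> borel_measurable (cyl_restr \<mu> \<Gamma>)"
  shows "(LINT u|cyl_restr \<mu> \<Gamma>. f u) = (LINT u|cyl_restr \<mu> \<Gamma>'. f u)"
  by (intro integral_subalgebra cyl_restr_subalgebra assms)

text \<open>The imaginary part of the Levy--Khintchine integrand.\<close>

definition trunc_err :: "real \<Rightarrow> real" where
  "trunc_err \<beta> = sin \<beta> - \<beta> * indicator {-1..1} \<beta>"

lemma cmod_levy_integrand_le:
  "cmod (iexp \<beta> - 1 - \<i> * complex_of_real \<beta> * indicator {-1..1} \<beta>) \<le> 2 * min (\<beta>\<^sup>2) 1"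
proof (cases "\<beta> \<in> {-1..1}")
  case True
  then have "\<beta>\<^sup>2 \<le> 1" by (simp add: abs_square_le_1 abs_le_iff)
  moreover have "cmod (iexp \<beta> - 1 - \<i> * complex_of_real \<beta>) \<le> \<beta>\<^sup>2 / 2"
    using iexp_approx1[of \<beta> 1] by (simp add: numeral_2_eq_2 diff_diff_eq)
  ultimately have "cmod (iexp \<beta> - 1 - \<i> * complex_of_real \<beta>) \<le> 2 * min (\<beta>\<^sup>2) 1"
    using zero_le_power2[of \<beta>] by linarith
  then show ?thesis using True by simp
next
  case False
  then have "1 < \<bar>\<beta>\<bar>" by auto
  then have "1 \<le> \<beta>\<^sup>2" using one_le_power[of "\<bar>\<beta>\<bar>" 2] by simp
  then show ?thesis using False cmod_iexp_diff_le2[of \<beta> 0] by simp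
qed

context cyl_levy
begin

lemma mu_cyl: "cylindrical_measure \<mu>"
  and mu_levy: "(\<integral>\<^sup>+ u. ennreal (min ((blinfun_apply x u)\<^sup>2) 1) \<partial>cyl_restr \<mu> {x}) < \<infinity>"
  using char by (auto simp: has_characteristics_def cylindrical_levy_measure_def)

lemma Q_nonneg: "0 \<le> blinfun_apply (blinfun_apply Q x) x"
  using char by (auto simp: has_characteristics_def)

lemma nn_integral_min_finite:
  assumes "finite \<Gamma>" "x \<in> \<Gamma>"
  shows "(\<integral>\<^sup>+ u. ennreal (min ((blinfun_apply x u)\<^sup>2) 1) \<partial>cyl_restr \<mu> \<Gamma>) < \<infinity>"
proof -
  have [measurable]: "blinfun_apply x \<in> borel_measurable (cyl_restr \<mu> {x})" by (rule measurable_cyl_restr) simp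
  have "(\<lambda>u. ennreal (min ((blinfun_apply x u)\<^sup>2) 1)) \<in> borel_measurable (cyl_restr \<mu> {x})" by measurable
  from nn_integral_cyl_restr_mono[OF mu_cyl assms(1) _ this] show ?thesis using mu_levy[of x] assms by simp
qed

lemma integrable_min:
  assumes "finite \<Gamma>" "x \<in> \<Gamma>"
  shows "integrable (cyl_restr \<mu> \<Gamma>) (\<lambda>u. min ((blinfun_apply x u)\<^sup>2) 1)"
proof -
  have [measurable]: "blinfun_apply x \<in> borel_measurable (cyl_restr \<mu> \<Gamma>)" using assms by (intro measurable_cyl_restr)
  show ?thesis by (rule integrableI_nonneg) (use nn_integral_min_finite[OF assms] in auto)
qed

text \<open>The symbol at \<open>x\<close> is defined over the \<sigma>-algebra of \<open>x\<close>
  alone. Here it is represented over any finite set containing \<open>x\<close>, so that different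
  functionals share one measure.\<close>

lemma \<Psi>_integral:
  assumes \<Gamma>: "finite \<Gamma>" "x \<in> \<Gamma>"
  shows "integrable (cyl_restr \<mu> \<Gamma>) (\<lambda>u. 1 - cos (blinfun_apply x u))"
    and "kexp x = blinfun_apply (blinfun_apply Q x) x / 2 + (LINT u|cyl_restr \<mu> \<Gamma>. 1 - cos (blinfun_apply x u))"
    and "integrable (cyl_restr \<mu> \<Gamma>) (\<lambda>u. trunc_err (blinfun_apply x u))"
    and "Im (\<Psi> x) = a x + (LINT u|cyl_restr \<mu> \<Gamma>. trunc_err (blinfun_apply x u))"
proof -
  let ?f = "\<lambda>u. iexp (blinfun_apply x u) - 1 - \<i> * complex_of_real (blinfun_apply x u) * indicator {-1..1} (blinfun_apply x u)"
  have meas: "?f \<in> borel_measurable (cyl_restr \<mu> \<Gamma>')" if "x \<in> \<Gamma>'" for \<Gamma>'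
  proof -
    have [measurable]: "blinfun_apply x \<in> borel_measurable (cyl_restr \<mu> \<Gamma>')" using that by (rule measurable_cyl_restr)
    show ?thesis by measurable
  qed
  have int: "integrable (cyl_restr \<mu> \<Gamma>) ?f"
  proof (rule Bochner_Integration.integrable_bound)
    show "integrable (cyl_restr \<mu> \<Gamma>) (\<lambda>u. 2 * min ((blinfun_apply x u)\<^sup>2) 1)"
      using integrable_min[OF \<Gamma>] by simp
    show "AE u in cyl_restr \<mu> \<Gamma>. norm (?f u) \<le> norm (2 * min ((blinfun_apply x u)\<^sup>2) 1)"
      by (rule AE_I2, rule order_trans[OF cmod_levy_integrand_le]) simp
  qed (rule meas[OF \<Gamma>(2)])
  have eq: "(LINT u|cyl_restr \<mu> {x}. ?f u) = (LINT u|cyl_restr \<mu> \<Gamma>. ?f u)"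
    using \<Gamma> by (intro integral_cyl_restr_mono mu_cyl meas) auto
  have re: "Re (?f u) = - (1 - cos (blinfun_apply x u))" and im: "Im (?f u) = trunc_err (blinfun_apply x u)" for u
    by (simp_all add: trunc_err_def indicator_def cis_conv_exp[symmetric])
  have "integrable (cyl_restr \<mu> \<Gamma>) (\<lambda>u. Re (?f u))" using int by (rule integrable_Re)
  then have i: "integrable (cyl_restr \<mu> \<Gamma>) (\<lambda>u. - (1 - cos (blinfun_apply x u)))" unfolding re .
  then show i1: "integrable (cyl_restr \<mu> \<Gamma>) (\<lambda>u. 1 - cos (blinfun_apply x u))"
    using integrable_minus[OF i] by simp
  have "integrable (cyl_restr \<mu> \<Gamma>) (\<lambda>u. Im (?f u))" using int by (rule integrable_Im)
  then show "integrable (cyl_restr \<mu> \<Gamma>) (\<lambda>u. trunc_err (blinfun_apply x u))" unfolding im .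
  have "Re (LINT u|cyl_restr \<mu> \<Gamma>. ?f u) = (LINT u|cyl_restr \<mu> \<Gamma>. - (1 - cos (blinfun_apply x u)))"
    using integral_Re[OF int] unfolding re by simp
  then show "kexp x = blinfun_apply (blinfun_apply Q x) x / 2 + (LINT u|cyl_restr \<mu> \<Gamma>. 1 - cos (blinfun_apply x u))"
    using integral_minus[of "cyl_restr \<mu> \<Gamma>" "\<lambda>u. 1 - cos (blinfun_apply x u)"]
    unfolding kexp_def levy_symbol_def eq by simp
  have "Im (LINT u|cyl_restr \<mu> \<Gamma>. ?f u) = (LINT u|cyl_restr \<mu> \<Gamma>. trunc_err (blinfun_apply x u))"
    using integral_Im[OF int] unfolding im by simp
  then show "Im (\<Psi> x) = a x + (LINT u|cyl_restr \<mu> \<Gamma>. trunc_err (blinfun_apply x u))"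
    unfolding levy_symbol_def eq by simp
qed

lemma ennreal_kexp:
  assumes \<Gamma>: "finite \<Gamma>" "x \<in> \<Gamma>"
  shows "ennreal (kexp x) = ennreal (blinfun_apply (blinfun_apply Q x) x / 2) + (\<integral>\<^sup>+u. ennreal (1 - cos (blinfun_apply x u)) \<partial>cyl_restr \<mu> \<Gamma>)"
  unfolding \<Psi>_integral(2)[OF \<Gamma>]
  by (subst ennreal_plus)
    (auto simp: Q_nonneg nn_integral_eq_integral[OF \<Psi>_integral(1)[OF \<Gamma>]] intro!: integral_nonneg_AE)

text \<open>The cylindrical measure may have infinite, not \<open>\<sigma>\<close>-finite mass on the joint kernel of the
  functionals, where all integrands below vanish.\<close>

lemma sigma_finite_off_kernel:
  fixes x :: "nat \<Rightarrow> 'u \<Rightarrow>\<^sub>L real"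
  assumes I: "finite I"
  defines "Z \<equiv> {u. \<exists>k\<in>I. blinfun_apply (x k) u \<noteq> 0}"
  shows "sigma_finite_measure (density (cyl_restr \<mu> (x ` I)) (indicator Z))"
    and "Z \<in> sets (cyl_restr \<mu> (x ` I))"
proof -
  let ?N = "cyl_restr \<mu> (x ` I)"
  have m[measurable]: "blinfun_apply (x k) \<in> borel_measurable ?N" if "k \<in> I" for k
    using that by (intro measurable_cyl_restr) auto
  have mk: "{u. c < \<bar>blinfun_apply (x k) u\<bar>} \<in> sets ?N" if "k \<in> I" for k and c :: real
  proof -
    note [measurable] = m[OF that]
    have "{u \<in> space ?N. c < \<bar>blinfun_apply (x k) u\<bar>} \<in> sets ?N" by measurable
    then show ?thesis by simp
  qed
  have "Z = (\<Union>k\<in>I. {u. 0 < \<bar>blinfun_apply (x k) u\<bar>})" by (auto simp: Z_def)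
  also have "\<dots> \<in> sets ?N" using I mk[of _ 0] by (intro sets.finite_UN)
  finally show Z[measurable]: "Z \<in> sets ?N" .
  let ?D = "density ?N (indicator Z)"
  let ?E = "\<lambda>(k, j). {u. 1 / real (Suc j) < \<bar>blinfun_apply (x k) u\<bar>}"
  show "sigma_finite_measure ?D"
  proof
    show "\<exists>A. countable A \<and> A \<subseteq> sets ?D \<and> \<Union>A = space ?D \<and> (\<forall>a\<in>A. emeasure ?D a \<noteq> \<infinity>)"
    proof (intro exI[of _ "insert (- Z) (?E ` (I \<times> UNIV))"] conjI ballI)
      show "countable (insert (- Z) (?E ` (I \<times> UNIV)))" using I by (auto intro: countable_finite)
      have "- Z \<in> sets ?N" using sets.compl_sets[OF Z] by (simp add: Compl_eq_Diff_UNIV)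
      then show "insert (- Z) (?E ` (I \<times> UNIV)) \<subseteq> sets ?D" using mk by auto
      have "u \<in> \<Union>(?E ` (I \<times> UNIV))" if "u \<in> Z" for u
      proof -
        from that obtain k where k: "k \<in> I" "0 < \<bar>blinfun_apply (x k) u\<bar>" by (auto simp: Z_def)
        from reals_Archimedean[OF k(2)] obtain j where "inverse (real (Suc j)) < \<bar>blinfun_apply (x k) u\<bar>" by blast
        with k(1) show ?thesis by (auto simp: inverse_eq_divide intro!: bexI[of _ "(k, j)"])
      qed
      then show "\<Union>(insert (- Z) (?E ` (I \<times> UNIV))) = space ?D" by auto
      fix A assume "A \<in> insert (- Z) (?E ` (I \<times> UNIV))"
      then consider "A = - Z" | k j where "k \<in> I" "A = ?E (k, j)" by auto
      then show "emeasure ?D A \<noteq> \<infinity>"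
      proof cases
        case 1
        have "emeasure ?D (- Z) = (\<integral>\<^sup>+u. indicator Z u * indicator (- Z) u \<partial>?N)"
          using \<open>- Z \<in> sets ?N\<close> by (intro emeasure_density) auto
        also have "\<dots> = (\<integral>\<^sup>+u. 0 \<partial>?N)" by (intro nn_integral_cong) (auto simp: indicator_def)
        finally show ?thesis using 1 by simp
      next
        case 2
        have A: "A \<in> sets ?N" using 2 mk by auto
        note [measurable] = m[OF 2(1)]
        \<comment> \<open>Chebyshev's inequality: on \<open>A\<close> the integrand
          \<open>min (x^2) 1\<close> is at least \<open>1 / ?c\<close>, and its integral is
          finite.\<close>
        let ?c = "real (Suc j) ^ 2"
        have "emeasure ?D A = (\<integral>\<^sup>+u. indicator Z u * indicator A u \<partial>?N)"
          using A by (intro emeasure_density) auto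
        also have "\<dots> \<le> (\<integral>\<^sup>+u. ennreal ?c * ennreal (min ((blinfun_apply (x k) u)\<^sup>2) 1) \<partial>?N)"
        proof (rule nn_integral_mono)
          fix u
          have "1 \<le> ?c * min ((blinfun_apply (x k) u)\<^sup>2) 1" if "u \<in> A"
          proof -
            have "1 \<le> real (Suc j) * \<bar>blinfun_apply (x k) u\<bar>"
              using that 2(2) by (simp add: field_simps del: of_nat_Suc)
            then have "1 \<le> (real (Suc j) * \<bar>blinfun_apply (x k) u\<bar>) ^ 2" by (rule one_le_power)
            moreover have "1 \<le> ?c" by (rule one_le_power) simp
            ultimately show ?thesis by (auto simp: min_def power_mult_distrib)
          qed
          then have "indicator A u \<le> ennreal (?c * min ((blinfun_apply (x k) u)\<^sup>2) 1)"
            by (auto simp: indicator_def simp flip: ennreal_1 intro!: ennreal_leI)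
          moreover have "indicator Z u * indicator A u \<le> (indicator A u :: ennreal)"
            by (auto simp: indicator_def)
          ultimately show "indicator Z u * indicator A u \<le> ennreal ?c * ennreal (min ((blinfun_apply (x k) u)\<^sup>2) 1)"
            by (simp add: ennreal_mult)
        qed
        also have "\<dots> = ennreal ?c * (\<integral>\<^sup>+u. ennreal (min ((blinfun_apply (x k) u)\<^sup>2) 1) \<partial>?N)"
          by (rule nn_integral_cmult) measurable
        also have "\<dots> < \<infinity>"
          using nn_integral_min_finite[of "x ` I" "x k"] I 2(1) by (simp add: ennreal_mult_less_top)
        finally show ?thesis by simp
      qed
    qed
  qed
qed

text \<open>The Gaussian average of the quadratic form leaves its diagonal, that of
  \<open>1 - cos\<close> leaves \<open>1 - exp\<close>. Fubini asks for a \<sigma>-finite measure,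
  so the jump part is first moved to \<open>?D\<close>, which discards only the joint
  kernel.\<close>

lemma gauss_mean_kexp:
  assumes I: "finite I"
  shows "(\<integral>\<^sup>+g. ennreal (kexp (\<Sum>k\<in>I. g k *\<^sub>R x k)) \<partial>gauss I)
    = ennreal ((\<Sum>k\<in>I. blinfun_apply (blinfun_apply Q (x k)) (x k)) / 2)
      + (\<integral>\<^sup>+u. ennreal (1 - exp (- (\<Sum>k\<in>I. (blinfun_apply (x k) u)\<^sup>2) / 2)) \<partial>cyl_restr \<mu> (x ` I))"
proof -
  interpret G: prob_space "gauss I" by (rule prob_space_gauss)
  let ?N = "cyl_restr \<mu> (x ` I)"
  define S where "S g u = (\<Sum>k\<in>I. g k * blinfun_apply (x k) u)" for g :: "nat \<Rightarrow> real" and u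
  define Z where "Z = {u. \<exists>k\<in>I. blinfun_apply (x k) u \<noteq> 0}"
  let ?D = "density ?N (indicator Z)"
  interpret D: sigma_finite_measure ?D unfolding Z_def by (rule sigma_finite_off_kernel[OF I])
  have Zm[measurable]: "Z \<in> sets ?N" unfolding Z_def by (rule sigma_finite_off_kernel[OF I])
  interpret P: pair_sigma_finite "gauss I" ?D ..
  have m: "blinfun_apply (x k) \<in> borel_measurable ?N" if "k \<in> I" for k
    using that by (intro measurable_cyl_restr) auto
  have Sm: "S g \<in> borel_measurable ?N" for g
    unfolding S_def using m by (intro borel_measurable_sum borel_measurable_times) auto
  have off: "(\<integral>\<^sup>+u. h u \<partial>?N) = (\<integral>\<^sup>+u. h u \<partial>?D)"
    if h: "h \<in> borel_measurable ?N" "\<And>u. u \<notin> Z \<Longrightarrow> h u = 0" for h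
  proof -
    have "(\<integral>\<^sup>+u. h u \<partial>?D) = (\<integral>\<^sup>+u. indicator Z u * h u \<partial>?N)"
      using h(1) by (intro nn_integral_density) auto
    also have "\<dots> = (\<integral>\<^sup>+u. h u \<partial>?N)"
      by (intro nn_integral_cong) (use h(2) in \<open>auto simp: indicator_def\<close>)
    finally show ?thesis ..
  qed
  define q where "q g = blinfun_apply (blinfun_apply Q (\<Sum>k\<in>I. g k *\<^sub>R x k)) (\<Sum>k\<in>I. g k *\<^sub>R x k)" for g
  \<comment> \<open>\<open>kexp y\<close> is represented over a set containing the combination
    \<open>y\<close>, but its integrand depends on the vectors \<open>x k\<close> only. The random
    combination therefore disappears from the measure, which becomes the same for all
    \<open>g\<close>.\<close>
  have jump: "(\<integral>\<^sup>+u. ennreal (1 - cos (blinfun_apply y u)) \<partial>cyl_restr \<mu> (insert y (x ` I))) = (\<integral>\<^sup>+u. ennreal (1 - cos (S g u)) \<partial>?D)"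
    if y: "y = (\<Sum>k\<in>I. g k *\<^sub>R x k)" for y g
  proof -
    note [measurable] = Sm
    have e: "blinfun_apply y u = S g u" for u by (simp add: y S_def blinfun.sum_left blinfun.scaleR_left)
    have "(\<lambda>u. ennreal (1 - cos (S g u))) \<in> borel_measurable ?N" by measurable
    moreover have "S g u = 0" if "u \<notin> Z" for u using that by (auto simp: S_def Z_def)
    ultimately show ?thesis
      using nn_integral_cyl_restr_mono[OF mu_cyl, of "insert y (x ` I)" "x ` I" "\<lambda>u. ennreal (1 - cos (S g u))", OF _ subset_insertI]
        off[of "\<lambda>u. ennreal (1 - cos (S g u))"] I by (simp add: e)
  qed
  have k: "ennreal (kexp (\<Sum>k\<in>I. g k *\<^sub>R x k)) = ennreal (q g / 2) + (\<integral>\<^sup>+u. ennreal (1 - cos (S g u)) \<partial>?D)" for g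
    using ennreal_kexp[of "insert (\<Sum>k\<in>I. g k *\<^sub>R x k) (x ` I)" "\<Sum>k\<in>I. g k *\<^sub>R x k"] I
    by (simp add: jump[OF refl] q_def)
  have qm: "(\<lambda>g. ennreal (q g / 2)) \<in> borel_measurable (gauss I)"
  proof -
    have "continuous_on UNIV (\<lambda>y. blinfun_apply (blinfun_apply Q y) y)" by (intro continuous_intros)
    from measurable_gauss_continuous[OF this] have "q \<in> borel_measurable (gauss I)" unfolding q_def .
    then show ?thesis by measurable
  qed
  have comp[measurable]: "(\<lambda>p. fst p k) \<in> borel_measurable (gauss I \<Otimes>\<^sub>M ?D)" if "k \<in> I" for k
    using measurable_compose[OF measurable_fst measurable_component_singleton[OF that, of "\<lambda>_. std_normal_distribution"]]
    by simp
  have compx[measurable]: "(\<lambda>p. blinfun_apply (x k) (snd p)) \<in> borel_measurable (gauss I \<Otimes>\<^sub>M ?D)" if "k \<in> I" for k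
    using m[OF that] by (intro measurable_compose[OF measurable_snd]) simp
  have SM: "(\<lambda>(g, u). ennreal (1 - cos (S g u))) \<in> borel_measurable (gauss I \<Otimes>\<^sub>M ?D)"
    unfolding S_def split_beta' by measurable
  have "(\<integral>\<^sup>+g. ennreal (kexp (\<Sum>k\<in>I. g k *\<^sub>R x k)) \<partial>gauss I)
    = (\<integral>\<^sup>+g. ennreal (q g / 2) \<partial>gauss I) + (\<integral>\<^sup>+g. (\<integral>\<^sup>+u. ennreal (1 - cos (S g u)) \<partial>?D) \<partial>gauss I)"
    unfolding k by (rule nn_integral_add[OF qm D.borel_measurable_nn_integral[OF SM]])
  also have "(\<integral>\<^sup>+g. (\<integral>\<^sup>+u. ennreal (1 - cos (S g u)) \<partial>?D) \<partial>gauss I) = (\<integral>\<^sup>+u. (\<integral>\<^sup>+g. ennreal (1 - cos (S g u)) \<partial>gauss I) \<partial>?D)"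
    by (rule P.Fubini'[OF SM, symmetric])
  also have "\<dots> = (\<integral>\<^sup>+u. ennreal (1 - exp (- (\<Sum>k\<in>I. (blinfun_apply (x k) u)\<^sup>2) / 2)) \<partial>?D)"
    unfolding S_def by (simp add: gauss_one_minus_cos[OF I])
  also have "\<dots> = (\<integral>\<^sup>+u. ennreal (1 - exp (- (\<Sum>k\<in>I. (blinfun_apply (x k) u)\<^sup>2) / 2)) \<partial>?N)"
  proof (rule off[symmetric])
    note [measurable] = m
    show "(\<lambda>u. ennreal (1 - exp (- (\<Sum>k\<in>I. (blinfun_apply (x k) u)\<^sup>2) / 2))) \<in> borel_measurable ?N" by measurable
  qed (auto simp: Z_def)
  also have "(\<integral>\<^sup>+g. ennreal (q g / 2) \<partial>gauss I) = ennreal ((\<Sum>k\<in>I. blinfun_apply (blinfun_apply Q (x k)) (x k)) / 2)"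
  proof -
    have qe: "q g = (\<Sum>k\<in>I. \<Sum>l\<in>I. (g k * g l) * blinfun_apply (blinfun_apply Q (x k)) (x l))" for g
    proof -
      have "q g = blinfun_apply (\<Sum>k\<in>I. g k *\<^sub>R blinfun_apply Q (x k)) (\<Sum>l\<in>I. g l *\<^sub>R x l)"
        by (simp add: q_def blinfun.sum_right blinfun.scaleR_right)
      also have "\<dots> = (\<Sum>k\<in>I. g k * blinfun_apply (blinfun_apply Q (x k)) (\<Sum>l\<in>I. g l *\<^sub>R x l))"
        by (simp add: blinfun.sum_left blinfun.scaleR_left)
      also have "\<dots> = (\<Sum>k\<in>I. g k * (\<Sum>l\<in>I. g l * blinfun_apply (blinfun_apply Q (x k)) (x l)))"
        by (simp add: blinfun.sum_right blinfun.scaleR_right)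
      finally show ?thesis by (simp add: sum_distrib_left mult.assoc)
    qed
    have int: "integrable (gauss I) (\<lambda>g. (g k * g l) * blinfun_apply (blinfun_apply Q (x k)) (x l))" if "k \<in> I" "l \<in> I" for k l
      using gauss_mean_component(1)[OF I that] by simp
    have q0: "q g \<ge> 0" for g by (simp add: q_def Q_nonneg)
    have qi: "integrable (gauss I) q"
      unfolding qe by (intro Bochner_Integration.integrable_sum int)
    have "(LINT g|gauss I. q g) = (\<Sum>k\<in>I. \<Sum>l\<in>I. (LINT g|gauss I. g k * g l) * blinfun_apply (blinfun_apply Q (x k)) (x l))"
      unfolding qe using int by (simp add: Bochner_Integration.integral_sum)
    also have "\<dots> = (\<Sum>k\<in>I. \<Sum>l\<in>I. if k = l then blinfun_apply (blinfun_apply Q (x k)) (x k) else 0)"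
      by (intro sum.cong refl) (simp add: gauss_mean_component(2)[OF I])
    also have "\<dots> = (\<Sum>k\<in>I. blinfun_apply (blinfun_apply Q (x k)) (x k))" using I by simp
    finally have "(LINT g|gauss I. q g / 2) = (\<Sum>k\<in>I. blinfun_apply (blinfun_apply Q (x k)) (x k)) / 2" by simp
    moreover have "(\<integral>\<^sup>+g. ennreal (q g / 2) \<partial>gauss I) = ennreal (LINT g|gauss I. q g / 2)"
      by (rule nn_integral_eq_integral) (use qi q0 in auto)
    ultimately show ?thesis by simp
  qed
  finally show ?thesis .
qed

text \<open>A factor 4 per doubling means quadratic growth. The summand 1 covers the unit ball, and
  the factor 4 pays for rounding the norm up to a power of 2.\<close>

lemma kexp_growth:
  obtains C where "C \<ge> 0" "\<And>x. kexp x \<le> C * (1 + 4 * (norm x)\<^sup>2)"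
proof -
  obtain C where C: "C \<ge> 0" "\<And>x. norm x \<le> 1 \<Longrightarrow> cmod (\<Psi> x) \<le> C" using \<Psi>_bounded by blast
  have pow: "cmod (\<Psi> ((2 ^ n) *\<^sub>R x)) \<le> 4 ^ n * C" if "norm x \<le> 1" for n x
  proof (induction n)
    case 0
    then show ?case using C(2)[OF that] by simp
  next
    case (Suc n)
    show ?case using cmod_\<Psi>_double_le[of "(2 ^ n) *\<^sub>R x"] Suc by simp
  qed
  have "cmod (\<Psi> x) \<le> C * (1 + 4 * (norm x)\<^sup>2)" for x
  proof -
    define n where "n = (LEAST n. norm x \<le> 2 ^ n)"
    obtain n0 where "norm x < 2 ^ n0" using real_arch_pow[of 2 "norm x"] by auto
    then have n: "norm x \<le> 2 ^ n" unfolding n_def by (rule LeastI[of "\<lambda>n. norm x \<le> 2 ^ n", OF less_imp_le])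
    have "cmod (\<Psi> x) \<le> 4 ^ n * C"
      using pow[of "(1 / 2 ^ n) *\<^sub>R x" n] n by simp
    moreover have "(4::real) ^ n \<le> 1 + 4 * (norm x)\<^sup>2"
    proof (cases n)
      case (Suc k)
      then have "\<not> norm x \<le> 2 ^ k" using not_less_Least[of k "\<lambda>n. norm x \<le> 2 ^ n"] by (simp add: n_def[symmetric])
      then have "(2 ^ k)\<^sup>2 \<le> (norm x)\<^sup>2" by (intro power_mono) auto
      moreover have "(4::real) ^ n = 4 * (2 ^ k)\<^sup>2"
        using Suc by (simp add: power_mult[symmetric] mult.commute[of k 2] power_mult)
      ultimately show ?thesis by linarith
    qed simp
    then have "4 ^ n * C \<le> (1 + 4 * (norm x)\<^sup>2) * C" using C(1) by (rule mult_right_mono)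
    ultimately show ?thesis by (simp add: mult.commute)
  qed
  then show thesis using C(1) order_trans[OF kexp_le_cmod] by (intro that[of C]) blast+
qed

text \<open>Quadratic growth meets the second Gaussian moments. The bound sees the vectors through
  \<open>r\<close> only, which makes it uniform in \<open>s\<close> for
  \<open>x k = fs s (h k)\<close>.\<close>

lemma gauss_mean_kexp_bounded:
  assumes I: "finite I"
  obtains C where "C \<ge> 0" "\<And>x. (\<And>k. k \<in> I \<Longrightarrow> norm (x k) \<le> r) \<Longrightarrow>
    (\<integral>\<^sup>+g. ennreal (kexp (\<Sum>k\<in>I. g k *\<^sub>R x k)) \<partial>gauss I) \<le> ennreal C"
proof -
  interpret G: prob_space "gauss I" by (rule prob_space_gauss)
  obtain C where C: "C \<ge> 0" "\<And>x. kexp x \<le> C * (1 + 4 * (norm x)\<^sup>2)" using kexp_growth by blast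
  let ?h = "\<lambda>g :: nat \<Rightarrow> real. C * (1 + 4 * (r\<^sup>2 * (real (card I) * (\<Sum>k\<in>I. g k * g k))))"
  have int: "integrable (gauss I) ?h"
    using gauss_mean_component(1)[OF I] by (intro integrable_mult_right Bochner_Integration.integrable_add Bochner_Integration.integrable_sum) auto
  have h0: "?h g \<ge> 0" for g
  proof -
    have "0 \<le> (\<Sum>k\<in>I. g k * g k)" by (intro sum_nonneg zero_le_square)
    then show ?thesis using C(1) by simp
  qed
  have "(\<integral>\<^sup>+g. ennreal (kexp (\<Sum>k\<in>I. g k *\<^sub>R x k)) \<partial>gauss I) \<le> ennreal (LINT g|gauss I. ?h g)"
    if x: "\<And>k. k \<in> I \<Longrightarrow> norm (x k) \<le> r" for x
  proof -
    have "(\<integral>\<^sup>+g. ennreal (kexp (\<Sum>k\<in>I. g k *\<^sub>R x k)) \<partial>gauss I) \<le> (\<integral>\<^sup>+g. ennreal (?h g) \<partial>gauss I)"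
    proof (intro nn_integral_mono ennreal_leI)
      fix g
      have "norm (\<Sum>k\<in>I. g k *\<^sub>R x k) \<le> (\<Sum>k\<in>I. \<bar>g k\<bar> * norm (x k))"
        by (rule order_trans[OF norm_sum]) simp
      also have "\<dots> \<le> (\<Sum>k\<in>I. \<bar>g k\<bar> * r)" using x by (intro sum_mono mult_left_mono) auto
      finally have "(norm (\<Sum>k\<in>I. g k *\<^sub>R x k))\<^sup>2 \<le> ((\<Sum>k\<in>I. \<bar>g k\<bar>) * r)\<^sup>2"
        by (intro power_mono) (auto simp: sum_distrib_right)
      also have "\<dots> \<le> (real (card I) * (\<Sum>k\<in>I. g k * g k)) * r\<^sup>2"
        unfolding power_mult_distrib
        using Cauchy_Schwarz_ineq_sum[of "\<lambda>_. 1" "\<lambda>k. \<bar>g k\<bar>" I]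
        by (intro mult_right_mono) (auto simp: power2_eq_square)
      finally have "(norm (\<Sum>k\<in>I. g k *\<^sub>R x k))\<^sup>2 \<le> r\<^sup>2 * (real (card I) * (\<Sum>k\<in>I. g k * g k))" by (simp add: mult.commute)
      then have "C * (1 + 4 * (norm (\<Sum>k\<in>I. g k *\<^sub>R x k))\<^sup>2) \<le> ?h g" using C(1) by (intro mult_left_mono) auto
      then show "kexp (\<Sum>k\<in>I. g k *\<^sub>R x k) \<le> ?h g" using C(2) order_trans by blast
    qed
    also have "\<dots> = ennreal (LINT g|gauss I. ?h g)" using int h0 by (intro nn_integral_eq_integral) auto
    finally show ?thesis .
  qed
  moreover have "0 \<le> (LINT g|gauss I. ?h g)" by (intro integral_nonneg_AE AE_I2 h0)
  ultimately show thesis by (rule that[rotated])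
qed

end

section \<open>Square summability\<close>

definition proj_onb :: "(nat \<Rightarrow> 'v::real_inner) \<Rightarrow> nat \<Rightarrow> 'v \<Rightarrow> 'v" where
  "proj_onb e n v = (\<Sum>k<n. inner (e k) v *\<^sub>R e k)"

lemma proj_onb_add: "proj_onb e n (v + w) = proj_onb e n v + proj_onb e n w"
  by (simp add: proj_onb_def inner_add_right scaleR_add_left sum.distrib)

lemma proj_onb_scale: "proj_onb e n (c *\<^sub>R v) = c *\<^sub>R proj_onb e n v"
  by (simp add: proj_onb_def scaleR_sum_right)

context
  fixes e :: "nat \<Rightarrow> 'v::real_inner"
  assumes e: "orthonormal_basis e"
begin

lemma inner_onb: "inner (e i) (e j) = (if i = j then 1 else 0)"
  using e by (simp add: orthonormal_basis_def)

lemma norm_sum_onb: "finite I \<Longrightarrow> (norm (\<Sum>k\<in>I. a k *\<^sub>R e k))\<^sup>2 = (\<Sum>k\<in>I. (a k)\<^sup>2)"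
  unfolding power2_norm_eq_inner
  by (simp add: inner_sum_left inner_sum_right inner_onb if_distrib power2_eq_square cong: if_cong)

lemma norm_diff_proj_onb: "(norm (v - proj_onb e n v))\<^sup>2 = (norm v)\<^sup>2 - (\<Sum>k<n. (inner (e k) v)\<^sup>2)"
proof -
  have "inner v (proj_onb e n v) = (\<Sum>k<n. (inner (e k) v)\<^sup>2)"
    by (simp add: proj_onb_def inner_sum_right power2_eq_square inner_commute)
  moreover have "inner (proj_onb e n v) (proj_onb e n v) = (\<Sum>k<n. (inner (e k) v)\<^sup>2)"
    using norm_sum_onb[of "{..<n}" "\<lambda>k. inner (e k) v"] by (simp add: proj_onb_def power2_norm_eq_inner)
  ultimately show ?thesis
    by (simp add: power2_norm_eq_inner inner_diff_left inner_diff_right inner_commute)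
qed

lemma norm_diff_proj_onb_le: "norm (v - proj_onb e n v) \<le> norm v"
proof (rule power2_le_imp_le)
  show "(norm (v - proj_onb e n v))\<^sup>2 \<le> (norm v)\<^sup>2"
    unfolding norm_diff_proj_onb by (simp add: sum_nonneg)
qed simp

text \<open>On the dense span the projections are eventually the identity, and the residual map is a
  contraction.\<close>

lemma proj_onb_tendsto: "(\<lambda>n. proj_onb e n v) \<longlonglongrightarrow> v"
proof (rule LIMSEQ_I)
  fix r :: real assume r: "r > 0"
  have "v \<in> closure (span (range e))" using e by (simp add: orthonormal_basis_def)
  then obtain w where w: "w \<in> span (range e)" "dist w v < r"
    using r unfolding closure_approachable by blast
  have "\<exists>N. \<forall>n\<ge>N. proj_onb e n w = w"
    using w(1)
  proof (induction rule: span_induct_alt)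
    case base
    show ?case by (simp add: proj_onb_def)
  next
    case (step c x y)
    then obtain i N where i: "x = e i" and N: "\<forall>n\<ge>N. proj_onb e n y = y" by auto
    have "proj_onb e n (e i) = e i" if "n > i" for n
    proof -
      have "proj_onb e n (e i) = (\<Sum>k<n. if k = i then e i else 0)"
        unfolding proj_onb_def by (intro sum.cong) (auto simp: inner_onb)
      then show ?thesis using that by simp
    qed
    then have "\<forall>n\<ge>max N (Suc i). proj_onb e n (c *\<^sub>R x + y) = c *\<^sub>R x + y"
      using N by (simp add: proj_onb_add proj_onb_scale i)
    then show ?case by blast
  qed
  then obtain N where N: "\<And>n. n \<ge> N \<Longrightarrow> proj_onb e n w = w" by blast
  have "norm (proj_onb e n v - v) < r" if "n \<ge> N" for n
  proof -
    have "proj_onb e n v = proj_onb e n (v - w) + w"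
      using proj_onb_add[of e n "v - w" w] N[OF that] by simp
    then have "norm (proj_onb e n v - v) = norm ((v - w) - proj_onb e n (v - w))"
      by (simp add: norm_minus_commute algebra_simps)
    also have "\<dots> \<le> norm (v - w)" by (rule norm_diff_proj_onb_le)
    finally show ?thesis using w(2) by (simp add: dist_norm norm_minus_commute)
  qed
  then show "\<exists>N. \<forall>n\<ge>N. norm (proj_onb e n v - v) < r" by blast
qed

end

lemma summable_onb:
  fixes e :: "nat \<Rightarrow> 'v::{real_inner, banach}"
  assumes e: "orthonormal_basis e" and a: "summable (\<lambda>k. (a k)\<^sup>2 :: real)"
  shows "summable (\<lambda>k. a k *\<^sub>R e k)"
  unfolding summable_Cauchy
proof (intro allI impI)
  fix r :: real assume r: "r > 0"
  then have "r\<^sup>2 > 0" by simp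
  then obtain N where N: "\<And>m n. m \<ge> N \<Longrightarrow> norm (\<Sum>k=m..<n. (a k)\<^sup>2) < r\<^sup>2"
    using a unfolding summable_Cauchy by blast
  have "norm (\<Sum>k=m..<n. a k *\<^sub>R e k) < r" if "m \<ge> N" for m n
  proof (rule power2_less_imp_less)
    show "(norm (\<Sum>k=m..<n. a k *\<^sub>R e k))\<^sup>2 < r\<^sup>2"
      using N[OF that, of n] norm_sum_onb[OF e, of "{m..<n}" a] by (simp add: sum_nonneg)
  qed (use r in simp)
  then show "\<exists>N. \<forall>m\<ge>N. \<forall>n. norm (\<Sum>k=m..<n. a k *\<^sub>R e k) < r" by blast
qed

text \<open>If the squared differences do not sum, every tail has supremum at least 1 in
  \<open>h\<close>. The event \<open>B\<close> of this has probability at most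
  \<open>\<delta> m\<close> for each \<open>m\<close>, hence 0. The centring constants are the
  values \<open>X k \<omega>'\<close> at a frozen outcome of the copy.\<close>

lemma (in prob_space) summable_squares_if_symmetrized:
  assumes [measurable]: "\<And>k::nat. X k \<in> borel_measurable M"
    and \<delta>: "\<delta> \<longlonglongrightarrow> 0"
    and le: "\<And>m n. (\<integral>\<^sup>+\<omega>. ennreal (1 - exp (- (\<Sum>k\<in>{m..n}. (X k (fst \<omega>) - X k (snd \<omega>))\<^sup>2) / 2)) \<partial>(M \<Otimes>\<^sub>M M)) \<le> \<delta> m"
  obtains c where "AE \<omega> in M. summable (\<lambda>k. (X k \<omega> - c k)\<^sup>2)"
proof -
  interpret P: pair_prob_space M M ..
  define D where "D k \<omega> = (X k (fst \<omega>) - X k (snd \<omega>))\<^sup>2" for k and \<omega> :: "'a \<times> 'a"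
  have [measurable]: "D k \<in> borel_measurable (M \<Otimes>\<^sub>M M)" for k unfolding D_def by measurable
  have D0: "D k \<omega> \<ge> 0" for k \<omega> by (simp add: D_def)
  define h where "h m n \<omega> = ennreal (1 - exp (- (\<Sum>k\<in>{m..n}. D k \<omega>) / 2))" for m n \<omega>
  have [measurable]: "h m n \<in> borel_measurable (M \<Otimes>\<^sub>M M)" for m n unfolding h_def by measurable
  have inc: "incseq (h m)" for m
    unfolding h_def by (intro incseq_SucI le_funI ennreal_leI) (auto simp: D0 sum_nonneg sum.atLeastAtMost_shift_bounds intro!: sum_mono2)
  have one: "(SUP n. h m n \<omega>) \<ge> 1" if ns: "\<not> summable (\<lambda>k. D k \<omega>)" for m \<omega>
  proof -
    have "ennreal (1 - exp (- B / 2)) \<le> (SUP n. h m n \<omega>)" for B :: real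
    proof -
      have "\<exists>n. (\<Sum>k\<in>{m..n}. D k \<omega>) > B"
      proof (rule ccontr)
        assume "\<not> ?thesis"
        then have B: "(\<Sum>k\<in>{m..n}. D k \<omega>) \<le> B" for n by (simp add: not_less)
        have "summable (\<lambda>k. D k \<omega>)"
        proof (rule summableI_nonneg_bounded)
          fix n
          have "(\<Sum>k<n. D k \<omega>) \<le> (\<Sum>k\<in>{..<m} \<union> {m..n}. D k \<omega>)" by (intro sum_mono2) (auto simp: D0)
          also have "\<dots> = (\<Sum>k<m. D k \<omega>) + (\<Sum>k\<in>{m..n}. D k \<omega>)" by (intro sum.union_disjoint) auto
          also have "\<dots> \<le> (\<Sum>k<m. D k \<omega>) + B" using B by simp
          finally show "(\<Sum>k<n. D k \<omega>) \<le> (\<Sum>k<m. D k \<omega>) + B" .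
        qed (rule D0)
        with ns show False by simp
      qed
      then obtain n where "(\<Sum>k\<in>{m..n}. D k \<omega>) > B" by blast
      then have "ennreal (1 - exp (- B / 2)) \<le> h m n \<omega>" unfolding h_def by (intro ennreal_leI) simp
      also have "\<dots> \<le> (SUP n. h m n \<omega>)" by (rule SUP_upper) simp
      finally show ?thesis .
    qed
    moreover have "(\<lambda>n. ennreal (1 - exp (- real n / 2))) \<longlonglongrightarrow> ennreal 1"
    proof (rule tendsto_ennrealI)
      have "((\<lambda>x. 1 - exp (- x / 2)) \<longlongrightarrow> (1 :: real)) at_top" by real_asymp
      then show "(\<lambda>n. 1 - exp (- real n / 2)) \<longlonglongrightarrow> 1" by (rule filterlim_compose) (rule filterlim_real_sequentially)
    qed
    ultimately have "ennreal 1 \<le> (SUP n. h m n \<omega>)" by (intro LIMSEQ_le_const2) auto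
    then show ?thesis by simp
  qed
  define B where "B = {\<omega> \<in> space (M \<Otimes>\<^sub>M M). \<forall>m. (SUP n. h m n \<omega>) \<ge> 1}"
  have [measurable]: "B \<in> sets (M \<Otimes>\<^sub>M M)" unfolding B_def by measurable
  have "emeasure (M \<Otimes>\<^sub>M M) B \<le> \<delta> m" for m
  proof -
    have "emeasure (M \<Otimes>\<^sub>M M) B = (\<integral>\<^sup>+\<omega>. indicator B \<omega> \<partial>(M \<Otimes>\<^sub>M M))" by simp
    also have "\<dots> \<le> (\<integral>\<^sup>+\<omega>. (SUP n. h m n \<omega>) \<partial>(M \<Otimes>\<^sub>M M))"
      by (intro nn_integral_mono) (auto simp: indicator_def B_def)
    also have "\<dots> = (SUP n. \<integral>\<^sup>+\<omega>. h m n \<omega> \<partial>(M \<Otimes>\<^sub>M M))"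
      by (rule nn_integral_monotone_convergence_SUP[OF inc]) measurable
    also have "\<dots> \<le> \<delta> m" using le by (intro SUP_least) (auto simp: h_def D_def)
    finally show ?thesis .
  qed
  then have "emeasure (M \<Otimes>\<^sub>M M) B \<le> 0" by (intro LIMSEQ_le_const[OF \<delta>]) auto
  then have "AE \<omega> in M \<Otimes>\<^sub>M M. \<omega> \<notin> B" by (intro AE_not_in) (auto simp: null_sets_def)
  then have "AE \<omega> in M \<Otimes>\<^sub>M M. summable (\<lambda>k. D k \<omega>)" using AE_space by eventually_elim (use one in \<open>auto simp: B_def\<close>)
  then have "AE \<omega>' in M. AE \<omega> in M. summable (\<lambda>k. D k (\<omega>', \<omega>))"
    by (rule P.AE_pair)
  \<comment> \<open>Almost every \<omega>' has this property and the space has mass one, so some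
    \<omega>' has it.\<close>
  then obtain \<omega>' where "AE \<omega> in M. summable (\<lambda>k. D k (\<omega>', \<omega>))"
    by (metis (mono_tags, lifting) AE_E2 AE_False emeasure_space_1 eventually_mono zero_neq_one)
  then have "AE \<omega> in M. summable (\<lambda>k. (X k \<omega> - X k \<omega>')\<^sup>2)"
    by eventually_elim (simp add: D_def power2_commute)
  then show thesis by (rule that)
qed

lemma (in prob_space) bounded_if_tendsto_prob_const:
  fixes d :: "nat \<Rightarrow> real"
  assumes [measurable]: "W \<in> borel_measurable M" and d: "tendsto_prob M (\<lambda>n _. d n) W sequentially"
  obtains C where "\<And>n. \<bar>d n\<bar> \<le> C"
proof -
  have "(\<lambda>n. measure M {\<omega> \<in> space M. 1 < \<bar>d n - W \<omega>\<bar>}) \<longlonglongrightarrow> 0"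
    using d unfolding tendsto_prob_def by simp
  then have "eventually (\<lambda>n. measure M {\<omega> \<in> space M. 1 < \<bar>d n - W \<omega>\<bar>} < 1 / 2) sequentially"
    by (intro order_tendstoD) auto
  then obtain N where N: "\<And>n. n \<ge> N \<Longrightarrow> measure M {\<omega> \<in> space M. 1 < \<bar>d n - W \<omega>\<bar>} < 1 / 2"
    unfolding eventually_sequentially by blast
  have tail: "\<bar>d n - d N\<bar> \<le> 2" if "n \<ge> N" for n
  proof (rule ccontr)
    \<comment> \<open>Then each \<omega> is further than 1 from \<open>d n\<close> or from
      \<open>d N\<close>, so two events of probability below one half would cover the space.\<close>
    assume far: "\<not> \<bar>d n - d N\<bar> \<le> 2"
    have "1 = measure M (space M)" by (simp add: prob_space)
    also have "\<dots> \<le> measure M ({\<omega> \<in> space M. 1 < \<bar>d n - W \<omega>\<bar>} \<union> {\<omega> \<in> space M. 1 < \<bar>d N - W \<omega>\<bar>})"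
      using far by (intro finite_measure_mono) auto
    also have "\<dots> \<le> measure M {\<omega> \<in> space M. 1 < \<bar>d n - W \<omega>\<bar>} + measure M {\<omega> \<in> space M. 1 < \<bar>d N - W \<omega>\<bar>}"
      by (intro measure_Un_le) auto
    also have "\<dots> < 1" using N[OF that] N[of N] by simp
    finally show False by simp
  qed
  have "\<bar>d n\<bar> \<le> (\<Sum>k\<le>N. \<bar>d k\<bar>) + 2" for n
  proof (cases "n \<le> N")
    case True
    then have "\<bar>d n\<bar> \<le> (\<Sum>k\<le>N. \<bar>d k\<bar>)" by (intro member_le_sum) auto
    then show ?thesis by simp
  next
    case False
    then have "\<bar>d n - d N\<bar> \<le> 2" by (intro tail) simp
    moreover have "\<bar>d N\<bar> \<le> (\<Sum>k\<le>N. \<bar>d k\<bar>)" by (intro member_le_sum) auto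
    ultimately show ?thesis by linarith
  qed
  then show thesis by (rule that)
qed

text \<open>Banach--Steinhaus bounds the partial functionals in norm. Testing the
  \<open>n\<close>-th one at \<open>?v\<close>, the truncation of the sequence itself, gives
  \<open>|?v|^2 \<le> C |?v|\<close>.\<close>

lemma square_summable_if_weakly_bounded:
  fixes e :: "nat \<Rightarrow> 'v::{real_inner, banach}"
  assumes e: "orthonormal_basis e" and bdd: "\<And>v. \<exists>C. \<forall>n. \<bar>\<Sum>k<n. inner (e k) v * c k\<bar> \<le> C"
  shows "summable (\<lambda>k. (c k)\<^sup>2)"
proof -
  obtain C where C: "C \<ge> 0" "\<And>n v. \<bar>\<Sum>k<n. inner (e k) v * c k\<bar> \<le> C * norm v"
  proof (rule uniform_boundedness_seminorms[of UNIV "\<lambda>n v. \<bar>\<Sum>k<n. inner (e k) v * c k\<bar>"])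
    show "continuous_on UNIV (\<lambda>v. \<bar>\<Sum>k<n. inner (e k) v * c k\<bar>)" for n by (intro continuous_intros)
    show "\<bar>\<Sum>k<n. inner (e k) (x + y) * c k\<bar> \<le> \<bar>\<Sum>k<n. inner (e k) x * c k\<bar> + \<bar>\<Sum>k<n. inner (e k) y * c k\<bar>" for n x y
      by (simp add: inner_add_right distrib_right sum.distrib)
    show "\<bar>\<Sum>k<n. inner (e k) (r *\<^sub>R x) * c k\<bar> = \<bar>r\<bar> * \<bar>\<Sum>k<n. inner (e k) x * c k\<bar>" for n r x
      by (simp add: abs_mult[symmetric] sum_distrib_left mult.assoc)
    show "\<exists>C. \<forall>n\<in>UNIV. \<bar>\<Sum>k<n. inner (e k) x * c k\<bar> \<le> C" for x using bdd by simp
  qed auto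
  show ?thesis
  proof (rule summableI_nonneg_bounded)
    fix n
    let ?v = "\<Sum>k<n. c k *\<^sub>R e k" and ?s = "\<Sum>k<n. (c k)\<^sup>2"
    have "inner (e k) ?v = c k" if "k < n" for k
      using that by (simp add: inner_sum_right inner_onb[OF e] if_distrib cong: if_cong)
    then have "(\<Sum>k<n. inner (e k) ?v * c k) = ?s" by (simp add: power2_eq_square)
    then have le: "?s \<le> C * norm ?v" using C(2)[where n=n and v="?v"] by simp
    have nv: "(norm ?v)\<^sup>2 = ?s" by (rule norm_sum_onb[OF e]) simp
    show "?s \<le> C\<^sup>2"
    proof (cases "norm ?v = 0")
      case False
      have "norm ?v * norm ?v \<le> C * norm ?v" using le nv by (simp add: power2_eq_square)
      then have "norm ?v \<le> C" using False by simp
      then have "(norm ?v)\<^sup>2 \<le> C\<^sup>2" by (intro power_mono) auto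
      then show ?thesis using nv by simp
    qed (use nv in simp)
  qed simp
qed

section \<open>Integrability from small Gaussian means\<close>

lemma adj_add: "adj F (v + w) = adj F v + adj F w"
  by (rule blinfun_eqI) (simp add: inner_add_right blinfun.add_left)

lemma adj_scale: "adj F (c *\<^sub>R v) = c *\<^sub>R adj F v"
  by (rule blinfun_eqI) (simp add: blinfun.scaleR_left)

lemma adj_0 [simp]: "adj F 0 = 0"
  using adj_scale[of F 0 0] by simp

lemma adj_sum: "adj F (\<Sum>k\<in>I. v k) = (\<Sum>k\<in>I. adj F (v k))"
  by (rule blinfun_eqI) (simp add: inner_sum_right blinfun.sum_left)

lemma norm_adj_le: "norm (adj F v) \<le> norm F * norm v"
proof (rule norm_blinfun_bound)
  fix u
  have "norm (blinfun_apply (adj F v) u) \<le> norm (blinfun_apply F u) * norm v"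
    by (simp add: Cauchy_Schwarz_ineq2)
  also have "\<dots> \<le> (norm F * norm u) * norm v" by (intro mult_right_mono norm_blinfun) simp
  finally show "norm (blinfun_apply (adj F v) u) \<le> norm F * norm v * norm u" by (simp add: mult_ac)
qed simp

lemma bounded_linear_adj: "bounded_linear (adj F)"
  by (rule bounded_linear_intro[of _ "norm F"])
    (simp_all add: adj_add adj_scale norm_adj_le mult.commute[of "norm _" "norm F"])

lemma ennreal_tendsto_0I:
  fixes \<delta> :: "'i \<Rightarrow> ennreal"
  assumes "\<And>e::real. e > 0 \<Longrightarrow> eventually (\<lambda>i. \<delta> i \<le> ennreal e) F"
  shows "(\<delta> \<longlongrightarrow> 0) F"
proof (rule order_tendstoI)
  fix a :: ennreal assume a: "0 < a"
  obtain e :: real where e: "e > 0" "ennreal e < a"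
  proof (cases a)
    case (real r)
    then show ?thesis using a by (intro that[of "r / 2"]) (auto simp: ennreal_less_iff)
  next
    case top
    then show ?thesis by (intro that[of 1]) auto
  qed
  from assms[OF e(1)] show "eventually (\<lambda>i. \<delta> i < a) F" by eventually_elim (use e(2) in auto)
qed auto

locale levy_integrand = cyl_levy M L a Q \<mu>
  for M :: "'w measure"
    and L :: "real \<Rightarrow> ('u::real_normed_vector \<Rightarrow>\<^sub>L real) \<Rightarrow> 'w \<Rightarrow> real"
    and a :: "('u \<Rightarrow>\<^sub>L real) \<Rightarrow> real"
    and Q :: "('u \<Rightarrow>\<^sub>L real) \<Rightarrow>\<^sub>L (('u \<Rightarrow>\<^sub>L real) \<Rightarrow>\<^sub>L real)"
    and \<mu> :: "'u set \<Rightarrow> ennreal" +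
  fixes T :: real and e :: "nat \<Rightarrow> 'v::{real_inner, banach, second_countable_topology}"
    and f :: "real \<Rightarrow> 'u \<Rightarrow>\<^sub>L 'v"
  assumes T: "T > 0" and onb: "orthonormal_basis e" and reg: "weakly_regulated T f"
begin

abbreviation fs :: "real \<Rightarrow> 'v \<Rightarrow> 'u \<Rightarrow>\<^sub>L real" where "fs s v \<equiv> adj (f s) v"

lemma regulated_fs: "regulated T (\<lambda>s. fs s v)"
  using reg by (simp add: weakly_regulated_def)

text \<open>Regulatedness is given for each \<open>v\<close> separately and bounds
  \<open>fs s v\<close> in \<open>s\<close> pointwise in \<open>v\<close>. Uniform boundedness turns
  this into a bound on the operators.\<close>

lemma fs_bounded:
  obtains C where "C \<ge> 0" "\<And>s v. s \<in> {0..T} \<Longrightarrow> norm (fs s v) \<le> C * norm v"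
proof (rule uniform_boundedness_seminorms[of "{0..T}" "\<lambda>s v. norm (fs s v)"])
  show "continuous_on UNIV (\<lambda>v. norm (fs s v))" for s
    by (intro continuous_intros bounded_linear.continuous_on[OF bounded_linear_adj])
  show "norm (fs s (v + w)) \<le> norm (fs s v) + norm (fs s w)" for s v w
    by (simp add: adj_add norm_triangle_ineq)
  show "norm (fs s (c *\<^sub>R v)) = \<bar>c\<bar> * norm (fs s v)" for s c v by (simp add: adj_scale)
  show "\<exists>C. \<forall>s\<in>{0..T}. norm (fs s v) \<le> C" for v
    by (rule regulated_bounded[OF regulated_fs[of v]]) blast
qed auto

lemma measurable_fs: "continuous_on UNIV \<phi> \<Longrightarrow> (\<lambda>s. \<phi> (fs s v)) \<in> borel_measurable (leb T)"
  for \<phi> :: "_ \<Rightarrow> 'c::metric_space"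
  by (rule measurable_continuous_regulated[OF T regulated_fs])

lemma measurable_indicator_fs:
  assumes A[measurable]: "A \<in> sets borel"
  shows "(\<lambda>s. \<Psi> (indicator A s *\<^sub>R fs s v)) \<in> borel_measurable (leb T)"
proof -
  have "(\<lambda>s. indicator A s *\<^sub>R \<Psi> (fs s v)) \<in> borel_measurable (leb T)"
    by (rule borel_measurable_scaleR[OF measurable_restrict_space1 measurable_fs[OF continuous_\<Psi>]]) simp
  moreover have "indicator A s *\<^sub>R \<Psi> (fs s v) = \<Psi> (indicator A s *\<^sub>R fs s v)" for s
    by (auto simp: indicator_def)
  ultimately show ?thesis by simp
qed

text \<open>For \<open>h = e\<close> and \<open>I = {m..n}\<close>, splitting \<open>kappa\<close> into its Gaussian part \<open>qterm\<close> and its jump part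
  \<open>jterm\<close> yields conditions (2) and (3).\<close>

definition kappa :: "(nat \<Rightarrow> 'v) \<Rightarrow> nat set \<Rightarrow> ennreal" where
  "kappa h I = (\<integral>\<^sup>+s. (\<integral>\<^sup>+g. ennreal (kexp (fs s (\<Sum>k\<in>I. g k *\<^sub>R h k))) \<partial>gauss I) \<partial>leb T)"

definition qterm :: "(nat \<Rightarrow> 'v) \<Rightarrow> nat \<Rightarrow> real \<Rightarrow> real" where
  "qterm h k s = blinfun_apply (blinfun_apply Q (fs s (h k))) (fs s (h k))"

definition jterm :: "(nat \<Rightarrow> 'v) \<Rightarrow> nat set \<Rightarrow> real \<Rightarrow> ennreal" where
  "jterm h I s = (\<integral>\<^sup>+u. ennreal (1 - exp (- (\<Sum>k\<in>I. (blinfun_apply (fs s (h k)) u)\<^sup>2) / 2))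
     \<partial>cyl_restr \<mu> ((\<lambda>k. fs s (h k)) ` I))"

lemma fs_sum: "fs s (\<Sum>k\<in>I. g k *\<^sub>R h k) = (\<Sum>k\<in>I. g k *\<^sub>R fs s (h k))"
  by (simp add: adj_sum adj_scale)

lemma qterm_nonneg: "qterm h k s \<ge> 0"
  by (simp add: qterm_def Q_nonneg)

lemma qterm_measurable [measurable]: "qterm h k \<in> borel_measurable (leb T)"
  unfolding qterm_def
  by (rule measurable_fs[of "\<lambda>x. blinfun_apply (blinfun_apply Q x) x"]) (intro continuous_intros)

text \<open>A jointly measurable version of the integrand of \<open>kappa\<close>, equal to it off
  countably many times. Integrals over \<open>s\<close> do not notice the change, and Fubini becomes
  applicable.\<close>

lemma kappa_version:
  assumes I: "finite I"
  obtains \<kappa> N where "\<kappa> \<in> borel_measurable (leb T \<Otimes>\<^sub>M gauss I)" "countable N"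
    "\<And>s g. s \<in> {0..T} \<Longrightarrow> s \<notin> N \<Longrightarrow> g \<in> space (gauss I) \<Longrightarrow> \<kappa> (s, g) = kexp (fs s (\<Sum>k\<in>I. g k *\<^sub>R h k))"
proof (rule measurable_regulated_Caratheodory[of T I "\<lambda>k s. fs s (h k)" "\<lambda>y g. kexp (\<Sum>k\<in>I. g k *\<^sub>R y k)" "gauss I", OF T regulated_fs I])
  show "(\<lambda>g. kexp (\<Sum>k\<in>I. g k *\<^sub>R y k)) \<in> borel_measurable (gauss I)" for y
    by (rule measurable_gauss_continuous[OF continuous_kexp])
  show "(\<lambda>j. kexp (\<Sum>k\<in>I. g k *\<^sub>R Y j k)) \<longlonglongrightarrow> kexp (\<Sum>k\<in>I. g k *\<^sub>R y k)"
    if "\<And>k. k \<in> I \<Longrightarrow> (\<lambda>j. Y j k) \<longlonglongrightarrow> y k" for Y y g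
    by (rule continuous_on_tendsto_compose[OF continuous_kexp]) (auto intro!: tendsto_intros that)
qed (auto simp: fs_sum intro: that)

lemma kappa_swap:
  assumes I: "finite I"
  shows "(\<integral>\<^sup>+g. (\<integral>\<^sup>+s. ennreal (kexp (fs s (\<Sum>k\<in>I. g k *\<^sub>R h k))) \<partial>leb T) \<partial>gauss I) = kappa h I" (is ?swap)
    and "(\<integral>\<^sup>+g. (\<integral>\<^sup>+s. ennreal (kexp (fs s (\<Sum>k\<in>I. g k *\<^sub>R h k))) \<partial>leb T)\<^sup>2 \<partial>gauss I) \<le> 3 * (kappa h I)\<^sup>2" (is ?Hoelder)
    and "jterm h I \<in> borel_measurable (leb T)" (is ?meas)
    and "(\<lambda>g. \<integral>\<^sup>+s. ennreal (kexp (fs s (\<Sum>k\<in>I. g k *\<^sub>R h k))) \<partial>leb T) \<in> borel_measurable (gauss I)" (is ?gmeas)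
proof -
  obtain \<kappa> N where [measurable]: "\<kappa> \<in> borel_measurable (leb T \<Otimes>\<^sub>M gauss I)" and N: "countable N"
    and \<kappa>: "\<And>s g. s \<in> {0..T} \<Longrightarrow> s \<notin> N \<Longrightarrow> g \<in> space (gauss I) \<Longrightarrow> \<kappa> (s, g) = kexp (fs s (\<Sum>k\<in>I. g k *\<^sub>R h k))"
    using kappa_version[OF I] by blast
  interpret S: finite_measure "leb T" by (rule finite_measure_leb)
  interpret G: prob_space "gauss I" by (rule prob_space_gauss)
  interpret P: pair_sigma_finite "leb T" "gauss I" ..
  let ?K = "\<lambda>s g. ennreal (kexp (fs s (\<Sum>k\<in>I. g k *\<^sub>R h k)))"
  have s_int: "(\<integral>\<^sup>+s. ?K s g \<partial>leb T) = (\<integral>\<^sup>+s. ennreal (\<kappa> (s, g)) \<partial>leb T)" if "g \<in> space (gauss I)" for g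
    by (intro nn_integral_cong_AE AE_leb_if_countable[OF N]) (use \<kappa> that in auto)
  have g_int: "(\<integral>\<^sup>+g. ?K s g \<partial>gauss I) = (\<integral>\<^sup>+g. ennreal (\<kappa> (s, g)) \<partial>gauss I)"
    if "s \<in> {0..T}" "s \<notin> N" for s
    by (intro nn_integral_cong) (use \<kappa> that in auto)
  have g2_int: "(\<integral>\<^sup>+g. (?K s g)\<^sup>2 \<partial>gauss I) = (\<integral>\<^sup>+g. (ennreal (\<kappa> (s, g)))\<^sup>2 \<partial>gauss I)"
    if "s \<in> {0..T}" "s \<notin> N" for s
    by (intro nn_integral_cong) (use \<kappa> that in auto)
  have kap: "kappa h I = (\<integral>\<^sup>+s. (\<integral>\<^sup>+g. ennreal (\<kappa> (s, g)) \<partial>gauss I) \<partial>leb T)"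
    unfolding kappa_def by (intro nn_integral_cong_AE AE_leb_if_countable[OF N] g_int)
  have "(\<integral>\<^sup>+g. (\<integral>\<^sup>+s. ?K s g \<partial>leb T) \<partial>gauss I) = (\<integral>\<^sup>+g. (\<integral>\<^sup>+s. ennreal (\<kappa> (s, g)) \<partial>leb T) \<partial>gauss I)"
    by (intro nn_integral_cong s_int)
  also have "\<dots> = kappa h I" unfolding kap by (rule P.Fubini') measurable
  finally show sw: ?swap .
  have "(\<integral>\<^sup>+g. (\<integral>\<^sup>+s. ?K s g \<partial>leb T)\<^sup>2 \<partial>gauss I) = (\<integral>\<^sup>+g. (\<integral>\<^sup>+s. ennreal (\<kappa> (s, g)) \<partial>leb T)\<^sup>2 \<partial>gauss I)"
    by (intro nn_integral_cong) (simp add: s_int)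
  also have "\<dots> \<le> 3 * (\<integral>\<^sup>+g. (\<integral>\<^sup>+s. ennreal (\<kappa> (s, g)) \<partial>leb T) \<partial>gauss I)\<^sup>2"
  proof (rule reverse_Hoelder_mixture)
    show "AE s in leb T. (\<integral>\<^sup>+g. (ennreal (\<kappa> (s, g)))\<^sup>2 \<partial>gauss I) \<le> 3 * (\<integral>\<^sup>+g. ennreal (\<kappa> (s, g)) \<partial>gauss I)\<^sup>2"
    proof (rule AE_leb_if_countable[OF N])
      fix s assume s: "s \<in> {0..T}" "s \<notin> N"
      show "(\<integral>\<^sup>+g. (ennreal (\<kappa> (s, g)))\<^sup>2 \<partial>gauss I) \<le> 3 * (\<integral>\<^sup>+g. ennreal (\<kappa> (s, g)) \<partial>gauss I)\<^sup>2"
        unfolding g_int[OF s, symmetric] g2_int[OF s, symmetric] fs_sum by (rule reverse_Hoelder_kexp[OF I])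
    qed
    show "(\<lambda>p. ennreal (\<kappa> p)) \<in> borel_measurable (leb T \<Otimes>\<^sub>M gauss I)" by measurable
  qed (rule S.sigma_finite_measure_axioms G.sigma_finite_measure_axioms)+
  also have "(\<integral>\<^sup>+g. (\<integral>\<^sup>+s. ennreal (\<kappa> (s, g)) \<partial>leb T) \<partial>gauss I) = kappa h I"
    unfolding kap by (rule P.Fubini') measurable
  finally show ?Hoelder .
  \<comment> \<open>The measure inside \<open>jterm\<close> changes with \<open>s\<close>.
    Measurability is obtained by subtracting the finite trace part from the Gaussian mean of
    \<open>kexp\<close>.\<close>
  show ?meas
  proof (rule measurable_leb_if_countable_eq[OF _ N])
    show "(\<lambda>s. (\<integral>\<^sup>+g. ennreal (\<kappa> (s, g)) \<partial>gauss I) - ennreal ((\<Sum>k\<in>I. qterm h k s) / 2)) \<in> borel_measurable (leb T)"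
      by measurable
    fix s assume s: "s \<in> {0..T}" "s \<notin> N"
    have "(\<integral>\<^sup>+g. ennreal (\<kappa> (s, g)) \<partial>gauss I) = ennreal ((\<Sum>k\<in>I. qterm h k s) / 2) + jterm h I s"
      unfolding g_int[OF s, symmetric] fs_sum jterm_def qterm_def by (rule gauss_mean_kexp[OF I])
    then show "(\<integral>\<^sup>+g. ennreal (\<kappa> (s, g)) \<partial>gauss I) - ennreal ((\<Sum>k\<in>I. qterm h k s) / 2) = jterm h I s"
      by (simp add: ennreal_add_diff_cancel_left)
  qed simp
  have "(\<lambda>g. \<integral>\<^sup>+s. ennreal (\<kappa> (s, g)) \<partial>leb T) \<in> borel_measurable (gauss I)" by measurable
  then show ?gmeas by (simp add: s_int cong: measurable_cong)
qed

lemma kappa_split: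
  assumes I: "finite I"
  shows "kappa h I = ennreal (1 / 2) * (\<Sum>k\<in>I. \<integral>\<^sup>+s. ennreal (qterm h k s) \<partial>leb T) + (\<integral>\<^sup>+s. jterm h I s \<partial>leb T)"
proof -
  have q: "ennreal ((\<Sum>k\<in>I. qterm h k s) / 2) = ennreal (1 / 2) * (\<Sum>k\<in>I. ennreal (qterm h k s))" for s
  proof -
    have "ennreal ((\<Sum>k\<in>I. qterm h k s) / 2) = ennreal (1 / 2 * (\<Sum>k\<in>I. qterm h k s))" by simp
    also have "\<dots> = ennreal (1 / 2) * ennreal (\<Sum>k\<in>I. qterm h k s)"
      by (rule ennreal_mult) (auto intro: sum_nonneg qterm_nonneg)
    finally show ?thesis by (simp add: sum_ennreal qterm_nonneg)
  qed
  have "kappa h I = (\<integral>\<^sup>+s. ennreal (1 / 2) * (\<Sum>k\<in>I. ennreal (qterm h k s)) + jterm h I s \<partial>leb T)"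
    unfolding kappa_def fs_sum gauss_mean_kexp[OF I] jterm_def q[symmetric] by (simp add: qterm_def)
  also have "\<dots> = (\<integral>\<^sup>+s. ennreal (1 / 2) * (\<Sum>k\<in>I. ennreal (qterm h k s)) \<partial>leb T) + (\<integral>\<^sup>+s. jterm h I s \<partial>leb T)"
    by (rule nn_integral_add[OF _ kappa_swap(3)[OF I]]) measurable
  also have "(\<integral>\<^sup>+s. ennreal (1 / 2) * (\<Sum>k\<in>I. ennreal (qterm h k s)) \<partial>leb T) = ennreal (1 / 2) * (\<Sum>k\<in>I. \<integral>\<^sup>+s. ennreal (qterm h k s) \<partial>leb T)"
    by (subst nn_integral_cmult) (auto simp: nn_integral_sum)
  finally show ?thesis .
qed

lemma nn_integral_trace_conj:
  "(\<integral>\<^sup>+ s\<in>{0..T}. trace_conj e Q (f s) \<partial>lborel) = (\<Sum>k. \<integral>\<^sup>+s. ennreal (qterm e k s) \<partial>leb T)"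
proof -
  have "(\<integral>\<^sup>+ s\<in>{0..T}. trace_conj e Q (f s) \<partial>lborel) = (\<integral>\<^sup>+s. (\<Sum>k. ennreal (qterm e k s)) \<partial>leb T)"
    by (subst nn_integral_restrict_space) (simp_all add: trace_conj_def qterm_def)
  also have "\<dots> = (\<Sum>k. \<integral>\<^sup>+s. ennreal (qterm e k s) \<partial>leb T)"
    by (rule nn_integral_suminf) measurable
  finally show ?thesis .
qed

lemma step_limit_int_sum:
  assumes I: "finite I" and X: "\<And>k. k \<in> I \<Longrightarrow> step_limit_int T (h k) (X k)"
  shows "step_limit_int T (\<lambda>s. \<Sum>k\<in>I. c k *\<^sub>R h k s) (\<lambda>\<omega>. \<Sum>k\<in>I. c k * X k \<omega>)"
  using I X
proof induction
  case empty
  have "step_limit_int T (\<lambda>_. 0) (\<lambda>_. 0)"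
    unfolding step_limit_int_def
    by (intro conjI exI[of _ "\<lambda>_. []"] exI[of _ 0]) (auto simp: steps_on_def step_fun_def step_int_def[abs_def] tendsto_prob_def)
  then show ?case by simp
next
  case (insert k I)
  then have "step_limit_int T (\<lambda>s. (\<Sum>k\<in>I. c k *\<^sub>R h k s) + c k *\<^sub>R h k s) (\<lambda>\<omega>. (\<Sum>k\<in>I. c k * X k \<omega>) + c k * X k \<omega>)"
    by (intro step_limit_int_lincomb) auto
  then show ?case using insert.hyps by (simp add: add.commute)
qed

lemma step_limit_int_fs_exists:
  assumes A: "A \<in> sets borel"
  obtains X where "step_limit_int T (\<lambda>s. indicator A s *\<^sub>R fs s v) X"
proof -
  obtain xs C where "\<And>n. steps_on T (xs n)" "\<And>n s. s \<in> {0..T} \<Longrightarrow> norm (step_fun (xs n) s) \<le> C"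
    "AE s in leb T. (\<lambda>n. step_fun (xs n) s) \<longlonglongrightarrow> indicator A s *\<^sub>R fs s v"
    using step_approximation[OF T A regulated_fs] by blast
  from step_limit_int_exists[OF less_imp_le[OF T] this] that show thesis by blast
qed

lemma integrable_\<Psi>_fs:
  assumes A: "A \<in> sets borel"
  shows "integrable (leb T) (\<lambda>s. \<Psi> (indicator A s *\<^sub>R fs s v))"
proof -
  interpret finite_measure "leb T" by (rule finite_measure_leb)
  obtain C where C: "\<And>s. s \<in> {0..T} \<Longrightarrow> norm (fs s v) \<le> C" using regulated_bounded[OF regulated_fs] by blast
  obtain B where B: "B \<ge> 0" "\<And>x. norm x \<le> C \<Longrightarrow> cmod (\<Psi> x) \<le> B" using \<Psi>_bounded by blast
  show ?thesis
    by (rule integrable_const_bound[of _ B]) (use B C measurable_indicator_fs[OF A] in \<open>auto simp: indicator_def space_restrict_space\<close>)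
qed

text \<open>The squared modulus is \<open>exp (- 2 I)\<close>, and
  \<open>1 - exp (- y) \<le> y\<close>. As \<open>kexp\<close> is nonnegative, \<open>A\<close> may
  be enlarged to the whole interval, so that one bound by \<open>kappa\<close> serves all
  \<open>A\<close>.\<close>

lemma one_minus_cmod_exp_le:
  assumes A: "A \<in> sets borel"
  shows "ennreal (1 - (cmod (exp (LINT s|leb T. \<Psi> (indicator A s *\<^sub>R fs s v))))\<^sup>2) \<le> 2 * (\<integral>\<^sup>+s. ennreal (kexp (fs s v)) \<partial>leb T)"
proof -
  let ?I = "LINT s|leb T. kexp (indicator A s *\<^sub>R fs s v)"
  have re: "Re (LINT s|leb T. \<Psi> (indicator A s *\<^sub>R fs s v)) = - ?I"
    using integral_Re[OF integrable_\<Psi>_fs[OF A]] by (simp add: kexp_def)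
  have int: "integrable (leb T) (\<lambda>s. kexp (indicator A s *\<^sub>R fs s v))"
    using integrable_Re[OF integrable_\<Psi>_fs[OF A]] by (simp add: kexp_def)
  have "1 - (cmod (exp (LINT s|leb T. \<Psi> (indicator A s *\<^sub>R fs s v))))\<^sup>2 = 1 - exp (- 2 * ?I)"
    by (simp add: re power2_eq_square flip: exp_add)
  also have "\<dots> \<le> 2 * ?I" using exp_ge_add_one_self[of "- 2 * ?I"] by simp
  finally have "ennreal (1 - (cmod (exp (LINT s|leb T. \<Psi> (indicator A s *\<^sub>R fs s v))))\<^sup>2) \<le> ennreal (2 * ?I)"
    by (rule ennreal_leI)
  also have "\<dots> = 2 * ennreal ?I"
    by (subst ennreal_mult) (auto intro!: integral_nonneg_AE simp: kexp_nonneg)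
  also have "ennreal ?I = (\<integral>\<^sup>+s. ennreal (kexp (indicator A s *\<^sub>R fs s v)) \<partial>leb T)"
    using int by (intro nn_integral_eq_integral[symmetric]) (auto simp: kexp_nonneg)
  also have "\<dots> \<le> (\<integral>\<^sup>+s. ennreal (kexp (fs s v)) \<partial>leb T)"
    by (intro nn_integral_mono ennreal_leI) (auto simp: indicator_def kexp_nonneg)
  finally show ?thesis by (simp add: mult_left_mono)
qed

text \<open>Continuity at 0 of the integral as a function of the vector, which permits expanding the
  vector in the basis under the integral.\<close>

lemma step_limit_int_fs_tendsto:
  assumes A: "A \<in> sets borel" and w: "w \<longlonglongrightarrow> 0"
    and X: "\<And>n. step_limit_int T (\<lambda>s. indicator A s *\<^sub>R fs s (w n)) (X n)"
  shows "tendsto_prob M X (\<lambda>_. 0) sequentially"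
proof (rule tendsto_prob_zero_if_char[OF step_limit_int_measurable[OF X]])
  fix t :: real
  obtain C where C: "C \<ge> 0" "\<And>s v. s \<in> {0..T} \<Longrightarrow> norm (fs s v) \<le> C * norm v" using fs_bounded by blast
  obtain B where B: "\<And>n. norm (w n) \<le> B" using Bseq_def convergent_imp_Bseq[OF convergentI[OF w]] by (auto simp: Bseq_def)
  have s0: "step_limit_int T (\<lambda>_. 0) (\<lambda>_. 0)" using step_limit_int_sum[of "{}"] by simp
  have "step_limit_int T (\<lambda>s. indicator A s *\<^sub>R fs s (t *\<^sub>R w n)) (\<lambda>\<omega>. t * X n \<omega>)" for n
    using step_limit_int_lincomb[OF s0 X, of t n] by (simp add: adj_scale mult.commute)
  from step_limit_int_char[OF less_imp_le[OF T] this measurable_indicator_fs[OF A]]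
  have "(LINT \<omega>|M. iexp (t * X n \<omega>)) = exp (LINT s|leb T. \<Psi> (indicator A s *\<^sub>R fs s (t *\<^sub>R w n)))" for n .
  moreover have "(\<lambda>n. exp (LINT s|leb T. \<Psi> (indicator A s *\<^sub>R fs s (t *\<^sub>R w n)))) \<longlonglongrightarrow> exp (LINT s|leb T. \<Psi> 0)"
  proof (intro tendsto_exp \<Psi>_integral_tendsto[where C="C * (\<bar>t\<bar> * B)"] measurable_indicator_fs A)
    have "(\<lambda>n. fs s (t *\<^sub>R w n)) \<longlonglongrightarrow> fs s (t *\<^sub>R 0)" for s
      by (intro bounded_linear.tendsto[OF bounded_linear_adj] tendsto_intros w)
    then have "(\<lambda>n. indicator A s *\<^sub>R fs s (t *\<^sub>R w n)) \<longlonglongrightarrow> indicator A s *\<^sub>R fs s (t *\<^sub>R 0)" for s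
      by (intro tendsto_intros)
    moreover have "fs s 0 = 0" for s using adj_scale[of "f s" 0 0] by simp
    ultimately show "AE s in leb T. (\<lambda>n. indicator A s *\<^sub>R fs s (t *\<^sub>R w n)) \<longlonglongrightarrow> 0" by simp
    fix n s assume s: "s \<in> {0..T}"
    have "norm (fs s (t *\<^sub>R w n)) \<le> C * norm (t *\<^sub>R w n)" by (rule C(2)[OF s])
    also have "\<dots> \<le> C * (\<bar>t\<bar> * B)" using B C(1) by (auto intro!: mult_left_mono)
    finally show "norm (indicator A s *\<^sub>R fs s (t *\<^sub>R w n)) \<le> C * (\<bar>t\<bar> * B)"
      using order_trans[OF norm_ge_zero] by (auto simp: indicator_def)
  qed simp
  ultimately show "(\<lambda>n. LINT \<omega>|M. iexp (t * X n \<omega>)) \<longlonglongrightarrow> 1" by simp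
qed

lemma symmetrized_le_kappa:
  assumes A: "A \<in> sets borel" and X: "\<And>k. step_limit_int T (\<lambda>s. indicator A s *\<^sub>R fs s (e k)) (X k)"
    and I: "finite I"
  shows "(\<integral>\<^sup>+\<omega>. ennreal (1 - exp (- (\<Sum>k\<in>I. (X k (fst \<omega>) - X k (snd \<omega>))\<^sup>2) / 2)) \<partial>(M \<Otimes>\<^sub>M M)) \<le> 2 * kappa e I"
proof -
  have "(\<integral>\<^sup>+\<omega>. ennreal (1 - exp (- (\<Sum>k\<in>I. (X k (fst \<omega>) - X k (snd \<omega>))\<^sup>2) / 2)) \<partial>(M \<Otimes>\<^sub>M M))
    = (\<integral>\<^sup>+g. ennreal (1 - (cmod (LINT \<omega>|M. iexp (\<Sum>k\<in>I. g k * X k \<omega>)))\<^sup>2) \<partial>gauss I)"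
    by (rule nn_integral_symmetrization_gauss[OF step_limit_int_measurable[OF X] I])
  also have "\<dots> \<le> (\<integral>\<^sup>+g. 2 * (\<integral>\<^sup>+s. ennreal (kexp (fs s (\<Sum>k\<in>I. g k *\<^sub>R e k))) \<partial>leb T) \<partial>gauss I)"
  proof (rule nn_integral_mono)
    fix g
    have "step_limit_int T (\<lambda>s. indicator A s *\<^sub>R fs s (\<Sum>k\<in>I. g k *\<^sub>R e k)) (\<lambda>\<omega>. \<Sum>k\<in>I. g k * X k \<omega>)"
      using step_limit_int_sum[OF I X, of g] by (simp add: fs_sum scaleR_sum_right mult.commute)
    from step_limit_int_char[OF less_imp_le[OF T] this measurable_indicator_fs[OF A]] one_minus_cmod_exp_le[OF A]
    show "ennreal (1 - (cmod (LINT \<omega>|M. iexp (\<Sum>k\<in>I. g k * X k \<omega>)))\<^sup>2) \<le> 2 * (\<integral>\<^sup>+s. ennreal (kexp (fs s (\<Sum>k\<in>I. g k *\<^sub>R e k))) \<partial>leb T)"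
      by simp
  qed
  also have "\<dots> = 2 * kappa e I"
    by (subst nn_integral_cmult[OF kappa_swap(4)[OF I]]) (simp add: kappa_swap(1)[OF I])
  finally show ?thesis .
qed

lemma stochastically_integrable_if_kappa:
  assumes kap: "\<And>r::real. r > 0 \<Longrightarrow> \<exists>m0. \<forall>m\<ge>m0. \<forall>n. kappa e {m..n} \<le> ennreal r"
  shows "stochastically_integrable M L T f"
  unfolding stochastically_integrable_def
proof (intro conjI reg ballI impI)
  fix A :: "real set" assume A: "A \<in> sets borel"
  have "\<exists>X. \<forall>v. step_limit_int T (\<lambda>s. indicator A s *\<^sub>R fs s v) (X v)"
    by (rule choice) (use step_limit_int_fs_exists[OF A] in blast)
  then obtain Z where Z: "\<And>v. step_limit_int T (\<lambda>s. indicator A s *\<^sub>R fs s v) (Z v)" by blast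
  define X where "X k = Z (e k)" for k
  have X: "step_limit_int T (\<lambda>s. indicator A s *\<^sub>R fs s (e k)) (X k)" for k by (simp add: X_def Z)
  have [measurable]: "Z v \<in> borel_measurable M" "X k \<in> borel_measurable M" for v k
    using Z X by (auto intro: step_limit_int_measurable)
  have partial: "tendsto_prob M (\<lambda>n \<omega>. \<Sum>k<n. inner (e k) v * X k \<omega>) (Z v) sequentially" for v
  proof -
    have "step_limit_int T (\<lambda>s. indicator A s *\<^sub>R fs s (proj_onb e n v - v)) (\<lambda>\<omega>. (\<Sum>k<n. inner (e k) v * X k \<omega>) + (-1) * Z v \<omega>)" for n
    proof -
      have "step_limit_int T (\<lambda>s. (\<Sum>k<n. inner (e k) v *\<^sub>R (indicator A s *\<^sub>R fs s (e k))) + (-1) *\<^sub>R (indicator A s *\<^sub>R fs s v))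
          (\<lambda>\<omega>. (\<Sum>k<n. inner (e k) v * X k \<omega>) + (-1) * Z v \<omega>)"
        by (intro step_limit_int_lincomb step_limit_int_sum X Z) simp
      moreover have "fs s (proj_onb e n v - v) = (\<Sum>k<n. inner (e k) v *\<^sub>R fs s (e k)) + (-1) *\<^sub>R fs s v" for s
        using adj_add[of "f s" "proj_onb e n v" "(-1) *\<^sub>R v"] adj_scale[of "f s" "-1" v]
        by (simp add: proj_onb_def fs_sum)
      ultimately show ?thesis by (simp add: scaleR_sum_right scaleR_diff_right mult.commute)
    qed
    moreover have "(\<lambda>n. proj_onb e n v - v) \<longlonglongrightarrow> 0"
      using proj_onb_tendsto[OF onb, of v] by (simp add: LIM_zero)
    ultimately have "tendsto_prob M (\<lambda>n \<omega>. (\<Sum>k<n. inner (e k) v * X k \<omega>) + (-1) * Z v \<omega>) (\<lambda>_. 0) sequentially"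
      by (rule step_limit_int_fs_tendsto[OF A, rotated])
    then show ?thesis unfolding tendsto_prob_def by simp
  qed
  \<comment> \<open>The supremum over \<open>n\<close> is taken first, since summability of the
    whole tail from \<open>m\<close> on is at stake before \<open>m\<close> grows.\<close>
  define \<delta> where "\<delta> m = (SUP n. 2 * kappa e {m..n})" for m
  have "\<delta> \<longlonglongrightarrow> 0"
  proof (rule ennreal_tendsto_0I)
    fix r :: real assume "r > 0"
    then obtain m0 where m0: "\<forall>m\<ge>m0. \<forall>n. kappa e {m..n} \<le> ennreal (r / 2)" using kap[of "r / 2"] by auto
    have "\<delta> m \<le> ennreal r" if "m \<ge> m0" for m
      unfolding \<delta>_def
    proof (rule SUP_least)
      fix n
      have "2 * kappa e {m..n} \<le> 2 * ennreal (r / 2)" using m0 that by (intro mult_left_mono) auto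
      also have "\<dots> = ennreal r" using \<open>r > 0\<close> ennreal_mult[of 2 "r / 2"] by simp
      finally show "2 * kappa e {m..n} \<le> ennreal r" .
    qed
    then show "eventually (\<lambda>m. \<delta> m \<le> ennreal r) sequentially" unfolding eventually_sequentially by blast
  qed
  moreover have "(\<integral>\<^sup>+\<omega>. ennreal (1 - exp (- (\<Sum>k\<in>{m..n}. (X k (fst \<omega>) - X k (snd \<omega>))\<^sup>2) / 2)) \<partial>(M \<Otimes>\<^sub>M M)) \<le> \<delta> m" for m n
    unfolding \<delta>_def
    by (rule order_trans[OF symmetrized_le_kappa[OF A X finite_atLeastAtMost]]) (rule SUP_upper, simp)
  ultimately obtain c where c: "AE \<omega> in M. summable (\<lambda>k. (X k \<omega> - c k)\<^sup>2)"
    using summable_squares_if_symmetrized[of X \<delta>] by auto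
  define Y where "Y \<omega> = lim (\<lambda>n. \<Sum>k<n. (X k \<omega> - c k) *\<^sub>R e k)" for \<omega>
  have [measurable]: "Y \<in> borel_measurable M"
    unfolding Y_def by (rule borel_measurable_lim_metric) measurable
  have lim_onb: "(\<lambda>n. \<Sum>k<n. inner (e k) v * b k) \<longlonglongrightarrow> inner (lim (\<lambda>n. \<Sum>k<n. b k *\<^sub>R e k)) v"
    if "summable (\<lambda>k. (b k)\<^sup>2)" for b v
  proof -
    have "convergent (\<lambda>n. \<Sum>k<n. b k *\<^sub>R e k)"
      using summable_onb[OF onb that] by (simp add: summable_iff_convergent)
    then have "(\<lambda>n. inner (\<Sum>k<n. b k *\<^sub>R e k) v) \<longlonglongrightarrow> inner (lim (\<lambda>n. \<Sum>k<n. b k *\<^sub>R e k)) v"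
      by (intro tendsto_intros) (simp add: convergent_LIMSEQ_iff)
    then show ?thesis by (simp add: inner_sum_left mult.commute)
  qed
  \<comment> \<open>For fixed \<open>v\<close> the sums with \<open>X k\<close> converge in
    probability to \<open>Z v\<close>, those with \<open>X k - c k\<close> to
    \<open>inner (Y \<omega>) v\<close>. Their difference is deterministic and converges in
    probability, so it is bounded; Banach--Steinhaus does the rest.\<close>
  have "summable (\<lambda>k. (c k)\<^sup>2)"
  proof (rule square_summable_if_weakly_bounded[OF onb])
    fix v
    have "tendsto_prob M (\<lambda>n \<omega>. \<Sum>k<n. inner (e k) v * (X k \<omega> - c k)) (\<lambda>\<omega>. inner (Y \<omega>) v) sequentially"
      by (rule tendsto_prob_if_AE, measurable, use c in eventually_elim) (simp add: Y_def lim_onb)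
    then have "tendsto_prob M (\<lambda>n \<omega>. (\<Sum>k<n. inner (e k) v * X k \<omega>) + (-1) * (\<Sum>k<n. inner (e k) v * (X k \<omega> - c k)))
        (\<lambda>\<omega>. Z v \<omega> + (-1) * inner (Y \<omega>) v) sequentially"
      by (intro tendsto_prob_add tendsto_prob_cmult partial) measurable
    then have t: "tendsto_prob M (\<lambda>n _. \<Sum>k<n. inner (e k) v * c k) (\<lambda>\<omega>. Z v \<omega> + (-1) * inner (Y \<omega>) v) sequentially"
      by (simp add: right_diff_distrib sum_subtractf)
    have m: "(\<lambda>\<omega>. Z v \<omega> + (-1) * inner (Y \<omega>) v) \<in> borel_measurable M" by measurable
    show "\<exists>C. \<forall>n. \<bar>\<Sum>k<n. inner (e k) v * c k\<bar> \<le> C"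
      by (rule bounded_if_tendsto_prob_const[OF m t]) blast
  qed
  have X2: "AE \<omega> in M. summable (\<lambda>k. (X k \<omega>)\<^sup>2)"
    using c
  proof eventually_elim
    case (elim \<omega>)
    have s: "summable (\<lambda>k. 2 * (X k \<omega> - c k)\<^sup>2 + 2 * (c k)\<^sup>2)"
      by (intro summable_add summable_mult elim \<open>summable (\<lambda>k. (c k)\<^sup>2)\<close>)
    have "(X k \<omega>)\<^sup>2 \<le> 2 * (X k \<omega> - c k)\<^sup>2 + 2 * (c k)\<^sup>2" for k
      using sum_squares_bound[of "X k \<omega> - c k" "c k"] zero_le_power2[of "(X k \<omega> - c k) - c k"]
      by (simp add: power2_eq_square algebra_simps)
    then show ?case by (intro summable_comparison_test'[OF s, of 0]) auto
  qed
  \<comment> \<open>\<open>Z v\<close> was chosen for each \<open>v\<close> separately, with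
    exceptional null sets depending on \<open>v\<close>. \<open>J\<close> is one random vector whose
    inner products are versions of all of them.\<close>
  define J where "J \<omega> = lim (\<lambda>n. \<Sum>k<n. X k \<omega> *\<^sub>R e k)" for \<omega>
  have [measurable]: "J \<in> borel_measurable M"
    unfolding J_def by (rule borel_measurable_lim_metric) measurable
  have "has_cyl_integral M L T (\<lambda>s. indicator A s *\<^sub>R fs s v) (\<lambda>\<omega>. inner (J \<omega>) v)" for v
  proof (rule has_cyl_integral_if_step_limit_int[OF less_imp_le[OF T] step_limit_int_AE_cong[OF Z]])
    have "tendsto_prob M (\<lambda>n \<omega>. \<Sum>k<n. inner (e k) v * X k \<omega>) (\<lambda>\<omega>. inner (J \<omega>) v) sequentially"
      by (rule tendsto_prob_if_AE, measurable, use X2 in eventually_elim) (simp add: J_def lim_onb)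
    then show "AE \<omega> in M. Z v \<omega> = inner (J \<omega>) v"
      by (intro tendsto_prob_unique[OF _ _ _ partial]) measurable
  qed measurable
  then show "\<exists>I\<in>borel_measurable M. \<forall>v. has_cyl_integral M L T (\<lambda>s. indicator A s *\<^sub>R fs s v) (\<lambda>\<omega>. inner (I \<omega>) v)"
    by (intro bexI[of _ J]) auto
qed

end

section \<open>Small Gaussian means from integrability\<close>

text \<open>The concave function \<open>1 - exp (- y)\<close> lies above its chord on
  \<open>[0, c]\<close> and above the chord's end value afterwards. The first form replaces
  \<open>min z 1\<close> by the parabola \<open>z - z^2 / 4\<close>, whose mean is controlled by two
  moments.\<close>

lemma one_minus_exp_ge:
  fixes y c :: real
  assumes y: "y \<ge> 0" and c: "c > 0"
  shows "(1 - exp (- c)) * (y / c - y\<^sup>2 / (4 * c\<^sup>2)) \<le> 1 - exp (- y)"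
    and "(1 - exp (- c)) * min (y / c) 1 \<le> 1 - exp (- y)"
proof -
  have pos: "1 - exp (- c) \<ge> 0" using c by simp
  show m: "(1 - exp (- c)) * min (y / c) 1 \<le> 1 - exp (- y)"
  proof (cases "y \<le> c")
    case True
    define z where "z = y / c"
    have z: "0 \<le> z" "z \<le> 1" and y': "- y = (1 - z) * 0 + z * (- c)" using y c True by (auto simp: z_def)
    have "exp (- y) \<le> (1 - z) * exp 0 + z * exp (- c)"
      using convex_onD[OF exp_convex z, of 0 "- c"] unfolding y' by simp
    then show ?thesis using z by (simp add: z_def[symmetric] min_def algebra_simps)
  next
    case False
    then have "min (y / c) 1 = 1" using c by (simp add: min_def field_simps)
    then show ?thesis using False by simp
  qed
  have "y / c - y\<^sup>2 / (4 * c\<^sup>2) \<le> min (y / c) 1"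
  proof -
    define z where "z = y / c"
    have "y\<^sup>2 / (4 * c\<^sup>2) = z\<^sup>2 / 4" by (simp add: z_def power_divide)
    moreover have "z - z\<^sup>2 / 4 \<le> 1" using zero_le_power2[of "z / 2 - 1"] by (simp add: power2_eq_square field_simps)
    ultimately show ?thesis by (simp add: z_def[symmetric])
  qed
  then have "(1 - exp (- c)) * (y / c - y\<^sup>2 / (4 * c\<^sup>2)) \<le> (1 - exp (- c)) * min (y / c) 1"
    using pos by (rule mult_left_mono)
  with m show "(1 - exp (- c)) * (y / c - y\<^sup>2 / (4 * c\<^sup>2)) \<le> 1 - exp (- y)" by linarith
qed

text \<open>As in the Paley--Zygmund inequality, the second moment bound prevents \<open>K\<close> from being large only on
  a set of small probability.\<close>

lemma (in prob_space) one_minus_exp_mean_le: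
  fixes K :: "'a \<Rightarrow> real"
  assumes [measurable]: "K \<in> borel_measurable M" and K0: "\<And>\<omega>. K \<omega> \<ge> 0"
    and \<kappa>: "(\<integral>\<^sup>+\<omega>. ennreal (K \<omega>) \<partial>M) = ennreal \<kappa>" "\<kappa> \<ge> 0"
    and le: "(\<integral>\<^sup>+\<omega>. (ennreal (K \<omega>))\<^sup>2 \<partial>M) \<le> 3 * (ennreal \<kappa>)\<^sup>2"
  shows "ennreal ((1 - exp (- 3 * \<kappa>)) / 3) \<le> (\<integral>\<^sup>+\<omega>. ennreal (1 - exp (- 2 * K \<omega>)) \<partial>M)"
proof (cases "\<kappa> = 0")
  case False
  then have \<kappa>0: "\<kappa> > 0" using \<kappa>(2) by simp
  have iK: "integrable M K" by (rule integrableI_nonneg) (use K0 \<kappa> in auto)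
  have mK: "(LINT \<omega>|M. K \<omega>) = \<kappa>"
    using \<kappa> nn_integral_eq_integral[OF iK] K0 by (simp add: integral_nonneg_AE)
  have sq: "(ennreal (K \<omega>))\<^sup>2 = ennreal ((K \<omega>)\<^sup>2)" for \<omega> using K0 by (simp add: ennreal_power)
  have le': "(\<integral>\<^sup>+\<omega>. ennreal ((K \<omega>)\<^sup>2) \<partial>M) \<le> ennreal (3 * \<kappa>\<^sup>2)"
    using le \<kappa>(2) by (simp add: sq ennreal_power ennreal_mult)
  have iK2: "integrable M (\<lambda>\<omega>. (K \<omega>)\<^sup>2)"
    by (rule integrableI_nonneg) (use le' in \<open>auto intro: le_less_trans\<close>)
  have mK2: "(LINT \<omega>|M. (K \<omega>)\<^sup>2) \<le> 3 * \<kappa>\<^sup>2"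
    using le' nn_integral_eq_integral[OF iK2] by (simp add: ennreal_le_iff)
  \<comment> \<open>The moments give the parabola a mean of at least \<open>2 x - 3 x^2\<close> with
    \<open>x = \<kappa> / ?c\<close>. This is largest at \<open>x = 1 / 3\<close>, with value
    \<open>1 / 3\<close>.\<close>
  let ?c = "3 * \<kappa>"
  have iE: "integrable M (\<lambda>\<omega>. 1 - exp (- 2 * K \<omega>))"
    by (rule integrable_const_bound[of _ 1]) (use K0 in auto)
  have "1 / 3 \<le> (LINT \<omega>|M. 2 * K \<omega> / ?c - (2 * K \<omega>)\<^sup>2 / (4 * ?c\<^sup>2))"
  proof -
    have "(LINT \<omega>|M. 2 * K \<omega> / ?c - (2 * K \<omega>)\<^sup>2 / (4 * ?c\<^sup>2)) = 2 * \<kappa> / ?c - (4 / (4 * ?c\<^sup>2)) * (LINT \<omega>|M. (K \<omega>)\<^sup>2)"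
      using iK iK2 mK by (simp add: power_mult_distrib)
    moreover have "(4 / (4 * ?c\<^sup>2)) * (LINT \<omega>|M. (K \<omega>)\<^sup>2) \<le> (4 / (4 * ?c\<^sup>2)) * (3 * \<kappa>\<^sup>2)"
      using mK2 by (intro mult_left_mono) auto
    moreover have "2 * \<kappa> / ?c - (4 / (4 * ?c\<^sup>2)) * (3 * \<kappa>\<^sup>2) = 1 / 3"
      using \<kappa>0 by (simp add: power2_eq_square field_simps)
    ultimately show ?thesis by linarith
  qed
  then have "(1 - exp (- ?c)) * (1 / 3) \<le> (1 - exp (- ?c)) * (LINT \<omega>|M. 2 * K \<omega> / ?c - (2 * K \<omega>)\<^sup>2 / (4 * ?c\<^sup>2))"
    using \<kappa>0 by (intro mult_left_mono) auto
  also have "\<dots> = (LINT \<omega>|M. (1 - exp (- ?c)) * (2 * K \<omega> / ?c - (2 * K \<omega>)\<^sup>2 / (4 * ?c\<^sup>2)))" by simp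
  also have "\<dots> \<le> (LINT \<omega>|M. 1 - exp (- 2 * K \<omega>))"
  proof (rule integral_mono[OF _ iE])
    show "integrable M (\<lambda>\<omega>. (1 - exp (- ?c)) * (2 * K \<omega> / ?c - (2 * K \<omega>)\<^sup>2 / (4 * ?c\<^sup>2)))"
      using iK iK2 by (simp add: power_mult_distrib)
    show "(1 - exp (- ?c)) * (2 * K \<omega> / ?c - (2 * K \<omega>)\<^sup>2 / (4 * ?c\<^sup>2)) \<le> 1 - exp (- 2 * K \<omega>)" for \<omega>
      using one_minus_exp_ge(1)[of "2 * K \<omega>" ?c] K0 \<kappa>0 by simp
  qed
  finally have "(1 - exp (- 3 * \<kappa>)) / 3 \<le> (LINT \<omega>|M. 1 - exp (- 2 * K \<omega>))" by simp
  moreover have "(\<integral>\<^sup>+\<omega>. ennreal (1 - exp (- 2 * K \<omega>)) \<partial>M) = ennreal (LINT \<omega>|M. 1 - exp (- 2 * K \<omega>))"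
    using iE K0 by (intro nn_integral_eq_integral) auto
  ultimately show ?thesis by (simp add: ennreal_leI)
qed simp

lemma sum_inner_onb_le:
  assumes e: "orthonormal_basis e"
  shows "(\<Sum>k\<in>{m..n}. (inner (e k) z)\<^sup>2) \<le> (norm (z - proj_onb e m z))\<^sup>2"
proof (cases "m \<le> Suc n")
  case True
  have "(\<Sum>k<m. (inner (e k) z)\<^sup>2) + (\<Sum>k\<in>{m..n}. (inner (e k) z)\<^sup>2) = (\<Sum>k\<in>{..<m} \<union> {m..n}. (inner (e k) z)\<^sup>2)"
    by (rule sum.union_disjoint[symmetric]) auto
  also have "{..<m} \<union> {m..n} = {..<Suc n}" using True by auto
  finally show ?thesis
    using norm_diff_proj_onb[OF e, of z m] norm_diff_proj_onb[OF e, of z "Suc n"]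
      zero_le_power2[of "norm (z - proj_onb e (Suc n) z)"] by linarith
qed simp

context levy_integrand
begin

text \<open>Finiteness for each finite \<open>I\<close> lets \<open>kappa\<close> be treated as a
  real number in the second moment argument.\<close>

lemma kappa_finite:
  assumes I: "finite I"
  shows "kappa h I < \<infinity>"
proof -
  interpret finite_measure "leb T" by (rule finite_measure_leb)
  obtain C where C: "C \<ge> 0" "\<And>s v. s \<in> {0..T} \<Longrightarrow> norm (fs s v) \<le> C * norm v" using fs_bounded by blast
  define r where "r = (\<Sum>k\<in>I. C * norm (h k))"
  have r: "norm (fs s (h k)) \<le> r" if "s \<in> {0..T}" "k \<in> I" for s k
    unfolding r_def by (rule order_trans[OF C(2)[OF that(1)]]) (use I C(1) that(2) in \<open>intro member_le_sum; simp\<close>)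
  obtain B where B: "B \<ge> 0" "\<And>x. (\<And>k. k \<in> I \<Longrightarrow> norm (x k) \<le> r) \<Longrightarrow>
    (\<integral>\<^sup>+g. ennreal (kexp (\<Sum>k\<in>I. g k *\<^sub>R x k)) \<partial>gauss I) \<le> ennreal B"
    by (rule gauss_mean_kexp_bounded[OF I, of r]) (rule that, assumption, blast)
  have "kappa h I \<le> (\<integral>\<^sup>+s. ennreal B \<partial>leb T)"
    unfolding kappa_def fs_sum
    by (rule nn_integral_mono) (use B(2) r in \<open>simp add: space_restrict_space\<close>)
  also have "\<dots> < \<infinity>" by (simp add: ennreal_mult_less_top emeasure_eq_measure)
  finally show ?thesis .
qed

lemma has_cyl_integral_fs_char:
  assumes A: "A \<in> sets borel" and X: "has_cyl_integral M L T (\<lambda>s. indicator A s *\<^sub>R fs s v) X"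
  shows "(LINT \<omega>|M. iexp (X \<omega>)) = exp (LINT s|leb T. \<Psi> (indicator A s *\<^sub>R fs s v))"
  by (rule has_cyl_integral_char[OF T X measurable_indicator_fs[OF A]])

definition Kint :: "'v \<Rightarrow> real" where
  "Kint v = (LINT s|leb T. kexp (fs s v))"

lemma integrable_kexp_fs: "integrable (leb T) (\<lambda>s. kexp (fs s v))"
  using integrable_Re[OF integrable_\<Psi>_fs[of UNIV v]] by (simp add: kexp_def)

lemma ennreal_Kint: "ennreal (Kint v) = (\<integral>\<^sup>+s. ennreal (kexp (fs s v)) \<partial>leb T)"
  unfolding Kint_def using integrable_kexp_fs
  by (intro nn_integral_eq_integral[symmetric]) (auto simp: kexp_nonneg)

lemma Kint_nonneg: "Kint v \<ge> 0"
  unfolding Kint_def by (intro integral_nonneg_AE) (simp add: kexp_nonneg)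

lemma cmod_char_Kint:
  assumes "has_cyl_integral M L T (\<lambda>s. indicator {0..T} s *\<^sub>R fs s v) X"
  shows "cmod (LINT \<omega>|M. iexp (X \<omega>)) = exp (- Kint v)"
proof -
  have "(LINT \<omega>|M. iexp (X \<omega>)) = exp (LINT s|leb T. \<Psi> (indicator {0..T} s *\<^sub>R fs s v))"
    by (rule has_cyl_integral_fs_char[OF _ assms]) simp
  also have "(LINT s|leb T. \<Psi> (indicator {0..T} s *\<^sub>R fs s v)) = (LINT s|leb T. \<Psi> (fs s v))"
    by (intro Bochner_Integration.integral_cong) (auto simp: space_restrict_space)
  finally show ?thesis
    using integral_Re[OF integrable_\<Psi>_fs[of UNIV v]] by (simp add: Kint_def kexp_def)
qed

text \<open>The tail of the symmetrized integral \<open>z\<close> beyond the first \<open>m\<close>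
  basis vectors tends to 0 pointwise, so the mean of \<open>d m\<close> tends to 0. It dominates the
  symmetrized mean over \<open>{m..n}\<close> for every \<open>n\<close> at once, and this is
  bounded below by \<open>(1 - exp (- 3 \<kappa>)) / 3\<close>.\<close>

lemma kappa_small_if_stochastically_integrable:
  assumes int: "stochastically_integrable M L T f" and r: "r > 0"
  shows "\<exists>m0. \<forall>m\<ge>m0. \<forall>n. kappa e {m..n} \<le> ennreal r"
proof -
  have "{0..T} \<in> sets borel" by simp
  with int obtain J where J[measurable]: "J \<in> borel_measurable M"
    and cyl: "\<And>v. has_cyl_integral M L T (\<lambda>s. indicator {0..T} s *\<^sub>R fs s v) (\<lambda>\<omega>. inner (J \<omega>) v)"
    unfolding stochastically_integrable_def by blast
  interpret P: pair_prob_space M M ..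
  define z where "z \<omega> = J (fst \<omega>) - J (snd \<omega>)" for \<omega> :: "'w \<times> 'w"
  have [measurable]: "z \<in> borel_measurable (M \<Otimes>\<^sub>M M)" unfolding z_def by measurable
  define d where "d m \<omega> = 1 - exp (- ((norm (z \<omega> - proj_onb e m (z \<omega>)))\<^sup>2) / 2)" for m \<omega>
  have [measurable]: "d m \<in> borel_measurable (M \<Otimes>\<^sub>M M)" for m unfolding d_def proj_onb_def by measurable
  have d01: "0 \<le> d m \<omega>" "d m \<omega> \<le> 1" for m \<omega> by (auto simp: d_def)
  have "(\<lambda>m. LINT \<omega>|(M \<Otimes>\<^sub>M M). d m \<omega>) \<longlonglongrightarrow> (LINT \<omega>|(M \<Otimes>\<^sub>M M). 0)"
  proof (rule integral_dominated_convergence[where w="\<lambda>_. 1"])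
    show "AE \<omega> in M \<Otimes>\<^sub>M M. (\<lambda>m. d m \<omega>) \<longlonglongrightarrow> 0"
    proof (rule AE_I2)
      fix \<omega>
      have "(\<lambda>m. d m \<omega>) \<longlonglongrightarrow> 1 - exp (- ((norm (z \<omega> - z \<omega>))\<^sup>2) / 2)"
        unfolding d_def by (intro tendsto_intros proj_onb_tendsto onb) auto
      then show "(\<lambda>m. d m \<omega>) \<longlonglongrightarrow> 0" by simp
    qed
  qed (use d01 in auto)
  \<comment> \<open>The lower bound evaluated at \<open>\<kappa> = r\<close>; by strict
    monotonicity, staying below it forces \<open>\<kappa> < r\<close>.\<close>
  moreover have "0 < (1 - exp (- 3 * r)) / 3" using r by simp
  ultimately have "eventually (\<lambda>m. (LINT \<omega>|(M \<Otimes>\<^sub>M M). d m \<omega>) < (1 - exp (- 3 * r)) / 3) sequentially"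
    by (intro order_tendstoD(2)) auto
  then obtain m0 where m0: "\<And>m. m \<ge> m0 \<Longrightarrow> (LINT \<omega>|(M \<Otimes>\<^sub>M M). d m \<omega>) < (1 - exp (- 3 * r)) / 3"
    unfolding eventually_sequentially by blast
  have "kappa e {m..n} \<le> ennreal r" if m: "m \<ge> m0" for m n
  proof -
    let ?I = "{m..n}"
    define X where "X k \<omega> = inner (J \<omega>) (e k)" for k \<omega>
    have [measurable]: "X k \<in> borel_measurable M" for k unfolding X_def by measurable
    interpret G: prob_space "gauss ?I" by (rule prob_space_gauss)
    define K where "K g = Kint (\<Sum>k\<in>?I. g k *\<^sub>R e k)" for g
    obtain \<kappa> where \<kappa>: "kappa e ?I = ennreal \<kappa>" "\<kappa> \<ge> 0"
      using kappa_finite[of ?I e] by (cases "kappa e ?I") auto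
    have eK: "ennreal (K g) = (\<integral>\<^sup>+s. ennreal (kexp (fs s (\<Sum>k\<in>?I. g k *\<^sub>R e k))) \<partial>leb T)" for g
      unfolding K_def by (rule ennreal_Kint)
    have K0: "K g \<ge> 0" for g by (simp add: K_def Kint_nonneg)
    have "(\<lambda>g. ennreal (K g)) \<in> borel_measurable (gauss ?I)"
      unfolding eK by (rule kappa_swap(4)) simp
    then have "(\<lambda>g. enn2real (ennreal (K g))) \<in> borel_measurable (gauss ?I)" by measurable
    then have [measurable]: "K \<in> borel_measurable (gauss ?I)" using K0 by simp
    have "ennreal ((1 - exp (- 3 * \<kappa>)) / 3) \<le> (\<integral>\<^sup>+g. ennreal (1 - exp (- 2 * K g)) \<partial>gauss ?I)"
    proof (rule G.one_minus_exp_mean_le[OF _ K0 _ \<kappa>(2)])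
      show "(\<integral>\<^sup>+g. ennreal (K g) \<partial>gauss ?I) = ennreal \<kappa>"
        unfolding eK \<kappa>(1)[symmetric] by (rule kappa_swap(1)) simp
      show "(\<integral>\<^sup>+g. (ennreal (K g))\<^sup>2 \<partial>gauss ?I) \<le> 3 * (ennreal \<kappa>)\<^sup>2"
        unfolding eK \<kappa>(1)[symmetric] by (rule kappa_swap(2)) simp
    qed measurable
    also have "\<dots> = (\<integral>\<^sup>+g. ennreal (1 - (cmod (LINT \<omega>|M. iexp (\<Sum>k\<in>?I. g k * X k \<omega>)))\<^sup>2) \<partial>gauss ?I)"
    proof (rule nn_integral_cong)
      fix g
      have "(\<Sum>k\<in>?I. g k * X k \<omega>) = inner (J \<omega>) (\<Sum>k\<in>?I. g k *\<^sub>R e k)" for \<omega>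
        by (simp add: X_def inner_sum_right)
      then have "cmod (LINT \<omega>|M. iexp (\<Sum>k\<in>?I. g k * X k \<omega>)) = exp (- K g)"
        using cmod_char_Kint[OF cyl] by (simp add: K_def)
      then have "(cmod (LINT \<omega>|M. iexp (\<Sum>k\<in>?I. g k * X k \<omega>)))\<^sup>2 = exp (- 2 * K g)"
        by (simp only: power2_eq_square exp_add[symmetric]) simp
      then show "ennreal (1 - exp (- 2 * K g)) = ennreal (1 - (cmod (LINT \<omega>|M. iexp (\<Sum>k\<in>?I. g k * X k \<omega>)))\<^sup>2)"
        by simp
    qed
    also have "\<dots> = (\<integral>\<^sup>+\<omega>. ennreal (1 - exp (- (\<Sum>k\<in>?I. (X k (fst \<omega>) - X k (snd \<omega>))\<^sup>2) / 2)) \<partial>(M \<Otimes>\<^sub>M M))"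
      by (rule nn_integral_symmetrization_gauss[symmetric]) auto
    also have "\<dots> \<le> (\<integral>\<^sup>+\<omega>. ennreal (d m \<omega>) \<partial>(M \<Otimes>\<^sub>M M))"
    proof (intro nn_integral_mono ennreal_leI)
      fix \<omega>
      have "(\<Sum>k\<in>?I. (X k (fst \<omega>) - X k (snd \<omega>))\<^sup>2) = (\<Sum>k\<in>?I. (inner (e k) (z \<omega>))\<^sup>2)"
        by (simp add: X_def z_def inner_diff_right inner_commute)
      then show "1 - exp (- (\<Sum>k\<in>?I. (X k (fst \<omega>) - X k (snd \<omega>))\<^sup>2) / 2) \<le> d m \<omega>"
        using sum_inner_onb_le[OF onb, of "z \<omega>" m n] by (simp add: d_def)
    qed
    also have "\<dots> = ennreal (LINT \<omega>|(M \<Otimes>\<^sub>M M). d m \<omega>)"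
    proof (rule nn_integral_eq_integral)
      show "integrable (M \<Otimes>\<^sub>M M) (d m)" by (rule P.integrable_const_bound[of _ 1]) (use d01 in auto)
    qed (use d01 in auto)
    finally have "(1 - exp (- 3 * \<kappa>)) / 3 \<le> (LINT \<omega>|(M \<Otimes>\<^sub>M M). d m \<omega>)"
      by (subst (asm) ennreal_le_iff) (auto intro!: integral_nonneg_AE simp: d01)
    also have "\<dots> < (1 - exp (- 3 * r)) / 3" by (rule m0[OF m])
    finally have "\<kappa> < r" by simp
    then show ?thesis using \<kappa> by (simp add: ennreal_leI)
  qed
  then show ?thesis by blast
qed

section \<open>Comparison with conditions (2) and (3)\<close>

definition mterm :: "(nat \<Rightarrow> 'v) \<Rightarrow> nat set \<Rightarrow> real \<Rightarrow> ennreal" where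
  "mterm h I s = (\<integral>\<^sup>+ u. ennreal (min (\<Sum>k\<in>I. (blinfun_apply (fs s (h k)) u)\<^sup>2) 1)
     \<partial>cyl_restr \<mu> ((\<lambda>k. fs s (h k)) ` I))"

lemma jterm_le_mterm: "jterm h I s \<le> mterm h I s"
  unfolding jterm_def mterm_def
proof (intro nn_integral_mono ennreal_leI)
  fix u
  let ?y = "\<Sum>k\<in>I. (blinfun_apply (fs s (h k)) u)\<^sup>2"
  have "?y \<ge> 0" by (simp add: sum_nonneg)
  then show "1 - exp (- ?y / 2) \<le> min ?y 1" using exp_ge_add_one_self[of "- ?y / 2"] by simp
qed

text \<open>The chord bound for \<open>1 - exp (- y / 2)\<close> with its corner at
  \<open>y = 1\<close>, where the value is \<open>1 - exp (- 1 / 2)\<close>.\<close>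

lemma mterm_le_jterm:
  assumes I: "finite I"
  shows "mterm h I s \<le> ennreal (1 / (1 - exp (- 1 / 2))) * jterm h I s"
proof -
  let ?N = "cyl_restr \<mu> ((\<lambda>k. fs s (h k)) ` I)" and ?y = "\<lambda>u. \<Sum>k\<in>I. (blinfun_apply (fs s (h k)) u)\<^sup>2"
  let ?c = "1 - exp (- 1 / 2) :: real"
  have c: "?c > 0" by simp
  have m: "blinfun_apply (fs s (h k)) \<in> borel_measurable ?N" if "k \<in> I" for k
    using that by (intro measurable_cyl_restr) auto
  have [measurable]: "?y \<in> borel_measurable ?N"
    by (intro borel_measurable_sum borel_measurable_power m)
  have "mterm h I s \<le> (\<integral>\<^sup>+u. ennreal (1 / ?c) * ennreal (1 - exp (- ?y u / 2)) \<partial>?N)"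
    unfolding mterm_def
  proof (rule nn_integral_mono)
    fix u
    have "?y u \<ge> 0" by (simp add: sum_nonneg)
    then have "?c * min (?y u) 1 \<le> 1 - exp (- ?y u / 2)" and p: "0 \<le> 1 - exp (- ?y u / 2)"
      using one_minus_exp_ge(2)[of "?y u / 2" "1 / 2"] by simp_all
    then have "min (?y u) 1 \<le> 1 / ?c * (1 - exp (- ?y u / 2))" using c by (simp add: field_simps)
    then have "ennreal (min (?y u) 1) \<le> ennreal (1 / ?c * (1 - exp (- ?y u / 2)))" by (rule ennreal_leI)
    also have "\<dots> = ennreal (1 / ?c) * ennreal (1 - exp (- ?y u / 2))" using c p by (intro ennreal_mult) auto
    finally show "ennreal (min (?y u) 1) \<le> ennreal (1 / ?c) * ennreal (1 - exp (- ?y u / 2))" .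
  qed
  also have "\<dots> = ennreal (1 / ?c) * jterm h I s"
    unfolding jterm_def by (rule nn_integral_cmult) measurable
  finally show ?thesis .
qed

lemma nn_integral_mterm_le:
  assumes I: "finite I"
  shows "(\<integral>\<^sup>+s. mterm h I s \<partial>leb T) \<le> ennreal (1 / (1 - exp (- 1 / 2))) * kappa h I"
proof -
  have "(\<integral>\<^sup>+s. mterm h I s \<partial>leb T) \<le> (\<integral>\<^sup>+s. ennreal (1 / (1 - exp (- 1 / 2))) * jterm h I s \<partial>leb T)"
    by (intro nn_integral_mono mterm_le_jterm I)
  also have "\<dots> = ennreal (1 / (1 - exp (- 1 / 2))) * (\<integral>\<^sup>+s. jterm h I s \<partial>leb T)"
    by (rule nn_integral_cmult[OF kappa_swap(3)[OF I]])
  also have "\<dots> \<le> ennreal (1 / (1 - exp (- 1 / 2))) * kappa h I"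
    unfolding kappa_split[OF I, of h] by (intro mult_left_mono) (auto intro: add_increasing)
  finally show ?thesis .
qed

lemma limsup_mterm_iff:
  "limsup (\<lambda>m. SUP n\<in>{m..}. \<integral>\<^sup>+ s\<in>{0..T}.
      (\<integral>\<^sup>+ u. ennreal (min (\<Sum>k=m..n. (blinfun_apply (adj (f s) (e k)) u)\<^sup>2) 1)
        \<partial>cyl_restr \<mu> ((\<lambda>k. adj (f s) (e k)) ` {m..n})) \<partial>lborel) = 0
    \<longleftrightarrow> (\<forall>r>0. \<exists>m0. \<forall>m\<ge>m0. \<forall>n\<ge>m. (\<integral>\<^sup>+s. mterm e {m..n} s \<partial>leb T) \<le> ennreal r)" (is "limsup ?S = 0 \<longleftrightarrow> ?R")
proof -
  have S: "?S = (\<lambda>m. SUP n\<in>{m..}. \<integral>\<^sup>+s. mterm e {m..n} s \<partial>leb T)"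
    by (subst nn_integral_restrict_space) (simp_all add: mterm_def)
  show ?thesis
  proof
    assume l: "limsup ?S = 0"
    show ?R
    proof (intro allI impI)
      fix r :: real assume "r > 0"
      then have "limsup ?S < ennreal r" using l by simp
      then have "eventually (\<lambda>m. (SUP n\<in>{m..}. \<integral>\<^sup>+s. mterm e {m..n} s \<partial>leb T) < ennreal r) sequentially"
        unfolding S by (rule Limsup_lessD)
      then obtain m0 where "\<And>m. m \<ge> m0 \<Longrightarrow> (SUP n\<in>{m..}. \<integral>\<^sup>+s. mterm e {m..n} s \<partial>leb T) < ennreal r"
        unfolding eventually_sequentially by blast
      moreover have "(\<integral>\<^sup>+s. mterm e {m..n} s \<partial>leb T) \<le> (SUP n\<in>{m..}. \<integral>\<^sup>+s. mterm e {m..n} s \<partial>leb T)" if "n \<ge> m" for m n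
        using that by (intro SUP_upper) simp
      ultimately show "\<exists>m0. \<forall>m\<ge>m0. \<forall>n\<ge>m. (\<integral>\<^sup>+s. mterm e {m..n} s \<partial>leb T) \<le> ennreal r"
        by (intro exI[of _ m0] allI impI) (meson less_imp_le order_trans)
    qed
  next
    assume R: ?R
    have "(\<lambda>m. SUP n\<in>{m..}. \<integral>\<^sup>+s. mterm e {m..n} s \<partial>leb T) \<longlonglongrightarrow> 0"
    proof (rule ennreal_tendsto_0I)
      fix r :: real assume "r > 0"
      then obtain m0 where m0: "\<forall>m\<ge>m0. \<forall>n\<ge>m. (\<integral>\<^sup>+s. mterm e {m..n} s \<partial>leb T) \<le> ennreal r" using R by blast
      then have "(SUP n\<in>{m..}. \<integral>\<^sup>+s. mterm e {m..n} s \<partial>leb T) \<le> ennreal r" if "m \<ge> m0" for m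
        using that by (intro SUP_least) auto
      then show "eventually (\<lambda>m. (SUP n\<in>{m..}. \<integral>\<^sup>+s. mterm e {m..n} s \<partial>leb T) \<le> ennreal r) sequentially"
        unfolding eventually_sequentially by blast
    qed
    then show "limsup ?S = 0" unfolding S by (intro lim_imp_Limsup) auto
  qed
qed

text \<open>The trace part of \<open>kappa\<close> over \<open>{m..n}\<close> is a block of a series
  of nonnegative terms, so its smallness is convergence of the series once the single terms are
  finite. The jump part is comparable with \<open>mterm\<close> up to constants. For
  \<open>n < m\<close> the index set is empty and \<open>kappa\<close> vanishes.\<close>

lemma kappa_small_iff:
  "(\<forall>r>0. \<exists>m0. \<forall>m\<ge>m0. \<forall>n. kappa e {m..n} \<le> ennreal r) \<longleftrightarrow>
    (\<Sum>k. \<integral>\<^sup>+s. ennreal (qterm e k s) \<partial>leb T) < \<infinity> \<and>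
    (\<forall>r>0. \<exists>m0. \<forall>m\<ge>m0. \<forall>n\<ge>m. (\<integral>\<^sup>+s. mterm e {m..n} s \<partial>leb T) \<le> ennreal r)" (is "?L \<longleftrightarrow> ?Q \<and> ?R")
proof
  let ?b = "\<lambda>k. \<integral>\<^sup>+s. ennreal (qterm e k s) \<partial>leb T"
  assume L: ?L
  have half: "ennreal (1 / 2) * (\<Sum>k\<in>I. ?b k) \<le> kappa e I" if "finite I" for I
    unfolding kappa_split[OF that] by (rule add_increasing2) auto
  have ?Q
  proof -
    from L obtain m0 where m0: "\<And>n. kappa e {m0..n} \<le> ennreal 1" by (metis order_refl zero_less_one)
    have "(\<Sum>k. ?b k) \<le> (\<Sum>k<m0. ?b k) + 2"
    proof (rule suminf_le_const[OF summableI])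
      fix n
      have two: "2 * (ennreal (1 / 2) * x) = x" for x
        using ennreal_mult[of 2 "1 / 2"] by (simp add: mult.assoc[symmetric])
      have "(\<Sum>k<n. ?b k) \<le> (\<Sum>k\<in>{..<m0} \<union> {m0..n}. ?b k)" by (intro sum_mono2) auto
      also have "\<dots> = (\<Sum>k<m0. ?b k) + (\<Sum>k\<in>{m0..n}. ?b k)" by (intro sum.union_disjoint) auto
      also have "(\<Sum>k\<in>{m0..n}. ?b k) \<le> 2"
      proof -
        have "ennreal (1 / 2) * (\<Sum>k\<in>{m0..n}. ?b k) \<le> ennreal 1" by (rule order_trans[OF half m0]) simp
        then have "2 * (ennreal (1 / 2) * (\<Sum>k\<in>{m0..n}. ?b k)) \<le> 2 * ennreal 1" by (rule mult_left_mono) simp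
        then show ?thesis unfolding two by simp
      qed
      finally show "(\<Sum>k<n. ?b k) \<le> (\<Sum>k<m0. ?b k) + 2" by (auto intro: add_left_mono)
    qed
    also have "\<dots> < \<infinity>"
    proof -
      have "?b k < \<infinity>" for k
      proof -
        have "ennreal (1 / 2) * ?b k \<le> kappa e {k}" using half[of "{k}"] by simp
        also have "\<dots> < \<infinity>" by (rule kappa_finite) simp
        finally show ?thesis by (auto simp: ennreal_mult_less_top)
      qed
      then have "(\<Sum>k<m0. ?b k) < \<infinity>" by (induction m0) simp_all
      then show ?thesis by simp
    qed
    finally show ?Q .
  qed
  moreover have ?R
  proof (intro allI impI)
    fix r :: real assume r: "r > 0"
    let ?c = "1 / (1 - exp (- 1 / 2)) :: real"
    have c: "?c > 0" by simp
    then obtain m0 where m0: "\<forall>m\<ge>m0. \<forall>n. kappa e {m..n} \<le> ennreal (r / ?c)" using L r by (metis divide_pos_pos)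
    have "(\<integral>\<^sup>+s. mterm e {m..n} s \<partial>leb T) \<le> ennreal r" if "m \<ge> m0" for m n
    proof -
      have "(\<integral>\<^sup>+s. mterm e {m..n} s \<partial>leb T) \<le> ennreal ?c * kappa e {m..n}" by (rule nn_integral_mterm_le) simp
      also have "\<dots> \<le> ennreal ?c * ennreal (r / ?c)" using m0 that by (intro mult_left_mono) auto
      also have "\<dots> = ennreal (?c * (r / ?c))" using c r by (intro ennreal_mult[symmetric]) auto
      also have "?c * (r / ?c) = r" using c by simp
      finally show ?thesis .
    qed
    then show "\<exists>m0. \<forall>m\<ge>m0. \<forall>n\<ge>m. (\<integral>\<^sup>+s. mterm e {m..n} s \<partial>leb T) \<le> ennreal r" by blast
  qed
  ultimately show "?Q \<and> ?R" ..
next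
  let ?b = "\<lambda>k. \<integral>\<^sup>+s. ennreal (qterm e k s) \<partial>leb T"
  assume QR: "?Q \<and> ?R"
  define \<beta> where "\<beta> k = enn2real (?b k)" for k
  have bfin: "?b k < \<infinity>" for k
    using QR ennreal_suminf_lessD by (metis infinity_ennreal_def)
  have b: "?b k = ennreal (\<beta> k)" for k using bfin[of k] by (simp add: \<beta>_def)
  have \<beta>0: "\<beta> k \<ge> 0" for k by (simp add: \<beta>_def)
  have "(\<Sum>k. ennreal (\<beta> k)) \<noteq> top" using QR by (simp add: b less_top)
  then have sm: "summable \<beta>" by (intro summable_suminf_not_top) (use \<beta>0 in auto)
  show ?L
  proof (intro allI impI)
    fix r :: real assume r: "r > 0"
    obtain m1 where m1: "\<And>m n. m \<ge> m1 \<Longrightarrow> norm (\<Sum>k=m..<n. \<beta> k) < r / 2"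
      using sm r unfolding summable_Cauchy by (metis half_gt_zero)
    obtain m2 where m2: "\<And>m n. m \<ge> m2 \<Longrightarrow> n \<ge> m \<Longrightarrow> (\<integral>\<^sup>+s. mterm e {m..n} s \<partial>leb T) \<le> ennreal (r / 2)"
      using QR r by (metis half_gt_zero)
    have "kappa e {m..n} \<le> ennreal r" if m: "m \<ge> max m1 m2" for m n
    proof (cases "n \<ge> m")
      case True
      have "(\<Sum>k\<in>{m..n}. ?b k) = ennreal (\<Sum>k\<in>{m..n}. \<beta> k)" by (simp add: b sum_ennreal \<beta>0)
      also have "\<dots> \<le> ennreal (r / 2)"
        using m1[of m "Suc n"] m by (intro ennreal_leI) (simp add: atLeastLessThanSuc_atLeastAtMost sum_nonneg \<beta>0)
      finally have "ennreal (1 / 2) * (\<Sum>k\<in>{m..n}. ?b k) \<le> ennreal (1 / 2) * ennreal (r / 2)"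
        by (rule mult_left_mono) simp
      also have "\<dots> \<le> ennreal 1 * ennreal (r / 2)" by (intro mult_right_mono ennreal_leI) auto
      also have "\<dots> = ennreal (r / 2)" by simp
      finally have q: "ennreal (1 / 2) * (\<Sum>k\<in>{m..n}. ?b k) \<le> ennreal (r / 2)" .
      have "(\<integral>\<^sup>+s. jterm e {m..n} s \<partial>leb T) \<le> (\<integral>\<^sup>+s. mterm e {m..n} s \<partial>leb T)"
        by (intro nn_integral_mono jterm_le_mterm)
      also have "\<dots> \<le> ennreal (r / 2)" using m True by (intro m2) auto
      finally have "kappa e {m..n} \<le> ennreal (r / 2) + ennreal (r / 2)"
        unfolding kappa_split[OF finite_atLeastAtMost] by (intro add_mono q)
      also have "\<dots> = ennreal r" using r by (simp flip: ennreal_plus)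
      finally show ?thesis .
    next
      case False
      then have "{m..n} = {}" by simp
      then show ?thesis by (simp add: kappa_def)
    qed
    then show "\<exists>m0. \<forall>m\<ge>m0. \<forall>n. kappa e {m..n} \<le> ennreal r" by blast
  qed
qed

end

section \<open>The drift\<close>

text \<open>For a bound \<open>C\<close> of \<open>\<phi>\<close>, the functional \<open>\<phi> + C \<integral>\<close> is positive and hence given by a Radon--Nikodym
  density, so that testing with indicators is enough.\<close>

lemma L1_functional_tendsto:
  assumes "finite_measure N" and \<phi>: "L1_functional N \<phi>"
    and int: "\<And>n. integrable N (g n)" "integrable N h"
    and B: "\<And>n s. s \<in> space N \<Longrightarrow> \<bar>g n s - h s\<bar> \<le> B"
    and lim: "\<And>A. A \<in> sets N \<Longrightarrow> (\<lambda>n. LINT s|N. indicator A s * (g n s - h s)) \<longlonglongrightarrow> 0"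
  shows "(\<lambda>n. \<phi> (g n)) \<longlonglongrightarrow> \<phi> h"
proof -
  interpret finite_measure N by fact
  from \<phi> obtain C0 where add: "\<And>g h. integrable N g \<Longrightarrow> integrable N h \<Longrightarrow> \<phi> (\<lambda>s. g s + h s) = \<phi> g + \<phi> h"
    and scale: "\<And>c g. integrable N g \<Longrightarrow> \<phi> (\<lambda>s. c * g s) = c * \<phi> g"
    and C0: "\<And>g. integrable N g \<Longrightarrow> \<bar>\<phi> g\<bar> \<le> C0 * (LINT s|N. \<bar>g s\<bar>)"
    unfolding L1_functional_def by blast
  define C where "C = max C0 0"
  have C: "\<bar>\<phi> g\<bar> \<le> C * (LINT s|N. \<bar>g s\<bar>)" if "integrable N g" for g
  proof -
    have "C0 * (LINT s|N. \<bar>g s\<bar>) \<le> C * (LINT s|N. \<bar>g s\<bar>)"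
      unfolding C_def by (intro mult_right_mono integral_nonneg_AE) auto
    with C0[OF that] show ?thesis by linarith
  qed
  have C0': "C \<ge> 0" by (simp add: C_def)
  define \<nu> where "\<nu> A = \<phi> (indicator A) + C * measure N A" for A
  have ind: "integrable N (indicator A :: _ \<Rightarrow> real)" if "A \<in> sets N" for A
    using that by (simp add: emeasure_eq_measure)
  have \<nu>: "0 \<le> \<nu> A" "\<nu> A \<le> 2 * C * measure N A" if "A \<in> sets N" for A
    using C[OF ind[OF that]] that sets.sets_into_space[OF that] by (auto simp: \<nu>_def abs_le_iff)
  have \<phi>0: "\<phi> (\<lambda>_. 0) = 0" using scale[of "\<lambda>_. 0" 0] by simp
  have "\<phi> (indicator {}) = \<phi> (\<lambda>_. 0)" by (rule arg_cong[of _ _ \<phi>]) (simp add: fun_eq_iff)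
  then have \<nu>_empty: "\<nu> {} = 0" using \<phi>0 by (simp add: \<nu>_def)
  have \<nu>_Un: "\<nu> (A \<union> A') = \<nu> A + \<nu> A'" if A: "A \<in> sets N" "A' \<in> sets N" "A \<inter> A' = {}" for A A'
  proof -
    have "(indicator (A \<union> A') :: _ \<Rightarrow> real) = (\<lambda>s. indicator A s + indicator A' s)"
      using A(3) by (auto simp: indicator_def fun_eq_iff)
    then show ?thesis using add[OF ind[OF A(1)] ind[OF A(2)]] finite_measure_Union[OF A]
      by (simp add: \<nu>_def distrib_left)
  qed
  \<comment> \<open>Additivity is inherited from the functional, and
    \<open>\<nu> \<le> 2 C measure N\<close> gives continuity at the empty set.\<close>
  have ca: "countably_additive (sets N) (\<lambda>A. ennreal (\<nu> A))"
  proof (rule sets.empty_continuous_imp_countably_additive)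
    show "positive (sets N) (\<lambda>A. ennreal (\<nu> A))" by (simp add: positive_def \<nu>_empty)
    show "additive (sets N) (\<lambda>A. ennreal (\<nu> A))" by (auto simp: additive_def \<nu>_Un \<nu>)
    fix A :: "nat \<Rightarrow> _" assume A: "range A \<subseteq> sets N" "decseq A" "(\<Inter>i. A i) = {}"
    have "(\<lambda>i. measure N (A i)) \<longlonglongrightarrow> measure N (\<Inter>i. A i)" by (rule finite_Lim_measure_decseq) (use A in auto)
    then have l: "(\<lambda>i. 2 * C * measure N (A i)) \<longlonglongrightarrow> 0" using A(3) by (auto intro: tendsto_mult_right_zero)
    have "(\<lambda>i. \<nu> (A i)) \<longlonglongrightarrow> 0"
      by (rule tendsto_sandwich[OF _ _ tendsto_const l]) (use A(1) \<nu> in \<open>auto simp: image_subset_iff\<close>)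
    then show "(\<lambda>i. ennreal (\<nu> (A i))) \<longlonglongrightarrow> 0" using tendsto_ennrealI by fastforce
  qed simp
  define N' where "N' = measure_of (space N) (sets N) (\<lambda>A. ennreal (\<nu> A))"
  have sN': "sets N' = sets N" "space N' = space N" by (simp_all add: N'_def)
  have eN': "emeasure N' A = ennreal (\<nu> A)" if "A \<in> sets N" for A
    unfolding N'_def by (rule emeasure_measure_of_sigma[OF sets.sigma_algebra_axioms _ ca that])
      (simp add: positive_def \<nu>_empty)
  have "absolutely_continuous N N'"
    unfolding absolutely_continuous_def
  proof (rule subsetI)
    fix A assume "A \<in> null_sets N"
    then have A: "A \<in> sets N" "measure N A = 0" by (auto simp: null_sets_def emeasure_eq_measure)
    then have "\<nu> A \<le> 0" using \<nu>(2)[OF A(1)] by simp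
    then show "A \<in> null_sets N'" using A(1) by (simp add: null_sets_def sN' eN' ennreal_eq_0_iff)
  qed
  then obtain w where w[measurable]: "w \<in> borel_measurable N" and dens: "density N w = N'"
    using Radon_Nikodym sN' by metis
  have wA: "(\<integral>\<^sup>+s. w s * indicator A s \<partial>N) = ennreal (\<nu> A)" if "A \<in> sets N" for A
    using emeasure_density[OF w that] eN'[OF that] dens by simp
  have "(\<integral>\<^sup>+s. w s \<partial>N) \<noteq> \<infinity>"
    using wA[OF sets.top] by (simp cong: nn_integral_cong_simp add: indicator_def)
  then have fin: "AE s in N. w s \<noteq> \<infinity>" by (intro nn_integral_PInf_AE) auto
  define w' where "w' s = enn2real (w s)" for s
  have [measurable]: "w' \<in> borel_measurable N" unfolding w'_def by measurable
  have w'0: "w' s \<ge> 0" for s by (simp add: w'_def)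
  have nnw': "(\<integral>\<^sup>+s. ennreal (indicator A s * w' s) \<partial>N) = ennreal (\<nu> A)" if "A \<in> sets N" for A
  proof -
    have "(\<integral>\<^sup>+s. ennreal (indicator A s * w' s) \<partial>N) = (\<integral>\<^sup>+s. w s * indicator A s \<partial>N)"
      by (rule nn_integral_cong_AE, use fin in eventually_elim) (auto simp: w'_def indicator_def less_top)
    then show ?thesis using wA[OF that] by simp
  qed
  have iw': "integrable N (\<lambda>s. indicator A s * w' s)" if "A \<in> sets N" for A
    by (rule integrableI_nonneg) (use that nnw'[OF that] w'0 in auto)
  have w'A: "(LINT s|N. indicator A s * w' s) = \<nu> A" if "A \<in> sets N" for A
  proof -
    have "ennreal (LINT s|N. indicator A s * w' s) = ennreal (\<nu> A)"
      using nn_integral_eq_integral[OF iw'[OF that]] nnw'[OF that] w'0 by simp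
    then show ?thesis using \<nu>(1)[OF that] w'0 by (subst (asm) ennreal_inj) (auto intro!: integral_nonneg_AE)
  qed
  have w_int: "integrable N w'"
    using iw'[OF sets.top] by (simp cong: Bochner_Integration.integrable_cong)
  \<comment> \<open>The same domination bounds the density almost everywhere, so that it can be
    multiplied with arbitrary integrable functions and limits pass in \<open>rep\<close>.\<close>
  have w_le: "AE s in N. w' s \<le> 2 * C"
  proof -
    define A where "A = {s \<in> space N. w' s > 2 * C}"
    have A[measurable]: "A \<in> sets N" unfolding A_def by measurable
    have i: "integrable N (\<lambda>s. indicator A s * (w' s - 2 * C))"
      using iw'[OF A] ind[OF A] by (simp add: right_diff_distrib)
    have "(LINT s|N. indicator A s * (w' s - 2 * C)) = \<nu> A - 2 * C * measure N A"
      using iw'[OF A] ind[OF A] w'A[OF A] sets.sets_into_space[OF A] by (simp add: right_diff_distrib Int_absorb2)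
    also have "\<dots> \<le> 0" using \<nu>(2)[OF A] by simp
    finally have "(LINT s|N. indicator A s * (w' s - 2 * C)) = 0"
      by (intro antisym integral_nonneg_AE AE_I2) (auto simp: A_def indicator_def)
    then have "AE s in N. indicator A s * (w' s - 2 * C) = 0"
      using integral_nonneg_eq_0_iff_AE[OF i] by (auto simp: A_def indicator_def)
    then show ?thesis using AE_space by eventually_elim (auto simp: A_def indicator_def split: if_splits)
  qed
  have iww: "integrable N (\<lambda>s. k s * w' s)" if "integrable N k" for k
  proof (rule Bochner_Integration.integrable_bound[of N "\<lambda>s. 2 * C * k s"])
    show "AE s in N. norm (k s * w' s) \<le> norm (2 * C * k s)"
      using w_le
    proof eventually_elim
      case (elim s)
      then have "\<bar>k s\<bar> * w' s \<le> \<bar>k s\<bar> * (2 * C)" by (intro mult_left_mono) auto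
      then show ?case using w'0[of s] C0' by (simp add: abs_mult mult_ac)
    qed
  qed (use that in auto)
  have rep: "\<phi> k = (LINT s|N. k s * w' s) - C * (LINT s|N. k s)" if "integrable N k" for k
    using that
  proof (induct rule: integrable_induct)
    case (base A c)
    have "(\<lambda>x. indicator A x *\<^sub>R c) = (\<lambda>x. c * indicator A x)" by (auto simp: fun_eq_iff)
    then have "\<phi> (\<lambda>x. indicator A x *\<^sub>R c) = c * (\<nu> A - C * measure N A)"
      using scale[OF ind[OF base(1)], of c] by (simp add: \<nu>_def)
    moreover have "(LINT s|N. (indicator A s *\<^sub>R c) * w' s) = c * \<nu> A"
    proof -
      have "(LINT s|N. (indicator A s *\<^sub>R c) * w' s) = (LINT s|N. c * (indicator A s * w' s))"
        by (simp add: mult_ac)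
      also have "\<dots> = c * \<nu> A" using w'A[OF base(1)] by (simp only: integral_mult_right_zero)
      finally show ?thesis .
    qed
    moreover have "(LINT s|N. indicator A s *\<^sub>R c) = c * measure N A"
      using sets.sets_into_space[OF base(1)] by (simp add: Int_absorb2 mult.commute)
    ultimately show ?case by (simp only: right_diff_distrib mult_ac)
  next
    case (add k l)
    then show ?case using \<open>\<And>g h. integrable N g \<Longrightarrow> integrable N h \<Longrightarrow> \<phi> (\<lambda>s. g s + h s) = \<phi> g + \<phi> h\<close>[OF add(1,3)]
      by (simp add: distrib_right distrib_left iww)
  next
    case (lim k sq)
    have d: "(\<lambda>i. LINT s|N. \<bar>sq i s - k s\<bar>) \<longlonglongrightarrow> (LINT s|N. \<bar>0\<bar>)"
    proof (rule integral_dominated_convergence[where w="\<lambda>s. 3 * \<bar>k s\<bar>"])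
      show "AE s in N. (\<lambda>i. \<bar>sq i s - k s\<bar>) \<longlonglongrightarrow> \<bar>0\<bar>"
      proof (rule AE_I2)
        fix s assume "s \<in> space N"
        then have "(\<lambda>i. \<bar>sq i s - k s\<bar>) \<longlonglongrightarrow> \<bar>k s - k s\<bar>" by (intro tendsto_intros lim)
        then show "(\<lambda>i. \<bar>sq i s - k s\<bar>) \<longlonglongrightarrow> \<bar>0\<bar>" by simp
      qed
      show "AE s in N. norm \<bar>sq i s - k s\<bar> \<le> 3 * \<bar>k s\<bar>" for i
      proof (rule AE_I2)
        fix s assume "s \<in> space N"
        then show "norm \<bar>sq i s - k s\<bar> \<le> 3 * \<bar>k s\<bar>" using lim(4)[of s i] by simp
      qed
    qed (use lim in auto)
    have diff: "\<bar>\<phi> (sq i) - \<phi> k\<bar> \<le> C * (LINT s|N. \<bar>sq i s - k s\<bar>)" for i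
    proof -
      have "\<phi> (\<lambda>s. sq i s + (-1) * k s) = \<phi> (sq i) - \<phi> k"
        using add[of "sq i" "\<lambda>s. (-1) * k s"] scale[of k "-1"] lim by simp
      then show ?thesis using C[of "\<lambda>s. sq i s + (-1) * k s"] lim by simp
    qed
    have "(\<lambda>i. \<phi> (sq i) - \<phi> k) \<longlonglongrightarrow> 0"
      by (rule Lim_null_comparison[OF _ tendsto_mult_right_zero[OF d[simplified], of C]]) (use diff in auto)
    then have 1: "(\<lambda>i. \<phi> (sq i)) \<longlonglongrightarrow> \<phi> k" by (rule LIM_zero_cancel)
    have "(\<lambda>i. LINT s|N. sq i s * w' s) \<longlonglongrightarrow> (LINT s|N. k s * w' s)"
    proof (rule integral_dominated_convergence[where w="\<lambda>s. 2 * \<bar>k s * w' s\<bar>"])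
      show "AE s in N. (\<lambda>i. sq i s * w' s) \<longlonglongrightarrow> k s * w' s" by (intro AE_I2 tendsto_intros lim)
      show "AE s in N. norm (sq i s * w' s) \<le> 2 * \<bar>k s * w' s\<bar>" for i
      proof (rule AE_I2)
        fix s assume "s \<in> space N"
        then have "\<bar>sq i s\<bar> * w' s \<le> 2 * \<bar>k s\<bar> * w' s" using lim(4)[of s i] w'0[of s] by (intro mult_right_mono) auto
        then show "norm (sq i s * w' s) \<le> 2 * \<bar>k s * w' s\<bar>" using w'0[of s] by (simp add: abs_mult)
      qed
    qed (use lim iww in auto)
    moreover have "(\<lambda>i. LINT s|N. sq i s) \<longlonglongrightarrow> (LINT s|N. k s)"
      by (rule integral_dominated_convergence[where w="\<lambda>s. 2 * \<bar>k s\<bar>"]) (use lim in auto)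
    ultimately have "(\<lambda>i. (LINT s|N. sq i s * w' s) - C * (LINT s|N. sq i s)) \<longlonglongrightarrow> (LINT s|N. k s * w' s) - C * (LINT s|N. k s)"
      by (intro tendsto_intros)
    then show ?case using 1 lim(2) by (simp add: LIMSEQ_unique)
  qed
  define d where "d n s = g n s - h s" for n s
  have di: "integrable N (d n)" for n unfolding d_def using int by simp
  have dB: "\<bar>d n s\<bar> \<le> B" if "s \<in> space N" for n s using B[OF that] by (simp add: d_def)
  have dk: "integrable N (\<lambda>s. d n s * k s)" if k: "integrable N k" for n k
  proof (rule Bochner_Integration.integrable_bound[of N "\<lambda>s. B * k s"])
    show "AE s in N. norm (d n s * k s) \<le> norm (B * k s)"
    proof (rule AE_I2)
      fix s assume "s \<in> space N"
      then have "\<bar>d n s\<bar> \<le> \<bar>B\<bar>" using dB[of s n] by linarith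
      then have "\<bar>d n s\<bar> * \<bar>k s\<bar> \<le> \<bar>B\<bar> * \<bar>k s\<bar>" by (rule mult_right_mono) simp
      then show "norm (d n s * k s) \<le> norm (B * k s)" by (simp add: abs_mult)
    qed
  qed (use k di[of n] in auto)
  \<comment> \<open>The uniform bound \<open>B\<close> on the differences carries the convergence
    from indicators to limits of simple functions in mean.\<close>
  have test: "(\<lambda>n. LINT s|N. d n s * k s) \<longlonglongrightarrow> 0" if "integrable N k" for k
    using that
  proof (induct rule: integrable_induct)
    case (base A c)
    have "(\<lambda>n. (LINT s|N. indicator A s * d n s) * c) \<longlonglongrightarrow> 0 * c"
      using lim[OF base(1)] by (intro tendsto_intros) (simp add: d_def)
    moreover have "(LINT s|N. d n s * (indicator A s *\<^sub>R c)) = (LINT s|N. indicator A s * d n s) * c" for n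
    proof -
      have "(LINT s|N. d n s * (indicator A s *\<^sub>R c)) = (LINT s|N. (indicator A s * d n s) * c)"
        by (simp add: mult_ac)
      then show ?thesis by (simp only: integral_mult_left_zero)
    qed
    ultimately show ?case by simp
  next
    case (add k l)
    show ?case using tendsto_add[OF add(2,4)] by (simp add: distrib_left dk[OF add(1)] dk[OF add(3)])
  next
    case (lim k sq)
    have d: "(\<lambda>i. LINT s|N. \<bar>sq i s - k s\<bar>) \<longlonglongrightarrow> (LINT s|N. \<bar>0\<bar>)"
    proof (rule integral_dominated_convergence[where w="\<lambda>s. 3 * \<bar>k s\<bar>"])
      show "AE s in N. (\<lambda>i. \<bar>sq i s - k s\<bar>) \<longlonglongrightarrow> \<bar>0\<bar>"
      proof (rule AE_I2)
        fix s assume "s \<in> space N"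
        then have "(\<lambda>i. \<bar>sq i s - k s\<bar>) \<longlonglongrightarrow> \<bar>k s - k s\<bar>" by (intro tendsto_intros lim)
        then show "(\<lambda>i. \<bar>sq i s - k s\<bar>) \<longlonglongrightarrow> \<bar>0\<bar>" by simp
      qed
      show "AE s in N. norm \<bar>sq i s - k s\<bar> \<le> 3 * \<bar>k s\<bar>" for i
      proof (rule AE_I2)
        fix s assume "s \<in> space N"
        then show "norm \<bar>sq i s - k s\<bar> \<le> 3 * \<bar>k s\<bar>" using lim(4)[of s i] by simp
      qed
    qed (use lim in auto)
    show ?case
    proof (rule LIMSEQ_I)
      fix r :: real assume r: "r > 0"
      have "(\<lambda>i. B * (LINT s|N. \<bar>sq i s - k s\<bar>)) \<longlonglongrightarrow> 0" using tendsto_mult_right_zero[OF d[simplified]] .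
      then have "eventually (\<lambda>i. B * (LINT s|N. \<bar>sq i s - k s\<bar>) < r / 2) sequentially"
        using r by (intro order_tendstoD) auto
      then obtain i where i: "B * (LINT s|N. \<bar>sq i s - k s\<bar>) < r / 2" by (auto simp: eventually_sequentially)
      obtain m where m: "\<And>n. n \<ge> m \<Longrightarrow> norm ((LINT s|N. d n s * sq i s) - 0) < r / 2"
        using LIMSEQ_D[OF lim(2)[of i], of "r / 2"] r by auto
      have "norm ((LINT s|N. d n s * k s) - 0) < r" if "n \<ge> m" for n
      proof -
        have "(LINT s|N. d n s * k s) = (LINT s|N. d n s * sq i s) - (LINT s|N. d n s * (sq i s - k s))"
          using dk lim by (simp add: right_diff_distrib)
        moreover have "\<bar>LINT s|N. d n s * (sq i s - k s)\<bar> \<le> (LINT s|N. B * \<bar>sq i s - k s\<bar>)"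
        proof (intro order_trans[OF integral_abs_bound] integral_mono)
          show "integrable N (\<lambda>s. \<bar>d n s * (sq i s - k s)\<bar>)" by (intro integrable_abs dk) (use lim in auto)
          show "integrable N (\<lambda>s. B * \<bar>sq i s - k s\<bar>)" using lim by auto
          fix s assume "s \<in> space N"
          then show "\<bar>d n s * (sq i s - k s)\<bar> \<le> B * \<bar>sq i s - k s\<bar>"
            unfolding abs_mult by (intro mult_right_mono dB) auto
        qed
        ultimately show ?thesis using m[OF that] i by simp
      qed
      then show "\<exists>m. \<forall>n\<ge>m. norm ((LINT s|N. d n s * k s) - 0) < r" by blast
    qed
  qed
  have "(\<lambda>n. (LINT s|N. d n s * w' s) - C * (LINT s|N. d n s * 1)) \<longlonglongrightarrow> 0 - C * 0"
    by (intro tendsto_intros test w_int) simp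
  then have "(\<lambda>n. \<phi> (d n)) \<longlonglongrightarrow> 0" by (simp add: rep[OF di])
  moreover have "\<phi> (d n) = \<phi> (g n) - \<phi> h" for n
    using add[of "g n" "\<lambda>s. (-1) * h s"] scale[of h "-1"] int by (simp add: d_def[abs_def])
  ultimately show ?thesis by (simp add: LIM_zero_cancel)
qed

text \<open>Within distance 1 of 1 the exponential has positive real part, so the imaginary part of
  \<open>q\<close> never equals \<open>pi / 2\<close> in modulus. Starting from 0 it stays in the
  strip of the principal branch.\<close>

lemma Ln_exp_along_path:
  fixes q :: "real \<Rightarrow> complex"
  assumes cont: "continuous_on {0..1} q" and q0: "q 0 = 0"
    and near: "\<And>t. t \<in> {0..1} \<Longrightarrow> cmod (exp (q t) - 1) < 1"
  shows "q 1 = Ln (exp (q 1))"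
proof -
  have "\<bar>Im (q 1)\<bar> < pi / 2"
  proof (rule ccontr)
    assume "\<not> \<bar>Im (q 1)\<bar> < pi / 2"
    moreover have "continuous_on {0..1} (\<lambda>t. \<bar>Im (q t)\<bar>)" by (intro continuous_intros cont)
    ultimately obtain t where t: "t \<in> {0..1}" "\<bar>Im (q t)\<bar> = pi / 2"
      using IVT'[of "\<lambda>t. \<bar>Im (q t)\<bar>" 0 "pi / 2" 1] q0 by auto
    then have "Im (q t) = pi / 2 \<or> Im (q t) = - (pi / 2)" by linarith
    then have "cos (Im (q t)) = 0" by (elim disjE) (simp_all only: cos_minus cos_pi_half)
    then have "Re (exp (q t)) = 0" by (simp add: Re_exp)
    then have "1 \<le> cmod (exp (q t) - 1)" using abs_Re_le_cmod[of "exp (q t) - 1"] by simp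
    with near[OF t(1)] show False by simp
  qed
  then have "- pi < Im (q 1)" "Im (q 1) \<le> pi" using pi_gt_zero by linarith+
  then show ?thesis by (simp add: Ln_exp)
qed

section \<open>Increments of the truncated drift compensator\<close>

lemma abs_sin_diff_le: "\<bar>sin a - sin b\<bar> \<le> \<bar>a - b\<bar>" for a b :: real
  using abs_Im_le_cmod[of "iexp a - iexp b"] cmod_iexp_diff_le[of a b]
  by (simp add: cis_conv_exp[symmetric])

lemma abs_one_minus_cos_le: "\<bar>cos x - 1\<bar> \<le> \<bar>x\<bar>" for x :: real
  using abs_Re_le_cmod[of "iexp x - iexp 0"] cmod_iexp_diff_le[of x 0]
  by (simp add: cis_conv_exp[symmetric])

lemma abs_sin_minus_le: "\<bar>sin x - x\<bar> \<le> x\<^sup>2 / 2" for x :: real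
  using abs_Im_le_cmod[of "iexp x - 1 - \<i> * x"] iexp_approx1[of x 1]
  by (simp add: cis_conv_exp[symmetric] numeral_2_eq_2 diff_diff_eq)

text \<open>The continuous truncation. It splits \<open>trunc_err\<close> into the Lipschitz
  function \<open>sin - clip\<close> and a step function with jumps at 1 and -1.\<close>

definition clip :: "real \<Rightarrow> real" where
  "clip \<beta> = max (-1) (min 1 \<beta>)"

text \<open>Near 0 the function is \<open>sin x - x\<close>, whose slope vanishes at 0, so an
  increment \<open>q\<close> is multiplied by the size of the arguments. The product form matters:
  truncated squares are what \<mu> integrates.\<close>

lemma sin_minus_clip_diff_le:
  "\<bar>(sin (p + q) - clip (p + q)) - (sin p - clip p)\<bar> \<le> 4 * min 1 \<bar>q\<bar> * (min 1 \<bar>p\<bar> + min 1 \<bar>q\<bar>)"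
proof -
  have s1: "\<bar>sin x\<bar> \<le> 1" "\<bar>clip x\<bar> \<le> 1" for x :: real by (auto simp: clip_def)
  have lip: "\<bar>(sin (p + q) - clip (p + q)) - (sin p - clip p)\<bar> \<le> 2 * \<bar>q\<bar>"
    using abs_sin_diff_le[of "p + q" p] by (auto simp: clip_def max_def min_def)
  consider "\<bar>q\<bar> \<ge> 1" | "\<bar>q\<bar> < 1" "\<bar>p\<bar> + \<bar>q\<bar> \<ge> 1" | "\<bar>q\<bar> < 1" "\<bar>p\<bar> + \<bar>q\<bar> < 1" by linarith
  then show ?thesis
  proof cases
    case 1
    have "\<bar>(sin (p + q) - clip (p + q)) - (sin p - clip p)\<bar> \<le> 4"
      using s1[of "p + q"] s1[of p] by linarith
    also have "4 \<le> 4 * min 1 \<bar>q\<bar> * (min 1 \<bar>p\<bar> + min 1 \<bar>q\<bar>)" using 1 by simp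
    finally show ?thesis .
  next
    case 2
    then have "1 \<le> min 1 \<bar>p\<bar> + min 1 \<bar>q\<bar>" by (auto simp: min_def)
    then have "2 * \<bar>q\<bar> * 1 \<le> 4 * \<bar>q\<bar> * (min 1 \<bar>p\<bar> + min 1 \<bar>q\<bar>)" by (intro mult_mono) auto
    then show ?thesis using lip 2 by (simp add: min_def)
  next
    case 3
    have c: "clip (p + q) = p + q" "clip p = p" using 3 by (auto simp: clip_def)
    \<comment> \<open>The midpoint in the product formula for a difference of sines.\<close>
    define z where "z = p + q / 2"
    have "sin (p + q) - sin p = 2 * sin (q / 2) * cos z"
      using sin_diff_sin[of "p + q" p] by (simp add: z_def field_simps)
    then have "(sin (p + q) - clip (p + q)) - (sin p - clip p) = 2 * sin (q / 2) * (cos z - 1) + 2 * (sin (q / 2) - q / 2)"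
      unfolding c by (simp add: algebra_simps)
    also have "\<bar>\<dots>\<bar> \<le> \<bar>2 * sin (q / 2)\<bar> * \<bar>cos z - 1\<bar> + 2 * \<bar>sin (q / 2) - q / 2\<bar>"
      by (rule order_trans[OF abs_triangle_ineq]) (simp only: abs_mult abs_numeral order_refl)
    also have "\<dots> \<le> \<bar>q\<bar> * \<bar>z\<bar> + 2 * ((q / 2)\<^sup>2 / 2)"
      using abs_sin_x_le_abs_x[of "q / 2"] abs_one_minus_cos_le[of z] abs_sin_minus_le[of "q / 2"]
      by (intro add_mono mult_mono) auto
    also have "\<dots> \<le> \<bar>q\<bar> * (\<bar>p\<bar> + \<bar>q\<bar> / 2) + \<bar>q\<bar> * \<bar>q\<bar> / 4"
    proof -
      have "\<bar>z\<bar> \<le> \<bar>p\<bar> + \<bar>q\<bar> / 2" by (simp add: z_def)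
      then have "\<bar>q\<bar> * \<bar>z\<bar> \<le> \<bar>q\<bar> * (\<bar>p\<bar> + \<bar>q\<bar> / 2)" by (rule mult_left_mono) simp
      then show ?thesis by (simp add: power2_eq_square)
    qed
    also have "\<dots> \<le> 4 * \<bar>q\<bar> * (\<bar>p\<bar> + \<bar>q\<bar>)"
    proof -
      have "r * (s + r / 2) + r * r / 4 \<le> 4 * r * (s + r)" if "0 \<le> r" "0 \<le> s" for r s :: real
        using mult_nonneg_nonneg[OF that] mult_nonneg_nonneg[OF that(1) that(1)] by (simp add: field_simps)
      from this[OF abs_ge_zero abs_ge_zero] show ?thesis .
    qed
    finally have "\<bar>(sin (p + q) - clip (p + q)) - (sin p - clip p)\<bar> \<le> 4 * \<bar>q\<bar> * (\<bar>p\<bar> + \<bar>q\<bar>)" .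
    moreover have "min 1 \<bar>q\<bar> = \<bar>q\<bar>" "min 1 \<bar>p\<bar> = \<bar>p\<bar>" using 3 by auto
    ultimately show ?thesis by (simp only:)
  qed
qed

text \<open>The part of the jump of the truncation at \<open>\<plusminus>1\<close> that survives when \<open>q\<close> tends to \<open>0\<close>.\<close>

definition side_jump :: "real \<Rightarrow> real \<Rightarrow> real" where
  "side_jump p q = (if p = 1 \<and> q > 0 then 1 else if p = -1 \<and> q < 0 then -1 else 0)"

text \<open>The weight \<epsilon> splits the mixed product by Young's inequality, leaving a small
  multiple for \<open>p\<close> and a large one for \<open>q\<close>. The width \<delta> separates
  values of \<open>p\<close> so close to 1 in modulus that a small \<open>q\<close> may carry them
  across the discontinuity.\<close>

lemma trunc_err_diff_le:
  assumes \<delta>: "0 < \<delta>" "\<delta> \<le> 1 / 2" and \<epsilon>: "\<epsilon> > 0"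
  shows "\<bar>trunc_err (p + q) - trunc_err p - side_jump p q\<bar>
    \<le> 4 * \<epsilon> * min (p\<^sup>2) 1 + (1 / \<epsilon> + 4 + 2 / \<delta>\<^sup>2) * min (q\<^sup>2) 1 + 2 * indicator {\<beta>. 0 < \<bar>\<bar>\<beta>\<bar> - 1\<bar> \<and> \<bar>\<bar>\<beta>\<bar> - 1\<bar> \<le> \<delta>} p"
proof -
  define G where "G \<beta> = (if \<beta> > 1 then 1 else if \<beta> < -1 then -1 else 0 :: real)" for \<beta> :: real
  let ?m = "\<lambda>x :: real. min 1 \<bar>x\<bar>" and ?S = "{\<beta>. 0 < \<bar>\<bar>\<beta>\<bar> - 1\<bar> \<and> \<bar>\<bar>\<beta>\<bar> - 1\<bar> \<le> \<delta>}"
  have msq: "(?m x)\<^sup>2 = min (x\<^sup>2) 1" for x :: real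
  proof (cases "\<bar>x\<bar> \<le> 1")
    case True
    then have "x\<^sup>2 \<le> 1" by (simp add: abs_square_le_1)
    then show ?thesis using True by (simp add: min_def)
  next
    case False
    then have "1 \<le> x\<^sup>2" using one_le_power[of "\<bar>x\<bar>" 2] by simp
    then show ?thesis using False by (simp add: min_def)
  qed
  have R: "trunc_err \<beta> = (sin \<beta> - clip \<beta>) + G \<beta>" for \<beta>
    by (auto simp: trunc_err_def clip_def G_def indicator_def)
  \<comment> \<open>An increment of size at least \<delta> is paid for by its truncated square. A
    smaller one crosses the discontinuity only from the window around 1 or from modulus 1 itself,
    and \<open>side_jump\<close> accounts for the latter exactly.\<close>
  have g: "\<bar>G (p + q) - G p - side_jump p q\<bar> \<le> 2 / \<delta>\<^sup>2 * (?m q)\<^sup>2 + 2 * indicator ?S p"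
  proof (cases "\<bar>q\<bar> \<ge> \<delta>")
    case True
    then have "\<delta> \<le> ?m q" using \<delta> by simp
    then have "\<delta>\<^sup>2 \<le> (?m q)\<^sup>2" using \<delta> by (intro power_mono) auto
    then have "2 \<le> 2 / \<delta>\<^sup>2 * (?m q)\<^sup>2" using \<delta> by (simp add: field_simps)
    moreover have "\<bar>G (p + q) - G p - side_jump p q\<bar> \<le> 2" by (auto simp: G_def side_jump_def)
    ultimately show ?thesis by (simp add: indicator_def)
  next
    case False
    have nn: "0 \<le> 2 / \<delta>\<^sup>2 * (?m q)\<^sup>2" by simp
    show ?thesis
    proof (cases "p \<in> ?S")
      case True
      have "\<bar>G (p + q) - G p - side_jump p q\<bar> \<le> 2" by (auto simp: G_def side_jump_def)
      moreover have "indicator ?S p = (1 :: real)" using True by (rule indicator_simps(1))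
      ultimately show ?thesis using nn by linarith
    next
      case out: False
      then have "\<bar>p\<bar> = 1 \<or> \<bar>\<bar>p\<bar> - 1\<bar> > \<delta>" by auto
      then have "G (p + q) - G p - side_jump p q = 0"
        using False \<delta> by (auto simp: G_def side_jump_def abs_if split: if_splits)
      then show ?thesis using nn by simp
    qed
  qed
  have am: "?m q * ?m p \<le> \<epsilon> * (?m p)\<^sup>2 + (?m q)\<^sup>2 / (4 * \<epsilon>)"
  proof -
    have "0 \<le> (2 * \<epsilon> * ?m p - ?m q)\<^sup>2" by simp
    then have "4 * \<epsilon> * (?m q * ?m p) \<le> 4 * \<epsilon> * (\<epsilon> * (?m p)\<^sup>2) + (?m q)\<^sup>2"
      by (simp add: power2_eq_square algebra_simps)
    then show ?thesis using \<epsilon> by (simp add: field_simps)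
  qed
  have "\<bar>trunc_err (p + q) - trunc_err p - side_jump p q\<bar>
    \<le> \<bar>(sin (p + q) - clip (p + q)) - (sin p - clip p)\<bar> + \<bar>G (p + q) - G p - side_jump p q\<bar>"
    unfolding R by linarith
  also have "\<dots> \<le> 4 * ?m q * (?m p + ?m q) + (2 / \<delta>\<^sup>2 * (?m q)\<^sup>2 + 2 * indicator ?S p)"
    by (intro add_mono sin_minus_clip_diff_le g)
  also have "4 * ?m q * (?m p + ?m q) = 4 * (?m q * ?m p) + 4 * (?m q)\<^sup>2"
    by (simp add: power2_eq_square distrib_left mult.assoc)
  also have "4 * (?m q * ?m p) + 4 * (?m q)\<^sup>2 \<le> 4 * (\<epsilon> * (?m p)\<^sup>2 + (?m q)\<^sup>2 / (4 * \<epsilon>)) + 4 * (?m q)\<^sup>2"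
    using am by simp
  finally show ?thesis unfolding msq by (simp add: algebra_simps add_divide_distrib)
qed

lemma abs_trunc_err_le: "\<bar>trunc_err \<beta>\<bar> \<le> 2 * min (\<beta>\<^sup>2) 1"
proof -
  have "Im (iexp \<beta> - 1 - \<i> * complex_of_real \<beta> * indicator {-1..1} \<beta>) = trunc_err \<beta>"
    by (simp add: trunc_err_def cis_conv_exp[symmetric] indicator_def)
  then show ?thesis using order_trans[OF abs_Im_le_cmod cmod_levy_integrand_le[of \<beta>]] by simp
qed

lemma LIMSEQ_if_subseq_subseq:
  fixes x :: "nat \<Rightarrow> 'a::metric_space"
  assumes sub: "\<And>\<sigma> :: nat \<Rightarrow> nat. strict_mono \<sigma> \<Longrightarrow> \<exists>\<rho> :: nat \<Rightarrow> nat. strict_mono \<rho> \<and> (\<lambda>n. x (\<sigma> (\<rho> n))) \<longlonglongrightarrow> l"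
  shows "x \<longlonglongrightarrow> l"
proof (rule ccontr)
  assume "\<not> x \<longlonglongrightarrow> l"
  then obtain r where r: "r > 0" and inf: "\<And>N. \<exists>n\<ge>N. \<not> dist (x n) l < r"
    unfolding lim_sequentially by blast
  have "infinite {n. \<not> dist (x n) l < r}" unfolding infinite_nat_iff_unbounded_le using inf by auto
  then obtain \<sigma> :: "nat \<Rightarrow> nat" where \<sigma>: "strict_mono \<sigma>" "\<And>n. \<not> dist (x (\<sigma> n)) l < r"
    using infinite_enumerate by blast
  from sub[OF \<sigma>(1)] obtain \<rho> :: "nat \<Rightarrow> nat" where "(\<lambda>n. x (\<sigma> (\<rho> n))) \<longlonglongrightarrow> l" by blast
  from tendstoD[OF this r] \<sigma>(2) show False by (simp add: eventually_sequentially)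
qed

section \<open>Weak convergence and characteristic functions\<close>

lemma weakly_tendsto_inner:
  assumes "weakly_tendsto v w"
  shows "(\<lambda>n. inner x (v n)) \<longlonglongrightarrow> inner x w"
  using assms[unfolded weakly_tendsto_def, rule_format, of "blinfun_inner_right x"] by simp

lemma weakly_tendsto_subseq:
  "weakly_tendsto v w \<Longrightarrow> strict_mono \<sigma> \<Longrightarrow> weakly_tendsto (\<lambda>n. v (\<sigma> n)) w"
  unfolding weakly_tendsto_def using LIMSEQ_subseq_LIMSEQ[unfolded o_def] by fast

lemma weakly_tendsto_bounded:
  fixes v :: "nat \<Rightarrow> 'v::{real_inner, banach}"
  assumes "weakly_tendsto v w"
  obtains C where "C \<ge> 0" "\<And>n. norm (v n) \<le> C"
proof (rule uniform_boundedness_seminorms[of UNIV "\<lambda>n x. \<bar>inner x (v n)\<bar>"])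
  show "\<exists>C. \<forall>n\<in>UNIV. \<bar>inner x (v n)\<bar> \<le> C" for x
  proof -
    have "Bseq (\<lambda>n. inner x (v n))"
      using weakly_tendsto_inner[OF assms] by (intro convergent_imp_Bseq convergentI)
    then show ?thesis unfolding Bseq_def by auto
  qed
  show "\<bar>inner (x + y) (v n)\<bar> \<le> \<bar>inner x (v n)\<bar> + \<bar>inner y (v n)\<bar>" for n x y
    by (simp add: inner_add_left)
  fix C assume C: "C \<ge> 0" "\<And>n x. n \<in> UNIV \<Longrightarrow> \<bar>inner x (v n)\<bar> \<le> C * norm x"
  show thesis
  proof (rule that[OF C(1)])
    fix n
    have "norm (v n) * norm (v n) \<le> C * norm (v n)"
      using C(2)[of n "v n"] by (simp add: dot_square_norm power2_eq_square)
    then show "norm (v n) \<le> C" using C(1) by (cases "v n = 0") auto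
  qed
qed (auto simp: abs_mult intro!: continuous_intros)

lemma weakly_tendsto_diff: "weakly_tendsto v w \<Longrightarrow> weakly_tendsto (\<lambda>n. v n - w) 0"
  unfolding weakly_tendsto_def by (auto simp: blinfun.diff_right LIM_zero_iff)

lemma weakly_tendsto_scale: "weakly_tendsto u 0 \<Longrightarrow> weakly_tendsto (\<lambda>n. c *\<^sub>R u n) 0"
  unfolding weakly_tendsto_def by (auto simp: blinfun.scaleR_right intro: tendsto_mult_right_zero)

lemma (in prob_space) expectation_inner_tendsto_0:
  fixes J :: "'a \<Rightarrow> 'v::{real_inner, second_countable_topology}"
  assumes J: "J \<in> borel_measurable M" and u: "weakly_tendsto u 0"
  shows "(\<lambda>n. LINT \<omega>|M. min 2 \<bar>inner (J \<omega>) (u n)\<bar>) \<longlonglongrightarrow> 0"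
proof -
  note [measurable] = J
  have "(\<lambda>n. LINT \<omega>|M. min 2 \<bar>inner (J \<omega>) (u n)\<bar>) \<longlonglongrightarrow> (LINT \<omega>|M. 0)"
  proof (rule integral_dominated_convergence[where w="\<lambda>_. 2"])
    show "AE \<omega> in M. (\<lambda>n. min 2 \<bar>inner (J \<omega>) (u n)\<bar>) \<longlonglongrightarrow> 0"
    proof (rule AE_I2)
      fix \<omega>
      have "(\<lambda>n. min 2 \<bar>inner (J \<omega>) (u n)\<bar>) \<longlonglongrightarrow> min 2 \<bar>inner (J \<omega>) 0\<bar>"
        by (intro tendsto_intros weakly_tendsto_inner u)
      then show "(\<lambda>n. min 2 \<bar>inner (J \<omega>) (u n)\<bar>) \<longlonglongrightarrow> 0" by simp
    qed
  qed auto
  then show ?thesis by simp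
qed

lemma (in prob_space) cmod_char_inner_diff_le:
  fixes J :: "'a \<Rightarrow> 'v::{real_inner, second_countable_topology}"
  assumes J: "J \<in> borel_measurable M"
  shows "cmod ((LINT \<omega>|M. iexp (inner (J \<omega>) v)) - (LINT \<omega>|M. iexp (inner (J \<omega>) w)))
    \<le> (LINT \<omega>|M. min 2 \<bar>inner (J \<omega>) (v - w)\<bar>)"
proof -
  note [measurable] = J
  have i: "integrable M (\<lambda>\<omega>. iexp (inner (J \<omega>) v))" for v by (rule integrable_iexp) measurable
  have "cmod (LINT \<omega>|M. iexp (inner (J \<omega>) v) - iexp (inner (J \<omega>) w)) \<le> (LINT \<omega>|M. min 2 \<bar>inner (J \<omega>) (v - w)\<bar>)"
  proof (rule order_trans[OF Bochner_Integration.integral_norm_bound Bochner_Integration.integral_mono])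
    show "integrable M (\<lambda>\<omega>. cmod (iexp (inner (J \<omega>) v) - iexp (inner (J \<omega>) w)))"
      by (intro Bochner_Integration.integrable_norm Bochner_Integration.integrable_diff i)
    show "integrable M (\<lambda>\<omega>. min 2 \<bar>inner (J \<omega>) (v - w)\<bar>)" by (rule integrable_const_bound[of _ 2]) auto
    show "cmod (iexp (inner (J \<omega>) v) - iexp (inner (J \<omega>) w)) \<le> min 2 \<bar>inner (J \<omega>) (v - w)\<bar>" for \<omega>
      using cmod_iexp_diff_le[of "inner (J \<omega>) v" "inner (J \<omega>) w"] cmod_iexp_diff_le2[of "inner (J \<omega>) v" "inner (J \<omega>) w"]
      by (simp add: inner_diff_right)
  qed
  then show ?thesis by (simp add: Bochner_Integration.integral_diff i)
qed

section \<open>Jump integrals and their one-sided discontinuities\<close>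

lemma measurable_side_jump [measurable]: "(\<lambda>z. side_jump (fst z) (snd z)) \<in> borel_measurable (borel \<Otimes>\<^sub>M borel)"
  unfolding side_jump_def by measurable

lemma measurable_trunc_err [measurable]: "trunc_err \<in> borel_measurable borel"
  unfolding trunc_err_def by measurable

abbreviation near_one :: "real \<Rightarrow> real set" where
  "near_one \<delta> \<equiv> {\<beta>. 0 < \<bar>\<bar>\<beta>\<bar> - 1\<bar> \<and> \<bar>\<bar>\<beta>\<bar> - 1\<bar> \<le> \<delta>}"

context cyl_levy
begin

definition jump_err :: "('u \<Rightarrow>\<^sub>L real) \<Rightarrow> real" where
  "jump_err x = (LINT u|cyl_restr \<mu> {x}. trunc_err (blinfun_apply x u))"

definition jump_sq :: "('u \<Rightarrow>\<^sub>L real) \<Rightarrow> real" where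
  "jump_sq x = (LINT u|cyl_restr \<mu> {x}. min ((blinfun_apply x u)\<^sup>2) 1)"

text \<open>The one-sided jump of \<open>jump_err\<close> at \<open>x\<close> in the direction
  \<open>y\<close>.\<close>

definition jump_tie :: "('u \<Rightarrow>\<^sub>L real) \<Rightarrow> ('u \<Rightarrow>\<^sub>L real) \<Rightarrow> real" where
  "jump_tie x y = (LINT u|cyl_restr \<mu> {x, y}. side_jump (blinfun_apply x u) (blinfun_apply y u))"

definition near_mass :: "real \<Rightarrow> ('u \<Rightarrow>\<^sub>L real) \<Rightarrow> real" where
  "near_mass \<delta> x = (LINT u|cyl_restr \<mu> {x}. indicator (near_one \<delta>) (blinfun_apply x u))"

lemma Im_\<Psi>: "Im (\<Psi> x) = a x + jump_err x"
  unfolding jump_err_def by (rule \<Psi>_integral(4)) auto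

lemma cyl_comp_measurable:
  assumes "x \<in> \<Gamma>" "\<phi> \<in> borel_measurable borel"
  shows "(\<lambda>u. \<phi> (blinfun_apply x u)) \<in> borel_measurable (cyl_restr \<mu> \<Gamma>)"
  by (rule measurable_compose[OF measurable_cyl_restr[OF assms(1)] assms(2)])

lemma side_jump_cyl_measurable:
  assumes "x \<in> \<Gamma>" "y \<in> \<Gamma>"
  shows "(\<lambda>u. side_jump (blinfun_apply x u) (blinfun_apply y u)) \<in> borel_measurable (cyl_restr \<mu> \<Gamma>)"
  using measurable_compose[OF measurable_Pair[OF measurable_cyl_restr[OF assms(1)] measurable_cyl_restr[OF assms(2)]] measurable_side_jump]
  by simp

lemma cyl_integral_eq:
  assumes \<Gamma>: "finite \<Gamma>" "x \<in> \<Gamma>"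
  shows "(LINT u|cyl_restr \<mu> \<Gamma>. trunc_err (blinfun_apply x u)) = jump_err x"
    and "(LINT u|cyl_restr \<mu> \<Gamma>. min ((blinfun_apply x u)\<^sup>2) 1) = jump_sq x"
    and "(LINT u|cyl_restr \<mu> \<Gamma>. indicator (near_one \<delta>) (blinfun_apply x u)) = near_mass \<delta> x"
proof -
  have sub: "{x} \<subseteq> \<Gamma>" using \<Gamma> by simp
  note mono = integral_cyl_restr_mono[OF mu_cyl \<Gamma>(1) sub, symmetric]
  show "(LINT u|cyl_restr \<mu> \<Gamma>. trunc_err (blinfun_apply x u)) = jump_err x"
    unfolding jump_err_def by (rule mono, rule cyl_comp_measurable) simp_all
  show "(LINT u|cyl_restr \<mu> \<Gamma>. min ((blinfun_apply x u)\<^sup>2) 1) = jump_sq x"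
    unfolding jump_sq_def by (rule mono, rule cyl_comp_measurable[where \<phi>="\<lambda>\<beta>. min (\<beta>\<^sup>2) 1"]) simp_all
  show "(LINT u|cyl_restr \<mu> \<Gamma>. indicator (near_one \<delta>) (blinfun_apply x u)) = near_mass \<delta> x"
    unfolding near_mass_def by (rule mono, rule cyl_comp_measurable) simp_all
qed

lemma jump_tie_eq:
  assumes \<Gamma>: "finite \<Gamma>" "x \<in> \<Gamma>" "y \<in> \<Gamma>"
  shows "(LINT u|cyl_restr \<mu> \<Gamma>. side_jump (blinfun_apply x u) (blinfun_apply y u)) = jump_tie x y"
  unfolding jump_tie_def
  by (rule integral_cyl_restr_mono[OF mu_cyl \<Gamma>(1), symmetric]) (use \<Gamma> in \<open>auto intro: side_jump_cyl_measurable\<close>)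

lemma jump_tie_scale: "c > 0 \<Longrightarrow> jump_tie x (c *\<^sub>R y) = jump_tie x y"
proof -
  assume c: "c > 0"
  have s: "side_jump p (c * q) = side_jump p q" for p q
    using c by (auto simp: side_jump_def zero_less_mult_iff mult_less_0_iff)
  let ?\<Gamma> = "{x, y, c *\<^sub>R y}"
  have "jump_tie x (c *\<^sub>R y) = (LINT u|cyl_restr \<mu> ?\<Gamma>. side_jump (blinfun_apply x u) (blinfun_apply (c *\<^sub>R y) u))"
    by (rule jump_tie_eq[symmetric]) auto
  also have "\<dots> = (LINT u|cyl_restr \<mu> ?\<Gamma>. side_jump (blinfun_apply x u) (blinfun_apply y u))"
    by (simp add: blinfun.scaleR_left s)
  also have "\<dots> = jump_tie x y" by (rule jump_tie_eq) auto
  finally show ?thesis .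
qed

lemma near_one_le: "\<delta> \<le> 1 / 2 \<Longrightarrow> indicator (near_one \<delta>) \<beta> \<le> 4 * min (\<beta>\<^sup>2) (1 :: real)"
proof (cases "\<beta> \<in> near_one \<delta>")
  case True
  assume "\<delta> \<le> 1 / 2"
  then have "1 / 2 \<le> \<bar>\<beta>\<bar>" using True by auto
  then have "(1 / 2)\<^sup>2 \<le> \<bar>\<beta>\<bar>\<^sup>2" by (rule power_mono) simp
  then show ?thesis using True by (simp add: power2_eq_square)
qed simp

text \<open>\<open>near_one\<close> leaves out the points of modulus 1, so the windows shrink to the
  empty set. The shift by 2 starts the widths at one half, where the truncated square dominates the
  indicator.\<close>

lemma near_mass_tendsto: "(\<lambda>n. near_mass (1 / (real n + 2)) x) \<longlonglongrightarrow> 0"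
proof -
  have "(\<lambda>n. near_mass (1 / (real n + 2)) x) \<longlonglongrightarrow> (LINT u|cyl_restr \<mu> {x}. 0)"
    unfolding near_mass_def
  proof (rule integral_dominated_convergence[where w="\<lambda>u. 4 * min ((blinfun_apply x u)\<^sup>2) 1"])
    show "integrable (cyl_restr \<mu> {x}) (\<lambda>u. 4 * min ((blinfun_apply x u)\<^sup>2) 1)"
      by (intro integrable_mult_right integrable_min) auto
    show "(\<lambda>u. indicator (near_one (1 / (real n + 2))) (blinfun_apply x u)) \<in> borel_measurable (cyl_restr \<mu> {x})" for n
      by (rule cyl_comp_measurable) simp_all
    show "AE u in cyl_restr \<mu> {x}. norm (indicator (near_one (1 / (real n + 2))) (blinfun_apply x u) :: real) \<le> 4 * min ((blinfun_apply x u)\<^sup>2) 1" for n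
    proof (rule AE_I2)
      fix u
      have "1 / (real n + 2) \<le> 1 / 2" by (simp add: field_simps)
      from near_one_le[OF this] show "norm (indicator (near_one (1 / (real n + 2))) (blinfun_apply x u) :: real) \<le> 4 * min ((blinfun_apply x u)\<^sup>2) 1"
        by (simp only: real_norm_def abs_of_nonneg indicator_pos_le)
    qed
    show "AE u in cyl_restr \<mu> {x}. (\<lambda>n. indicator (near_one (1 / (real n + 2))) (blinfun_apply x u)) \<longlonglongrightarrow> (0 :: real)"
    proof (rule AE_I2)
      fix u
      define d where "d = \<bar>\<bar>blinfun_apply x u\<bar> - 1\<bar>"
      have "eventually (\<lambda>n. indicator (near_one (1 / (real n + 2))) (blinfun_apply x u) = (0 :: real)) sequentially"
      proof (cases "d = 0")
        case False
        then have "d > 0" by (simp add: d_def)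
        moreover have "(\<lambda>n. 1 / (real n + 2)) \<longlonglongrightarrow> 0" by real_asymp
        ultimately have "eventually (\<lambda>n. 1 / (real n + 2) < d) sequentially" by (intro order_tendstoD(2)) auto
        then show ?thesis by eventually_elim (simp add: d_def indicator_def)
      qed (simp add: d_def)
      then show "(\<lambda>n. indicator (near_one (1 / (real n + 2))) (blinfun_apply x u)) \<longlonglongrightarrow> (0 :: real)"
        by (rule tendsto_eventually)
    qed
  qed simp
  then show ?thesis by simp
qed

lemma jump_err_diff_le:
  assumes \<delta>: "0 < \<delta>" "\<delta> \<le> 1 / 2" and \<epsilon>: "\<epsilon> > 0"
  shows "\<bar>jump_err (x + y) - jump_err x - jump_tie x y\<bar>
    \<le> 4 * \<epsilon> * jump_sq x + (1 / \<epsilon> + 4 + 2 / \<delta>\<^sup>2) * jump_sq y + 2 * near_mass \<delta> x"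
proof -
  let ?\<Gamma> = "{x, y, x + y}"
  let ?N = "cyl_restr \<mu> ?\<Gamma>" and ?x = "blinfun_apply x" and ?y = "blinfun_apply y"
  let ?c = "1 / \<epsilon> + 4 + 2 / \<delta>\<^sup>2"
  have it: "integrable ?N (\<lambda>u. trunc_err (blinfun_apply (x + y) u))" "integrable ?N (\<lambda>u. trunc_err (?x u))"
    by (rule \<Psi>_integral(3); simp)+
  have im: "integrable ?N (\<lambda>u. min ((?x u)\<^sup>2) 1)" "integrable ?N (\<lambda>u. min ((?y u)\<^sup>2) 1)"
    by (rule integrable_min; simp)+
  have sj: "integrable ?N (\<lambda>u. side_jump (?x u) (?y u))"
  proof (rule Bochner_Integration.integrable_bound[OF im(1)])
    show "(\<lambda>u. side_jump (?x u) (?y u)) \<in> borel_measurable ?N" by (rule side_jump_cyl_measurable) simp_all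
  qed (auto simp: side_jump_def intro!: AE_I2)
  have "indicator (near_one \<delta>) (?x u) \<le> 4 * min ((?x u)\<^sup>2) 1" for u by (rule near_one_le[OF \<delta>(2)])
  then have ii: "integrable ?N (\<lambda>u. indicator (near_one \<delta>) (?x u) :: real)"
    by (intro Bochner_Integration.integrable_bound[OF integrable_mult_right[OF im(1), of 4]] cyl_comp_measurable AE_I2) simp_all
  have "\<bar>LINT u|?N. trunc_err (blinfun_apply (x + y) u) - trunc_err (?x u) - side_jump (?x u) (?y u)\<bar>
    \<le> (LINT u|?N. 4 * \<epsilon> * min ((?x u)\<^sup>2) 1 + ?c * min ((?y u)\<^sup>2) 1 + 2 * indicator (near_one \<delta>) (?x u))"
  proof (rule order_trans[OF integral_abs_bound integral_mono])
    show "integrable ?N (\<lambda>u. \<bar>trunc_err (blinfun_apply (x + y) u) - trunc_err (?x u) - side_jump (?x u) (?y u)\<bar>)"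
      by (intro integrable_abs Bochner_Integration.integrable_diff it sj)
    show "integrable ?N (\<lambda>u. 4 * \<epsilon> * min ((?x u)\<^sup>2) 1 + ?c * min ((?y u)\<^sup>2) 1 + 2 * indicator (near_one \<delta>) (?x u))"
      by (intro Bochner_Integration.integrable_add integrable_mult_right im ii)
  qed (simp only: blinfun.add_left trunc_err_diff_le[OF \<delta> \<epsilon>])
  also have "(LINT u|?N. trunc_err (blinfun_apply (x + y) u) - trunc_err (?x u) - side_jump (?x u) (?y u))
    = jump_err (x + y) - jump_err x - jump_tie x y"
    using it sj by (simp add: Bochner_Integration.integral_diff cyl_integral_eq jump_tie_eq del: plus_blinfun.rep_eq)
  also have "(LINT u|?N. 4 * \<epsilon> * min ((?x u)\<^sup>2) 1 + ?c * min ((?y u)\<^sup>2) 1 + 2 * indicator (near_one \<delta>) (?x u))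
    = 4 * \<epsilon> * jump_sq x + ?c * jump_sq y + 2 * near_mass \<delta> x"
    using im ii by (simp only: Bochner_Integration.integral_add integrable_mult_right integral_mult_right_zero
      Bochner_Integration.integrable_add cyl_integral_eq
      finite.emptyI finite_insert insert_iff simp_thms)
  finally show ?thesis .
qed

lemma jump_sq_nonneg: "jump_sq x \<ge> 0"
  unfolding jump_sq_def by (intro integral_nonneg_AE) simp

lemma jump_err_tie_tendsto:
  assumes y: "(\<lambda>n. jump_sq (y n)) \<longlonglongrightarrow> 0"
  shows "(\<lambda>n. jump_err (x + y n) - jump_err x - jump_tie x (y n)) \<longlonglongrightarrow> 0"
proof (rule LIMSEQ_I)
  fix r :: real assume r: "r > 0"
  \<comment> \<open>The coefficient of \<open>jump_sq (y n)\<close> depends on \<epsilon> and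
    \<delta>, so both are fixed before \<open>n\<close> grows. Adding 1 in the denominator covers
    \<open>jump_sq x = 0\<close>.\<close>
  define \<epsilon> where "\<epsilon> = r / (12 * (jump_sq x + 1))"
  have \<epsilon>: "\<epsilon> > 0" using r jump_sq_nonneg[of x] by (simp add: \<epsilon>_def)
  have e: "4 * \<epsilon> * jump_sq x < r / 3"
    using r jump_sq_nonneg[of x] by (simp add: \<epsilon>_def field_simps)
  obtain k where k: "near_mass (1 / (real k + 2)) x < r / 6"
    using order_tendstoD(2)[OF near_mass_tendsto, of "r / 6" x] r by (auto simp: eventually_sequentially)
  define \<delta> where "\<delta> = 1 / (real k + 2)"
  have \<delta>: "0 < \<delta>" "\<delta> \<le> 1 / 2" by (auto simp: \<delta>_def field_simps)
  let ?c = "1 / \<epsilon> + 4 + 2 / \<delta>\<^sup>2"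
  have "eventually (\<lambda>n. ?c * jump_sq (y n) < r / 3) sequentially"
    using tendsto_mult_right_zero[OF y, of ?c] r by (intro order_tendstoD(2)) auto
  then have "eventually (\<lambda>n. norm (jump_err (x + y n) - jump_err x - jump_tie x (y n) - 0) < r) sequentially"
  proof eventually_elim
    case (elim n)
    then show ?case using jump_err_diff_le[OF \<delta> \<epsilon>, of x "y n"] e k by (simp only: \<delta>_def real_norm_def diff_zero)
  qed
  then show "\<exists>n0. \<forall>n\<ge>n0. norm (jump_err (x + y n) - jump_err x - jump_tie x (y n) - 0) < r"
    by (simp only: eventually_sequentially)
qed

text \<open>\<open>jump_err\<close> inherits norm continuity from \<open>Im \<Psi>\<close> and \<open>a\<close>, while \<open>jump_tie x y\<close> does not change
  when \<open>y\<close> is replaced by \<open>c y\<close> with a small \<open>c > 0\<close>.\<close>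

lemma jump_tie_zero:
  assumes a: "continuous_on UNIV a"
  shows "jump_tie x y = 0"
proof -
  define c where "c n = inverse (real (Suc n))" for n
  have c: "c n > 0" for n by (simp add: c_def)
  have c0: "c \<longlonglongrightarrow> 0" unfolding c_def by (rule LIMSEQ_inverse_real_of_nat)
  have sq: "jump_sq (c n *\<^sub>R y) = (LINT u|cyl_restr \<mu> {y}. min ((c n * blinfun_apply y u)\<^sup>2) 1)" for n
  proof -
    have "jump_sq (c n *\<^sub>R y) = (LINT u|cyl_restr \<mu> {y, c n *\<^sub>R y}. min ((blinfun_apply (c n *\<^sub>R y) u)\<^sup>2) 1)"
      by (rule cyl_integral_eq(2)[symmetric]) auto
    also have "\<dots> = (LINT u|cyl_restr \<mu> {y, c n *\<^sub>R y}. min ((c n * blinfun_apply y u)\<^sup>2) 1)"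
      by (simp add: blinfun.scaleR_left)
    also have "\<dots> = (LINT u|cyl_restr \<mu> {y}. min ((c n * blinfun_apply y u)\<^sup>2) 1)"
      by (rule integral_cyl_restr_mono[OF mu_cyl, symmetric])
        (auto intro!: cyl_comp_measurable[where \<phi>="\<lambda>\<beta>. min ((c n * \<beta>)\<^sup>2) 1"])
    finally show ?thesis .
  qed
  have "(\<lambda>n. jump_sq (c n *\<^sub>R y)) \<longlonglongrightarrow> (LINT u|cyl_restr \<mu> {y}. 0)"
    unfolding sq
  proof (rule integral_dominated_convergence[where w="\<lambda>u. min ((blinfun_apply y u)\<^sup>2) 1"])
    show "integrable (cyl_restr \<mu> {y}) (\<lambda>u. min ((blinfun_apply y u)\<^sup>2) 1)" by (rule integrable_min) auto
    show "(\<lambda>u. min ((c n * blinfun_apply y u)\<^sup>2) 1) \<in> borel_measurable (cyl_restr \<mu> {y})" for n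
      by (rule cyl_comp_measurable[where \<phi>="\<lambda>\<beta>. min ((c n * \<beta>)\<^sup>2) 1"]) auto
    show "AE u in cyl_restr \<mu> {y}. (\<lambda>n. min ((c n * blinfun_apply y u)\<^sup>2) 1) \<longlonglongrightarrow> 0"
    proof (rule AE_I2)
      fix u
      have "(\<lambda>n. min ((c n * blinfun_apply y u)\<^sup>2) 1) \<longlonglongrightarrow> min ((0 * blinfun_apply y u)\<^sup>2) 1"
        by (intro tendsto_intros c0)
      then show "(\<lambda>n. min ((c n * blinfun_apply y u)\<^sup>2) 1) \<longlonglongrightarrow> 0" by simp
    qed
    show "AE u in cyl_restr \<mu> {y}. norm (min ((c n * blinfun_apply y u)\<^sup>2) 1) \<le> min ((blinfun_apply y u)\<^sup>2) 1" for n
    proof (rule AE_I2)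
      fix u
      have "c n \<le> 1" by (simp add: c_def inverse_eq_divide)
      then have "\<bar>c n * blinfun_apply y u\<bar> \<le> \<bar>blinfun_apply y u\<bar>"
        using c[of n] by (simp add: abs_mult mult_left_le_one_le)
      then have "(c n * blinfun_apply y u)\<^sup>2 \<le> (blinfun_apply y u)\<^sup>2" by (rule abs_le_square_iff[THEN iffD1])
      then show "norm (min ((c n * blinfun_apply y u)\<^sup>2) 1) \<le> min ((blinfun_apply y u)\<^sup>2) 1" by simp
    qed
  qed simp
  then have "(\<lambda>n. jump_sq (c n *\<^sub>R y)) \<longlonglongrightarrow> 0" by simp
  then have 1: "(\<lambda>n. jump_err (x + c n *\<^sub>R y) - jump_err x - jump_tie x y) \<longlonglongrightarrow> 0"
    using jump_err_tie_tendsto[of "\<lambda>n. c n *\<^sub>R y" x] by (simp add: jump_tie_scale c)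
  have l: "(\<lambda>n. x + c n *\<^sub>R y) \<longlonglongrightarrow> x + 0 *\<^sub>R y" by (intro tendsto_intros c0)
  have "(\<lambda>n. Im (\<Psi> (x + c n *\<^sub>R y)) - a (x + c n *\<^sub>R y)) \<longlonglongrightarrow> Im (\<Psi> (x + 0 *\<^sub>R y)) - a (x + 0 *\<^sub>R y)"
    by (intro tendsto_intros \<Psi>_tendsto l continuous_on_tendsto_compose[OF a]) auto
  then have "(\<lambda>n. jump_err (x + c n *\<^sub>R y)) \<longlonglongrightarrow> jump_err x" by (simp add: Im_\<Psi>)
  then have "(\<lambda>n. jump_err (x + c n *\<^sub>R y) - jump_err x - jump_tie x y) \<longlonglongrightarrow> jump_err x - jump_err x - jump_tie x y"
    by (intro tendsto_intros)
  from LIMSEQ_unique[OF this 1] show ?thesis by simp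
qed

text \<open>The increments need only be small in the sense of truncated squares, which is what
  weakly convergent vectors provide where convergence in norm may fail.\<close>

lemma jump_err_tendsto:
  assumes "continuous_on UNIV a" and "(\<lambda>n. jump_sq (y n)) \<longlonglongrightarrow> 0"
  shows "(\<lambda>n. jump_err (x + y n)) \<longlonglongrightarrow> jump_err x"
  using jump_err_tie_tendsto[OF assms(2), of x] by (simp add: jump_tie_zero[OF assms(1)] LIM_zero_iff)

lemma abs_jump_err_le: "\<bar>jump_err x\<bar> \<le> 2 * jump_sq x"
proof -
  have "\<bar>jump_err x\<bar> \<le> (LINT u|cyl_restr \<mu> {x}. 2 * min ((blinfun_apply x u)\<^sup>2) 1)"
    unfolding jump_err_def
    by (rule order_trans[OF integral_abs_bound integral_mono])
      (auto intro!: integrable_min \<Psi>_integral(3) abs_trunc_err_le)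
  then show ?thesis by (simp add: jump_sq_def)
qed

lemma ennreal_jump_sq: "ennreal (jump_sq x) = (\<integral>\<^sup>+u. ennreal (min ((blinfun_apply x u)\<^sup>2) 1) \<partial>cyl_restr \<mu> {x})"
  unfolding jump_sq_def by (rule nn_integral_eq_integral[symmetric]) (auto intro!: integrable_min)

end

section \<open>Weakly convergent integrands\<close>

context levy_integrand
begin

text \<open>The characteristic functions only determine the exponentials of the integrals. The branch of the
  logarithm is fixed by following the path \<open>t \<mapsto> t v\<close> from \<open>0\<close> to \<open>v\<close>.\<close>

lemma \<Psi>_fs_integral_weak_tendsto:
  assumes A: "A \<in> sets borel" and J: "J \<in> borel_measurable M"
    and cyl: "\<And>v. has_cyl_integral M L T (\<lambda>s. indicator A s *\<^sub>R fs s v) (\<lambda>\<omega>. inner (J \<omega>) v)"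
    and v: "weakly_tendsto v w"
  shows "(\<lambda>n. LINT s|leb T. \<Psi> (indicator A s *\<^sub>R fs s (v n))) \<longlonglongrightarrow> (LINT s|leb T. \<Psi> (indicator A s *\<^sub>R fs s w))"
proof -
  define Z where "Z v = (LINT s|leb T. \<Psi> (indicator A s *\<^sub>R fs s v))" for v
  define d where "d n = (LINT \<omega>|M. min 2 \<bar>inner (J \<omega>) (v n - w)\<bar>)" for n
  have Z: "(LINT \<omega>|M. iexp (inner (J \<omega>) v)) = exp (Z v)" for v
    unfolding Z_def by (rule has_cyl_integral_fs_char[OF A cyl])
  have d: "d \<longlonglongrightarrow> 0"
    unfolding d_def by (rule expectation_inner_tendsto_0[OF J weakly_tendsto_diff[OF v]])
  obtain C where C: "C \<ge> 0" "\<And>s v. s \<in> {0..T} \<Longrightarrow> norm (fs s v) \<le> C * norm v" using fs_bounded by blast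
  have cont: "continuous_on {0..1} (\<lambda>t. Z (t *\<^sub>R x))" for x
    unfolding continuous_on_sequentially o_def
  proof (intro allI ballI impI)
    fix t :: "nat \<Rightarrow> real" and t0 assume t0: "t0 \<in> {0..1}" and t: "(\<forall>n. t n \<in> {0..1}) \<and> t \<longlonglongrightarrow> t0"
    show "(\<lambda>n. Z (t n *\<^sub>R x)) \<longlonglongrightarrow> Z (t0 *\<^sub>R x)"
      unfolding Z_def
    proof (rule \<Psi>_integral_tendsto[where C="C * norm x"])
      show "norm (indicator A s *\<^sub>R fs s (t n *\<^sub>R x)) \<le> C * norm x" if s: "s \<in> {0..T}" for n s
      proof -
        have "norm (indicator A s *\<^sub>R fs s (t n *\<^sub>R x)) \<le> norm (fs s (t n *\<^sub>R x))"
          by (auto simp: indicator_def)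
        also have "\<dots> \<le> C * norm (t n *\<^sub>R x)" by (rule C(2)[OF s])
        also have "norm (t n *\<^sub>R x) \<le> 1 * norm x"
          unfolding norm_scaleR by (rule mult_right_mono) (use t in \<open>auto simp: abs_le_iff intro: order_trans[of _ 0]\<close>)
        finally show ?thesis using C(1) by (simp add: mult_left_mono)
      qed
      show "AE s in leb T. (\<lambda>n. indicator A s *\<^sub>R fs s (t n *\<^sub>R x)) \<longlonglongrightarrow> indicator A s *\<^sub>R fs s (t0 *\<^sub>R x)"
        unfolding adj_scale by (intro AE_I2 tendsto_intros) (use t in auto)
    qed (rule measurable_indicator_fs[OF A])+
  qed
  have "continuous_on {0..1} (\<lambda>t. cmod (exp (Z (t *\<^sub>R w))))" by (intro continuous_intros cont)
  then have "\<exists>t0\<in>{0..1}. \<forall>t\<in>{0..1}. cmod (exp (Z (t0 *\<^sub>R w))) \<le> cmod (exp (Z (t *\<^sub>R w)))"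
    by (intro continuous_attains_inf) auto
  then obtain t0 :: real where
    t0: "\<And>t. t \<in> {0..1} \<Longrightarrow> cmod (exp (Z (t0 *\<^sub>R w))) \<le> cmod (exp (Z (t *\<^sub>R w)))" by blast
  \<comment> \<open>A positive lower bound for the characteristic function along the whole path to
    \<open>w\<close>. Division by it turns closeness of characteristic functions into closeness of
    \<open>exp (q n t)\<close> to 1, uniformly in \<open>t\<close>.\<close>
  define m where "m = cmod (exp (Z (t0 *\<^sub>R w)))"
  have m: "m > 0" by (simp add: m_def)
  define q where "q n t = Z (t *\<^sub>R v n) - Z (t *\<^sub>R w)" for n t
  have le: "cmod (exp (q n t) - 1) \<le> d n / m" if t: "t \<in> {0..1}" for n t
  proof -
    have "cmod (exp (q n t) - 1) * cmod (exp (Z (t *\<^sub>R w))) = cmod (exp (Z (t *\<^sub>R v n)) - exp (Z (t *\<^sub>R w)))"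
    proof -
      have "(exp (q n t) - 1) * exp (Z (t *\<^sub>R w)) = exp (Z (t *\<^sub>R v n)) - exp (Z (t *\<^sub>R w))"
        by (simp add: q_def left_diff_distrib flip: exp_add)
      then show ?thesis by (metis norm_mult)
    qed
    also have "\<dots> \<le> (LINT \<omega>|M. min 2 \<bar>inner (J \<omega>) (t *\<^sub>R v n - t *\<^sub>R w)\<bar>)"
      unfolding Z[symmetric] by (rule cmod_char_inner_diff_le[OF J])
    also have "\<dots> \<le> d n"
      unfolding d_def
    proof (rule integral_mono)
      have [measurable]: "J \<in> borel_measurable M" by fact
      show "integrable M (\<lambda>\<omega>. min 2 \<bar>inner (J \<omega>) (t *\<^sub>R v n - t *\<^sub>R w)\<bar>)"
        "integrable M (\<lambda>\<omega>. min 2 \<bar>inner (J \<omega>) (v n - w)\<bar>)" by (rule integrable_const_bound[of _ 2]; simp)+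
      fix \<omega>
      have "\<bar>t * inner (J \<omega>) (v n - w)\<bar> \<le> \<bar>inner (J \<omega>) (v n - w)\<bar>"
        using t by (simp add: abs_mult mult_left_le_one_le)
      then show "min 2 \<bar>inner (J \<omega>) (t *\<^sub>R v n - t *\<^sub>R w)\<bar> \<le> min 2 \<bar>inner (J \<omega>) (v n - w)\<bar>"
        by (simp add: scaleR_right_diff_distrib[symmetric])
    qed
    finally have "cmod (exp (q n t) - 1) * cmod (exp (Z (t *\<^sub>R w))) \<le> d n" .
    moreover have "cmod (exp (q n t) - 1) * m \<le> cmod (exp (q n t) - 1) * cmod (exp (Z (t *\<^sub>R w)))"
      unfolding m_def by (rule mult_left_mono[OF t0[OF t]]) simp
    ultimately show ?thesis using m by (simp add: field_simps)
  qed
  have dm: "(\<lambda>n. d n / m) \<longlonglongrightarrow> 0" using tendsto_divide[OF d tendsto_const[of m]] m by simp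
  have one: "(1 :: real) \<in> {0..1}" by simp
  have "(\<lambda>n. exp (q n 1) - 1) \<longlonglongrightarrow> 0"
    by (rule Lim_null_comparison[OF _ dm]) (use le[OF one] in auto)
  then have "(\<lambda>n. exp (q n 1)) \<longlonglongrightarrow> 1" by (simp add: LIM_zero_iff)
  then have "(\<lambda>n. Ln (exp (q n 1))) \<longlonglongrightarrow> Ln 1" by (intro tendsto_Ln) auto
  moreover have "eventually (\<lambda>n. Ln (exp (q n 1)) = q n 1) sequentially"
    using order_tendstoD(2)[OF dm zero_less_one]
  proof eventually_elim
    case (elim n)
    have "continuous_on {0..1} (q n)" unfolding q_def by (intro continuous_intros cont)
    moreover have "q n 0 = 0" by (simp add: q_def)
    ultimately show ?case using Ln_exp_along_path[of "q n"] le elim by (metis order_le_less_trans)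
  qed
  ultimately have "(\<lambda>n. q n 1) \<longlonglongrightarrow> 0" using Lim_transform_eventually by fastforce
  then show ?thesis by (simp add: q_def Z_def[symmetric] LIM_zero_iff)
qed

lemma jump_sq_fs_le:
  "ennreal (jump_sq (fs s v)) \<le> ennreal (1 / (1 - exp (- 1 / 2))) * jterm (\<lambda>_. v) {0} s"
  using mterm_le_jterm[of "{0}" "\<lambda>_. v" s] by (simp add: mterm_def ennreal_jump_sq)

text \<open>A single vector is encoded as a constant family over the index set \<open>{0}\<close>,
  which makes the Gaussian mean bounds available for it.\<close>

lemma jterm_bounded:
  obtains B where "B \<ge> 0" "\<And>s (v :: 'v). s \<in> {0..T} \<Longrightarrow> norm v \<le> r \<Longrightarrow> jterm (\<lambda>_. v) {0} s \<le> ennreal B"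
proof -
  obtain C where C: "C \<ge> 0" "\<And>s v. s \<in> {0..T} \<Longrightarrow> norm (fs s v) \<le> C * norm v" using fs_bounded by blast
  obtain B where B: "B \<ge> 0" "\<And>x. (\<And>k. k \<in> {0} \<Longrightarrow> norm (x k) \<le> C * r) \<Longrightarrow>
    (\<integral>\<^sup>+g. ennreal (kexp (\<Sum>k\<in>{0}. g k *\<^sub>R x k)) \<partial>gauss {0}) \<le> ennreal B"
    by (rule gauss_mean_kexp_bounded[of "{0}" "C * r"]) (simp, rule that, assumption, blast)
  show thesis
  proof (rule that[OF B(1)])
    fix s and v :: 'v assume s: "s \<in> {0..T}" and v: "norm v \<le> r"
    have "norm (fs s v) \<le> C * r" by (rule order_trans[OF C(2)[OF s] mult_left_mono[OF v C(1)]])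
    then have "(\<integral>\<^sup>+g. ennreal (kexp (\<Sum>k\<in>{0}. g k *\<^sub>R fs s v)) \<partial>gauss {0}) \<le> ennreal B" by (intro B(2)) simp
    moreover have "jterm (\<lambda>_. v) {0} s \<le> (\<integral>\<^sup>+g. ennreal (kexp (\<Sum>k\<in>{0}. g k *\<^sub>R fs s v)) \<partial>gauss {0})"
      unfolding jterm_def by (subst gauss_mean_kexp) (auto intro: add_increasing)
    ultimately show "jterm (\<lambda>_. v) {0} s \<le> ennreal B" by (rule order_trans[rotated])
  qed
qed

lemma jump_err_fs_bounded:
  obtains B where "B \<ge> 0" "\<And>s (v :: 'v). s \<in> {0..T} \<Longrightarrow> norm v \<le> r \<Longrightarrow> \<bar>jump_err (fs s v)\<bar> \<le> B"
proof -
  let ?c = "1 / (1 - exp (- 1 / 2)) :: real"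
  have c: "?c > 0" by simp
  obtain B where B: "B \<ge> 0" "\<And>s (v :: 'v). s \<in> {0..T} \<Longrightarrow> norm v \<le> r \<Longrightarrow> jterm (\<lambda>_. v) {0} s \<le> ennreal B"
    by (rule jterm_bounded[of r]) blast
  show thesis
  proof (rule that[of "2 * (?c * B)"])
    show "2 * (?c * B) \<ge> 0" using B(1) c by simp
    fix s and v :: 'v assume s: "s \<in> {0..T}" and v: "norm v \<le> r"
    have "ennreal (jump_sq (fs s v)) \<le> ennreal ?c * ennreal B"
      by (rule order_trans[OF jump_sq_fs_le mult_left_mono[OF B(2)[OF s v]]]) simp
    also have "\<dots> = ennreal (?c * B)" using B(1) c by (intro ennreal_mult[symmetric]) auto
    finally have "jump_sq (fs s v) \<le> ?c * B" using B(1) c by (subst (asm) ennreal_le_iff) auto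
    then show "\<bar>jump_err (fs s v)\<bar> \<le> 2 * (?c * B)" using abs_jump_err_le[of "fs s v"] by linarith
  qed
qed

text \<open>For each scalar \<open>c\<close> the modulus of the characteristic function of
  \<open>inner (J \<omega>) (c *\<^sub>R u n)\<close>, which is
  \<open>exp (- Kint (c *\<^sub>R u n))\<close>, tends to 1. The average over Gaussian
  \<open>c\<close> follows by domination, since \<open>kexp\<close> grows quadratically and
  \<open>u\<close> is bounded.\<close>

lemma kappa_weak_tendsto_0:
  fixes J :: "'w \<Rightarrow> 'v"
  assumes J: "J \<in> borel_measurable M"
    and cyl: "\<And>v. has_cyl_integral M L T (\<lambda>s. indicator {0..T} s *\<^sub>R fs s v) (\<lambda>\<omega>. inner (J \<omega>) v)"
    and u: "weakly_tendsto u 0"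
  shows "(\<lambda>n. kappa (\<lambda>_. u n) {0}) \<longlonglongrightarrow> 0"
proof -
  interpret S: finite_measure "leb T" by (rule finite_measure_leb)
  interpret G: prob_space "gauss {0}" by (rule prob_space_gauss)
  obtain C where C: "C \<ge> 0" "\<And>s v. s \<in> {0..T} \<Longrightarrow> norm (fs s v) \<le> C * norm v" using fs_bounded by blast
  obtain D where D: "D \<ge> 0" "\<And>x. kexp x \<le> D * (1 + 4 * (norm x)\<^sup>2)" by (rule kexp_growth) blast
  obtain R where R: "R \<ge> 0" "\<And>n. norm (u n) \<le> R" by (rule weakly_tendsto_bounded[OF u]) blast
  have K0: "(\<lambda>n. Kint (c *\<^sub>R u n)) \<longlonglongrightarrow> 0" for c
  proof -
    have "(\<lambda>n. (LINT \<omega>|M. iexp (inner (J \<omega>) (c *\<^sub>R u n))) - (LINT \<omega>|M. iexp (inner (J \<omega>) 0))) \<longlonglongrightarrow> 0"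
    proof (rule Lim_null_comparison[OF _ expectation_inner_tendsto_0[OF J weakly_tendsto_scale[OF u, of c]]])
      show "eventually (\<lambda>n. norm ((LINT \<omega>|M. iexp (inner (J \<omega>) (c *\<^sub>R u n))) - (LINT \<omega>|M. iexp (inner (J \<omega>) 0)))
        \<le> (LINT \<omega>|M. min 2 \<bar>inner (J \<omega>) (c *\<^sub>R u n)\<bar>)) sequentially"
        using cmod_char_inner_diff_le[OF J, of "c *\<^sub>R u _" 0] by (intro always_eventually allI) simp
    qed
    then have "(\<lambda>n. LINT \<omega>|M. iexp (inner (J \<omega>) (c *\<^sub>R u n))) \<longlonglongrightarrow> 1" by (simp add: LIM_zero_iff prob_space)
    then have "(\<lambda>n. cmod (LINT \<omega>|M. iexp (inner (J \<omega>) (c *\<^sub>R u n)))) \<longlonglongrightarrow> cmod 1" by (rule tendsto_norm)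
    then have "(\<lambda>n. exp (- Kint (c *\<^sub>R u n))) \<longlonglongrightarrow> 1" by (simp only: cmod_char_Kint[OF cyl] norm_one)
    then have "(\<lambda>n. - ln (exp (- Kint (c *\<^sub>R u n)))) \<longlonglongrightarrow> - ln 1" by (intro tendsto_intros) auto
    then show ?thesis by simp
  qed
  have dom: "Kint (c *\<^sub>R u n) \<le> measure (leb T) (space (leb T)) * (D * (1 + 4 * (C * R)\<^sup>2 * c\<^sup>2))" for c n
  proof -
    have "Kint (c *\<^sub>R u n) \<le> (LINT s|leb T. D * (1 + 4 * (C * R)\<^sup>2 * c\<^sup>2))"
      unfolding Kint_def
    proof (rule integral_mono[OF integrable_kexp_fs])
      fix s assume "s \<in> space (leb T)"
      then have s: "s \<in> {0..T}" by (simp add: space_restrict_space)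
      have "norm (fs s (c *\<^sub>R u n)) \<le> C * norm (c *\<^sub>R u n)" by (rule C(2)[OF s])
      also have "\<dots> \<le> C * (\<bar>c\<bar> * R)" unfolding norm_scaleR by (intro mult_left_mono R C) auto
      finally have "(norm (fs s (c *\<^sub>R u n)))\<^sup>2 \<le> (C * (\<bar>c\<bar> * R))\<^sup>2" by (rule power_mono) simp
      also have "\<dots> = (C * R)\<^sup>2 * c\<^sup>2" by (simp add: power_mult_distrib)
      finally have "D * (1 + 4 * (norm (fs s (c *\<^sub>R u n)))\<^sup>2) \<le> D * (1 + 4 * (C * R)\<^sup>2 * c\<^sup>2)"
        using D(1) by (intro mult_left_mono) auto
      with D(2) show "kexp (fs s (c *\<^sub>R u n)) \<le> D * (1 + 4 * (C * R)\<^sup>2 * c\<^sup>2)" by (rule order_trans)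
    qed simp
    then show ?thesis by simp
  qed
  define W where "W g = measure (leb T) (space (leb T)) * (D * (1 + 4 * (C * R)\<^sup>2 * (g 0)\<^sup>2))" for g :: "nat \<Rightarrow> real"
  have iW: "integrable (gauss {0}) W"
    using gauss_mean_component(1)[of "{0}" 0 0] unfolding W_def power2_eq_square
    by (intro integrable_mult_right Bochner_Integration.integrable_add integrable_const) auto
  have eK: "(\<integral>\<^sup>+s. ennreal (kexp (fs s (\<Sum>k\<in>{0}. g k *\<^sub>R u n))) \<partial>leb T) = ennreal (Kint (g 0 *\<^sub>R u n))" for g :: "nat \<Rightarrow> real" and n
    by (simp add: ennreal_Kint)
  have kap: "kappa (\<lambda>_. u n) {0} = (\<integral>\<^sup>+g. ennreal (Kint (g 0 *\<^sub>R u n)) \<partial>gauss {0})" for n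
    unfolding eK[symmetric] by (rule kappa_swap(1)[symmetric]) simp
  have "(\<lambda>n. \<integral>\<^sup>+g. ennreal (Kint (g 0 *\<^sub>R u n)) \<partial>gauss {0}) \<longlonglongrightarrow> (\<integral>\<^sup>+g. 0 \<partial>gauss {0})"
  proof (rule nn_integral_dominated_convergence[where w="\<lambda>g. ennreal (W g)"])
    show "(\<lambda>g. ennreal (Kint (g 0 *\<^sub>R u n))) \<in> borel_measurable (gauss {0})" for n
      unfolding eK[symmetric] by (rule kappa_swap(4)) simp
    show "(\<lambda>g. ennreal (W g)) \<in> borel_measurable (gauss {0})" using iW by measurable
    show "AE g in gauss {0}. ennreal (Kint (g 0 *\<^sub>R u n)) \<le> ennreal (W g)" for n
      unfolding W_def by (intro AE_I2 ennreal_leI dom)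
    have "W g \<ge> 0" for g using D(1) by (simp add: W_def)
    then show "(\<integral>\<^sup>+g. ennreal (W g) \<partial>gauss {0}) < \<infinity>" using iW by (simp add: nn_integral_eq_integral)
    show "AE g in gauss {0}. (\<lambda>n. ennreal (Kint (g 0 *\<^sub>R u n))) \<longlonglongrightarrow> 0"
      using tendsto_ennrealI[OF K0] by (intro AE_I2) simp
  qed simp
  then show ?thesis by (simp add: kap)
qed

lemma continuous_jump_err:
  assumes "continuous_on UNIV a"
  shows "continuous_on UNIV jump_err"
proof -
  have "jump_err = (\<lambda>x. Im (\<Psi> x) - a x)" by (simp add: fun_eq_iff Im_\<Psi>)
  then show ?thesis using assms by (simp add: continuous_intros continuous_\<Psi>)
qed

text \<open>Smallness of \<open>kappa\<close> gives the truncated squares of the increments in mean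
  over \<open>s\<close> only. Along a further subsequence they tend to 0 for almost every
  \<open>s\<close>, where \<open>jump_err_tendsto\<close> applies; a uniform bound then yields
  convergence in mean.\<close>

lemma jump_err_fs_L1_tendsto:
  fixes J :: "'w \<Rightarrow> 'v"
  assumes a: "continuous_on UNIV a" and J: "J \<in> borel_measurable M"
    and cyl: "\<And>v. has_cyl_integral M L T (\<lambda>s. indicator {0..T} s *\<^sub>R fs s v) (\<lambda>\<omega>. inner (J \<omega>) v)"
    and v: "weakly_tendsto v w"
  shows "(\<lambda>n. LINT s|leb T. \<bar>jump_err (fs s (v n)) - jump_err (fs s w)\<bar>) \<longlonglongrightarrow> 0"
proof (rule LIMSEQ_if_subseq_subseq)
  fix \<sigma> :: "nat \<Rightarrow> nat" assume \<sigma>: "strict_mono \<sigma>"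
  interpret S: finite_measure "leb T" by (rule finite_measure_leb)
  define u where "u n = v (\<sigma> n) - w" for n
  have u: "weakly_tendsto u 0"
    unfolding u_def[abs_def] by (rule weakly_tendsto_diff[OF weakly_tendsto_subseq[OF v \<sigma>]])
  obtain R where R: "R \<ge> 0" "\<And>n. norm (u n) \<le> R" by (rule weakly_tendsto_bounded[OF u]) blast
  obtain R' where R': "R' \<ge> 0" "\<And>n. norm (v n) \<le> R'" by (rule weakly_tendsto_bounded[OF v]) blast
  obtain B where B: "B \<ge> 0" "\<And>s (v :: 'v). s \<in> {0..T} \<Longrightarrow> norm v \<le> R \<Longrightarrow> jterm (\<lambda>_. v) {0} s \<le> ennreal B"
    by (rule jterm_bounded[of R]) blast
  obtain B' where B': "B' \<ge> 0" "\<And>s (v :: 'v). s \<in> {0..T} \<Longrightarrow> norm v \<le> max R' (norm w) \<Longrightarrow> \<bar>jump_err (fs s v)\<bar> \<le> B'"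
    by (rule jump_err_fs_bounded[of "max R' (norm w)"]) blast
  \<comment> \<open>A real majorant of \<open>jump_sq\<close>, up to a constant, whose measurability
    in \<open>s\<close> is already known.\<close>
  define j where "j n s = enn2real (jterm (\<lambda>_. u n) {0} s)" for n s
  have j0: "j n s \<ge> 0" for n s by (simp add: j_def)
  have ej: "ennreal (j n s) = jterm (\<lambda>_. u n) {0} s" if s: "s \<in> {0..T}" for n s
    unfolding j_def using B(2)[OF s R(2), of n] by (intro ennreal_enn2real) (auto intro: le_less_trans)
  have jB: "j n s \<le> B" if s: "s \<in> {0..T}" for n s
    using B(2)[OF s R(2), of n] B(1) unfolding ej[OF s, symmetric] by simp
  have jm[measurable]: "j n \<in> borel_measurable (leb T)" for n
    using kappa_swap(3)[of "{0}" "\<lambda>_. u n"] unfolding j_def by measurable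
  have ji: "integrable (leb T) (j n)" for n
    by (rule S.integrable_const_bound[of _ B]) (use j0 jB in \<open>auto simp: space_restrict_space intro!: AE_I2\<close>)
  have "ennreal (LINT s|leb T. j n s) \<le> kappa (\<lambda>_. u n) {0}" for n
  proof -
    have "ennreal (LINT s|leb T. j n s) = (\<integral>\<^sup>+s. ennreal (j n s) \<partial>leb T)"
      using ji j0 by (intro nn_integral_eq_integral[symmetric]) auto
    also have "\<dots> = (\<integral>\<^sup>+s. jterm (\<lambda>_. u n) {0} s \<partial>leb T)"
      by (intro nn_integral_cong ej) (simp add: space_restrict_space)
    also have "\<dots> \<le> kappa (\<lambda>_. u n) {0}"
      by (subst kappa_split) (auto intro: add_increasing)
    finally show ?thesis .
  qed
  then have "(\<lambda>n. ennreal (LINT s|leb T. j n s)) \<longlonglongrightarrow> 0"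
    by (intro tendsto_sandwich[OF _ _ tendsto_const kappa_weak_tendsto_0[OF J cyl u]]) auto
  then have "(\<lambda>n. ennreal (LINT s|leb T. j n s)) \<longlonglongrightarrow> ennreal 0" by simp
  then have "(\<lambda>n. LINT s|leb T. j n s) \<longlonglongrightarrow> 0"
    by (subst (asm) tendsto_ennreal_iff) (auto intro!: always_eventually integral_nonneg_AE AE_I2 j0)
  then have "(\<lambda>n. LINT s|leb T. norm (j n s)) \<longlonglongrightarrow> 0" using j0 by simp
  from tendsto_L1_AE_subseq[OF ji this] obtain \<rho> :: "nat \<Rightarrow> nat"
    where \<rho>: "strict_mono \<rho>" "AE s in leb T. (\<lambda>n. j (\<rho> n) s) \<longlonglongrightarrow> 0" by blast
  let ?c = "1 / (1 - exp (- 1 / 2)) :: real"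
  have c: "?c > 0" by simp
  have mj: "(\<lambda>s. jump_err (fs s x)) \<in> borel_measurable (leb T)" for x
    by (rule measurable_fs[OF continuous_jump_err[OF a]])
  have "(\<lambda>n. LINT s|leb T. \<bar>jump_err (fs s (v (\<sigma> (\<rho> n)))) - jump_err (fs s w)\<bar>) \<longlonglongrightarrow> (LINT s|leb T. 0)"
  proof (rule integral_dominated_convergence[where w="\<lambda>_. 2 * B'"])
    show "AE s in leb T. (\<lambda>n. \<bar>jump_err (fs s (v (\<sigma> (\<rho> n)))) - jump_err (fs s w)\<bar>) \<longlonglongrightarrow> 0"
      using \<rho>(2) AE_space
    proof eventually_elim
      case (elim s)
      then have s: "s \<in> {0..T}" by (simp add: space_restrict_space)
      have le: "jump_sq (fs s (u n)) \<le> ?c * j n s" for n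
      proof -
        have "ennreal (jump_sq (fs s (u n))) \<le> ennreal ?c * ennreal (j n s)"
          unfolding ej[OF s] by (rule jump_sq_fs_le)
        also have "\<dots> = ennreal (?c * j n s)" using c j0 by (intro ennreal_mult[symmetric]) auto
        finally show ?thesis using c j0 by (subst (asm) ennreal_le_iff) auto
      qed
      have "(\<lambda>n. jump_sq (fs s (u (\<rho> n)))) \<longlonglongrightarrow> 0"
        by (rule tendsto_sandwich[OF _ _ tendsto_const tendsto_mult_right_zero[OF elim(1), of ?c]])
          (use le jump_sq_nonneg in \<open>auto intro!: always_eventually\<close>)
      from jump_err_tendsto[OF a this, of "fs s w"]
      have "(\<lambda>n. jump_err (fs s (v (\<sigma> (\<rho> n))))) \<longlonglongrightarrow> jump_err (fs s w)"
        by (simp add: adj_add[symmetric] u_def)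
      then have "(\<lambda>n. \<bar>jump_err (fs s (v (\<sigma> (\<rho> n)))) - jump_err (fs s w)\<bar>) \<longlonglongrightarrow> \<bar>jump_err (fs s w) - jump_err (fs s w)\<bar>"
        by (intro tendsto_intros)
      then show ?case by simp
    qed
    show "AE s in leb T. norm \<bar>jump_err (fs s (v (\<sigma> (\<rho> n)))) - jump_err (fs s w)\<bar> \<le> 2 * B'" for n
    proof (rule AE_I2)
      fix s assume "s \<in> space (leb T)"
      then have s: "s \<in> {0..T}" by (simp add: space_restrict_space)
      have "\<bar>jump_err (fs s (v (\<sigma> (\<rho> n))))\<bar> \<le> B'" "\<bar>jump_err (fs s w)\<bar> \<le> B'"
        by (intro B'(2)[OF s]; simp add: R'(2) le_max_iff_disj)+
      then show "norm \<bar>jump_err (fs s (v (\<sigma> (\<rho> n)))) - jump_err (fs s w)\<bar> \<le> 2 * B'" by simp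
    qed
    show "(\<lambda>s. \<bar>jump_err (fs s (v (\<sigma> (\<rho> n)))) - jump_err (fs s w)\<bar>) \<in> borel_measurable (leb T)" for n
      by (intro borel_measurable_abs borel_measurable_diff mj)
  qed auto
  then show "\<exists>\<rho> :: nat \<Rightarrow> nat. strict_mono \<rho> \<and>
    (\<lambda>n. LINT s|leb T. \<bar>jump_err (fs s (v (\<sigma> (\<rho> n)))) - jump_err (fs s w)\<bar>) \<longlonglongrightarrow> 0"
    using \<rho>(1) by auto
qed

text \<open>\<open>a\<close> is \<open>Im \<Psi>\<close> minus \<open>jump_err\<close>.
  Integrability over every \<open>A\<close> handles the first term on indicators, convergence in
  mean the second, and the uniform bound on \<open>a\<close> extends testing from indicators to all
  functionals on \<open>L^1\<close>.\<close>

lemma weak_weak_seq_continuous_a: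
  assumes a: "continuous_on UNIV a" and int: "stochastically_integrable M L T f"
  shows "weak_weak_seq_continuous (leb T) (\<lambda>v s. a (fs s v))"
  unfolding weak_weak_seq_continuous_def L1_weakly_tendsto_def
proof (intro allI impI)
  fix v :: "nat \<Rightarrow> 'v" and w assume v: "weakly_tendsto v w"
  interpret S: finite_measure "leb T" by (rule finite_measure_leb)
  have J: "\<exists>J\<in>borel_measurable M. \<forall>v. has_cyl_integral M L T (\<lambda>s. indicator A s *\<^sub>R fs s v) (\<lambda>\<omega>. inner (J \<omega>) v)"
    if "A \<in> sets borel" "A \<subseteq> {0..T}" for A
    using int that unfolding stochastically_integrable_def by blast
  obtain C where C: "C \<ge> 0" "\<And>s v. s \<in> {0..T} \<Longrightarrow> norm (fs s v) \<le> C * norm v" using fs_bounded by blast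
  obtain R where R: "R \<ge> 0" "\<And>n. norm (v n) \<le> R" by (rule weakly_tendsto_bounded[OF v]) blast
  define r where "r = max R (norm w)"
  have r: "norm (v n) \<le> r" "norm w \<le> r" for n using R(2)[of n] by (auto simp: r_def)
  obtain B where B: "B \<ge> 0" "\<And>s (v :: 'v). s \<in> {0..T} \<Longrightarrow> norm v \<le> r \<Longrightarrow> \<bar>jump_err (fs s v)\<bar> \<le> B"
    by (rule jump_err_fs_bounded[of r]) blast
  obtain D where D: "D \<ge> 0" "\<And>x. norm x \<le> C * r \<Longrightarrow> cmod (\<Psi> x) \<le> D" by (rule \<Psi>_bounded[of "C * r"]) blast
  have aB: "\<bar>a (fs s x)\<bar> \<le> D + B" if s: "s \<in> {0..T}" and x: "norm x \<le> r" for s x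
  proof -
    have "norm (fs s x) \<le> C * r" by (rule order_trans[OF C(2)[OF s] mult_left_mono[OF x C(1)]])
    then have "\<bar>Im (\<Psi> (fs s x))\<bar> \<le> D" by (rule order_trans[OF abs_Im_le_cmod D(2)])
    then show ?thesis using B(2)[OF s x] Im_\<Psi>[of "fs s x"] by linarith
  qed
  have ia: "integrable (leb T) (\<lambda>s. a (fs s x))" if "norm x \<le> r" for x
    by (rule S.integrable_const_bound[of _ "D + B"])
      (use aB that measurable_fs[OF a] in \<open>auto simp: space_restrict_space intro!: AE_I2\<close>)
  have ij: "integrable (leb T) (\<lambda>s. jump_err (fs s x))" if "norm x \<le> r" for x
    by (rule S.integrable_const_bound[of _ B])
      (use B that measurable_fs[OF continuous_jump_err[OF a]] in \<open>auto simp: space_restrict_space intro!: AE_I2\<close>)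
  show "(\<forall>n. integrable (leb T) (\<lambda>s. a (fs s (v n)))) \<and> integrable (leb T) (\<lambda>s. a (fs s w)) \<and>
    (\<forall>\<phi>. L1_functional (leb T) \<phi> \<longrightarrow> (\<lambda>n. \<phi> (\<lambda>s. a (fs s (v n)))) \<longlonglongrightarrow> \<phi> (\<lambda>s. a (fs s w)))"
  proof (intro conjI allI impI)
    fix \<phi> assume \<phi>: "L1_functional (leb T) \<phi>"
    show "(\<lambda>n. \<phi> (\<lambda>s. a (fs s (v n)))) \<longlonglongrightarrow> \<phi> (\<lambda>s. a (fs s w))"
    proof (rule L1_functional_tendsto[OF finite_measure_leb \<phi> ia ia])
      show "\<bar>a (fs s (v n)) - a (fs s w)\<bar> \<le> 2 * (D + B)" if "s \<in> space (leb T)" for n s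
      proof -
        have "s \<in> {0..T}" using that by (simp add: space_restrict_space)
        from add_mono[OF aB[OF this r(1)[of n]] aB[OF this r(2)]] show ?thesis
          unfolding mult_2 by (rule order_trans[OF abs_triangle_ineq4])
      qed
      fix A assume A: "A \<in> sets (leb T)"
      then have Ab: "A \<in> sets borel" and AT: "A \<subseteq> {0..T}" by (auto simp: sets_restrict_space)
      define z where "z n = (LINT s|leb T. \<Psi> (indicator A s *\<^sub>R fs s (v n))) - (LINT s|leb T. \<Psi> (indicator A s *\<^sub>R fs s w))" for n
      define y where "y n = (LINT s|leb T. indicator A s * (jump_err (fs s (v n)) - jump_err (fs s w)))" for n
      obtain J where "J \<in> borel_measurable M" "\<And>v. has_cyl_integral M L T (\<lambda>s. indicator A s *\<^sub>R fs s v) (\<lambda>\<omega>. inner (J \<omega>) v)"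
        using J[OF Ab AT] by blast
      from \<Psi>_fs_integral_weak_tendsto[OF Ab this v] have "z \<longlonglongrightarrow> 0"
        unfolding z_def[abs_def] by (simp add: LIM_zero_iff)
      then have z: "(\<lambda>n. Im (z n)) \<longlonglongrightarrow> 0" using tendsto_Im by fastforce
      obtain J' where J': "J' \<in> borel_measurable M" "\<And>v. has_cyl_integral M L T (\<lambda>s. indicator {0..T} s *\<^sub>R fs s v) (\<lambda>\<omega>. inner (J' \<omega>) v)"
        using J[of "{0..T}"] by auto
      have y: "y \<longlonglongrightarrow> 0"
      proof (rule Lim_null_comparison[OF _ jump_err_fs_L1_tendsto[OF a J' v]])
        have "norm (y n) \<le> (LINT s|leb T. \<bar>jump_err (fs s (v n)) - jump_err (fs s w)\<bar>)" for n
          unfolding y_def real_norm_def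
        proof (rule order_trans[OF integral_abs_bound integral_mono])
          show "integrable (leb T) (\<lambda>s. \<bar>indicator A s * (jump_err (fs s (v n)) - jump_err (fs s w))\<bar>)"
            by (intro integrable_abs integrable_real_mult_indicator[OF A, unfolded mult.commute[of _ "indicator A _"]] Bochner_Integration.integrable_diff ij r)
          show "integrable (leb T) (\<lambda>s. \<bar>jump_err (fs s (v n)) - jump_err (fs s w)\<bar>)"
            by (intro integrable_abs Bochner_Integration.integrable_diff ij r)
        qed (auto simp: indicator_def)
        then show "eventually (\<lambda>n. norm (y n) \<le> (LINT s|leb T. \<bar>jump_err (fs s (v n)) - jump_err (fs s w)\<bar>)) sequentially"
          by simp
      qed
      have "(LINT s|leb T. indicator A s * (a (fs s (v n)) - a (fs s w))) = Im (z n) - y n" for n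
      proof -
        have i: "integrable (leb T) (\<lambda>s. Im (\<Psi> (indicator A s *\<^sub>R fs s x)))" for x
          by (rule integrable_Im[OF integrable_\<Psi>_fs[OF Ab]])
        have "Im (z n) = (LINT s|leb T. Im (\<Psi> (indicator A s *\<^sub>R fs s (v n))) - Im (\<Psi> (indicator A s *\<^sub>R fs s w)))"
          unfolding z_def by (simp only: minus_complex.sel integral_Im[OF integrable_\<Psi>_fs[OF Ab], symmetric]
            Bochner_Integration.integral_diff[OF i i])
        moreover have "y n = (LINT s|leb T. indicator A s * (jump_err (fs s (v n)) - jump_err (fs s w)))" by (simp add: y_def)
        moreover have ii: "integrable (leb T) (\<lambda>s. indicator A s * (jump_err (fs s (v n)) - jump_err (fs s w)))"
          by (intro integrable_real_mult_indicator[OF A, unfolded mult.commute[of _ "indicator A _"]] Bochner_Integration.integrable_diff ij r)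
        ultimately have "Im (z n) - y n = (LINT s|leb T. (Im (\<Psi> (indicator A s *\<^sub>R fs s (v n))) - Im (\<Psi> (indicator A s *\<^sub>R fs s w)))
            - indicator A s * (jump_err (fs s (v n)) - jump_err (fs s w)))"
          by (simp only: Bochner_Integration.integral_diff[OF Bochner_Integration.integrable_diff[OF i i] ii])
        also have "\<dots> = (LINT s|leb T. indicator A s * (a (fs s (v n)) - a (fs s w)))"
          by (intro Bochner_Integration.integral_cong refl) (auto simp: indicator_def Im_\<Psi>)
        finally show ?thesis by simp
      qed
      then show "(\<lambda>n. LINT s|leb T. indicator A s * (a (fs s (v n)) - a (fs s w))) \<longlonglongrightarrow> 0"
        using tendsto_diff[OF z y] by simp
    qed (rule r)+
  qed (rule ia r)+
qed

end

theorem theorem5p10: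
  fixes M :: "'w measure"
    and L W P :: "real \<Rightarrow> ('u::{banach, second_countable_topology} \<Rightarrow>\<^sub>L real) \<Rightarrow> 'w \<Rightarrow> real"
    and a :: "('u \<Rightarrow>\<^sub>L real) \<Rightarrow> real"
    and Q :: "('u \<Rightarrow>\<^sub>L real) \<Rightarrow>\<^sub>L (('u \<Rightarrow>\<^sub>L real) \<Rightarrow>\<^sub>L real)"
    and \<mu> :: "'u set \<Rightarrow> ennreal"
    and T :: real
    and e :: "nat \<Rightarrow> 'v::{real_inner, banach, second_countable_topology}"
    and f :: "real \<Rightarrow> 'u \<Rightarrow>\<^sub>L 'v"
  assumes "prob_space M"
    and "T > 0"
    and "cylindrical_levy_process M L" and "has_characteristics M L a Q \<mu>"
    and "cylindrical_levy_process M W" and "has_characteristics M W (\<lambda>_. 0) Q (\<lambda>_. 0)"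
    and "cylindrical_levy_process M P" and "has_characteristics M P a 0 \<mu>"
    and "independent_processes M W P"
    and "\<And>t x. t \<ge> 0 \<Longrightarrow> AE \<omega> in M. L t x \<omega> = W t x \<omega> + P t x \<omega>"
    and "continuous_on UNIV a"
    and "orthonormal_basis e"
    and "weakly_regulated T f"
  shows "stochastically_integrable M L T f \<longleftrightarrow>
    weak_weak_seq_continuous (restrict_space lborel {0..T}) (\<lambda>v s. a (adj (f s) v)) \<and>
    (\<integral>\<^sup>+ s\<in>{0..T}. trace_conj e Q (f s) \<partial>lborel) < \<infinity> \<and>
    limsup (\<lambda>m. SUP n\<in>{m..}. \<integral>\<^sup>+ s\<in>{0..T}.
      (\<integral>\<^sup>+ u. ennreal (min (\<Sum>k=m..n. (blinfun_apply (adj (f s) (e k)) u)\<^sup>2) 1)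
        \<partial>cyl_restr \<mu> ((\<lambda>k. adj (f s) (e k)) ` {m..n})) \<partial>lborel) = 0"
proof -
  interpret levy_integrand M L a Q \<mu> T e f
    using assms by (intro levy_integrand.intro cyl_levy.intro cyl_levy_axioms.intro levy_integrand_axioms.intro) auto
  have "stochastically_integrable M L T f \<longleftrightarrow> (\<forall>r>0. \<exists>m0. \<forall>m\<ge>m0. \<forall>n. kappa e {m..n} \<le> ennreal r)"
    using kappa_small_if_stochastically_integrable stochastically_integrable_if_kappa by blast
  then show ?thesis
    unfolding nn_integral_trace_conj limsup_mterm_iff kappa_small_iff
    using weak_weak_seq_continuous_a[OF \<open>continuous_on UNIV a\<close>] by blast
qed

end
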